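(* Let $r\in\{1,2\}$. For any $u_0\in H^r(\mathbb{R})$ and for all $T>0$, there exist a constant $C(T,\|u_0\|_{H^1(\mathbb{R})})$, depending only on $T$ and $\|u_0\|_{H^1(\mathbb{R})}$, and a constant $C(T,\|u_0\|_{L^2(\mathbb{R})})$, depending only on $T$ and $\|u_0\|_{L^2(\mathbb{R})}$, such that $$\left\|Z^{n\Delta t}u_0-u(n\Delta t)\right\|_{L^2(\mathbb{R})}\le C(T,\|u_0\|_{H^1(\mathbb{R})})\,\|u_0\|_{H^r(\mathbb{R})}^2\,(\Delta t)^{r/2}$$ and $$\left\|Z^{n\Delta t}u_0\right\|_{H^r(\mathbb{R})}\le C(T,\|u_0\|_{L^2(\mathbb{R})})\,\|u_0\|_{H^r(\mathbb{R})},$$ for all $\Delta t\in(0,1)$ and for all $n\in\mathbb{N}$ such that $0\le n\Delta t\le T$.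
   Context: All functions are real-valued. $K(z)=e^{-z}\chi_{(0,\infty)}(z)$, $*$ is convolution in $x\in\mathbb{R}$, and $G_t(x)=(4\pi t)^{-1/2}e^{-x^2/(4t)}$ is the heat kernel. $X^t$ ($t\ge0$) is the solution operator $v_0\mapsto v(t)$ of the linear equation $v_t=K*v-v+v_x$, $v(0)=v_0$ on $\mathbb{R}$; i.e. $X^tv_0=D_t*v_0$ with $\widehat{D_t}(\xi)=\exp\big(-t\xi^2/(1+i\xi)\big)$ (convention $\widehat f(\xi)=\int e^{-ix\xi}f(x)\,dx$); equivalently $(X^tv_0)(x)=e^{-t}\sum_{k\ge0}\frac{t^k}{k!}(K^{*k}*v_0)(x+t)$. $Y^t$ ($t\ge0$) is the solution operator $w_0\mapsto w(t)$ of the viscous Burgers equation $w_t-(w^2/2)_x=w_{xx}$, $w(0)=w_0$ (for $w_0\in L^2(\mathbb{R})$: the unique $w\in C([0,\infty);L^2(\mathbb{R}))$ with $w(t)=G_t*w_0+\frac12\int_0^t \partial_xG_{t-s}*w^2(s)\,ds$). $u(t)=S^tu_0$ is the solution of the augmented Burgers equation $u_t-(u^2/2)_x=u_{xx}+K*u-u+u_x$, $u(0)=u_0$ (the unique $u\in C([0,\infty);L^2(\mathbb{R}))$ with $u(t)=G_t*X^tu_0+\frac12\int_0^t \partial_xG_{t-s}*X^{t-s}u^2(s)\,ds$). The splitting flow is $Z^t=X^tY^t$, and $Z^{n\Delta t}$ denotes $(Z^{\Delta t})^n=(X^{\Delta t}Y^{\Delta t})^n$. *)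

theory Defs
  imports "HOL-Analysis.Analysis"
begin

text \<open>Elements of \<open>L\<^sup>2(\<real>)\<close> are handled through Borel measurable representatives
  \<open>real \<Rightarrow> real\<close>; equality in \<open>L\<^sup>2(\<real>)\<close> is equality almost everywhere. No class is lost, since
  every Lebesgue measurable function agrees almost everywhere with a Borel measurable one.\<close>

definition L2 :: "(real \<Rightarrow> real) set" where
  "L2 = {f \<in> borel_measurable borel. integrable lborel (\<lambda>x. (f x)\<^sup>2)}"

definition L2_norm :: "(real \<Rightarrow> real) \<Rightarrow> real" where
  "L2_norm f = sqrt (LINT x|lborel. (f x)\<^sup>2)"

definition loc_integrable :: "(real \<Rightarrow> real) \<Rightarrow> bool" where
  "loc_integrable f \<longleftrightarrow> (\<forall>a b. set_integrable lborel {a..b} f)"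

definition test_function :: "(real \<Rightarrow> real) \<Rightarrow> bool" where
  "test_function \<phi> \<longleftrightarrow>
     (\<forall>k x. (deriv ^^ k) \<phi> differentiable (at x)) \<and> compact (closure {x. \<phi> x \<noteq> 0})"

definition is_weak_deriv :: "nat \<Rightarrow> (real \<Rightarrow> real) \<Rightarrow> (real \<Rightarrow> real) \<Rightarrow> bool" where
  "is_weak_deriv j f g \<longleftrightarrow> loc_integrable f \<and> loc_integrable g \<and>
     (\<forall>\<phi>. test_function \<phi> \<longrightarrow>
        (LINT x|lborel. f x * (deriv ^^ j) \<phi> x) = (-1) ^ j * (LINT x|lborel. g x * \<phi> x))"

text \<open>The choice is immaterial: weak derivatives are unique almost everywhere.\<close>

definition weak_deriv :: "nat \<Rightarrow> (real \<Rightarrow> real) \<Rightarrow> real \<Rightarrow> real" where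
  "weak_deriv j f = (SOME g. is_weak_deriv j f g)"

definition Sobolev :: "nat \<Rightarrow> (real \<Rightarrow> real) set" where
  "Sobolev r = {f \<in> L2. \<forall>j\<le>r. \<exists>g\<in>L2. is_weak_deriv j f g}"

definition Sobolev_norm :: "nat \<Rightarrow> (real \<Rightarrow> real) \<Rightarrow> real" where
  "Sobolev_norm r f = sqrt (\<Sum>j\<le>r. (L2_norm (weak_deriv j f))\<^sup>2)"

definition conv :: "(real \<Rightarrow> real) \<Rightarrow> (real \<Rightarrow> real) \<Rightarrow> real \<Rightarrow> real" where
  "conv f g x = (LINT y|lborel. f (x - y) * g y)"

definition K :: "real \<Rightarrow> real" where
  "K z = exp (- z) * indicator {0<..} z"

definition heat_kernel :: "real \<Rightarrow> real \<Rightarrow> real" where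
  "heat_kernel t x = (4 * pi * t) powr (-1/2) * exp (- x\<^sup>2 / (4 * t))"

text \<open>Solution operator of \<open>v\<^sub>t = K * v - v + v\<^sub>x\<close>. The term \<open>K\<^sup>*\<^sup>k * v\<close> of the
  exponential series is the \<open>k\<close>-fold application of \<open>K * _\<close> to \<open>v\<close>, which for \<open>k = 0\<close>
  (where \<open>K\<^sup>*\<^sup>0\<close> is the Dirac delta) is \<open>v\<close> itself.\<close>

definition X_flow :: "real \<Rightarrow> (real \<Rightarrow> real) \<Rightarrow> real \<Rightarrow> real" where
  "X_flow t v x = exp (- t) * (\<Sum>k. t ^ k / fact k * (conv K ^^ k) v (x + t))"

definition continuous_in_L2 :: "(real \<Rightarrow> real \<Rightarrow> real) \<Rightarrow> bool" where
  "continuous_in_L2 w \<longleftrightarrow> (\<forall>t\<ge>0. w t \<in> L2) \<and>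
     (\<forall>t\<ge>0. ((\<lambda>s. L2_norm (\<lambda>x. w s x - w t x)) \<longlongrightarrow> 0) (at t within {0..}))"

text \<open>In the two mild formulations below, \<open>t = 0\<close> is separated because \<open>heat_kernel 0\<close> is not
  an approximation of the identity (it is the zero function in HOL). For fixed \<open>x\<close> the integrand
  in \<open>s\<close> is continuous on \<open>[0, t)\<close> and does not depend on the representatives \<open>w s\<close>; for almost
  every \<open>x\<close> it is integrable, and the pointwise integral represents the integral in
  \<open>L\<^sup>2(\<real>)\<close>.\<close>

definition mild_burgers :: "(real \<Rightarrow> real) \<Rightarrow> (real \<Rightarrow> real \<Rightarrow> real) \<Rightarrow> bool" where
  "mild_burgers w0 w \<longleftrightarrow> continuous_in_L2 w \<and>
     (AE x in lborel. w 0 x = w0 x) \<and>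
     (\<forall>t>0. AE x in lborel. w t x = conv (heat_kernel t) w0 x
        + 1/2 * (LBINT s:{0..t}. conv (deriv (heat_kernel (t - s))) (\<lambda>y. (w s y)\<^sup>2) x))"

definition mild_augmented_burgers :: "(real \<Rightarrow> real) \<Rightarrow> (real \<Rightarrow> real \<Rightarrow> real) \<Rightarrow> bool" where
  "mild_augmented_burgers u0 u \<longleftrightarrow> continuous_in_L2 u \<and>
     (AE x in lborel. u 0 x = u0 x) \<and>
     (\<forall>t>0. AE x in lborel. u t x = conv (heat_kernel t) (X_flow t u0) x
        + 1/2 * (LBINT s:{0..t}.
            conv (deriv (heat_kernel (t - s))) (X_flow (t - s) (\<lambda>y. (u s y)\<^sup>2)) x))"

text \<open>For data in \<open>L2\<close> the mild solutions exist and are unique up to null sets at each time,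
  so the choices below determine \<open>Y\<^sup>t w\<^sub>0\<close> and \<open>S\<^sup>t u\<^sub>0\<close> as elements of \<open>L\<^sup>2(\<real>)\<close>.\<close>

definition Y_flow :: "real \<Rightarrow> (real \<Rightarrow> real) \<Rightarrow> real \<Rightarrow> real" where
  "Y_flow t w0 = (SOME w. mild_burgers w0 w) t"

definition S_flow :: "real \<Rightarrow> (real \<Rightarrow> real) \<Rightarrow> real \<Rightarrow> real" where
  "S_flow t u0 = (SOME u. mild_augmented_burgers u0 u) t"

definition Z_flow :: "real \<Rightarrow> (real \<Rightarrow> real) \<Rightarrow> real \<Rightarrow> real" where
  "Z_flow t v = X_flow t (Y_flow t v)"

end

theory Submission
  imports Defs "HOL-Probability.Probability"
begin

text \<open>Let \<open>G\<^sub>t\<close> be the heat kernel. The exact solution and the splitting approximation satisfy Duhamel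
  formulas of the same shape,
  \<open>v(t) = G\<^sub>t * X\<^sup>q u\<^sub>0 + 1/2 \<integral> \<partial>\<^sub>xG\<^sub>t\<^sub>-\<^sub>s * X\<^bsup>q - \<theta>(s)\<^esup> v(s)\<^sup>2 ds\<close> (over \<open>0 \<le> s \<le> t\<close>), where \<open>\<theta>(s)\<close> is the time
  spent in the flow \<open>X\<close> when the Burgers clock shows \<open>s\<close>: it is \<open>s\<close> for the exact solution and
  \<open>\<Delta>t \<lfloor>s / \<Delta>t\<rfloor>\<close> for the splitting. Since \<open>X\<^sup>t\<close> averages translates against a compound Poisson law
  with first absolute moment at most \<open>2t\<close>, replacing one clock by the other costs \<open>O(\<Delta>t)\<close> times a bound
  for the first derivative. The kernel satisfies \<open>\<parallel>\<partial>\<^sub>xG\<^sub>t * f\<parallel>\<^sub>2 \<le> t powr (-3/4) \<parallel>f\<parallel>\<^sub>1\<close>, which is integrable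
  at \<open>0\<close>, so a weighted Gronwall argument closes the error estimate, in fact with rate \<open>\<Delta>t\<close> instead of
  \<open>\<Delta>t\<close> to the power \<open>r/2\<close>. The equations commute with translations, so the same argument applied to
  first and second differences propagates \<open>H\<^sup>r\<close> bounds; the \<open>L\<^sup>2\<close> bounds come from \<open>\<integral> v\<^sup>2 v\<^sub>x dx = 0\<close>.
  Derivatives are replaced by difference quotients and norms by pairings with \<open>L\<^sup>2\<close> functions
  throughout; weak derivatives are recovered at the end by a Riesz representation on test functions.\<close>

section \<open>The space of square integrable functions\<close>

text \<open>\<open>Y_flow\<close> and \<open>S_flow\<close> are choices, so solutions must be shown
  to exist, for all times. There is a circle to break: the energy inequality needs a Lipschitz bound
  under translations, that bound needs an \<open>L2\<close> bound, and the \<open>L2\<close> bound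
  is the energy inequality. Truncating the square outside the ball of radius
  \<open>L2_norm w0\<close> breaks it: the truncated equation has global solutions, energy puts them
  in the ball, and there the truncation is the identity. The estimates hold for every mild solution,
  hence for the chosen one. The square of an \<open>L2\<close> function is only integrable, so the
  Duhamel integral is paired with \<open>L2\<close> functions; in this weak form translations,
  averages and differences move freely between kernel, forcing and test function. No time derivative
  occurs: energy is compared over steps of length \<open>h\<close>, with an error of order
  \<open>h powr (5/4)\<close> whose sum vanishes as \<open>h\<close> tends to 0. The constants
  depend on \<open>T\<close> and a bound \<open>R\<close> of the \<open>L2\<close> norm alone,
  because these fix the weight \<open>exp (l * t)\<close> of the Gronwall argument.\<close>

definition ip :: "(real \<Rightarrow> real) \<Rightarrow> (real \<Rightarrow> real) \<Rightarrow> real" where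
  "ip f g = (LINT x|lborel. f x * g x)"

definition L1_norm :: "(real \<Rightarrow> real) \<Rightarrow> real" where
  "L1_norm f = (LINT x|lborel. \<bar>f x\<bar>)"

definition sh :: "real \<Rightarrow> (real \<Rightarrow> real) \<Rightarrow> real \<Rightarrow> real" where
  "sh k f x = f (x + k)"

definition fd :: "real \<Rightarrow> (real \<Rightarrow> real) \<Rightarrow> real \<Rightarrow> real" where
  "fd k f x = f (x + k) - f x"

lemma L2_measurable[measurable_dest]: "f \<in> L2 \<Longrightarrow> f \<in> borel_measurable borel"
  by (simp add: L2_def)

lemma L2_integrable_sq: "f \<in> L2 \<Longrightarrow> integrable lborel (\<lambda>x. (f x)\<^sup>2)"
  by (simp add: L2_def)

lemma L2I: "f \<in> borel_measurable borel \<Longrightarrow> integrable lborel (\<lambda>x. (f x)\<^sup>2) \<Longrightarrow> f \<in> L2"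
  by (simp add: L2_def)

lemma L2_mult_integrable:
  assumes "f \<in> L2" "g \<in> L2" shows "integrable lborel (\<lambda>x. f x * g x)"
proof (rule Bochner_Integration.integrable_bound)
  show "integrable lborel (\<lambda>x. (f x)\<^sup>2 + (g x)\<^sup>2)" using assms by (simp add: L2_integrable_sq)
  show "(\<lambda>x. f x * g x) \<in> borel_measurable lborel" using assms by (auto dest!: L2_measurable)
  have "\<bar>f x * g x\<bar> \<le> (f x)\<^sup>2 + (g x)\<^sup>2" for x
  proof -
    have "2 * \<bar>f x * g x\<bar> \<le> (f x)\<^sup>2 + (g x)\<^sup>2"
      using sum_squares_bound[of "\<bar>f x\<bar>" "\<bar>g x\<bar>"] by (simp add: abs_mult mult.assoc)
    then show ?thesis by linarith
  qed
  then show "AE x in lborel. norm (f x * g x) \<le> norm ((f x)\<^sup>2 + (g x)\<^sup>2)" by simp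
qed

lemma L2_scale: assumes "f \<in> L2" shows "(\<lambda>x. c * f x) \<in> L2"
  using assms by (intro L2I) (auto simp: power_mult_distrib L2_integrable_sq dest: L2_measurable)

lemma L2_zero: "(\<lambda>x. 0) \<in> L2" by (intro L2I) auto

lemma L2_add: assumes "f \<in> L2" "g \<in> L2" shows "(\<lambda>x. f x + g x) \<in> L2"
proof (rule L2I)
  show "(\<lambda>x. f x + g x) \<in> borel_measurable borel" using assms by (auto dest!: L2_measurable)
  have "(\<lambda>x. (f x + g x)\<^sup>2) = (\<lambda>x. ((f x)\<^sup>2 + 2 * (f x * g x)) + (g x)\<^sup>2)"
    by (auto simp: power2_eq_square algebra_simps)
  then show "integrable lborel (\<lambda>x. (f x + g x)\<^sup>2)"
    using assms by (simp add: L2_integrable_sq L2_mult_integrable)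
qed

lemma L2_uminus: "f \<in> L2 \<Longrightarrow> (\<lambda>x. - f x) \<in> L2" using L2_scale[of f "-1"] by simp

lemma L2_diff: "f \<in> L2 \<Longrightarrow> g \<in> L2 \<Longrightarrow> (\<lambda>x. f x - g x) \<in> L2"
  using L2_add[of f "\<lambda>x. - g x"] L2_uminus[of g] by simp

lemma lborel_shift:
  fixes f :: "real \<Rightarrow> real"
  shows "(LINT x|lborel. f (x + k)) = (LINT x|lborel. f x)"
  using lborel_integral_real_affine[of 1 f k] by (simp add: add.commute)

lemma lborel_shift_integrable:
  fixes f :: "real \<Rightarrow> real"
  shows "integrable lborel (\<lambda>x. f (x + k)) \<longleftrightarrow> integrable lborel f"
  using lborel_integrable_real_affine_iff[of 1 f k] by (simp add: add.commute)

lemma nn_lborel_shift: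
  assumes [measurable]: "f \<in> borel_measurable borel"
  shows "(\<integral>\<^sup>+x. f (x + k) \<partial>lborel) = (\<integral>\<^sup>+(x::real). f x \<partial>lborel)"
  using nn_integral_real_affine[of f 1 k] by (simp add: add.commute)

lemma lborel_reflect:
  fixes f :: "real \<Rightarrow> real"
  shows "(LINT x|lborel. f (k - x)) = (LINT x|lborel. f x)"
  using lborel_integral_real_affine[of "-1" f k] by simp

lemma lborel_reflect_integrable:
  fixes f :: "real \<Rightarrow> real"
  shows "integrable lborel (\<lambda>x. f (k - x)) \<longleftrightarrow> integrable lborel f"
  using lborel_integrable_real_affine_iff[of "-1" f k] by simp

lemma L2_sh: assumes "f \<in> L2" shows "sh k f \<in> L2"
proof (rule L2I)
  show "sh k f \<in> borel_measurable borel" using assms unfolding sh_def[abs_def] by (auto dest!: L2_measurable)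
  show "integrable lborel (\<lambda>x. (sh k f x)\<^sup>2)"
    unfolding sh_def using lborel_shift_integrable[of "\<lambda>x. (f x)\<^sup>2" k] L2_integrable_sq[OF assms] by simp
qed

lemma L2_norm_sh: "L2_norm (sh k f) = L2_norm f"
  unfolding L2_norm_def sh_def using lborel_shift[of "\<lambda>x. (f x)\<^sup>2" k] by simp

lemma L2_fd: "f \<in> L2 \<Longrightarrow> fd k f \<in> L2"
  using L2_diff[OF L2_sh[of f k], of f] by (simp add: fd_def[abs_def] sh_def[abs_def])

lemma L2_fdn: "f \<in> L2 \<Longrightarrow> (fd k ^^ j) f \<in> L2"
  by (induct j) (auto intro: L2_fd)

lemmas L2_intros = L2_scale L2_zero L2_add L2_uminus L2_diff L2_sh L2_fd L2_fdn

lemma L2_norm_nonneg[simp]: "0 \<le> L2_norm f"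
  by (simp add: L2_norm_def)

lemma L2_norm_sq: "(L2_norm f)\<^sup>2 = (LINT x|lborel. (f x)\<^sup>2)"
  by (simp add: L2_norm_def)

lemma L2_norm_sq_ip: "(L2_norm f)\<^sup>2 = ip f f"
  unfolding L2_norm_sq by (simp add: ip_def power2_eq_square)

lemma L2_norm_zero[simp]: "L2_norm (\<lambda>x. 0) = 0" by (simp add: L2_norm_def)

lemma ip_commute: "ip f g = ip g f" by (simp add: ip_def mult.commute)

lemma ip_add_right: "b \<in> L2 \<Longrightarrow> f \<in> L2 \<Longrightarrow> g \<in> L2 \<Longrightarrow> ip b (\<lambda>x. f x + g x) = ip b f + ip b g"
  by (simp add: ip_def distrib_left L2_mult_integrable)
lemma ip_diff_right: "b \<in> L2 \<Longrightarrow> f \<in> L2 \<Longrightarrow> g \<in> L2 \<Longrightarrow> ip b (\<lambda>x. f x - g x) = ip b f - ip b g"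
  by (simp add: ip_def right_diff_distrib L2_mult_integrable)
lemma ip_scale_right: "ip b (\<lambda>x. c * f x) = c * ip b f"
  by (simp add: ip_def mult.left_commute)

lemma L2_norm_scale: "L2_norm (\<lambda>x. c * f x) = \<bar>c\<bar> * L2_norm f"
  by (simp add: L2_norm_def power_mult_distrib real_sqrt_mult)

lemma L2_norm_uminus: "L2_norm (\<lambda>x. - f x) = L2_norm f"
  by (simp add: L2_norm_def)

lemma L2_norm_diff_commute: "L2_norm (\<lambda>x. f x - g x) = L2_norm (\<lambda>x. g x - f x)"
  by (simp add: L2_norm_def power2_commute)

text \<open>The squared norm of \<open>s * |f| - |g|\<close> is a nonnegative quadratic in
  \<open>s\<close>; its value at the minimiser \<open>?I / (L2_norm f)^2\<close> is the inequality.
  If \<open>L2_norm f = 0\<close> it is affine in \<open>s\<close> and can stay nonnegative only if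
  \<open>?I = 0\<close>.\<close>

lemma L2_CS_abs: assumes "f \<in> L2" "g \<in> L2"
  shows "(LINT x|lborel. \<bar>f x * g x\<bar>) \<le> L2_norm f * L2_norm g"
proof -
  let ?I = "LINT x|lborel. \<bar>f x * g x\<bar>"
  have iabs: "integrable lborel (\<lambda>x. \<bar>f x * g x\<bar>)" using L2_mult_integrable[OF assms] by simp
  have q: "0 \<le> s\<^sup>2 * (L2_norm f)\<^sup>2 - 2 * s * ?I + (L2_norm g)\<^sup>2" for s
  proof -
    have "0 \<le> (LINT x|lborel. (s * \<bar>f x\<bar> - \<bar>g x\<bar>)\<^sup>2)" by simp
    also have "\<dots> = (LINT x|lborel. s\<^sup>2 * (f x)\<^sup>2 - 2 * s * \<bar>f x * g x\<bar> + (g x)\<^sup>2)"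
      by (rule Bochner_Integration.integral_cong) (auto simp: power2_eq_square algebra_simps abs_mult)
    also have "\<dots> = s\<^sup>2 * (L2_norm f)\<^sup>2 - 2 * s * ?I + (L2_norm g)\<^sup>2"
      using assms iabs by (simp add: L2_norm_sq L2_integrable_sq)
    finally show ?thesis .
  qed
  show ?thesis
  proof (cases "L2_norm f = 0")
    case True
    have "?I \<le> 0"
    proof (rule ccontr)
      assume "\<not> ?I \<le> 0"
      then have "?I > 0" by simp
      \<comment> \<open>At this \<open>s\<close> the affine expression takes the value -1.\<close>
      with q[of "((L2_norm g)\<^sup>2 + 1) / (2 * ?I)"] True show False by simp
    qed
    then show ?thesis using True by simp
  next
    case False
    let ?n = "L2_norm f"
    have n: "?n > 0" using False by (simp add: less_le)
    have "0 \<le> (?I/?n\<^sup>2)\<^sup>2 * ?n\<^sup>2 - 2 * (?I/?n\<^sup>2) * ?I + (L2_norm g)\<^sup>2" by (rule q)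
    also have "(?I/?n\<^sup>2)\<^sup>2 * ?n\<^sup>2 = ?I\<^sup>2/?n\<^sup>2" using n
      by (simp add: power2_eq_square field_simps)
    also have "2 * (?I/?n\<^sup>2) * ?I = 2 * (?I\<^sup>2/?n\<^sup>2)" by (simp add: power2_eq_square)
    finally have "?I\<^sup>2/?n\<^sup>2 \<le> (L2_norm g)\<^sup>2" by simp
    then have "?I\<^sup>2 \<le> (?n * L2_norm g)\<^sup>2" using n by (simp add: field_simps)
    then show ?thesis using power2_le_imp_le by (metis L2_norm_nonneg mult_nonneg_nonneg)
  qed
qed

lemma ip_CS: assumes "f \<in> L2" "g \<in> L2" shows "\<bar>ip f g\<bar> \<le> L2_norm f * L2_norm g"
  using integral_abs_bound[of lborel "\<lambda>x. f x * g x"] L2_CS_abs[OF assms] unfolding ip_def by linarith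

lemma L2_norm_triangle: assumes "f \<in> L2" "g \<in> L2"
  shows "L2_norm (\<lambda>x. f x + g x) \<le> L2_norm f + L2_norm g"
proof -
  have "(L2_norm (\<lambda>x. f x + g x))\<^sup>2 = (LINT x|lborel. (f x)\<^sup>2 + 2 * (f x * g x) + (g x)\<^sup>2)"
    unfolding L2_norm_sq by (rule Bochner_Integration.integral_cong) (auto simp: power2_eq_square algebra_simps)
  also have "\<dots> = (L2_norm f)\<^sup>2 + 2 * ip f g + (L2_norm g)\<^sup>2"
    using assms by (simp add: L2_norm_sq L2_integrable_sq L2_mult_integrable ip_def)
  also have "\<dots> \<le> (L2_norm f + L2_norm g)\<^sup>2"
    using ip_CS[OF assms] by (simp add: power2_eq_square algebra_simps)
  finally show ?thesis by (rule power2_le_imp_le) simp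
qed

lemma L2_norm_triangle_diff: assumes "f \<in> L2" "g \<in> L2"
  shows "L2_norm (\<lambda>x. f x - g x) \<le> L2_norm f + L2_norm g"
  using L2_norm_triangle[OF assms(1) L2_uminus[OF assms(2)]] by (simp add: L2_norm_uminus)

lemma L2_norm_triangle3: assumes "f \<in> L2" "g \<in> L2" "h \<in> L2"
  shows "L2_norm (\<lambda>x. f x - h x) \<le> L2_norm (\<lambda>x. f x - g x) + L2_norm (\<lambda>x. g x - h x)"
  using L2_norm_triangle[OF L2_diff[OF assms(1,2)] L2_diff[OF assms(2,3)]] by simp

lemma L2_norm_le_diff: assumes "f \<in> L2" "g \<in> L2"
  shows "L2_norm f \<le> L2_norm g + L2_norm (\<lambda>x. f x - g x)"
  using L2_norm_triangle[OF assms(2) L2_diff[OF assms]] by simp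

lemma L2_cong_AE: assumes "f \<in> L2" "g \<in> borel_measurable borel" "AE x in lborel. g x = f x"
  shows "g \<in> L2"
proof (rule L2I[OF assms(2)])
  have m: "f \<in> borel_measurable borel" using assms(1) by (rule L2_measurable)
  show "integrable lborel (\<lambda>x. (g x)\<^sup>2)"
    using assms(2) m L2_integrable_sq[OF assms(1)]
    by (subst integrable_cong_AE[where g="\<lambda>x. (f x)\<^sup>2"]) (use assms(3) in auto)
qed

lemma L2_norm_cong_AE: assumes "f \<in> borel_measurable borel" "g \<in> borel_measurable borel" "AE x in lborel. f x = g x"
  shows "L2_norm f = L2_norm g"
  unfolding L2_norm_def using assms by (intro arg_cong[where f=sqrt] integral_cong_AE) auto

lemma ip_cong_AE: assumes "b \<in> borel_measurable borel" "f \<in> borel_measurable borel" "g \<in> borel_measurable borel" "AE x in lborel. f x = g x"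
  shows "ip b f = ip b g"
  unfolding ip_def using assms by (intro integral_cong_AE) auto

text \<open>Take \<open>b = v\<close> and cancel one factor. Solutions are known through their
  pairings, so nearly every \<open>L2\<close> bound for them passes through this converse of
  \<open>ip_CS\<close>.\<close>

lemma L2_norm_le_dual: assumes "v \<in> L2" "\<And>b. b \<in> L2 \<Longrightarrow> \<bar>ip b v\<bar> \<le> C * L2_norm b" "C \<ge> 0"
  shows "L2_norm v \<le> C"
proof -
  have "L2_norm v * L2_norm v \<le> C * L2_norm v"
    using assms(2)[OF assms(1)] by (simp add: L2_norm_sq_ip[symmetric] power2_eq_square)
  then show ?thesis using assms(3) L2_norm_nonneg[of v] by (cases "L2_norm v = 0") (auto simp: less_le)
qed

lemma L2_norm_eq_0_AE: assumes "f \<in> L2" "L2_norm f = 0" shows "AE x in lborel. f x = 0"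
proof -
  have "(LINT x|lborel. (f x)\<^sup>2) = 0" using L2_norm_sq[of f] assms(2) by simp
  then show ?thesis using integral_nonneg_eq_0_iff_AE[OF L2_integrable_sq[OF assms(1)]] by simp
qed

lemma L2_norm_nn: assumes "f \<in> borel_measurable borel"
  and "(\<integral>\<^sup>+x. ennreal ((f x)\<^sup>2) \<partial>lborel) \<le> ennreal (C\<^sup>2)" "C \<ge> 0"
  shows "f \<in> L2" "L2_norm f \<le> C"
proof -
  have i: "integrable lborel (\<lambda>x. (f x)\<^sup>2)"
    using assms by (intro integrableI_bounded) (auto intro: le_less_trans)
  then show "f \<in> L2" using assms by (intro L2I)
  have "ennreal (LINT x|lborel. (f x)\<^sup>2) \<le> ennreal (C\<^sup>2)"
    using assms(2) by (subst (asm) nn_integral_eq_integral[OF i]) auto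
  then show "L2_norm f \<le> C" using assms(3) by (auto simp: L2_norm_def real_le_lsqrt)
qed

lemma nn_integral_L2: assumes "f \<in> L2"
  shows "(\<integral>\<^sup>+x. ennreal ((f x)\<^sup>2) \<partial>lborel) = ennreal ((L2_norm f)\<^sup>2)"
  by (subst nn_integral_eq_integral[OF L2_integrable_sq[OF assms]]) (auto simp: L2_norm_sq)

lemma L1_norm_nonneg[simp]: "0 \<le> L1_norm f" by (simp add: L1_norm_def)

lemma L1_norm_mult_le: "f \<in> L2 \<Longrightarrow> g \<in> L2 \<Longrightarrow> L1_norm (\<lambda>x. f x * g x) \<le> L2_norm f * L2_norm g"
  unfolding L1_norm_def by (rule L2_CS_abs)

lemma L1_norm_triangle: "integrable lborel f \<Longrightarrow> integrable lborel g \<Longrightarrow> L1_norm (\<lambda>x. f x + g x) \<le> L1_norm f + L1_norm g"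
  unfolding L1_norm_def
  using integral_mono[of lborel "\<lambda>x. \<bar>f x + g x\<bar>" "\<lambda>x. \<bar>f x\<bar> + \<bar>g x\<bar>"]
  by (simp add: abs_triangle_ineq)

lemma L1_norm_scale: "L1_norm (\<lambda>x. c * f x) = \<bar>c\<bar> * L1_norm f"
  by (simp add: L1_norm_def abs_mult)

lemma L1_norm_diff_commute: "L1_norm (\<lambda>x. f x - g x) = L1_norm (\<lambda>x. g x - f x)"
  by (simp add: L1_norm_def abs_minus_commute)

lemma L1_sh: "integrable lborel f \<Longrightarrow> integrable lborel (sh k f)"
  unfolding sh_def[abs_def] by (simp add: lborel_shift_integrable)

lemma L1_fd: "integrable lborel f \<Longrightarrow> integrable lborel (fd k f)"
  unfolding fd_def[abs_def] by (simp add: lborel_shift_integrable)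

lemma ip_sh: "ip (sh k b) f = ip b (sh (-k) f)"
  unfolding ip_def sh_def using lborel_shift[of "\<lambda>x. b x * f (x - k)" k] by simp

lemma ip_fd: assumes "b \<in> L2" "f \<in> L2" shows "ip b (fd k f) = ip (fd (-k) b) f"
proof -
  have "fd k f = (\<lambda>x. sh k f x - f x)" "fd (-k) b = (\<lambda>x. sh (-k) b x - b x)"
    by (auto simp: fd_def sh_def)
  then show ?thesis using assms ip_sh[of "-k" b f]
    by (simp add: ip_diff_right ip_commute[of _ f] L2_sh)
qed

lemma ip_fdn: assumes "b \<in> L2" "f \<in> L2" shows "ip b ((fd k ^^ j) f) = ip ((fd (-k) ^^ j) b) f"
  using assms
proof (induct j arbitrary: b)
  case (Suc j)
  have "ip b ((fd k ^^ Suc j) f) = ip (fd (-k) b) ((fd k ^^ j) f)"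
    using Suc.prems by (simp add: ip_fd L2_fdn)
  also have "\<dots> = ip ((fd (-k) ^^ j) (fd (-k) b)) f"
    using Suc by (intro Suc.hyps) (auto intro: L2_fd)
  finally show ?case by (simp add: funpow_swap1)
qed simp

lemma L1_norm_square: "L1_norm (\<lambda>x. (f x)\<^sup>2) = (L2_norm f)\<^sup>2"
  by (simp add: L1_norm_def L2_norm_sq)

lemma L1_norm_square_diff: assumes "f \<in> L2" "g \<in> L2"
  shows "L1_norm (\<lambda>x. (f x)\<^sup>2 - (g x)\<^sup>2) \<le> L2_norm (\<lambda>x. f x - g x) * (L2_norm f + L2_norm g)"
proof -
  have "(\<lambda>x. (f x)\<^sup>2 - (g x)\<^sup>2) = (\<lambda>x. (f x - g x) * (f x + g x))"
    by (auto simp: power2_eq_square algebra_simps)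
  then show ?thesis
    using L1_norm_mult_le[OF L2_diff[OF assms] L2_add[OF assms]] L2_norm_triangle[OF assms]
    by (simp) (meson L2_norm_nonneg mult_left_mono order_trans)
qed

text \<open>Discrete form of \<open>|f'|^2 \<le> |f| |f''|\<close>: the adjoint of a forward
  difference is a backward one, and the latter is minus a translate of the forward difference, so
  both differences can be put on the same factor.\<close>

lemma fd_interpolation: assumes f: "f \<in> L2"
  shows "(L2_norm (fd k f))\<^sup>2 \<le> L2_norm f * L2_norm ((fd k ^^ 2) f)"
proof -
  have e: "fd (-k) (fd k f) = (\<lambda>x. - sh (-k) (fd k (fd k f)) x)"
    by (auto simp: fd_def sh_def)
  have "(L2_norm (fd k f))\<^sup>2 = ip (fd (-k) (fd k f)) f"
    using f by (simp add: L2_norm_sq_ip ip_fd L2_fd)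
  also have "\<dots> \<le> L2_norm (fd (-k) (fd k f)) * L2_norm f"
    using ip_CS[of "fd (-k) (fd k f)" f] f by (simp add: L2_fd)
  also have "L2_norm (fd (-k) (fd k f)) = L2_norm ((fd k ^^ 2) f)"
    unfolding e L2_norm_uminus L2_norm_sh by (simp add: numeral_2_eq_2)
  finally show ?thesis by (simp add: mult.commute)
qed

lemma L2_norm_fd_le: assumes "f \<in> L2" shows "L2_norm (fd k f) \<le> 2 * L2_norm f"
  using L2_norm_triangle_diff[OF L2_sh[OF assms, of k] assms] L2_norm_sh[of k f]
  by (simp add: fd_def[abs_def] sh_def[abs_def])

lemma L2_norm_fdn_le: assumes "f \<in> L2" shows "L2_norm ((fd k ^^ j) f) \<le> 2 ^ j * L2_norm f"
proof (induct j)
  case (Suc j)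
  then show ?case using L2_norm_fd_le[OF L2_fdn[OF assms], of k j k] by simp
qed simp

text \<open>Leibniz rule for differences of a square. At order 2 it produces products of first
  differences, which \<open>fd_interpolation\<close> turns back into \<open>f\<close> times its
  second difference; hence the bound is linear in the difference of order \<open>j\<close>, as the
  Gronwall argument demands.\<close>

lemma fd_square_L1: assumes f: "f \<in> L2" and j: "j \<in> {1, 2}"
  shows "L1_norm ((fd k ^^ j) (\<lambda>x. (f x)\<^sup>2)) \<le> 4 * L2_norm f * L2_norm ((fd k ^^ j) f)"
proof (cases "j = 1")
  case True
  have "fd k (\<lambda>x. (f x)\<^sup>2) = (\<lambda>x. (sh k f x)\<^sup>2 - (f x)\<^sup>2)" by (auto simp: fd_def sh_def)
  then have "L1_norm (fd k (\<lambda>x. (f x)\<^sup>2)) \<le> L2_norm (fd k f) * (2 * L2_norm f)"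
    using L1_norm_square_diff[OF L2_sh[OF f, of k] f] L2_norm_sh[of k f]
    by (simp add: fd_def[abs_def] sh_def[abs_def])
  also have "\<dots> \<le> 4 * L2_norm f * L2_norm (fd k f)" by simp
  finally show ?thesis using True by simp
next
  case False
  then have j: "j = 2" using j by simp
  let ?d = "fd k f" and ?dd = "(fd k ^^ 2) f"
  have L: "?d \<in> L2" "?dd \<in> L2" using f by (auto intro: L2_intros)
  define a where "a = (\<lambda>x. sh (2*k) f x + sh k f x)"
  define c where "c = (\<lambda>x. sh k ?d x + ?d x)"
  have La: "a \<in> L2" "c \<in> L2" unfolding a_def c_def using f by (auto intro!: L2_intros)
  have na: "L2_norm a \<le> 2 * L2_norm f" unfolding a_def
    using L2_norm_triangle[OF L2_sh[OF f] L2_sh[OF f], of "2*k" k] by (simp add: L2_norm_sh)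
  have nc: "L2_norm c \<le> 2 * L2_norm ?d" unfolding c_def
    using L2_norm_triangle[OF L2_sh[OF L(1)] L(1), of k] by (simp add: L2_norm_sh)
  have "(fd k ^^ 2) (\<lambda>x. (f x)\<^sup>2) = (\<lambda>x. a x * ?dd x + ?d x * c x)"
    by (rule ext) (simp add: a_def c_def numeral_2_eq_2 fd_def sh_def power2_eq_square algebra_simps)
  then have "L1_norm ((fd k ^^ 2) (\<lambda>x. (f x)\<^sup>2)) \<le> L1_norm (\<lambda>x. a x * ?dd x) + L1_norm (\<lambda>x. ?d x * c x)"
    using L1_norm_triangle[OF L2_mult_integrable[OF La(1) L(2)] L2_mult_integrable[OF L(1) La(2)]] by simp
  also have "\<dots> \<le> L2_norm a * L2_norm ?dd + L2_norm ?d * L2_norm c"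
    using L1_norm_mult_le L La by (intro add_mono) auto
  also have "\<dots> \<le> 2 * L2_norm f * L2_norm ?dd + L2_norm ?d * (2 * L2_norm ?d)"
    using na nc by (intro add_mono mult_right_mono mult_left_mono) auto
  also have "L2_norm ?d * (2 * L2_norm ?d) = 2 * (L2_norm ?d)\<^sup>2" by (simp add: power2_eq_square)
  also have "\<dots> \<le> 2 * (L2_norm f * L2_norm ?dd)" using fd_interpolation[OF f, of k] by simp
  finally show ?thesis using j by simp
qed

text \<open>Riesz-Fischer along a sequence with geometric increments. Monotone convergence for the
  sums \<open>S N\<close> of absolute increments gives a limit almost everywhere; Fatou's lemma
  carries the tail bound \<open>2 * C * (1/2)^n\<close> to it.\<close>

lemma L2_complete:
  fixes F :: "nat \<Rightarrow> real \<Rightarrow> real"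
  assumes F: "\<And>n. F n \<in> L2" and d: "\<And>n. L2_norm (\<lambda>x. F (Suc n) x - F n x) \<le> C * (1/2) ^ n"
      and C: "C \<ge> 0"
  shows "\<exists>f\<in>L2. \<forall>n. L2_norm (\<lambda>x. F n x - f x) \<le> 2 * C * (1/2) ^ n"
proof -
  have [measurable]: "F n \<in> borel_measurable borel" for n using F by (rule L2_measurable)
  define S where "S N x = (\<Sum>n<N. \<bar>F (Suc n) x - F n x\<bar>)" for N x
  have [measurable]: "S N \<in> borel_measurable borel" for N unfolding S_def by measurable
  have absL2: "(\<lambda>x. \<bar>f x\<bar>) \<in> L2" if "f \<in> L2" for f
    using that by (intro L2I) (auto simp: L2_integrable_sq dest: L2_measurable)
  have absn: "L2_norm (\<lambda>x. \<bar>f x\<bar>) = L2_norm f" for f by (simp add: L2_norm_def)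
  have SL: "S N \<in> L2 \<and> L2_norm (S N) \<le> 2 * C - 2 * C * (1/2)^N" for N
  proof (induct N)
    case 0 then show ?case by (simp add: S_def[abs_def] L2_zero)
  next
    case (Suc N)
    have e: "S (Suc N) = (\<lambda>x. S N x + \<bar>F (Suc N) x - F N x\<bar>)" by (auto simp: S_def)
    have a: "(\<lambda>x. \<bar>F (Suc N) x - F N x\<bar>) \<in> L2" by (intro absL2 L2_diff F)
    have "L2_norm (S (Suc N)) \<le> L2_norm (S N) + L2_norm (\<lambda>x. F (Suc N) x - F N x)"
      unfolding e using L2_norm_triangle[OF conjunct1[OF Suc] a] absn[of "\<lambda>x. F (Suc N) x - F N x"] by simp
    then show ?case using Suc d[of N] a L2_add[OF _ a] unfolding e by simp
  qed
  have Sm: "S N x \<le> S M x" if "N \<le> M" for N M x unfolding S_def using that by (intro sum_mono2) auto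
  have S0: "0 \<le> S N x" for N x unfolding S_def by (intro sum_nonneg) auto
  have inc: "incseq (\<lambda>N x. ennreal ((S N x)\<^sup>2))"
    unfolding incseq_def le_fun_def using Sm S0 by (auto intro!: ennreal_leI power_mono)
  have "(\<integral>\<^sup>+x. (SUP N. ennreal ((S N x)\<^sup>2)) \<partial>lborel) = (SUP N. \<integral>\<^sup>+x. ennreal ((S N x)\<^sup>2) \<partial>lborel)"
    using nn_integral_monotone_convergence_SUP[OF inc, of lborel] by simp
  also have "\<dots> \<le> ennreal ((2*C)\<^sup>2)"
  proof (rule SUP_least)
    fix N
    have "0 \<le> 2 * C * (1/2)^N" using C by simp
    then have "L2_norm (S N) \<le> 2 * C" using SL[of N] by linarith
    then have "(L2_norm (S N))\<^sup>2 \<le> (2*C)\<^sup>2" by (rule power_mono) simp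
    then show "(\<integral>\<^sup>+x. ennreal ((S N x)\<^sup>2) \<partial>lborel) \<le> ennreal ((2*C)\<^sup>2)"
      unfolding nn_integral_L2[OF conjunct1[OF SL]] by (rule ennreal_leI)
  qed
  finally have "(\<integral>\<^sup>+x. (SUP N. ennreal ((S N x)\<^sup>2)) \<partial>lborel) \<le> ennreal ((2*C)\<^sup>2)" .
  then have "(\<integral>\<^sup>+x. (SUP N. ennreal ((S N x)\<^sup>2)) \<partial>lborel) < \<infinity>"
    by (rule le_less_trans) simp
  then have fin: "(\<integral>\<^sup>+x. (SUP N. ennreal ((S N x)\<^sup>2)) \<partial>lborel) \<noteq> \<infinity>" by simp
  have ae: "AE x in lborel. (SUP N. ennreal ((S N x)\<^sup>2)) \<noteq> \<infinity>"
    by (rule nn_integral_PInf_AE[OF _ fin]) simp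
  define f where "f x = lim (\<lambda>n. F n x)" for x
  have [measurable]: "f \<in> borel_measurable borel" unfolding f_def by measurable
  have conv: "AE x in lborel. (\<lambda>n. F n x) \<longlonglongrightarrow> f x"
    using ae
  proof eventually_elim
    case (elim x)
    then obtain c where c: "(SUP N. ennreal ((S N x)\<^sup>2)) = ennreal c" "c \<ge> 0"
      by (metis ennreal_cases infinity_ennreal_def)
    have "S N x \<le> sqrt c" for N
    proof -
      have "ennreal ((S N x)\<^sup>2) \<le> ennreal c" unfolding c(1)[symmetric] by (rule SUP_upper) simp
      then have "(S N x)\<^sup>2 \<le> c" using c(2) by simp
      then show ?thesis using real_le_rsqrt by blast
    qed
    then have "summable (\<lambda>n. \<bar>F (Suc n) x - F n x\<bar>)"
      unfolding S_def by (intro bounded_imp_summable[of _ "sqrt c"])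
        (auto simp: lessThan_Suc_atMost[symmetric] simp del: sum.lessThan_Suc)
    then have "summable (\<lambda>n. F (Suc n) x - F n x)" by (rule summable_rabs_cancel)
    then have "convergent (\<lambda>N. \<Sum>n<N. F (Suc n) x - F n x)" by (simp add: summable_iff_convergent)
    then have c1: "convergent (\<lambda>N. F N x - F 0 x)"
      by (simp add: sum_lessThan_telescope[of "\<lambda>n. F n x"])
    have "convergent (\<lambda>N. F N x)" using convergent_add[OF c1 convergent_const[of "F 0 x"]] by simp
    then show ?case by (simp add: f_def convergent_LIMSEQ_iff)
  qed
  have tail: "L2_norm (\<lambda>x. F n x - F (n + m) x) \<le> 2 * C * (1/2)^n - 2 * C * (1/2)^(n+m)" for n m
  proof (induct m)
    case (Suc m)
    have "L2_norm (\<lambda>x. F n x - F (n + Suc m) x) \<le> L2_norm (\<lambda>x. F n x - F (n + m) x) + L2_norm (\<lambda>x. F (n+m) x - F (n + Suc m) x)"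
      by (rule L2_norm_triangle3[OF F F F])
    also have "L2_norm (\<lambda>x. F (n+m) x - F (n + Suc m) x) \<le> C * (1/2)^(n+m)"
      using d[of "n+m"] by (subst L2_norm_diff_commute) simp
    finally show ?case using Suc by simp
  qed simp
  have key: "(\<lambda>x. F n x - f x) \<in> L2 \<and> L2_norm (\<lambda>x. F n x - f x) \<le> 2 * C * (1/2)^n" for n
  proof -
    have "(\<integral>\<^sup>+x. ennreal ((F n x - f x)\<^sup>2) \<partial>lborel) = (\<integral>\<^sup>+x. liminf (\<lambda>m. ennreal ((F n x - F (n+m) x)\<^sup>2)) \<partial>lborel)"
    proof (rule nn_integral_cong_AE, use conv in eventually_elim)
      fix x assume "(\<lambda>n. F n x) \<longlonglongrightarrow> f x"
      then have "(\<lambda>m. F (n+m) x) \<longlonglongrightarrow> f x"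
        using LIMSEQ_ignore_initial_segment[of "\<lambda>n. F n x" "f x" n] by (simp add: add.commute)
      then have "(\<lambda>m. ennreal ((F n x - F (n+m) x)\<^sup>2)) \<longlonglongrightarrow> ennreal ((F n x - f x)\<^sup>2)"
        by (intro tendsto_ennrealI tendsto_intros)
      then show "ennreal ((F n x - f x)\<^sup>2) = liminf (\<lambda>m. ennreal ((F n x - F (n+m) x)\<^sup>2))"
        by (intro lim_imp_Liminf[symmetric]) auto
    qed
    also have "\<dots> \<le> liminf (\<lambda>m. \<integral>\<^sup>+x. ennreal ((F n x - F (n+m) x)\<^sup>2) \<partial>lborel)"
      by (rule nn_integral_liminf) simp
    also have "\<dots> \<le> limsup (\<lambda>m. \<integral>\<^sup>+x. ennreal ((F n x - F (n+m) x)\<^sup>2) \<partial>lborel)"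
      by (rule Liminf_le_Limsup) simp
    also have "\<dots> \<le> ennreal ((2 * C * (1/2)^n)\<^sup>2)"
    proof (rule Limsup_bounded, rule always_eventually, rule allI)
      fix m
      have "0 \<le> 2 * C * (1/2)^(n+m)" using C by simp
      then have "L2_norm (\<lambda>x. F n x - F (n + m) x) \<le> 2 * C * (1/2)^n" using tail[of n m] by linarith
      then show "(\<integral>\<^sup>+x. ennreal ((F n x - F (n+m) x)\<^sup>2) \<partial>lborel) \<le> ennreal ((2 * C * (1/2)^n)\<^sup>2)"
        by (subst nn_integral_L2[OF L2_diff[OF F F]]) (auto intro!: ennreal_leI power_mono)
    qed
    finally have "(\<integral>\<^sup>+x. ennreal ((F n x - f x)\<^sup>2) \<partial>lborel) \<le> ennreal ((2 * C * (1/2)^n)\<^sup>2)" .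
    then show ?thesis using C L2_norm_nn[of "\<lambda>x. F n x - f x" "2 * C * (1/2)^n"] by simp
  qed
  have "f \<in> L2" using L2_diff[OF F[of 0] conjunct1[OF key[of 0]]] by simp
  then show ?thesis using key by blast
qed

section \<open>Averages of translates against probability measures\<close>

text \<open>Convolution of \<open>f\<close> with the measure \<open>M\<close>. Both linear flows,
  the heat flow and \<open>X\<close>, are of this kind with \<open>M\<close> a probability measure,
  so contraction, commutation with translations and the distance to the identity are proved
  once.\<close>

definition Tm :: "real measure \<Rightarrow> (real \<Rightarrow> real) \<Rightarrow> real \<Rightarrow> real" where
  "Tm M f x = (LINT y|M. f (x - y))"

text \<open>The law of \<open>-y\<close>; averaging against it is the adjoint of averaging against
  \<open>M\<close>.\<close>

definition Tr :: "real measure \<Rightarrow> real measure" where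
  "Tr M = distr M borel uminus"

context real_distribution begin

lemma pair_lborel: "pair_sigma_finite lborel M" by unfold_locales
lemma real_distribution_Tr: "real_distribution (Tr M)"
  unfolding Tr_def by (rule real_distribution_distr) simp

lemma integral_Tr:
  fixes c :: "real \<Rightarrow> real"
  assumes [measurable]: "c \<in> borel_measurable borel"
  shows "(LINT y|Tr M. c y) = (LINT y|M. c (- y))"
  unfolding Tr_def by (subst integral_distr) auto

lemma Tm_measurable:
  assumes [measurable]: "f \<in> borel_measurable borel"
  shows "Tm M f \<in> borel_measurable borel"
  unfolding Tm_def by measurable

lemma Tm_sh: "Tm M (sh k f) = sh k (Tm M f)"
  by (auto simp: Tm_def sh_def algebra_simps)

lemma Tm_Tr: assumes [measurable]: "f \<in> borel_measurable borel"
  shows "Tm (Tr M) f x = (LINT y|M. f (x + y))"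
  unfolding Tm_def by (subst integral_Tr) auto

text \<open>Fubini for one average, with the product integrability supplied by a bound uniform in
  the translate. It is applied with \<open>b\<close> in \<open>L2\<close>, and with \<open>b\<close>
  bounded against an integrable \<open>f\<close>.\<close>

lemma Tm_pair:
  assumes [measurable]: "b \<in> borel_measurable borel" "f \<in> borel_measurable borel"
    and C: "\<And>y. (\<integral>\<^sup>+x. ennreal \<bar>b x * f (x - y)\<bar> \<partial>lborel) \<le> ennreal C"
  shows "(LINT x|lborel. b x * Tm M f x) = (LINT y|M. LINT x|lborel. b x * f (x - y))" (is ?A)
    and "integrable lborel (\<lambda>x. b x * Tm M f x)" (is ?B)
    and "AE x in lborel. integrable M (\<lambda>y. b x * f (x - y))" (is ?D)
proof -
  interpret P: pair_sigma_finite lborel M by (rule pair_lborel)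
  have i: "integrable (lborel \<Otimes>\<^sub>M M) (\<lambda>(x, y). b x * f (x - y))"
  proof (rule integrableI_bounded)
    have "(\<integral>\<^sup>+z. ennreal (norm (case z of (x, y) \<Rightarrow> b x * f (x - y))) \<partial>(lborel \<Otimes>\<^sub>M M))
       = (\<integral>\<^sup>+y. (\<integral>\<^sup>+x. ennreal \<bar>b x * f (x - y)\<bar> \<partial>lborel) \<partial>M)"
      by (subst P.nn_integral_snd[symmetric]) (auto simp: split_beta')
    also have "\<dots> \<le> (\<integral>\<^sup>+y. ennreal C \<partial>M)" by (intro nn_integral_mono C)
    also have "\<dots> = ennreal C" by (simp add: emeasure_space_1[unfolded space_eq_univ])
    finally show "(\<integral>\<^sup>+z. ennreal (norm (case z of (x, y) \<Rightarrow> b x * f (x - y))) \<partial>(lborel \<Otimes>\<^sub>M M)) < \<infinity>"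
      by (rule le_less_trans) simp
  qed simp
  have e: "b x * Tm M f x = (LINT y|M. b x * f (x - y))" for x by (simp add: Tm_def)
  show ?A unfolding e using P.Fubini_integral[of "\<lambda>x y. b x * f (x - y)"] i by simp
  show ?B unfolding e using P.integrable_fst[of "\<lambda>x y. b x * f (x - y)"] i by simp
  show ?D using P.AE_integrable_fst[of "\<lambda>x y. b x * f (x - y)"] i by simp
qed

lemma nn_ip_bound: assumes "b \<in> L2" "f \<in> L2"
  shows "(\<integral>\<^sup>+x. ennreal \<bar>b x * f (x - y)\<bar> \<partial>lborel) \<le> ennreal (L2_norm b * L2_norm f)"
proof -
  have i: "integrable lborel (\<lambda>x. \<bar>b x * f (x - y)\<bar>)"
    using L2_mult_integrable[OF assms(1) L2_sh[OF assms(2), of "-y"]] by (simp add: sh_def)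
  have "(LINT x|lborel. \<bar>b x * f (x - y)\<bar>) \<le> L2_norm b * L2_norm f"
    using L2_CS_abs[OF assms(1) L2_sh[OF assms(2), of "-y"]] by (simp add: sh_def L2_norm_sh)
  then show ?thesis by (subst nn_integral_eq_integral[OF i]) (auto intro: ennreal_leI)
qed

lemma ip_Tm: assumes "b \<in> L2" "f \<in> L2"
  shows "ip b (Tm M f) = (LINT y|M. ip b (sh (-y) f))"
  using Tm_pair(1)[OF L2_measurable[OF assms(1)] L2_measurable[OF assms(2)] nn_ip_bound[OF assms]]
  by (simp add: ip_def sh_def)

text \<open>Pointwise Jensen, in the form that a variance is nonnegative, then Tonelli and
  translation invariance of Lebesgue measure.\<close>

lemma L2_Tm: assumes f: "f \<in> L2" shows "Tm M f \<in> L2" "L2_norm (Tm M f) \<le> L2_norm f"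
proof -
  interpret P: pair_sigma_finite lborel M by (rule pair_lborel)
  have [measurable]: "f \<in> borel_measurable borel" using f by (rule L2_measurable)
  have t: "(\<integral>\<^sup>+x. (\<integral>\<^sup>+y. ennreal ((f (x - y))\<^sup>2) \<partial>M) \<partial>lborel) = ennreal ((L2_norm f)\<^sup>2)"
  proof -
    have "(\<integral>\<^sup>+x. (\<integral>\<^sup>+y. ennreal ((f (x - y))\<^sup>2) \<partial>M) \<partial>lborel) = (\<integral>\<^sup>+y. (\<integral>\<^sup>+x. ennreal ((f (x + - y))\<^sup>2) \<partial>lborel) \<partial>M)"
      by (subst P.Fubini'[symmetric]) auto
    also have "\<dots> = (\<integral>\<^sup>+y. ennreal ((L2_norm f)\<^sup>2) \<partial>M)"
      by (rule nn_integral_cong, subst nn_lborel_shift[where f="\<lambda>x. ennreal ((f x)\<^sup>2)"]) (auto simp: nn_integral_L2[OF f])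
    finally show ?thesis by (simp add: emeasure_space_1[unfolded space_eq_univ])
  qed
  have "AE x in lborel. (\<integral>\<^sup>+y. ennreal ((f (x - y))\<^sup>2) \<partial>M) \<noteq> \<infinity>"
    by (rule nn_integral_PInf_AE) (auto simp: t)
  then have ae: "AE x in lborel. ennreal ((Tm M f x)\<^sup>2) \<le> (\<integral>\<^sup>+y. ennreal ((f (x - y))\<^sup>2) \<partial>M)"
  proof eventually_elim
    case (elim x)
    have i2: "integrable M (\<lambda>y. (f (x - y))\<^sup>2)"
      using elim by (intro integrableI_bounded) (auto simp: less_top)
    have i1: "integrable M (\<lambda>y. f (x - y))" by (rule square_integrable_imp_integrable[OF _ i2]) simp
    have "0 \<le> variance (\<lambda>y. f (x - y))" by (rule variance_positive)
    then have "(Tm M f x)\<^sup>2 \<le> (LINT y|M. (f (x - y))\<^sup>2)"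
      unfolding variance_eq[OF i1 i2] by (simp add: Tm_def)
    then show ?case by (subst nn_integral_eq_integral[OF i2]) (auto intro: ennreal_leI)
  qed
  have "(\<integral>\<^sup>+x. ennreal ((Tm M f x)\<^sup>2) \<partial>lborel) \<le> ennreal ((L2_norm f)\<^sup>2)"
    unfolding t[symmetric] by (rule nn_integral_mono_AE[OF ae])
  then show "Tm M f \<in> L2" "L2_norm (Tm M f) \<le> L2_norm f"
    using L2_norm_nn[of "Tm M f" "L2_norm f"] by (auto simp: Tm_measurable)
qed

lemma ip_sh_measurable[measurable]: assumes "b \<in> L2" "f \<in> L2"
  shows "(\<lambda>y. ip b (sh y f)) \<in> borel_measurable borel"
proof -
  have [measurable]: "b \<in> borel_measurable borel" "f \<in> borel_measurable borel" using assms
    by (auto dest: L2_measurable)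
  show ?thesis unfolding ip_def sh_def by measurable
qed

lemma Tm_adjoint: assumes "b \<in> L2" "f \<in> L2"
  shows "ip b (Tm M f) = ip (Tm (Tr M) b) f"
proof -
  interpret R: real_distribution "Tr M" by (rule real_distribution_Tr)
  have "ip (Tm (Tr M) b) f = (LINT y|Tr M. ip f (sh (-y) b))"
    using R.ip_Tm[OF assms(2,1)] by (simp add: ip_commute)
  also have "\<dots> = (LINT y|M. ip f (sh y b))"
    using measurable_compose[OF borel_measurable_uminus[OF measurable_ident] ip_sh_measurable[OF assms(2,1)]]
    by (subst integral_Tr) auto
  also have "\<dots> = (LINT y|M. ip b (sh (-y) f))" by (simp add: ip_sh ip_commute[of f])
  finally show ?thesis by (simp add: ip_Tm assms)
qed

lemma integrable_ip_sh: assumes "b \<in> L2" "f \<in> L2"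
  shows "integrable M (\<lambda>y. ip b (sh (-y) f))"
proof (rule integrable_const_bound[where B="L2_norm b * L2_norm f"])
  show "AE y in M. norm (ip b (sh (-y) f)) \<le> L2_norm b * L2_norm f"
    using ip_CS[OF assms(1) L2_sh[OF assms(2)]] by (simp add: L2_norm_sh)
  show "(\<lambda>y. ip b (sh (-y) f)) \<in> borel_measurable M"
    using measurable_compose[OF borel_measurable_uminus[OF measurable_ident] ip_sh_measurable[OF assms]] by simp
qed

lemma sh_fdn: "sh a ((fd k ^^ j) f) = (fd k ^^ j) (sh a f)"
proof (induct j)
  case (Suc j)
  then show ?case by (simp add: Suc[symmetric]) (auto simp: fd_def sh_def algebra_simps)
qed simp

lemma ip_fdn_Tm: assumes "b \<in> L2" "f \<in> L2"
  shows "ip ((fd (-k) ^^ j) b) (Tm M f) = ip b (Tm M ((fd k ^^ j) f))"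
  using assms by (simp add: ip_Tm L2_fdn sh_fdn ip_fdn L2_sh)

text \<open>Each translate differs from \<open>f\<close> by at most \<open>|y| * B\<close> in norm,
  and \<open>M\<close> averages this to its first absolute moment times \<open>B\<close>. For the
  law of \<open>X\<close> over a time \<open>r\<close> the moment is at most \<open>2 * r\<close>:
  this is where the order of the splitting error comes from.\<close>

lemma Tm_near:
  assumes f: "f \<in> L2" and B: "\<And>k. L2_norm (fd k f) \<le> \<bar>k\<bar> * B" "B \<ge> 0"
    and m: "integrable M (\<lambda>y. \<bar>y\<bar>)" "(LINT y|M. \<bar>y\<bar>) \<le> m"
  shows "L2_norm (\<lambda>x. Tm M f x - f x) \<le> m * B"
proof (rule L2_norm_le_dual)
  show "(\<lambda>x. Tm M f x - f x) \<in> L2" using f by (intro L2_diff L2_Tm)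
  have "0 \<le> (LINT y|M. \<bar>y\<bar>)" by simp
  then have m0: "0 \<le> m" using m(2) by linarith
  then show "0 \<le> m * B" using B by simp
  fix b assume b: "b \<in> L2"
  have e: "ip b (sh (-y) f) - ip b f = ip b (fd (-y) f)" for y
    using ip_diff_right[OF b L2_sh[OF f] f, of "-y"] by (simp add: fd_def[abs_def] sh_def[abs_def])
  have "ip b (\<lambda>x. Tm M f x - f x) = (LINT y|M. ip b (sh (-y) f)) - ip b f"
    using b f by (simp add: ip_diff_right L2_Tm ip_Tm)
  also have "\<dots> = (LINT y|M. ip b (sh (-y) f) - ip b f)"
    using b f by (simp add: integrable_ip_sh prob_space[unfolded space_eq_univ])
  also have "\<dots> = (LINT y|M. ip b (fd (-y) f))" by (simp add: e)
  finally have e2: "ip b (\<lambda>x. Tm M f x - f x) = (LINT y|M. ip b (fd (-y) f))" .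
  have "\<bar>LINT y|M. ip b (fd (-y) f)\<bar> \<le> (LINT y|M. \<bar>y\<bar> * (B * L2_norm b))"
  proof (rule order_trans[OF integral_abs_bound], rule integral_mono)
    show "integrable M (\<lambda>y. \<bar>ip b (fd (-y) f)\<bar>)"
      unfolding e[symmetric] using b f by (intro integrable_abs Bochner_Integration.integrable_diff integrable_ip_sh) auto
    show "integrable M (\<lambda>y. \<bar>y\<bar> * (B * L2_norm b))" using m(1) by simp
    fix y
    have "\<bar>ip b (fd (-y) f)\<bar> \<le> L2_norm b * L2_norm (fd (-y) f)" by (rule ip_CS[OF b L2_fd[OF f]])
    also have "\<dots> \<le> L2_norm b * (\<bar>y\<bar> * B)" using B(1)[of "-y"] by (intro mult_left_mono) auto
    finally show "\<bar>ip b (fd (-y) f)\<bar> \<le> \<bar>y\<bar> * (B * L2_norm b)" by (simp add: mult_ac)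
  qed
  also have "\<dots> = (LINT y|M. \<bar>y\<bar>) * (B * L2_norm b)" by simp
  also have "\<dots> \<le> m * (B * L2_norm b)" using m(2) B by (intro mult_right_mono) auto
  finally show "\<bar>ip b (\<lambda>x. Tm M f x - f x)\<bar> \<le> m * B * L2_norm b" by (simp add: e2 mult_ac)
qed

lemma nn_bdd_L1: assumes "\<And>x. \<bar>b x\<bar> \<le> C" and f: "integrable lborel f"
  shows "(\<integral>\<^sup>+x. ennreal \<bar>b x * f (x - y)\<bar> \<partial>lborel) \<le> ennreal (C * L1_norm f)"
proof -
  have [measurable]: "f \<in> borel_measurable borel" using f by auto
  have i: "integrable lborel (\<lambda>x. C * \<bar>f (x - y)\<bar>)"
    using lborel_shift_integrable[of f "-y"] f by simp
  have "(\<integral>\<^sup>+x. ennreal \<bar>b x * f (x - y)\<bar> \<partial>lborel) \<le> (\<integral>\<^sup>+x. ennreal (C * \<bar>f (x - y)\<bar>) \<partial>lborel)"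
    using assms(1) by (intro nn_integral_mono ennreal_leI) (auto simp: abs_mult intro!: mult_right_mono)
  also have "\<dots> = ennreal (LINT x|lborel. C * \<bar>f (x - y)\<bar>)"
    using assms(1)[of 0] by (intro nn_integral_eq_integral[OF i]) auto
  also have "(LINT x|lborel. C * \<bar>f (x - y)\<bar>) = C * L1_norm f"
    using lborel_shift[of "\<lambda>x. \<bar>f x\<bar>" "-y"] by (simp add: L1_norm_def)
  finally show ?thesis .
qed

lemma L1_Tm: assumes f: "integrable lborel f"
  shows "integrable lborel (Tm M f)" "L1_norm (Tm M f) \<le> L1_norm f" "AE x in lborel. integrable M (\<lambda>y. f (x - y))"
proof -
  have m: "f \<in> borel_measurable borel" using f by auto
  show i: "integrable lborel (Tm M f)"
    using Tm_pair(2)[of "\<lambda>x. 1" f "1 * L1_norm f"] nn_bdd_L1[of "\<lambda>x. 1" 1 f] f m by simp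
  show "AE x in lborel. integrable M (\<lambda>y. f (x - y))"
    using Tm_pair(3)[of "\<lambda>x. 1" f "1 * L1_norm f"] nn_bdd_L1[of "\<lambda>x. 1" 1 f] f m by simp
  let ?a = "\<lambda>x. \<bar>f x\<bar>"
  have a: "integrable lborel ?a" "L1_norm ?a = L1_norm f" using f by (auto simp: L1_norm_def)
  have ia: "integrable lborel (Tm M ?a)"
    using Tm_pair(2)[of "\<lambda>x. 1" ?a "1 * L1_norm ?a"] nn_bdd_L1[of "\<lambda>x. 1" 1 ?a] a m by simp
  have "L1_norm (Tm M f) \<le> (LINT x|lborel. Tm M ?a x)"
    unfolding L1_norm_def
    by (rule integral_mono[OF integrable_abs[OF i] ia]) (simp add: Tm_def integral_abs_bound)
  also have "\<dots> = (LINT y|M. LINT x|lborel. \<bar>f (x - y)\<bar>)"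
    using Tm_pair(1)[of "\<lambda>x. 1" ?a "1 * L1_norm ?a"] nn_bdd_L1[of "\<lambda>x. 1" 1 ?a] a m by simp
  also have "\<dots> = L1_norm f"
    using lborel_shift[of ?a "- _"] by (simp add: L1_norm_def prob_space[unfolded space_eq_univ])
  finally show "L1_norm (Tm M f) \<le> L1_norm f" .
qed

text \<open>The same for squares of solutions, which are only integrable; Tonelli on absolute values
  replaces the pairing.\<close>

lemma Tm_near_L1:
  assumes f: "integrable lborel f" and B: "\<And>k. L1_norm (fd k f) \<le> \<bar>k\<bar> * B" "B \<ge> 0"
    and m: "integrable M (\<lambda>y. \<bar>y\<bar>)" "(LINT y|M. \<bar>y\<bar>) \<le> m"
  shows "L1_norm (\<lambda>x. Tm M f x - f x) \<le> m * B"
proof -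
  interpret P: pair_sigma_finite lborel M by (rule pair_lborel)
  have [measurable]: "f \<in> borel_measurable borel" using f by auto
  have i: "integrable lborel (\<lambda>x. \<bar>Tm M f x - f x\<bar>)" using L1_Tm(1)[OF f] f by simp
  have "0 \<le> (LINT y|M. \<bar>y\<bar>)" by simp
  then have m0: "0 \<le> m" using m(2) by linarith
  have "ennreal (L1_norm (\<lambda>x. Tm M f x - f x)) = (\<integral>\<^sup>+x. ennreal \<bar>Tm M f x - f x\<bar> \<partial>lborel)"
    unfolding L1_norm_def by (rule nn_integral_eq_integral[OF i, symmetric]) simp
  also have "\<dots> \<le> (\<integral>\<^sup>+x. (\<integral>\<^sup>+y. ennreal \<bar>f (x - y) - f x\<bar> \<partial>M) \<partial>lborel)"
  proof (rule nn_integral_mono_AE, use L1_Tm(3)[OF f] in eventually_elim)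
    fix x assume ix: "integrable M (\<lambda>y. f (x - y))"
    then have "Tm M f x - f x = (LINT y|M. f (x - y) - f x)"
      by (simp add: Tm_def prob_space[unfolded space_eq_univ])
    then have "\<bar>Tm M f x - f x\<bar> \<le> (LINT y|M. \<bar>f (x - y) - f x\<bar>)" by (simp add: integral_abs_bound)
    then show "ennreal \<bar>Tm M f x - f x\<bar> \<le> (\<integral>\<^sup>+y. ennreal \<bar>f (x - y) - f x\<bar> \<partial>M)"
      using ix by (subst nn_integral_eq_integral) (auto intro: ennreal_leI)
  qed
  also have "\<dots> = (\<integral>\<^sup>+y. (\<integral>\<^sup>+x. ennreal \<bar>f (x - y) - f x\<bar> \<partial>lborel) \<partial>M)"
    by (subst P.Fubini'[symmetric]) auto
  also have "\<dots> \<le> (\<integral>\<^sup>+y. ennreal (\<bar>y\<bar> * B) \<partial>M)"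
  proof (rule nn_integral_mono)
    fix y
    have "(\<integral>\<^sup>+x. ennreal \<bar>f (x - y) - f x\<bar> \<partial>lborel) = ennreal (L1_norm (fd (-y) f))"
      unfolding L1_norm_def using L1_fd[OF f, of "-y"]
      by (subst nn_integral_eq_integral[symmetric]) (auto simp: fd_def[abs_def])
    also have "\<dots> \<le> ennreal (\<bar>y\<bar> * B)" using B(1)[of "-y"] by (intro ennreal_leI) simp
    finally show "(\<integral>\<^sup>+x. ennreal \<bar>f (x - y) - f x\<bar> \<partial>lborel) \<le> ennreal (\<bar>y\<bar> * B)" .
  qed
  also have "\<dots> = ennreal (LINT y|M. \<bar>y\<bar> * B)"
    using m(1) B(2) by (intro nn_integral_eq_integral) auto
  also have "\<dots> \<le> ennreal (m * B)" using m B by (intro ennreal_leI) (auto intro!: mult_right_mono)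
  finally show ?thesis using m0 B(2) by simp
qed

end

text \<open>The pairing of \<open>b\<close> with \<open>q * f\<close>, integrated in the order in which the inner integral is a bounded
  function; so it makes sense for \<open>f\<close> merely integrable.\<close>

definition W :: "(real \<Rightarrow> real) \<Rightarrow> (real \<Rightarrow> real) \<Rightarrow> (real \<Rightarrow> real) \<Rightarrow> real" where
  "W q b f = (LINT y|lborel. f y * ip b (sh (-y) q))"

lemma ip_sh_meas: assumes "b \<in> L2" "f \<in> L2"
  shows "(\<lambda>y. ip b (sh (-y) f)) \<in> borel_measurable borel"
proof -
  have [measurable]: "b \<in> borel_measurable borel" "f \<in> borel_measurable borel" using assms
    by (auto dest: L2_measurable)
  show ?thesis unfolding ip_def sh_def by measurable
qed

lemma ip_sh_bound: assumes "b \<in> L2" "f \<in> L2" shows "\<bar>ip b (sh y f)\<bar> \<le> L2_norm b * L2_norm f"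
  using ip_CS[OF assms(1) L2_sh[OF assms(2)], of y] by (simp add: L2_norm_sh)

lemma L1_bdd_integrable:
  assumes f: "integrable lborel f" and g: "g \<in> borel_measurable borel" "\<And>x. \<bar>g x\<bar> \<le> C"
  shows "integrable lborel (\<lambda>x::real. f x * g x :: real)" "(LINT x|lborel. \<bar>f x * g x\<bar>) \<le> L1_norm f * C"
proof -
  have b: "\<bar>f x * g x\<bar> \<le> \<bar>f x\<bar> * C" for x using g(2) by (auto simp: abs_mult intro!: mult_left_mono)
  have i: "integrable lborel (\<lambda>x. \<bar>f x\<bar> * C)" using f by simp
  show j: "integrable lborel (\<lambda>x. f x * g x)"
    by (rule Bochner_Integration.integrable_bound[OF i]) (use f g b in \<open>auto intro: order_trans[OF _ abs_ge_self]\<close>)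
  show "(LINT x|lborel. \<bar>f x * g x\<bar>) \<le> L1_norm f * C"
    using integral_mono[OF integrable_abs[OF j] i b] by (simp add: L1_norm_def)
qed

lemma W_integrable: assumes "q \<in> L2" "b \<in> L2" "integrable lborel f"
  shows "integrable lborel (\<lambda>y. f y * ip b (sh (-y) q))"
  by (rule L1_bdd_integrable(1)[OF assms(3) ip_sh_meas[OF assms(2,1)] ip_sh_bound[OF assms(2,1)]])

text \<open>Young's inequality for an \<open>L2\<close> kernel and an integrable forcing, in paired
  form: each translate of \<open>q\<close> is paired with \<open>b\<close> by
  Cauchy-Schwarz.\<close>

lemma W_bound: assumes "q \<in> L2" "b \<in> L2" "integrable lborel f"
  shows "\<bar>W q b f\<bar> \<le> L2_norm q * L2_norm b * L1_norm f"
proof -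
  have "\<bar>W q b f\<bar> \<le> (LINT y|lborel. \<bar>f y * ip b (sh (-y) q)\<bar>)"
    unfolding W_def by (rule integral_abs_bound)
  also have "\<dots> \<le> L1_norm f * (L2_norm b * L2_norm q)"
    by (rule L1_bdd_integrable(2)[OF assms(3) ip_sh_meas[OF assms(2,1)] ip_sh_bound[OF assms(2,1)]])
  finally show ?thesis by (simp add: mult_ac)
qed

lemma W_diff_f: assumes "q \<in> L2" "b \<in> L2" "integrable lborel f" "integrable lborel g"
  shows "W q b (\<lambda>x. f x - g x) = W q b f - W q b g"
  using assms by (simp add: W_def left_diff_distrib W_integrable)

lemma W_scale_f: "W q b (\<lambda>x. c * f x) = c * W q b f"
  by (simp add: W_def mult.assoc)

lemma W_diff_b: assumes "q \<in> L2" "b \<in> L2" "b' \<in> L2" "integrable lborel f"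
  shows "W q (\<lambda>x. b x - b' x) f = W q b f - W q b' f"
proof -
  have "ip (\<lambda>x. b x - b' x) (sh (-y) q) = ip b (sh (-y) q) - ip b' (sh (-y) q)" for y
    using ip_diff_right[OF L2_sh[OF assms(1)] assms(2,3), of "-y"] by (simp add: ip_commute)
  then show ?thesis using assms by (simp add: W_def right_diff_distrib W_integrable)
qed

lemma W_diff_q: assumes "q \<in> L2" "q' \<in> L2" "b \<in> L2" "integrable lborel f"
  shows "W (\<lambda>x. q x - q' x) b f = W q b f - W q' b f"
proof -
  have "ip b (sh (-y) (\<lambda>x. q x - q' x)) = ip b (sh (-y) q) - ip b (sh (-y) q')" for y
    using ip_diff_right[OF assms(3) L2_sh[OF assms(1)] L2_sh[OF assms(2)], of "-y" "-y"] by (simp add: sh_def[abs_def])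
  then show ?thesis using assms by (simp add: W_def right_diff_distrib W_integrable)
qed

lemma W_scale_q: "W (\<lambda>x. c * q x) b f = c * W q b f"
proof -
  have "ip b (sh (-y) (\<lambda>x. c * q x)) = c * ip b (sh (-y) q)" for y
    using ip_scale_right[of b c "sh (-y) q"] by (simp add: sh_def[abs_def])
  then show ?thesis by (simp add: W_def mult.left_commute)
qed

lemma sh_sh: "sh a (sh b f) = sh (a + b) f" by (auto simp: sh_def algebra_simps)

lemma W_sh_b: "W q (sh k b) f = W q b (sh (-k) f)"
proof -
  have h: "sh (-(y + k)) q = sh (-k) (sh (-y) q)" for y by (rule ext) (simp add: sh_def algebra_simps)
  have "W q (sh k b) f = (LINT y|lborel. f y * ip b (sh (-(y + k)) q))"
    by (simp only: W_def ip_sh h)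
  also have "\<dots> = (LINT y|lborel. f (y + k - k) * ip b (sh (-(y + k)) q))" by simp
  also have "\<dots> = W q b (sh (-k) f)"
    unfolding W_def using lborel_shift[of "\<lambda>y. f (y - k) * ip b (sh (-y) q)" k] by (simp add: sh_def)
  finally show ?thesis .
qed

lemma W_sh_q: "W (sh k q) b f = W q b (sh k f)"
proof -
  have "W (sh k q) b f = (LINT y|lborel. f (y + - k + k) * ip b (sh (-(y + -k)) q))"
    by (simp add: W_def sh_sh)
  also have "\<dots> = W q b (sh k f)"
    unfolding W_def using lborel_shift[of "\<lambda>y. f (y + k) * ip b (sh (-y) q)" "-k"] by (simp add: sh_def)
  finally show ?thesis .
qed

lemma fd_sh: "fd k f = (\<lambda>x. sh k f x - f x)" by (auto simp: fd_def sh_def)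

lemma W_fd_b: assumes "q \<in> L2" "b \<in> L2" "integrable lborel f"
  shows "W q (fd k b) f = W q b (fd (-k) f)"
  using assms by (simp add: fd_sh[of k b] fd_sh[of "-k" f] W_diff_b W_diff_f L2_sh L1_sh W_sh_b)

lemma W_fd_q: assumes "q \<in> L2" "b \<in> L2" "integrable lborel f"
  shows "W (fd k q) b f = W q b (fd k f)"
  using assms by (simp add: fd_sh[of k q] fd_sh[of "k" f] W_diff_q W_diff_f L2_sh L1_sh W_sh_q)

lemma L1_fdn: "integrable lborel f \<Longrightarrow> integrable lborel ((fd k ^^ j) f)"
  by (induct j) (auto intro: L1_fd)

text \<open>Convolution commutes with translations, so differences may be taken of the test function
  or of the forcing. This is how a Duhamel formula is differenced in space.\<close>

lemma W_fdn_b: assumes "q \<in> L2" "b \<in> L2" "integrable lborel f"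
  shows "W q ((fd (-k) ^^ j) b) f = W q b ((fd k ^^ j) f)"
  using assms(3)
proof (induct j arbitrary: f)
  case (Suc j)
  have "W q ((fd (-k) ^^ Suc j) b) f = W q ((fd (-k) ^^ j) b) (fd k f)"
    using assms Suc by (simp add: W_fd_b L2_fdn)
  also have "\<dots> = W q b ((fd k ^^ j) (fd k f))" using Suc by (intro Suc.hyps) (auto intro: L1_fd)
  finally show ?case by (simp add: funpow_swap1)
qed simp

context real_distribution begin

lemma W_Tm_b: assumes "q \<in> L2" "b \<in> L2"
  shows "W q (Tm (Tr M) b) f = W (Tm M q) b f"
  using assms by (simp add: W_def Tm_adjoint[symmetric] L2_sh Tm_sh)

lemma Tm_dual_bdd:
  assumes em[measurable]: "e \<in> borel_measurable borel" and eb: "\<And>x. \<bar>e x\<bar> \<le> C"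
      and f: "integrable lborel f"
  shows "(LINT y|lborel. e y * Tm M f y) = (LINT y|lborel. f y * Tm (Tr M) e y)"
proof -
  interpret R: real_distribution "Tr M" by (rule real_distribution_Tr)
  interpret P: pair_sigma_finite lborel M by (rule pair_lborel)
  have [measurable]: "f \<in> borel_measurable borel" using f by auto
  have r: "(LINT y|lborel. e y * f (y - z)) = (LINT y|lborel. f y * e (y + z))" for z
    using lborel_shift[of "\<lambda>y. e y * f (y - z)" z] by (simp add: mult.commute)
  have "(LINT y|lborel. e y * Tm M f y) = (LINT z|M. LINT y|lborel. e y * f (y - z))"
    by (rule Tm_pair(1)[OF em _ nn_bdd_L1[OF eb f]]) simp
  also have "\<dots> = (LINT z|Tr M. LINT y|lborel. f y * e (y - z))"
    unfolding r by (subst integral_Tr) auto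
  also have "\<dots> = (LINT y|lborel. f y * Tm (Tr M) e y)"
  proof (rule R.Tm_pair(1)[symmetric, where C="C * L1_norm f"])
    fix z
    have "(\<integral>\<^sup>+y. ennreal \<bar>f y * e (y - z)\<bar> \<partial>lborel) = (\<integral>\<^sup>+y. ennreal \<bar>e (y - z) * f (y - 0)\<bar> \<partial>lborel)"
      by (simp add: mult.commute)
    also have "\<dots> \<le> ennreal (C * L1_norm f)" using nn_bdd_L1[of "\<lambda>y. e (y - z)" C f 0] eb f by auto
    finally show "(\<integral>\<^sup>+y. ennreal \<bar>f y * e (y - z)\<bar> \<partial>lborel) \<le> ennreal (C * L1_norm f)" .
  qed auto
  finally show ?thesis .
qed

text \<open>Transport of the forcing can be booked as transport of the kernel. This lets two Duhamel
  formulas with different clocks be rewritten with the same kernel.\<close>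

lemma W_Tm_f: assumes q: "q \<in> L2" and b: "b \<in> L2" and f: "integrable lborel f"
  shows "W q b (Tm M f) = W (Tm M q) b f"
proof -
  define e where "e = (\<lambda>y. ip b (sh (-y) q))"
  have em[measurable]: "e \<in> borel_measurable borel" unfolding e_def by (rule ip_sh_meas[OF b q])
  have eb: "\<bar>e y\<bar> \<le> L2_norm b * L2_norm q" for y unfolding e_def by (rule ip_sh_bound[OF b q])
  have "W q b (Tm M f) = (LINT y|lborel. e y * Tm M f y)" by (simp add: W_def e_def mult.commute)
  also have "\<dots> = (LINT y|lborel. f y * Tm (Tr M) e y)" by (rule Tm_dual_bdd[OF em eb f])
  also have "\<dots> = W (Tm M q) b f"
  proof -
    have "Tm (Tr M) e y = ip b (sh (-y) (Tm M q))" for y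
      unfolding Tm_sh[symmetric] e_def using q b using em[unfolded e_def]
      by (subst Tm_Tr) (auto simp: ip_Tm L2_sh sh_sh minus_diff_commute[of y])
    then show ?thesis by (simp add: W_def)
  qed
  finally show ?thesis .
qed

end

section \<open>Composition of averages as convolution of laws\<close>

lemma real_distribution_convolution:
  assumes "real_distribution M" "real_distribution N"
  shows "real_distribution (M \<star> N)"
proof -
  interpret M: real_distribution M by fact
  interpret N: real_distribution N by fact
  interpret P: pair_prob_space M N by unfold_locales
  show ?thesis unfolding convolution_def
    by (intro P.real_distribution_distr) simp
qed

lemma integral_convolution:
  fixes c :: "real \<Rightarrow> real"
  assumes "real_distribution M" "real_distribution N" and [measurable]: "c \<in> borel_measurable borel"
      and C: "\<And>x. \<bar>c x\<bar> \<le> C"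
  shows "(LINT z|(M \<star> N). c z) = (LINT y|M. LINT z|N. c (y + z))"
proof -
  interpret M: real_distribution M by fact
  interpret N: real_distribution N by fact
  interpret P: pair_prob_space M N by unfold_locales
  have i: "integrable (M \<Otimes>\<^sub>M N) (\<lambda>(y, z). c (y + z))"
    by (rule P.integrable_const_bound[where B=C]) (use C in auto)
  have "(LINT z|(M \<star> N). c z) = (LINT p|(M \<Otimes>\<^sub>M N). c (case p of (y, z) \<Rightarrow> y + z))"
    unfolding convolution_def by (subst integral_distr) auto
  also have "\<dots> = (LINT y|M. LINT z|N. c (y + z))"
    using P.integral_fst'[OF i] by (simp add: split_beta')
  finally show ?thesis .
qed

text \<open>Composition of averages, tested against \<open>L2\<close>. The pointwise version
  \<open>Tm_convolution_pt\<close> asks for integrability of the double average at the given point,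
  which for \<open>f\<close> in \<open>L2\<close> is available only almost everywhere.\<close>

lemma Tm_convolution:
  assumes M: "real_distribution M" and N: "real_distribution N" and b: "b \<in> L2" and f: "f \<in> L2"
  shows "ip b (Tm (M \<star> N) f) = ip b (Tm M (Tm N f))"
proof -
  interpret M: real_distribution M by fact
  interpret N: real_distribution N by fact
  interpret C: real_distribution "M \<star> N" by (rule real_distribution_convolution[OF M N])
  have "ip b (Tm (M \<star> N) f) = (LINT y|M. LINT z|N. ip b (sh (-(y + z)) f))"
    unfolding C.ip_Tm[OF b f]
    by (rule integral_convolution[OF M N ip_sh_meas[OF b f] ip_sh_bound[OF b f]])
  also have "\<dots> = (LINT y|M. ip b (sh (-y) (Tm N f)))"
    using b f by (simp add: N.Tm_sh[symmetric] N.ip_Tm L2_sh sh_sh algebra_simps)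
  finally show ?thesis using b f by (simp add: M.ip_Tm N.L2_Tm)
qed

lemma rd_finite: "real_distribution M \<Longrightarrow> finite_measure M"
  by (simp add: real_distribution_def prob_space_def)

lemma rd_sets: "real_distribution M \<Longrightarrow> sets M = sets borel"
  by (rule real_distribution.events_eq_borel)

lemma conv_comm: "real_distribution M \<Longrightarrow> real_distribution N \<Longrightarrow> (M \<star> N) = (N \<star> M)"
  by (intro convolution_commutative) (auto simp: rd_finite rd_sets)

lemma conv_assoc: "real_distribution L \<Longrightarrow> real_distribution M \<Longrightarrow> real_distribution N \<Longrightarrow> (L \<star> (M \<star> N)) = ((L \<star> M) \<star> N)"
  by (intro convolution_associative) (auto simp: rd_finite rd_sets)

lemma rd_return: "real_distribution (return borel 0)"
  unfolding real_distribution_def real_distribution_axioms_def by (simp add: prob_space_return)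

lemma return_conv: assumes "real_distribution M" shows "(return borel 0 \<star> M) = M"
proof (rule measure_eqI)
  interpret M: real_distribution M by fact
  show "sets (return borel 0 \<star> M) = sets M" by simp
  fix A assume "A \<in> sets (return borel 0 \<star> M)"
  then have [measurable]: "A \<in> sets borel" by simp
  have "emeasure (return borel 0 \<star> M) A = (\<integral>\<^sup>+x. \<integral>\<^sup>+y. indicator A (x + y) \<partial>M \<partial>return borel 0)"
    by (rule convolution_emeasure') (auto simp: rd_finite[OF rd_return] rd_finite[OF assms])
  also have "\<dots> = (\<integral>\<^sup>+y. indicator A y \<partial>M)" by (subst nn_integral_return) auto
  finally show "emeasure (return borel 0 \<star> M) A = emeasure M A" by simp
qed

lemma Tm_convolution_pt:
  assumes M: "real_distribution M" and N: "real_distribution N" and [measurable]: "f \<in> borel_measurable borel"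
    and i: "integrable (M \<star> N) (\<lambda>y. f (x - y))"
  shows "Tm (M \<star> N) f x = Tm M (Tm N f) x"
proof -
  interpret M: real_distribution M by fact
  interpret N: real_distribution N by fact
  interpret P: pair_prob_space M N by unfold_locales
  have i': "integrable (M \<Otimes>\<^sub>M N) (\<lambda>p. f (x - (case p of (y, z) \<Rightarrow> y + z)))"
    using i unfolding convolution_def by (subst (asm) integrable_distr_eq) auto
  have "Tm (M \<star> N) f x = (LINT p|(M \<Otimes>\<^sub>M N). f (x - (case p of (y, z) \<Rightarrow> y + z)))"
    unfolding Tm_def convolution_def by (subst integral_distr) auto
  also have "\<dots> = (LINT y|M. LINT z|N. f (x - (y + z)))"
    using P.integral_fst'[OF i'] by simp
  finally show ?thesis by (simp add: Tm_def diff_diff_add)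
qed

lemma Tm_return: "f \<in> borel_measurable borel \<Longrightarrow> Tm (return borel 0) f = f"
  unfolding Tm_def by (rule ext, subst integral_return) auto

section \<open>The flow of the linear equation\<close>

definition expm :: "real measure" where "expm = density lborel (\<lambda>x. ennreal (K x))"

lemma K_measurable[measurable]: "K \<in> borel_measurable borel"
  unfolding K_def[abs_def] by measurable

lemma K_nonneg: "0 \<le> K x" by (simp add: K_def)

lemma nn_integral_K: "(\<integral>\<^sup>+x. ennreal (x ^ n * K x) \<partial>lborel) = ennreal (fact n)"
proof -
  have "(\<integral>\<^sup>+x. ennreal (x ^ n * K x) \<partial>lborel) = (\<integral>\<^sup>+x. ennreal (x^n * exp (-x)) * indicator {0 ..} x \<partial>lborel)"
    using AE_lborel_singleton[of 0]
    by (intro nn_integral_cong_AE) (auto simp: K_def indicator_def elim!: eventually_mono)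
  then show ?thesis by (simp add: nn_intergal_power_times_exp_Ici)
qed

lemma rd_expm: "real_distribution expm"
proof -
  have "prob_space expm"
    unfolding expm_def using nn_integral_K[of 0] by (intro prob_spaceI) (simp add: emeasure_density)
  then show ?thesis by (simp add: real_distribution_def real_distribution_axioms_def expm_def)
qed

lemma Tm_expm: assumes [measurable]: "v \<in> borel_measurable borel" shows "Tm expm v = conv K v"
proof (rule ext)
  fix x
  have "Tm expm v x = (LINT y|lborel. K y * v (x - y))"
    unfolding Tm_def expm_def by (subst integral_density) (auto simp: K_nonneg)
  also have "\<dots> = conv K v x"
    unfolding conv_def using lborel_reflect[of "\<lambda>y. K y * v (x - y)" x] by simp
  finally show "Tm expm v x = conv K v x" .
qed

text \<open>Gamma laws: \<open>nu k\<close> is the \<open>k\<close>-fold convolution power of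
  \<open>K\<close> as a measure, which unlike a density makes sense for
  \<open>k = 0\<close>.\<close>

primrec nu :: "nat \<Rightarrow> real measure" where
  "nu 0 = return borel 0"
| "nu (Suc k) = (expm \<star> nu k)"

lemma rd_nu: "real_distribution (nu k)"
  by (induct k) (auto intro: rd_return real_distribution_convolution rd_expm)

lemma nu_add: "(nu k \<star> nu j) = nu (k + j)"
  by (induct k) (auto simp: return_conv rd_nu conv_assoc[symmetric] rd_expm)

lemma sets_nu[simp, measurable_cong]: "sets (nu k) = sets borel" by (rule rd_sets[OF rd_nu])

lemma nu_moment: "(\<integral>\<^sup>+y. ennreal \<bar>y\<bar> \<partial>nu k) \<le> ennreal (real k)"
proof (induct k)
  case 0 then show ?case by (simp add: nn_integral_return)
next
  case (Suc k)
  interpret E: real_distribution expm by (rule rd_expm)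
  interpret N: real_distribution "nu k" by (rule rd_nu)
  have e: "(\<integral>\<^sup>+x. ennreal \<bar>x\<bar> \<partial>expm) = 1"
    using nn_integral_K[of 1] unfolding expm_def
    by (subst nn_integral_density) (auto simp: K_def ennreal_mult''[symmetric] indicator_def mult.commute intro!: nn_integral_cong elim!: trans[rotated])
  have "(\<integral>\<^sup>+y. ennreal \<bar>y\<bar> \<partial>nu (Suc k)) = (\<integral>\<^sup>+x. \<integral>\<^sup>+y. ennreal \<bar>x + y\<bar> \<partial>nu k \<partial>expm)"
    unfolding nu.simps by (rule nn_integral_convolution) (auto simp: rd_finite[OF rd_expm] rd_finite[OF rd_nu])
  also have "\<dots> \<le> (\<integral>\<^sup>+x. \<integral>\<^sup>+y. ennreal \<bar>x\<bar> + ennreal \<bar>y\<bar> \<partial>nu k \<partial>expm)"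
    by (intro nn_integral_mono) (auto simp: ennreal_plus[symmetric] simp del: ennreal_plus intro!: ennreal_leI)
  also have "\<dots> = 1 + (\<integral>\<^sup>+y. ennreal \<bar>y\<bar> \<partial>nu k)"
    by (simp add: nn_integral_add e N.emeasure_space_1[unfolded N.space_eq_univ] E.emeasure_space_1[unfolded E.space_eq_univ])
  also have "\<dots> \<le> 1 + ennreal (real k)" using Suc by (intro add_left_mono)
  also have "\<dots> = ennreal 1 + ennreal (real k)" by simp
  also have "\<dots> = ennreal (real (Suc k))" by (subst ennreal_plus[symmetric]) auto
  finally show ?case .
qed

text \<open>\<open>poisson_pmf\<close> is meant for a positive rate; at time 0 no jump
  occurs.\<close>

definition pois :: "real \<Rightarrow> nat pmf" where
  "pois t = (if t > 0 then poisson_pmf t else return_pmf 0)"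

lemma pmf_pois: "t \<ge> 0 \<Longrightarrow> pmf (pois t) k = t ^ k / fact k * exp (- t)"
  by (auto simp: pois_def indicator_def)

text \<open>Independent Poisson counts add; on the level of weights this is the binomial
  theorem.\<close>

lemma pois_add:
  assumes "s \<ge> 0" "t \<ge> 0"
  shows "bind_pmf (pois s) (\<lambda>k. map_pmf ((+) k) (pois t)) = pois (s + t)"
proof (rule pmf_eqI)
  fix n
  have m: "pmf (map_pmf ((+) k) (pois t)) n = (if k \<le> n then pmf (pois t) (n - k) else 0)" for k
  proof (cases "k \<le> n")
    case True
    then have "pmf (map_pmf ((+) k) (pois t)) (k + (n - k)) = pmf (pois t) (n - k)"
      by (intro pmf_map_inj') simp
    then show ?thesis using True by simp
  next
    case False
    then show ?thesis by (auto intro!: pmf_map_outside)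
  qed
  have "pmf (bind_pmf (pois s) (\<lambda>k. map_pmf ((+) k) (pois t))) n = (\<Sum>k\<le>n. pmf (pois t) (n - k) * pmf (pois s) k)"
    unfolding pmf_bind m by (subst integral_measure_pmf_real[of "{..n}"]) (auto split: if_splits)
  also have "\<dots> = (\<Sum>k\<le>n. of_nat (n choose k) * s ^ k * t ^ (n - k) * (exp (-(s+t)) / fact n))"
    using assms by (intro sum.cong) (auto simp: pmf_pois binomial_fact exp_add[symmetric] field_simps exp_minus)
  also have "\<dots> = pmf (pois (s + t)) n"
    using assms by (simp add: sum_distrib_right sum_divide_distrib binomial_ring pmf_pois)
  finally show "pmf (bind_pmf (pois s) (\<lambda>k. map_pmf ((+) k) (pois t))) n = pmf (pois (s + t)) n" .
qed

lemma nn_integral_pois: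
  assumes "t \<ge> 0"
      shows "(\<integral>\<^sup>+k. a k \<partial>measure_pmf (pois t)) = (\<Sum>k. ennreal (t ^ k / fact k * exp (- t)) * a k)"
  using assms by (simp add: nn_integral_measure_pmf nn_integral_count_space_nat pmf_pois)

text \<open>A Poisson expectation is a weighted series, so the exchange is that of a series of
  nonnegative functions with an integral.\<close>

lemma nn_integral_pois_swap:
  assumes "t \<ge> 0" and "\<And>k. F k \<in> borel_measurable M"
  shows "(\<integral>\<^sup>+x. (\<integral>\<^sup>+k. F k x \<partial>measure_pmf (pois t)) \<partial>M) = (\<integral>\<^sup>+k. (\<integral>\<^sup>+x. F k x \<partial>M) \<partial>measure_pmf (pois t))"
  using assms by (simp add: nn_integral_pois nn_integral_suminf nn_integral_cmult)

text \<open>The law of \<open>E\<^sub>1 + \<dots> + E\<^sub>N - t\<close> with independent standard exponential \<open>E\<^sub>i\<close> and \<open>N\<close> Poisson distributed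
  with mean \<open>t\<close>; then \<open>X\<^sup>t v\<close> is \<open>Tm (mu t) v\<close> almost everywhere.\<close>

definition mu :: "real \<Rightarrow> real measure" where
  "mu t = measure_pmf (pois t) \<bind> (\<lambda>k. distr (nu k) borel (\<lambda>y. y - t))"

lemma rd_shift_nu: "real_distribution (distr (nu k) borel (\<lambda>y. y - t))"
  by (rule prob_space.real_distribution_distr[OF real_distribution.axioms(1)[OF rd_nu]]) simp

lemma sets_mu[simp, measurable_cong]: "sets (mu t) = sets borel"
  unfolding mu_def by (rule sets_bind) (auto simp: rd_sets[OF rd_shift_nu])

lemma nn_integral_mu:
  assumes [measurable]: "\<phi> \<in> borel_measurable borel"
  shows "(\<integral>\<^sup>+y. \<phi> y \<partial>mu t) = (\<integral>\<^sup>+k. (\<integral>\<^sup>+y. \<phi> (y - t) \<partial>nu k) \<partial>measure_pmf (pois t))"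
proof -
  have "(\<lambda>k. distr (nu k) borel (\<lambda>y. y - t)) \<in> measurable (measure_pmf (pois t)) (subprob_algebra borel)"
    using rd_shift_nu[of _ t]
    by (auto simp: space_subprob_algebra real_distribution_def intro!: prob_space_imp_subprob_space)
  then show ?thesis unfolding mu_def by (subst nn_integral_bind[of _ borel]) (auto simp: nn_integral_distr)
qed

lemma rd_mu: "real_distribution (mu t)"
proof -
  have "emeasure (mu t) UNIV = (\<integral>\<^sup>+y. 1 \<partial>mu t)" by (simp add: sets_eq_imp_space_eq[OF sets_mu])
  also have "\<dots> = 1"
    using real_distribution.axioms(1)[OF rd_nu, THEN prob_space.emeasure_space_1]
    by (subst nn_integral_mu) (auto simp: sets_eq_imp_space_eq[OF sets_nu])
  finally have "prob_space (mu t)" by (intro prob_spaceI) (simp add: sets_eq_imp_space_eq[OF sets_mu])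
  then show ?thesis by (simp add: real_distribution_def real_distribution_axioms_def)
qed

lemma mu_0: "mu 0 = return borel 0"
proof (rule measure_eqI)
  fix A assume "A \<in> sets (mu 0)"
  then have [measurable]: "A \<in> sets borel" by simp
  have "emeasure (mu 0) A = (\<integral>\<^sup>+y. indicator A y \<partial>mu 0)" by simp
  also have "\<dots> = emeasure (return borel 0) A"
    by (subst nn_integral_mu) (auto simp: pois_def nn_integral_return)
  finally show "emeasure (mu 0) A = emeasure (return borel 0) A" .
qed simp

text \<open>Semigroup law of \<open>X\<close>: condition on the two jump counts, merge the jumps by
  \<open>nu_add\<close> and the counts by \<open>pois_add\<close>; the drifts \<open>s\<close> and
  \<open>t\<close> add.\<close>

lemma mu_add: assumes "s \<ge> 0" "t \<ge> 0" shows "(mu s \<star> mu t) = mu (s + t)"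
proof (rule measure_eqI)
  interpret S: real_distribution "mu s" by (rule rd_mu)
  interpret T: real_distribution "mu t" by (rule rd_mu)
  interpret N: real_distribution "nu k" for k by (rule rd_nu)
  fix A assume "A \<in> sets (mu s \<star> mu t)"
  then have [measurable]: "A \<in> sets borel" by simp
  define a where "a n = (\<integral>\<^sup>+z. indicator A (z - (s + t)) \<partial>nu n :: ennreal)" for n
  have kj: "(\<integral>\<^sup>+x. \<integral>\<^sup>+y. indicator A (x - s + (y - t)) \<partial>nu j \<partial>nu k) = a (k + j)" for k j
    unfolding a_def nu_add[symmetric]
    by (subst nn_integral_convolution) (auto simp: rd_finite[OF rd_nu] algebra_simps)
  have "emeasure (mu s \<star> mu t) A = (\<integral>\<^sup>+x. \<integral>\<^sup>+y. indicator A (x + y) \<partial>mu t \<partial>mu s)"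
    by (rule convolution_emeasure') (auto simp: rd_finite[OF rd_mu])
  also have "\<dots> = (\<integral>\<^sup>+k. (\<integral>\<^sup>+x. \<integral>\<^sup>+y. indicator A (x - s + y) \<partial>mu t \<partial>nu k) \<partial>measure_pmf (pois s))"
    by (subst nn_integral_mu) auto
  also have "\<dots> = (\<integral>\<^sup>+k. (\<integral>\<^sup>+x. \<integral>\<^sup>+j. \<integral>\<^sup>+y. indicator A (x - s + (y - t)) \<partial>nu j \<partial>measure_pmf (pois t) \<partial>nu k) \<partial>measure_pmf (pois s))"
    by (subst nn_integral_mu) auto
  also have "\<dots> = (\<integral>\<^sup>+k. (\<integral>\<^sup>+j. \<integral>\<^sup>+x. \<integral>\<^sup>+y. indicator A (x - s + (y - t)) \<partial>nu j \<partial>nu k \<partial>measure_pmf (pois t)) \<partial>measure_pmf (pois s))"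
    by (intro nn_integral_cong nn_integral_pois_swap assms) measurable
  also have "\<dots> = (\<integral>\<^sup>+n. a n \<partial>measure_pmf (bind_pmf (pois s) (\<lambda>k. map_pmf ((+) k) (pois t))))"
    unfolding kj by (simp add: nn_integral_bind_pmf)
  also have "\<dots> = (\<integral>\<^sup>+y. indicator A y \<partial>mu (s + t))"
    unfolding pois_add[OF assms] by (subst nn_integral_mu) (auto simp: a_def intro!: nn_integral_cong)
  finally show "emeasure (mu s \<star> mu t) A = emeasure (mu (s + t)) A" by simp
qed simp

lemma pois_mean: assumes "t \<ge> 0"
  shows "(\<integral>\<^sup>+k. ennreal (real k) \<partial>measure_pmf (pois t)) = ennreal t"
proof -
  have "(\<lambda>k. t * (t ^ k / fact k * exp (- t))) sums (t * (exp t * exp (- t)))"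
    using exp_converges[of t] by (intro sums_mult sums_mult2) (simp add: field_simps)
  then have "(\<lambda>k. t ^ Suc k / fact (Suc k) * exp (- t) * real (Suc k)) sums t"
    by (simp add: exp_minus field_simps del: of_nat_Suc)
  then have "(\<lambda>k. t ^ k / fact k * exp (- t) * real k) sums (t + 0)"
    by (subst (asm) sums_Suc_iff) simp
  then have "(\<Sum>k. ennreal (t ^ k / fact k * exp (- t) * real k)) = ennreal t"
    using assms by (intro suminf_ennreal_eq) auto
  then show ?thesis using assms by (simp add: nn_integral_pois ennreal_mult''[symmetric])
qed

text \<open>The jumps contribute at most the mean \<open>t\<close> of their number, each having mean
  1, and the drift another \<open>t\<close>.\<close>

lemma mu_moment: assumes "t \<ge> 0"
  shows "(\<integral>\<^sup>+y. ennreal \<bar>y\<bar> \<partial>mu t) \<le> ennreal (2 * t)"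
proof -
  have "(\<integral>\<^sup>+y. ennreal \<bar>y\<bar> \<partial>mu t) = (\<integral>\<^sup>+k. (\<integral>\<^sup>+y. ennreal \<bar>y - t\<bar> \<partial>nu k) \<partial>measure_pmf (pois t))"
    by (subst nn_integral_mu) auto
  also have "\<dots> \<le> (\<integral>\<^sup>+k. (ennreal (real k) + ennreal t) \<partial>measure_pmf (pois t))"
  proof (rule nn_integral_mono)
    fix k
    interpret N: real_distribution "nu k" by (rule rd_nu)
    have "(\<integral>\<^sup>+y. ennreal \<bar>y - t\<bar> \<partial>nu k) \<le> (\<integral>\<^sup>+y. ennreal \<bar>y\<bar> + ennreal t \<partial>nu k)"
      using assms by (intro nn_integral_mono) (auto simp: ennreal_plus[symmetric] simp del: ennreal_plus intro!: ennreal_leI)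
    also have "\<dots> = (\<integral>\<^sup>+y. ennreal \<bar>y\<bar> \<partial>nu k) + ennreal t"
      by (simp add: nn_integral_add N.emeasure_space_1[unfolded N.space_eq_univ])
    also have "\<dots> \<le> ennreal (real k) + ennreal t" using nu_moment by (intro add_right_mono)
    finally show "(\<integral>\<^sup>+y. ennreal \<bar>y - t\<bar> \<partial>nu k) \<le> ennreal (real k) + ennreal t" .
  qed
  also have "\<dots> = ennreal t + ennreal t"
    using assms by (simp add: nn_integral_add pois_mean)
  also have "\<dots> = ennreal (2 * t)" using assms by (simp add: ennreal_plus[symmetric] del: ennreal_plus)
  finally show ?thesis .
qed

lemma moment_le:
  assumes "real_distribution M" "(\<integral>\<^sup>+y. ennreal \<bar>y\<bar> \<partial>M) \<le> ennreal m" "m \<ge> 0"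
  shows "integrable M (\<lambda>y. \<bar>y\<bar>)" "(LINT y|M. \<bar>y\<bar>) \<le> m"
proof -
  interpret real_distribution M by fact
  show i: "integrable M (\<lambda>y. \<bar>y\<bar>)"
    using assms(2) by (intro integrableI_bounded) (auto intro: le_less_trans)
  show "(LINT y|M. \<bar>y\<bar>) \<le> m"
    using assms(2,3) by (subst (asm) nn_integral_eq_integral[OF i]) auto
qed

text \<open>Integration against the mixture \<open>mu t\<close> is the Poisson series of integrals.
  For \<open>t = 0\<close> the weights with \<open>k > 0\<close> vanish and say nothing about
  \<open>nu k\<close>, hence the restriction to \<open>t ^ k \<noteq> 0\<close> in the second
  claim.\<close>

lemma mu_sums_nonneg:
  assumes t: "t \<ge> 0" and h: "integrable (mu t) h" "\<And>y. h y \<ge> 0"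
      and [measurable]: "h \<in> borel_measurable borel"
  shows "(\<lambda>k. t ^ k / fact k * exp (- t) * (LINT y|nu k. h (y - t))) sums (LINT y|mu t. h y)"
    "\<And>k. t ^ k \<noteq> 0 \<Longrightarrow> integrable (nu k) (\<lambda>y. h (y - t))"
proof -
  let ?p = "\<lambda>k. t ^ k / fact k * exp (- t)"
  interpret N: real_distribution "nu k" for k by (rule rd_nu)
  have e: "ennreal (LINT y|mu t. h y) = (\<Sum>k. ennreal (?p k) * (\<integral>\<^sup>+y. ennreal (h (y - t)) \<partial>nu k))"
  proof -
    have "ennreal (LINT y|mu t. h y) = (\<integral>\<^sup>+y. ennreal (h y) \<partial>mu t)"
      by (rule nn_integral_eq_integral[OF h(1), symmetric]) (simp add: h(2))
    then show ?thesis by (simp add: nn_integral_mu nn_integral_pois t)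
  qed
  have fin: "ennreal (?p k) * (\<integral>\<^sup>+y. ennreal (h (y - t)) \<partial>nu k) < \<infinity>" for k
  proof -
    have "(\<Sum>k\<in>{k}. ennreal (?p k) * (\<integral>\<^sup>+y. ennreal (h (y - t)) \<partial>nu k)) \<le> ennreal (LINT y|mu t. h y)"
      unfolding e by (rule sum_le_suminf) auto
    also have "\<dots> < \<infinity>" by simp
    finally show ?thesis by simp
  qed
  show i: "integrable (nu k) (\<lambda>y. h (y - t))" if "t ^ k \<noteq> 0" for k
  proof (rule integrableI_bounded)
    define p where "p = ?p k"
    have "t ^ k > 0" using that t by (metis less_eq_real_def zero_le_power)
    then have p: "p > 0" unfolding p_def by (intro mult_pos_pos divide_pos_pos) auto
    have "ennreal p * (\<integral>\<^sup>+y. ennreal (h (y - t)) \<partial>nu k) < \<infinity>" using fin[of k]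
      by (simp only: p_def)
    then have "(\<integral>\<^sup>+y. ennreal (h (y - t)) \<partial>nu k) < \<infinity>"
      using p by (auto simp: ennreal_mult_less_top)
    then show "(\<integral>\<^sup>+y. ennreal (norm (h (y - t))) \<partial>nu k) < \<infinity>" using h(2) by simp
  qed simp
  have tk: "ennreal (?p k) * (\<integral>\<^sup>+y. ennreal (h (y - t)) \<partial>nu k) = ennreal (?p k * (LINT y|nu k. h (y - t)))" for k
  proof (cases "t ^ k = 0")
    case False
    have "(\<integral>\<^sup>+y. ennreal (h (y - t)) \<partial>nu k) = ennreal (LINT y|nu k. h (y - t))"
      by (rule nn_integral_eq_integral[OF i[OF False]]) (simp add: h(2))
    then show ?thesis
      by (simp only:) (rule ennreal_mult[symmetric], use t h(2) in \<open>auto intro: integral_nonneg_AE\<close>)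
  next
    case True
    then have "?p k = 0" by (simp only: div_0 mult_zero_left)
    then show ?thesis by (simp only: mult_zero_left ennreal_0)
  qed
  have nn: "0 \<le> ?p k * (LINT y|nu k. h (y - t))" for k
    using t h(2) by (intro mult_nonneg_nonneg integral_nonneg_AE) auto
  have s: "summable (\<lambda>k. ?p k * (LINT y|nu k. h (y - t)))"
    using e unfolding tk by (intro summable_suminf_not_top nn) auto
  have "ennreal (LINT y|mu t. h y) = ennreal (\<Sum>k. ?p k * (LINT y|nu k. h (y - t)))"
    unfolding e tk by (rule suminf_ennreal2[OF nn s])
  then have "(LINT y|mu t. h y) = (\<Sum>k. ?p k * (LINT y|nu k. h (y - t)))"
    using h(2) nn s by (simp add: integral_nonneg_AE suminf_nonneg)
  then show "(\<lambda>k. ?p k * (LINT y|nu k. h (y - t))) sums (LINT y|mu t. h y)"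
    using s by (simp add: summable_sums)
qed

lemma mu_sums:
  assumes t: "t \<ge> 0" and h: "integrable (mu t) h" and [measurable]: "h \<in> borel_measurable borel"
  shows "(\<lambda>k. t ^ k / fact k * exp (- t) * (LINT y|nu k. h (y - t))) sums (LINT y|mu t. h y)"
proof -
  let ?p = "\<lambda>k. t ^ k / fact k * exp (- t)"
  let ?a = "\<lambda>y. max (h y) 0" and ?b = "\<lambda>y. max (- h y) 0"
  have ab: "integrable (mu t) ?a" "integrable (mu t) ?b" using h by auto
  have hd: "h = (\<lambda>y. ?a y - ?b y)" by (auto simp: max_def)
  note A = mu_sums_nonneg[OF t ab(1)] and B = mu_sums_nonneg[OF t ab(2)]
  have e: "?p k * (LINT y|nu k. h (y - t)) = ?p k * (LINT y|nu k. ?a (y - t)) - ?p k * (LINT y|nu k. ?b (y - t))" for k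
  proof (cases "t ^ k = 0")
    case False
    have "(LINT y|nu k. h (y - t)) = (LINT y|nu k. ?a (y - t) - ?b (y - t))"
      by (rule Bochner_Integration.integral_cong) (auto simp: max_def)
    also have "\<dots> = (LINT y|nu k. ?a (y - t)) - (LINT y|nu k. ?b (y - t))"
      by (rule Bochner_Integration.integral_diff) (use A(2)[OF _ _ False] B(2)[OF _ _ False] in auto)
    finally show ?thesis by (simp add: right_diff_distrib)
  next
    case True
    then have "?p k = 0" by (simp only: div_0 mult_zero_left)
    then show ?thesis by (simp only: mult_zero_left diff_self)
  qed
  have "(LINT y|mu t. h y) = (LINT y|mu t. ?a y - ?b y)"
    by (rule Bochner_Integration.integral_cong) (auto simp: max_def)
  also have "\<dots> = (LINT y|mu t. ?a y) - (LINT y|mu t. ?b y)"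
    using ab by (rule Bochner_Integration.integral_diff)
  finally show ?thesis unfolding e using sums_diff[OF A(1) B(1)] by simp
qed

section \<open>The exponential series of \<open>X_flow\<close> as a compound Poisson average\<close>

lemma AE_lborel_shift: assumes "AE x in lborel. P (x::real)" shows "AE x in lborel. P (x + k)"
proof -
  have "AE x in distr lborel borel ((+) k). P x" unfolding lborel_distr_plus by (rule assms)
  then have "AE x in lborel. P (k + x)" by (rule AE_distrD[rotated]) simp
  then show ?thesis by (simp add: add.commute)
qed

text \<open>The two sides can differ on a null set: where a double integral fails to converge
  absolutely, the iterated integrals and the integral against \<open>nu k\<close> may disagree. In
  the induction an exceptional null set is harmless because \<open>conv K\<close> integrates it
  away.\<close>

lemma conv_K_AE:
  assumes [measurable]: "v \<in> borel_measurable borel"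
      and i: "\<And>k. AE x in lborel. integrable (nu k) (\<lambda>y. v (x - y))"
  shows "(conv K ^^ k) v \<in> borel_measurable borel" "AE x in lborel. (conv K ^^ k) v x = Tm (nu k) v x"
proof (induct k)
  case 0
  { case 1 then show ?case by simp }
  { case 2 then show ?case by (simp add: Tm_return) }
next
  case (Suc k)
  interpret E: real_distribution expm by (rule rd_expm)
  interpret N: real_distribution "nu k" by (rule rd_nu)
  have m[measurable]: "(conv K ^^ k) v \<in> borel_measurable borel" by (rule Suc)
  have m2[measurable]: "Tm (nu k) v \<in> borel_measurable borel" by (rule N.Tm_measurable) simp
  { case 1 show ?case using E.Tm_measurable[OF m] by (simp add: Tm_expm) }
  have "conv K ((conv K ^^ k) v) x = conv K (Tm (nu k) v) x" for x
    unfolding conv_def[of K "(conv K ^^ k) v"] conv_def[of K "Tm (nu k) v"] by (rule integral_cong_AE) (use Suc(2) in auto)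
  then have e: "(conv K ^^ Suc k) v x = Tm expm (Tm (nu k) v) x" for x by (simp add: Tm_expm)
  { case 2 show ?case
      using i[of "Suc k"] unfolding e
      by eventually_elim (simp add: Tm_convolution_pt[OF rd_expm rd_nu]) }
qed

lemma X_flow_0: "X_flow 0 v = v"
proof (rule ext)
  fix x
  have "(\<lambda>k. 0 ^ k / fact k * (conv K ^^ k) v x) sums v x"
    using powser_sums_zero[of "\<lambda>k. (conv K ^^ k) v x / fact k"] by (simp add: field_simps)
  then show "X_flow 0 v x = v x" by (simp add: X_flow_def sums_iff)
qed

text \<open>The exceptional sets of all \<open>k\<close> are joined and shifted by \<open>t\<close>;
  outside them the series is the Poisson series of \<open>mu_sums\<close>. The hypothesis on all
  laws \<open>M\<close> is met by \<open>L2\<close> and by integrable functions, the two classes to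
  which \<open>X\<close> is applied.\<close>

lemma X_flow_AE:
  assumes t: "t \<ge> 0" and [measurable]: "v \<in> borel_measurable borel"
    and i: "\<And>M. real_distribution M \<Longrightarrow> AE x in lborel. integrable M (\<lambda>y. v (x - y))"
  shows "X_flow t v \<in> borel_measurable borel" "AE x in lborel. X_flow t v x = Tm (mu t) v x"
proof -
  note k = conv_K_AE[OF _ i[OF rd_nu]]
  have [measurable]: "(conv K ^^ k) v \<in> borel_measurable borel" for k by (rule k) simp
  show "X_flow t v \<in> borel_measurable borel"
    unfolding X_flow_def[abs_def] by measurable
  have "AE x in lborel. \<forall>k. (conv K ^^ k) v (x + t) = Tm (nu k) v (x + t)"
    by (subst AE_all_countable, rule allI, rule AE_lborel_shift, rule k) simp
  then show "AE x in lborel. X_flow t v x = Tm (mu t) v x"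
    using i[OF rd_mu[of t]]
  proof eventually_elim
    case (elim x)
    have "(\<lambda>k. t ^ k / fact k * exp (- t) * (LINT y|nu k. v (x - (y - t)))) sums (LINT y|mu t. v (x - y))"
      by (rule mu_sums[OF t elim(2)]) simp
    then have "(\<lambda>k. exp (- t) * (t ^ k / fact k * (conv K ^^ k) v (x + t))) sums Tm (mu t) v x"
      using elim(1) by (simp add: Tm_def algebra_simps)
    then have "(\<lambda>k. t ^ k / fact k * (conv K ^^ k) v (x + t)) sums (Tm (mu t) v x / exp (- t))"
      by (auto dest: sums_divide[of _ _ "exp (-t)"])
    then show ?case by (simp add: X_flow_def sums_iff)
  qed
qed

lemma (in real_distribution) L2_Tm_AE: assumes f: "f \<in> L2"
  shows "AE x in lborel. integrable M (\<lambda>y. f (x - y))"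
proof -
  have [measurable]: "f \<in> borel_measurable borel" using f by (rule L2_measurable)
  \<comment> \<open>A nowhere vanishing function in \<open>L2\<close>: integrability of
    \<open>b x * f (x - y)\<close> in \<open>y\<close> then gives that of
    \<open>f (x - y)\<close>.\<close>
  define b where "b x = sqrt (normal_density 0 1 x)" for x :: real
  have [measurable]: "b \<in> borel_measurable borel" unfolding b_def[abs_def] by measurable
  have b: "b \<in> L2" by (rule L2I) (auto simp: b_def)
  have b0: "b x \<noteq> 0" for x using normal_density_pos[of 1 0 x] by (simp add: b_def)
  have "AE x in lborel. integrable M (\<lambda>y. b x * f (x - y))"
    by (rule Tm_pair(3)[OF _ _ nn_ip_bound[OF b f]]) simp_all
  then show ?thesis using b0 by simp
qed

lemma X_flow_L2:
  assumes "t \<ge> 0" "v \<in> L2"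
  shows "X_flow t v \<in> L2" "AE x in lborel. X_flow t v x = Tm (mu t) v x"
proof -
  have m: "v \<in> borel_measurable borel" using assms by (auto dest: L2_measurable)
  note X = X_flow_AE[OF assms(1) m real_distribution.L2_Tm_AE[OF _ assms(2)]]
  show "AE x in lborel. X_flow t v x = Tm (mu t) v x" using X by simp
  then show "X_flow t v \<in> L2" by (intro L2_cong_AE[OF real_distribution.L2_Tm(1)[OF rd_mu[of t] assms(2)]] X)
qed

lemma X_flow_L1:
  assumes "t \<ge> 0" "integrable lborel v"
  shows "X_flow t v \<in> borel_measurable borel" "AE x in lborel. X_flow t v x = Tm (mu t) v x"
proof -
  have m: "v \<in> borel_measurable borel" using assms by auto
  show "X_flow t v \<in> borel_measurable borel" "AE x in lborel. X_flow t v x = Tm (mu t) v x"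
    using X_flow_AE[OF assms(1) m real_distribution.L1_Tm(3)[OF _ assms(2)]] by auto
qed

section \<open>The heat kernel\<close>

lemma heat_kernel_sqrt: "t > 0 \<Longrightarrow> heat_kernel t x = 1 / sqrt (4 * pi * t) * exp (- x\<^sup>2 / (4 * t))"
  using powr_minus[of "4 * pi * t" "1/2"] powr_half_sqrt[of "4 * pi * t"]
  by (simp add: heat_kernel_def inverse_eq_divide)

lemma heat_kernel_normal: "t > 0 \<Longrightarrow> heat_kernel t x = normal_density 0 (sqrt (2 * t)) x"
  by (simp add: heat_kernel_sqrt normal_density_def)

lemma heat_kernel_nonneg: "0 \<le> heat_kernel t x" by (simp add: heat_kernel_def)

lemma heat_kernel_measurable[measurable]: "heat_kernel t \<in> borel_measurable borel"
  unfolding heat_kernel_def[abs_def] by measurable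

lemma heat_kernel_DERIV: "t > 0 \<Longrightarrow> (heat_kernel t has_real_derivative - x / (2 * t) * heat_kernel t x) (at x)"
  unfolding heat_kernel_def by (auto intro!: derivative_eq_intros simp: field_simps power2_eq_square)

definition dG :: "real \<Rightarrow> real \<Rightarrow> real" where "dG t = deriv (heat_kernel t)"

lemma dG_eq: "t > 0 \<Longrightarrow> dG t x = - x / (2 * t) * heat_kernel t x"
  unfolding dG_def by (rule DERIV_imp_deriv[OF heat_kernel_DERIV])

lemma dG_eq_fun: "t > 0 \<Longrightarrow> dG t = (\<lambda>x. - x / (2 * t) * heat_kernel t x)"
  using dG_eq by auto

lemma dG_0: "dG 0 = (\<lambda>x. 0)"
proof -
  have "heat_kernel 0 = (\<lambda>x. 0)" by (auto simp: heat_kernel_def)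
  then show ?thesis by (simp add: dG_def)
qed

lemma dG_measurable: "t \<ge> 0 \<Longrightarrow> dG t \<in> borel_measurable borel"
  by (cases "t = 0") (auto simp: dG_0 dG_eq_fun)

lemma dG_DERIV: "t > 0 \<Longrightarrow> (dG t has_real_derivative (x\<^sup>2 / (4 * t\<^sup>2) - 1 / (2 * t)) * heat_kernel t x) (at x)"
  unfolding dG_eq_fun by (auto intro!: derivative_eq_intros heat_kernel_DERIV simp: field_simps power2_eq_square)

lemma x_exp_le: "(x::real)\<^sup>2 * exp (- x\<^sup>2 / (4 * t)) \<le> 4 * t" if "t > 0"
proof -
  have "x\<^sup>2 / (4 * t) \<le> exp (x\<^sup>2 / (4 * t))" using exp_ge_add_one_self[of "x\<^sup>2 / (4 * t)"] by linarith
  then have "x\<^sup>2 / (4 * t) * exp (- (x\<^sup>2 / (4 * t))) \<le> exp (x\<^sup>2 / (4 * t)) * exp (- (x\<^sup>2 / (4 * t)))"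
    by (rule mult_right_mono) simp
  then show ?thesis using that by (simp add: exp_minus field_simps)
qed

text \<open>Purely qualitative bounds at a fixed time. Averaging preserves both, so they pass to all
  later times and, through \<open>pk_bounds\<close>, give continuity of the Duhamel kernel in
  time.\<close>

lemma dG_bounds: assumes t: "t > 0"
  shows "\<exists>L\<ge>0. (\<forall>x. \<bar>dG t x\<bar> \<le> L) \<and> (\<forall>x y. \<bar>dG t x - dG t y\<bar> \<le> L * \<bar>x - y\<bar>)"
proof -
  define c where "c = (4 * pi * t) powr (-1/2)"
  have c: "c \<ge> 0" by (simp add: c_def)
  have hk: "heat_kernel t x = c * exp (- x\<^sup>2 / (4 * t))" for x by (simp add: heat_kernel_def c_def)
  have e1: "exp (- x\<^sup>2 / (4 * t)) \<le> 1" for x using t by simp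
  have e2: "x\<^sup>2 * heat_kernel t x \<le> c * (4 * t)" for x
    unfolding hk using mult_left_mono[OF x_exp_le[OF t, of x] c] by (simp add: mult_ac)
  have e3: "heat_kernel t x \<le> c" for x unfolding hk using mult_left_mono[OF e1 c] by simp
  define L1 where "L1 = (c + c * (4 * t)) / (2 * t)"
  define L2 where "L2 = (c * (4 * t)) / (4 * t\<^sup>2) + c / (2 * t)"
  have L: "L1 \<ge> 0" "L2 \<ge> 0" using c t by (auto simp: L1_def L2_def)
  have b1: "\<bar>dG t x\<bar> \<le> L1" for x
  proof -
    have "\<bar>x\<bar> \<le> 1 + x\<^sup>2" using sum_squares_bound[of 1 "\<bar>x\<bar>"]
      by (simp add: abs_if split: if_splits)
    then have "\<bar>x\<bar> * heat_kernel t x \<le> (1 + x\<^sup>2) * heat_kernel t x"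
      by (rule mult_right_mono) (rule heat_kernel_nonneg)
    also have "\<dots> \<le> c + c * (4 * t)" using e2[of x] e3[of x] by (simp add: algebra_simps)
    finally have "\<bar>x\<bar> * heat_kernel t x / (2 * t) \<le> L1" unfolding L1_def using t
      by (intro divide_right_mono) auto
    then show ?thesis using t by (simp add: dG_eq abs_mult heat_kernel_nonneg)
  qed
  have b2: "\<bar>(x\<^sup>2 / (4 * t\<^sup>2) - 1 / (2 * t)) * heat_kernel t x\<bar> \<le> L2" for x
  proof -
    have "\<bar>(x\<^sup>2 / (4 * t\<^sup>2) - 1 / (2 * t)) * heat_kernel t x\<bar> \<le> \<bar>(x\<^sup>2 * heat_kernel t x) / (4 * t\<^sup>2)\<bar> + \<bar>heat_kernel t x / (2 * t)\<bar>"
      using abs_triangle_ineq4[of "(x\<^sup>2 * heat_kernel t x) / (4 * t\<^sup>2)" "heat_kernel t x / (2 * t)"]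
      by (simp add: left_diff_distrib)
    also have "\<dots> = (x\<^sup>2 * heat_kernel t x) / (4 * t\<^sup>2) + heat_kernel t x / (2 * t)"
      using t heat_kernel_nonneg[of t x] by simp
    also have "\<dots> \<le> L2" unfolding L2_def using t e2[of x] e3[of x] by (intro add_mono divide_right_mono) auto
    finally show ?thesis .
  qed
  have lip: "\<bar>dG t x - dG t y\<bar> \<le> L2 * \<bar>x - y\<bar>" for x y
    using field_differentiable_bound[of UNIV "dG t" "\<lambda>x. (x\<^sup>2 / (4 * t\<^sup>2) - 1 / (2 * t)) * heat_kernel t x" L2 x y]
      dG_DERIV[OF t] b2 by auto
  show ?thesis
  proof (intro exI[of _ "L1 + L2"] conjI allI)
    show "\<bar>dG t x\<bar> \<le> L1 + L2" for x using b1[of x] L by linarith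
    show "\<bar>dG t x - dG t y\<bar> \<le> (L1 + L2) * \<bar>x - y\<bar>" for x y
      using lip[of x y] L by (simp add: distrib_right add_increasing)
  qed (use L in auto)
qed

text \<open>The square of a Gaussian is a multiple of the Gaussian of half its variance, so
  \<open>L2\<close> norms of the kernel and its derivative reduce to the mass and the variance of a
  normal law.\<close>

lemma heat_kernel_sq: assumes t: "t > 0"
  shows "(heat_kernel t x)\<^sup>2 = 1 / (2 * sqrt (2 * pi * t)) * normal_density 0 (sqrt t) x"
proof -
  have "(heat_kernel t x)\<^sup>2 = 1 / (4 * pi * t) * (exp (- x\<^sup>2 / (4 * t)))\<^sup>2"
    using t by (simp add: heat_kernel_sqrt power_mult_distrib power_divide)
  also have "(exp (- x\<^sup>2 / (4 * t)))\<^sup>2 = exp (- x\<^sup>2 / (2 * t))"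
    using t by (simp add: exp_double[symmetric] field_simps)
  also have "1 / (4 * pi * t) * exp (- x\<^sup>2 / (2 * t)) = 1 / (2 * sqrt (2 * pi * t)) * normal_density 0 (sqrt t) x"
    using t by (simp add: normal_density_def real_sqrt_mult_self)
  finally show ?thesis .
qed

lemma powr_quarter_sq: "t > 0 \<Longrightarrow> (t powr (-1/4))\<^sup>2 = 1 / sqrt t"
proof -
  assume t: "t > 0"
  have "(t powr (-1/4))\<^sup>2 = t powr (-(1/2))" using t by (simp add: power2_eq_square powr_add[symmetric])
  then show ?thesis using t by (simp add: powr_minus powr_half_sqrt inverse_eq_divide)
qed

lemma powr_3quarter_sq: "t > 0 \<Longrightarrow> (t powr (-3/4))\<^sup>2 = 1 / (t * sqrt t)"
proof -
  assume t: "t > 0"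
  have "(t powr (-3/4))\<^sup>2 = t powr (- 1 + -(1/2))" using t by (simp add: power2_eq_square powr_add[symmetric])
  also have "\<dots> = t powr (-1) * t powr (-(1/2))" by (rule powr_add)
  finally show ?thesis using t by (simp add: powr_minus powr_half_sqrt inverse_eq_divide)
qed

lemma heat_kernel_L2: assumes t: "t > 0"
  shows "heat_kernel t \<in> L2" "L2_norm (heat_kernel t) \<le> t powr (-1/4)"
proof -
  have s: "0 < sqrt t" using t by simp
  show "heat_kernel t \<in> L2" using s by (intro L2I) (auto simp: heat_kernel_sq[OF t])
  have "(L2_norm (heat_kernel t))\<^sup>2 = 1 / (2 * sqrt (2 * pi * t))"
    using s unfolding L2_norm_sq heat_kernel_sq[OF t] by simp
  also have "\<dots> \<le> 1 / sqrt t"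
  proof (intro divide_left_mono)
    have "t \<le> 2 * pi * t" using t pi_gt3 by simp
    then have "sqrt t \<le> sqrt (2 * pi * t)" by simp
    then show "sqrt t \<le> 2 * sqrt (2 * pi * t)" using s by linarith
  qed (use t in auto)
  also have "\<dots> = (t powr (-1/4))\<^sup>2" using powr_quarter_sq[OF t] by simp
  finally show "L2_norm (heat_kernel t) \<le> t powr (-1/4)" by (rule power2_le_imp_le) simp
qed

text \<open>The squared norm equals \<open>1 / (8 * t * sqrt (2 * pi * t))\<close>. The exponent
  \<open>-3/4\<close> is the reason why a merely integrable forcing can be treated: it exceeds -1,
  so the Duhamel integral converges at \<open>s = t\<close>.\<close>

lemma dG_L2: assumes t: "t > 0"
  shows "dG t \<in> L2" "L2_norm (dG t) \<le> t powr (-3/4)"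
proof -
  have s: "0 < sqrt t" using t by simp
  have sq: "(dG t x)\<^sup>2 = 1 / (4 * t\<^sup>2) * (1 / (2 * sqrt (2 * pi * t))) * (normal_density 0 (sqrt t) x * x\<^sup>2)" for x
    using t by (simp add: dG_eq power_mult_distrib heat_kernel_sq power_divide mult_ac)
  have m: "has_bochner_integral lborel (\<lambda>x. normal_density 0 (sqrt t) x * x\<^sup>2) t"
    using normal_moment_even[OF s, of 0 1] t by (simp add: fact_numeral)
  show "dG t \<in> L2" unfolding L2_def using m t by (auto simp: sq dG_measurable has_bochner_integral_iff)
  have "(L2_norm (dG t))\<^sup>2 = 1 / (4 * t\<^sup>2) * (1 / (2 * sqrt (2 * pi * t))) * t"
    unfolding L2_norm_sq sq using m by (simp add: has_bochner_integral_iff)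
  also have "\<dots> = 1 / (8 * t * sqrt (2 * pi * t))" using t by (simp add: power2_eq_square)
  also have "\<dots> \<le> 1 / (t * sqrt t)"
  proof (intro divide_left_mono)
    have "t \<le> 2 * pi * t" using t pi_gt3 by simp
    then have "sqrt t \<le> sqrt (2 * pi * t)" by simp
    then have "t * sqrt t \<le> t * sqrt (2 * pi * t)" using t by (intro mult_left_mono) auto
    moreover have "0 \<le> t * sqrt (2 * pi * t)" using t by simp
    ultimately show "t * sqrt t \<le> 8 * t * sqrt (2 * pi * t)" by linarith
  qed (use t in auto)
  also have "\<dots> = (t powr (-3/4))\<^sup>2" using powr_3quarter_sq[OF t] by simp
  finally show "L2_norm (dG t) \<le> t powr (-3/4)" by (rule power2_le_imp_le) simp
qed

text \<open>The Dirac measure at time 0 keeps the semigroup law valid there, where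
  \<open>heat_kernel 0\<close> is zero.\<close>

definition gau :: "real \<Rightarrow> real measure" where
  "gau t = (if t > 0 then density lborel (\<lambda>x. ennreal (heat_kernel t x)) else return borel 0)"

lemma rd_gau: "real_distribution (gau t)"
proof (cases "t > 0")
  case True
  then have "prob_space (gau t)"
    using prob_space_normal_density[of "sqrt (2 * t)" 0] by (simp add: gau_def heat_kernel_normal)
  then show ?thesis using True by (simp add: real_distribution_def real_distribution_axioms_def gau_def)
qed (auto simp: gau_def rd_return)

lemma gau_add: assumes "s \<ge> 0" "t \<ge> 0" shows "(gau s \<star> gau t) = gau (s + t)"
proof -
  consider "s = 0" | "t = 0" | "s > 0" "t > 0" using assms by linarith
  then show ?thesis
  proof cases
    case 1 then show ?thesis by (simp add: return_conv rd_gau gau_def[of 0])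
  next
    case 2 then show ?thesis using conv_comm[OF rd_gau[of s] rd_gau[of t]] by (simp add: return_conv rd_gau gau_def[of 0])
  next
    case 3
    have "(gau s \<star> gau t) = density lborel (\<lambda>x. \<integral>\<^sup>+y. ennreal (heat_kernel s (x - y)) * ennreal (heat_kernel t y) \<partial>lborel)"
      using 3 rd_finite[OF rd_gau[of s]] rd_finite[OF rd_gau[of t]] unfolding gau_def
      by (simp add: convolution_density)
    also have "(\<lambda>x. \<integral>\<^sup>+y. ennreal (heat_kernel s (x - y)) * ennreal (heat_kernel t y) \<partial>lborel) = (\<lambda>x. ennreal (heat_kernel (s + t) x))"
      using conv_normal_density_zero_mean[of "sqrt (2 * s)" "sqrt (2 * t)"] 3
      by (simp add: heat_kernel_normal ennreal_mult'[symmetric] algebra_simps)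
    finally show ?thesis using 3 by (simp add: gau_def)
  qed
qed

lemma integral_gau: fixes c :: "real \<Rightarrow> real"
  assumes "t > 0" and [measurable]: "c \<in> borel_measurable borel"
  shows "(LINT y|gau t. c y) = (LINT y|lborel. heat_kernel t y * c y)"
  using assms by (simp add: gau_def integral_density heat_kernel_nonneg)

lemma gau_moment: assumes "t \<ge> 0"
  shows "integrable (gau t) (\<lambda>y. \<bar>y\<bar>)" "(LINT y|gau t. \<bar>y\<bar>) \<le> sqrt (2 * t)"
proof -
  interpret real_distribution "gau t" by (rule rd_gau)
  have "integrable (gau t) (\<lambda>y. \<bar>y\<bar>) \<and> (LINT y|gau t. \<bar>y\<bar>) \<le> sqrt (2 * t)"
  proof (cases "t > 0")
    case True
    have s: "0 < sqrt (2 * t)" using True by simp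
    have m: "has_bochner_integral lborel (\<lambda>x. normal_density 0 (sqrt (2*t)) x * x\<^sup>2) (2 * t)"
      using normal_moment_even[OF s, of 0 1] True by (simp add: fact_numeral)
    have i2: "integrable (gau t) (\<lambda>y. \<bar>y\<bar>\<^sup>2)"
      using True m by (simp add: gau_def integrable_density heat_kernel_nonneg heat_kernel_normal has_bochner_integral_iff)
    have e2: "(LINT y|gau t. \<bar>y\<bar>\<^sup>2) = 2 * t"
      using True m by (subst integral_gau) (auto simp: heat_kernel_normal has_bochner_integral_iff)
    have i1: "integrable (gau t) (\<lambda>y. \<bar>y\<bar>)" by (rule square_integrable_imp_integrable[OF _ i2]) simp
    have "0 \<le> variance (\<lambda>y. \<bar>y\<bar>)" by (rule variance_positive)
    then have "(LINT y|gau t. \<bar>y\<bar>)\<^sup>2 \<le> 2 * t" unfolding variance_eq[OF i1 i2] e2 by simp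
    then show ?thesis using i1 by (auto intro: real_le_rsqrt)
  next
    case False
    then have "(\<integral>\<^sup>+y. ennreal \<bar>y\<bar> \<partial>gau t) \<le> ennreal (sqrt (2 * t))"
      by (simp add: gau_def nn_integral_return)
    then show ?thesis using moment_le[OF rd_gau] assms by simp
  qed
  then show "integrable (gau t) (\<lambda>y. \<bar>y\<bar>)" "(LINT y|gau t. \<bar>y\<bar>) \<le> sqrt (2 * t)" by auto
qed

text \<open>Completing the square, or conditioning one of two independent normal variables on their
  sum: given the sum \<open>x\<close>, the summand \<open>y\<close> is normal with mean
  \<open>x * h / (\<tau> + h)\<close>.\<close>

lemma heat_kernel_product:
  assumes t: "\<tau> > 0" "h > 0"
  shows "heat_kernel \<tau> (x - y) * heat_kernel h y
    = heat_kernel (\<tau> + h) x * normal_density (x * h / (\<tau> + h)) (sqrt (2 * \<tau> * h / (\<tau> + h))) y"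
proof -
  define s where "s = \<tau> + h"
  have s: "s > 0" using t by (simp add: s_def)
  have c: "1 / sqrt (4 * pi * \<tau>) * (1 / sqrt (4 * pi * h)) = 1 / sqrt (4 * pi * s) * (1 / sqrt (2 * pi * (2 * \<tau> * h / s)))"
  proof -
    have "(4 * pi * \<tau>) * (4 * pi * h) = (4 * pi * s) * (2 * pi * (2 * \<tau> * h / s))" using s by simp
    then show ?thesis by (simp add: real_sqrt_mult[symmetric] del: real_sqrt_mult)
  qed
  have "(x - y)\<^sup>2 * (h * s) + y\<^sup>2 * (\<tau> * s) = x\<^sup>2 * (\<tau> * h) + (y * s - x * h)\<^sup>2"
    unfolding s_def by (simp add: power2_eq_square algebra_simps)
  then have "((x - y)\<^sup>2 * (h * s) + y\<^sup>2 * (\<tau> * s)) / (4 * \<tau> * h * s) = (x\<^sup>2 * (\<tau> * h) + (y * s - x * h)\<^sup>2) / (4 * \<tau> * h * s)" by simp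
  then have "(x - y)\<^sup>2 / (4 * \<tau>) + y\<^sup>2 / (4 * h) = x\<^sup>2 / (4 * s) + (y * s - x * h)\<^sup>2 / (4 * \<tau> * h * s)"
    using t s by (simp add: add_divide_distrib)
  also have "(y * s - x * h)\<^sup>2 / (4 * \<tau> * h * s) = (y - x * h / s)\<^sup>2 / (2 * (2 * \<tau> * h / s))"
  proof -
    have "y * s - x * h = (y - x * h / s) * s" using s by (simp add: field_simps)
    then show ?thesis using s t by (simp add: power_mult_distrib power2_eq_square)
  qed
  finally have e: "exp (- (x - y)\<^sup>2 / (4 * \<tau>)) * exp (- y\<^sup>2 / (4 * h)) = exp (- x\<^sup>2 / (4 * s)) * exp (- (y - x * h / s)\<^sup>2 / (2 * (2 * \<tau> * h / s)))"
    by (simp add: exp_add[symmetric])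
  have "heat_kernel \<tau> (x - y) * heat_kernel h y
     = (1 / sqrt (4 * pi * \<tau>) * (1 / sqrt (4 * pi * h))) * (exp (- (x - y)\<^sup>2 / (4 * \<tau>)) * exp (- y\<^sup>2 / (4 * h)))"
    using t by (simp only: heat_kernel_sqrt mult_ac)
  also have "\<dots> = heat_kernel s x * normal_density (x * h / s) (sqrt (2 * \<tau> * h / s)) y"
  proof -
    have q: "(sqrt (2 * \<tau> * h / s))\<^sup>2 = 2 * \<tau> * h / s" using t s by simp
    show ?thesis unfolding c e normal_density_def q heat_kernel_sqrt[OF s] by (simp only: mult_ac)
  qed
  finally show ?thesis by (simp add: s_def)
qed

text \<open>The derivative of the kernel is linear times the kernel, so
  \<open>heat_kernel_product\<close> turns the convolution into the mean of \<open>x - y\<close>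
  under the conditional normal law, which is \<open>x * \<tau> / (\<tau> + h)\<close>. No
  differentiation under an integral occurs.\<close>

lemma Tm_gau_dG: assumes "\<tau> > 0" "h \<ge> 0" shows "Tm (gau h) (dG \<tau>) = dG (\<tau> + h)"
proof (cases "h = 0")
  case True then show ?thesis using assms by (simp add: gau_def Tm_return dG_measurable)
next
  case False
  then have h: "h > 0" using assms by simp
  define s where "s = \<tau> + h"
  have s: "s > 0" using assms by (simp add: s_def)
  note [measurable] = dG_measurable[OF less_imp_le[OF assms(1)]]
  show ?thesis
  proof (rule ext)
    fix x
    define N where "N = normal_density (x * h / s) (sqrt (2 * \<tau> * h / s))"
    have sg: "0 < sqrt (2 * \<tau> * h / s)" using assms h s by simp
    have i1: "integrable lborel N" "(LINT y|lborel. N y) = 1" unfolding N_def using sg by auto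
    have i2: "integrable lborel (\<lambda>y. N y * y)" "(LINT y|lborel. N y * y) = x * h / s"
      unfolding N_def using normal_moment_nz_1[OF sg] by (auto simp: has_bochner_integral_iff)
    have "Tm (gau h) (dG \<tau>) x = (LINT y|lborel. heat_kernel h y * dG \<tau> (x - y))"
      unfolding Tm_def by (rule integral_gau[OF h]) measurable
    also have "\<dots> = (LINT y|lborel. - heat_kernel s x / (2 * \<tau>) * (x * N y - N y * y))"
    proof (rule Bochner_Integration.integral_cong)
      fix y
      have "heat_kernel h y * dG \<tau> (x - y) = - (x - y) / (2 * \<tau>) * (heat_kernel \<tau> (x - y) * heat_kernel h y)"
        using assms by (simp add: dG_eq)
      also have "\<dots> = - (x - y) / (2 * \<tau>) * (heat_kernel s x * N y)"
        unfolding heat_kernel_product[OF assms(1) h] N_def s_def ..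
      also have "\<dots> = - heat_kernel s x / (2 * \<tau>) * (x * N y - N y * y)"
        by (simp add: algebra_simps diff_divide_distrib)
      finally show "heat_kernel h y * dG \<tau> (x - y) = - heat_kernel s x / (2 * \<tau>) * (x * N y - N y * y)" .
    qed simp
    also have "\<dots> = - heat_kernel s x / (2 * \<tau>) * (x - x * h / s)"
      using i1 i2 by simp
    also have "x - x * h / s = x * \<tau> / s" using s by (simp add: field_simps s_def)
    also have "- heat_kernel s x / (2 * \<tau>) * (x * \<tau> / s) = dG s x" using assms s by (simp add: dG_eq)
    finally show "Tm (gau h) (dG \<tau>) x = dG (\<tau> + h) x" by (simp add: s_def)
  qed
qed

section \<open>The joint linear propagator and the Duhamel kernel\<close>

definition Q :: "real \<Rightarrow> real \<Rightarrow> real measure" where "Q t s = (gau t \<star> mu s)"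

lemma rd_Q: "real_distribution (Q t s)"
  unfolding Q_def by (intro real_distribution_convolution rd_gau rd_mu)

lemma Q_add: assumes "t \<ge> 0" "s \<ge> 0" "t' \<ge> 0" "s' \<ge> 0"
  shows "(Q t s \<star> Q t' s') = Q (t + t') (s + s')"
proof -
  note r = rd_gau rd_mu real_distribution_convolution
  have "(Q t s \<star> Q t' s') = (gau t \<star> (mu s \<star> (gau t' \<star> mu s')))"
    unfolding Q_def by (simp add: conv_assoc r)
  also have "(mu s \<star> (gau t' \<star> mu s')) = (gau t' \<star> (mu s \<star> mu s'))"
    using conv_comm[OF rd_mu[of s] rd_gau[of t']] by (simp add: conv_assoc r)
  also have "(gau t \<star> (gau t' \<star> (mu s \<star> mu s'))) = (gau (t + t') \<star> mu (s + s'))"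
    using assms by (simp add: conv_assoc r gau_add mu_add)
  finally show ?thesis by (simp add: Q_def)
qed

lemma Q_0: "Q 0 s = mu s" "Q t 0 = gau t" "Q 0 0 = return borel 0"
  using conv_comm[OF rd_gau rd_return, of t]
  by (auto simp: Q_def gau_def[of 0] mu_0 return_conv rd_mu rd_gau rd_return)

lemma Q_moment: assumes "t \<ge> 0" "s \<ge> 0"
  shows "integrable (Q t s) (\<lambda>y. \<bar>y\<bar>)" "(LINT y|Q t s. \<bar>y\<bar>) \<le> sqrt (2 * t) + 2 * s"
proof -
  interpret G: real_distribution "gau t" by (rule rd_gau)
  interpret M: real_distribution "mu s" by (rule rd_mu)
  have g: "(\<integral>\<^sup>+y. ennreal \<bar>y\<bar> \<partial>gau t) \<le> ennreal (sqrt (2 * t))"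
    using gau_moment[OF assms(1)] by (subst nn_integral_eq_integral) (auto intro: ennreal_leI)
  have "(\<integral>\<^sup>+y. ennreal \<bar>y\<bar> \<partial>Q t s) = (\<integral>\<^sup>+x. \<integral>\<^sup>+y. ennreal \<bar>x + y\<bar> \<partial>mu s \<partial>gau t)"
    unfolding Q_def by (rule nn_integral_convolution) (auto simp: rd_finite[OF rd_gau] rd_finite[OF rd_mu])
  also have "\<dots> \<le> (\<integral>\<^sup>+x. \<integral>\<^sup>+y. ennreal \<bar>x\<bar> + ennreal \<bar>y\<bar> \<partial>mu s \<partial>gau t)"
    by (intro nn_integral_mono) (auto simp: ennreal_plus[symmetric] simp del: ennreal_plus intro!: ennreal_leI)
  also have "\<dots> = (\<integral>\<^sup>+x. ennreal \<bar>x\<bar> \<partial>gau t) + (\<integral>\<^sup>+y. ennreal \<bar>y\<bar> \<partial>mu s)"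
    by (simp add: nn_integral_add M.emeasure_space_1[unfolded M.space_eq_univ] G.emeasure_space_1[unfolded G.space_eq_univ])
  also have "\<dots> \<le> ennreal (sqrt (2 * t)) + ennreal (2 * s)" using g mu_moment[OF assms(2)] by (intro add_mono)
  also have "\<dots> = ennreal (sqrt (2 * t) + 2 * s)" using assms by (simp add: ennreal_plus[symmetric] del: ennreal_plus)
  finally have f: "(\<integral>\<^sup>+y. ennreal \<bar>y\<bar> \<partial>Q t s) \<le> ennreal (sqrt (2 * t) + 2 * s)" .
  show "integrable (Q t s) (\<lambda>y. \<bar>y\<bar>)" "(LINT y|Q t s. \<bar>y\<bar>) \<le> sqrt (2 * t) + 2 * s"
    by (rule moment_le[OF rd_Q f]; use assms in simp)+
qed

lemma (in real_distribution) Tm_bdd: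
  assumes [measurable]: "f \<in> borel_measurable borel" and C: "\<And>x. \<bar>f x\<bar> \<le> C"
  shows "integrable M (\<lambda>y. f (x - y))" "\<bar>Tm M f x\<bar> \<le> C"
proof -
  show i: "integrable M (\<lambda>y. f (x - y))" by (rule integrable_const_bound[where B=C]) (use C in auto)
  have "\<bar>Tm M f x\<bar> \<le> (LINT y|M. \<bar>f (x - y)\<bar>)" unfolding Tm_def by (rule integral_abs_bound)
  also have "\<dots> \<le> (LINT y|M. C)" using C i by (intro integral_mono) auto
  finally show "\<bar>Tm M f x\<bar> \<le> C" by (simp add: prob_space[unfolded space_eq_univ])
qed

lemma (in real_distribution) Tm_lip:
  assumes [measurable]: "f \<in> borel_measurable borel" and C: "\<And>x. \<bar>f x\<bar> \<le> C"
      and L: "\<And>x y. \<bar>f x - f y\<bar> \<le> L * \<bar>x - y\<bar>"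
  shows "\<bar>Tm M f x - Tm M f y\<bar> \<le> L * \<bar>x - y\<bar>"
    "integrable M (\<lambda>y. \<bar>y\<bar>) \<Longrightarrow> (LINT y|M. \<bar>y\<bar>) \<le> m \<Longrightarrow> L \<ge> 0 \<Longrightarrow> \<bar>Tm M f x - f x\<bar> \<le> L * m"
proof -
  note i = Tm_bdd(1)[OF assms(1) C]
  have "Tm M f x - Tm M f y = (LINT z|M. f (x - z) - f (y - z))" using i by (simp add: Tm_def)
  also have "\<bar>\<dots>\<bar> \<le> (LINT z|M. \<bar>f (x - z) - f (y - z)\<bar>)" by (rule integral_abs_bound)
  also have "\<dots> \<le> (LINT z|M. L * \<bar>x - y\<bar>)"
  proof (rule integral_mono)
    show "\<bar>f (x - z) - f (y - z)\<bar> \<le> L * \<bar>x - y\<bar>" for z using L[of "x - z" "y - z"] by simp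
  qed (use i in auto)
  finally show "\<bar>Tm M f x - Tm M f y\<bar> \<le> L * \<bar>x - y\<bar>"
    by (simp add: prob_space[unfolded space_eq_univ])
  assume m: "integrable M (\<lambda>y. \<bar>y\<bar>)" "(LINT y|M. \<bar>y\<bar>) \<le> m" "L \<ge> 0"
  have "Tm M f x - f x = (LINT z|M. f (x - z) - f x)" using i by (simp add: Tm_def prob_space[unfolded space_eq_univ])
  also have "\<bar>\<dots>\<bar> \<le> (LINT z|M. \<bar>f (x - z) - f x\<bar>)" by (rule integral_abs_bound)
  also have "\<dots> \<le> (LINT z|M. L * \<bar>z\<bar>)"
  proof (rule integral_mono)
    show "\<bar>f (x - z) - f x\<bar> \<le> L * \<bar>z\<bar>" for z using L[of "x - z" x] by simp
  qed (use i m(1) in auto)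
  also have "\<dots> \<le> L * m" using m(2,3) by (simp add: mult_left_mono)
  finally show "\<bar>Tm M f x - f x\<bar> \<le> L * m" .
qed

lemma Tm_convolution_bdd:
  assumes "real_distribution M" "real_distribution N" "f \<in> borel_measurable borel" "\<And>x. \<bar>f x\<bar> \<le> C"
  shows "Tm (M \<star> N) f = Tm M (Tm N f)"
  using Tm_convolution_pt[OF assms(1-3)] real_distribution.Tm_bdd(1)[OF real_distribution_convolution[OF assms(1,2)] assms(3,4)]
  by auto

text \<open>\<open>pk \<tau> s\<close> is \<open>\<partial>\<^sub>xG\<^sub>\<tau> * X\<^sup>s\<close>, the kernel of the Duhamel formula; \<open>pk 0 s\<close> is zero, a junk value.\<close>

definition pk :: "real \<Rightarrow> real \<Rightarrow> real \<Rightarrow> real" where "pk \<tau> s = Tm (mu s) (dG \<tau>)"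
text \<open>The kernel before differentiation in space; its difference quotients stand in for
  \<open>pk\<close> when a derivative has to be moved to another factor.\<close>

definition Gk :: "real \<Rightarrow> real \<Rightarrow> real \<Rightarrow> real"
  where "Gk \<tau> s = Tm (mu s) (heat_kernel \<tau>)"

lemma pk_0: "pk 0 s = (\<lambda>x. 0)" by (auto simp: pk_def Tm_def dG_0)

lemma pk_0r: "\<tau> > 0 \<Longrightarrow> pk \<tau> 0 = dG \<tau>" by (simp add: pk_def mu_0 Tm_return dG_measurable)

lemma pk_L2: "\<tau> \<ge> 0 \<Longrightarrow> pk \<tau> s \<in> L2"
  using real_distribution.L2_Tm(1)[OF rd_mu dG_L2(1), of \<tau> s, folded pk_def]
  by (cases "\<tau> = 0") (auto simp: pk_0 L2_zero)

lemma pk_norm: "\<tau> \<ge> 0 \<Longrightarrow> L2_norm (pk \<tau> s) \<le> \<tau> powr (-3/4)"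
  using order_trans[OF real_distribution.L2_Tm(2)[OF rd_mu dG_L2(1)] dG_L2(2), of \<tau> s, folded pk_def]
  by (cases "\<tau> = 0") (auto simp: pk_0)

lemma pk_measurable: "\<tau> \<ge> 0 \<Longrightarrow> pk \<tau> s \<in> borel_measurable borel"
  by (rule L2_measurable[OF pk_L2])

lemma Gk_L2: "\<tau> > 0 \<Longrightarrow> Gk \<tau> s \<in> L2" "\<tau> > 0 \<Longrightarrow> L2_norm (Gk \<tau> s) \<le> \<tau> powr (-1/4)"
  unfolding Gk_def
  by (rule real_distribution.L2_Tm(1)[OF rd_mu heat_kernel_L2(1)], assumption,
      rule order_trans[OF real_distribution.L2_Tm(2)[OF rd_mu heat_kernel_L2(1)] heat_kernel_L2(2)])

text \<open>Propagating the kernel advances its two clocks independently: \<open>gau\<close> acts on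
  the derivative of the heat kernel by \<open>Tm_gau_dG\<close>, and the compound Poisson laws add.
  The strict \<open>\<tau> > 0\<close> matters, since \<open>pk 0 s\<close> is the junk value
  zero.\<close>

lemma pk_Tm: assumes "\<tau> > 0" "s \<ge> 0" "h \<ge> 0" "r \<ge> 0"
  shows "Tm (Q h r) (pk \<tau> s) = pk (\<tau> + h) (s + r)"
proof -
  obtain L where L: "\<And>x. \<bar>dG \<tau> x\<bar> \<le> L" using dG_bounds[OF assms(1)] by blast
  note m = dG_measurable[OF less_imp_le[OF assms(1)]]
  have "(Q h r \<star> mu s) = (Q h r \<star> Q 0 s)" by (simp add: Q_0)
  also have "\<dots> = (Q 0 (r + s) \<star> Q h 0)" using assms by (simp add: Q_add add.commute)
  finally have e: "(Q h r \<star> mu s) = (mu (r + s) \<star> gau h)" by (simp add: Q_0)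
  have "Tm (Q h r) (pk \<tau> s) = Tm (Q h r \<star> mu s) (dG \<tau>)"
    unfolding pk_def by (rule Tm_convolution_bdd[OF rd_Q rd_mu m L, symmetric])
  also have "\<dots> = Tm (mu (r + s)) (Tm (gau h) (dG \<tau>))"
    unfolding e by (rule Tm_convolution_bdd[OF rd_mu rd_gau m L])
  also have "\<dots> = pk (\<tau> + h) (s + r)" using assms by (simp add: Tm_gau_dG pk_def add.commute)
  finally show ?thesis .
qed

text \<open>Every kernel with \<open>\<tau> \<ge> \<tau>0\<close> is an average of
  \<open>dG \<tau>0\<close> and inherits its supremum and Lipschitz constant; a further step of the
  propagator then moves it by at most that constant times the moment bound of
  \<open>Q_moment\<close>.\<close>

lemma pk_bounds: assumes "\<tau>0 > 0"
  shows "\<exists>L\<ge>0. \<forall>\<tau>\<ge>\<tau>0. \<forall>s\<ge>0. (\<forall>x. \<bar>pk \<tau> s x\<bar> \<le> L) \<and>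
    (\<forall>h\<ge>0. \<forall>r\<ge>0. \<forall>x. \<bar>pk (\<tau> + h) (s + r) x - pk \<tau> s x\<bar> \<le> L * (sqrt (2 * h) + 2 * r))"
proof -
  obtain L where L: "L \<ge> 0" "\<And>x. \<bar>dG \<tau>0 x\<bar> \<le> L" "\<And>x y. \<bar>dG \<tau>0 x - dG \<tau>0 y\<bar> \<le> L * \<bar>x - y\<bar>"
    using dG_bounds[OF assms(1)] by blast
  note m = dG_measurable[OF less_imp_le[OF assms(1)]]
  have e: "pk \<tau> s = Tm (Q (\<tau> - \<tau>0) s) (dG \<tau>0)" if "\<tau> \<ge> \<tau>0" "s \<ge> 0" for \<tau> s
    using pk_Tm[of \<tau>0 0 "\<tau> - \<tau>0" s] that assms by (simp add: pk_0r)
  have b: "\<bar>pk \<tau> s x\<bar> \<le> L" if "\<tau> \<ge> \<tau>0" "s \<ge> 0" for \<tau> s x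
    unfolding e[OF that] by (rule real_distribution.Tm_bdd(2)[OF rd_Q m L(2)])
  have l: "\<bar>pk \<tau> s x - pk \<tau> s y\<bar> \<le> L * \<bar>x - y\<bar>" if "\<tau> \<ge> \<tau>0" "s \<ge> 0"
    for \<tau> s x y
    unfolding e[OF that] by (rule real_distribution.Tm_lip(1)[OF rd_Q m L(2,3)])
  have c: "\<bar>pk (\<tau> + h) (s + r) x - pk \<tau> s x\<bar> \<le> L * (sqrt (2 * h) + 2 * r)"
    if "\<tau> \<ge> \<tau>0" "s \<ge> 0" "h \<ge> 0" "r \<ge> 0" for \<tau> s h r x
  proof -
    have t: "\<tau> > 0" using that assms by simp
    show ?thesis
      unfolding pk_Tm[OF t that(2-4), symmetric]
      by (rule real_distribution.Tm_lip(2)[OF rd_Q pk_measurable[OF less_imp_le[OF t]] b[OF that(1,2)] l[OF that(1,2)] Q_moment[OF that(3,4)] L(1)])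
  qed
  show ?thesis using L(1) b c by blast
qed

text \<open>The uniform law on \<open>[-k, 0]\<close>, whose average of a derivative is the forward
  difference quotient (\<open>fd_FTC\<close>). Passing from derivative to difference quotient is
  thus an average, to which \<open>Tm_near\<close> applies.\<close>

definition Uk :: "real \<Rightarrow> real measure" where
  "Uk k = density lborel (\<lambda>y. ennreal (indicator {-k..0} y / k))"

lemma rd_Uk: assumes "k > 0" shows "real_distribution (Uk k)"
proof -
  have "emeasure (Uk k) UNIV = (\<integral>\<^sup>+y. ennreal (1 / k) * indicator {-k..0} y \<partial>lborel)"
    unfolding Uk_def by (subst emeasure_density) (auto intro!: nn_integral_cong simp: indicator_def)
  also have "\<dots> = 1" using assms by (simp add: nn_integral_cmult ennreal_mult'[symmetric])
  finally have "prob_space (Uk k)" by (intro prob_spaceI) (simp add: Uk_def)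
  then show ?thesis by (simp add: real_distribution_def real_distribution_axioms_def Uk_def)
qed

lemma Uk_moment: assumes k: "k > 0"
  shows "integrable (Uk k) (\<lambda>y. \<bar>y\<bar>)" "(LINT y|Uk k. \<bar>y\<bar>) \<le> k"
proof -
  interpret real_distribution "Uk k" by (rule rd_Uk[OF k])
  have "(\<integral>\<^sup>+y. ennreal \<bar>y\<bar> \<partial>Uk k) = (\<integral>\<^sup>+y. ennreal (indicator {-k..0} y / k) * ennreal \<bar>y\<bar> \<partial>lborel)"
    unfolding Uk_def by (subst nn_integral_density) auto
  also have "\<dots> \<le> (\<integral>\<^sup>+y. ennreal (indicator {-k..0} y / k) * ennreal k \<partial>lborel)"
    using k by (intro nn_integral_mono) (auto simp: indicator_def intro!: mult_left_mono ennreal_leI)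
  also have "\<dots> = (\<integral>\<^sup>+y. ennreal k \<partial>Uk k)"
    unfolding Uk_def by (subst nn_integral_density) auto
  also have "\<dots> = ennreal k" by (simp add: emeasure_space_1[unfolded space_eq_univ])
  finally show "integrable (Uk k) (\<lambda>y. \<bar>y\<bar>)" "(LINT y|Uk k. \<bar>y\<bar>) \<le> k"
    using k by (auto intro: moment_le[OF rd_Uk])
qed

lemma fd_FTC: assumes d: "\<And>z. (F has_real_derivative f z) (at z)" and f: "continuous_on UNIV f" and k: "k > 0"
  shows "fd k F x = k * Tm (Uk k) f x"
proof -
  have [measurable]: "f \<in> borel_measurable borel" using f by (rule borel_measurable_continuous_onI)
  have "isCont f z" for z using f by (simp add: continuous_on_eq_continuous_at)
  then have "fd k F x = (LINT z|lborel. f z * indicator {x..x + k} z)"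
    unfolding fd_def using k d by (intro integral_FTC_Icc_real[symmetric]) auto
  also have "\<dots> = (LINT y|lborel. f (x - y) * indicator {x..x + k} (x - y))"
    by (rule lborel_reflect[symmetric])
  also have "\<dots> = (LINT y|lborel. k * (indicator {-k..0} y / k * f (x - y)))"
    using k by (intro Bochner_Integration.integral_cong) (auto simp: indicator_def)
  also have "\<dots> = k * Tm (Uk k) f x"
    unfolding Tm_def Uk_def using k by (subst integral_density) (auto simp del: times_divide_eq_left)
  finally show ?thesis .
qed

lemma fd_heat_kernel: assumes t: "\<tau> > 0" and k: "k > 0"
  shows "fd k (heat_kernel \<tau>) x = k * Tm (Uk k) (dG \<tau>) x"
proof (rule fd_FTC[OF _ _ k])
  show "(heat_kernel \<tau> has_real_derivative dG \<tau> z) (at z)" for z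
    using heat_kernel_DERIV[OF t, of z] by (simp add: dG_eq t)
  show "continuous_on UNIV (dG \<tau>)"
    by (intro continuous_at_imp_continuous_on ballI DERIV_isCont[OF dG_DERIV[OF t]])
qed

lemma fd_Gk: assumes t: "\<tau> > 0" and k: "k > 0"
  shows "fd k (Gk \<tau> s) = (\<lambda>x. k * Tm (Uk k) (pk \<tau> s) x)"
proof (rule ext)
  fix x
  interpret M: real_distribution "mu s" by (rule rd_mu)
  obtain L where L: "\<And>x. \<bar>dG \<tau> x\<bar> \<le> L" using dG_bounds[OF assms(1)] by blast
  note m = dG_measurable[OF less_imp_le[OF assms(1)]]
  have hb: "\<bar>heat_kernel \<tau> x\<bar> \<le> (4 * pi * \<tau>) powr (-1/2)" for x
    using t by (simp add: heat_kernel_def mult_left_le)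
  note i = M.Tm_bdd(1)[OF heat_kernel_measurable hb]
  have "fd k (Gk \<tau> s) x = Tm (mu s) (fd k (heat_kernel \<tau>)) x"
    unfolding fd_def Gk_def Tm_def using i[of x] i[of "x + k"] by (simp add: diff_add_eq algebra_simps)
  also have "\<dots> = k * Tm (mu s) (Tm (Uk k) (dG \<tau>)) x"
    using fd_heat_kernel[OF t k] by (simp add: Tm_def)
  also have "Tm (mu s) (Tm (Uk k) (dG \<tau>)) = Tm (Uk k) (pk \<tau> s)"
    unfolding pk_def Tm_convolution_bdd[OF rd_mu rd_Uk[OF k] m L, symmetric] Tm_convolution_bdd[OF rd_Uk[OF k] rd_mu m L, symmetric]
    by (subst conv_comm[OF rd_mu rd_Uk[OF k]]) simp
  finally show "fd k (Gk \<tau> s) x = k * Tm (Uk k) (pk \<tau> s) x" .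
qed

section \<open>Bounds for the Duhamel kernel\<close>

lemma real_le_linear_eps:
  fixes a E D :: real
  assumes "\<And>k. k > 0 \<Longrightarrow> a \<le> E + k * D" shows "a \<le> E"
proof (rule field_le_epsilon)
  fix e :: real assume e: "e > 0"
  have "a \<le> E + e / (\<bar>D\<bar> + 1) * D" using e by (intro assms) (auto intro!: divide_pos_pos add_nonneg_pos)
  also have "e / (\<bar>D\<bar> + 1) * D \<le> e" using e by (simp add: field_simps abs_if split: if_splits)
  finally show "a \<le> E + e" by simp
qed

lemma W_pk_bound: assumes "\<tau> \<ge> 0" "b \<in> L2" "integrable lborel f"
  shows "\<bar>W (pk \<tau> s) b f\<bar> \<le> \<tau> powr (-3/4) * L2_norm b * L1_norm f"
proof -
  have "\<bar>W (pk \<tau> s) b f\<bar> \<le> L2_norm (pk \<tau> s) * L2_norm b * L1_norm f"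
    using assms by (intro W_bound pk_L2)
  also have "\<dots> \<le> \<tau> powr (-3/4) * L2_norm b * L1_norm f"
    using assms by (intro mult_right_mono pk_norm) auto
  finally show ?thesis .
qed

text \<open>Dividing by \<open>k\<close> exhibits \<open>W (pk \<tau> s) b f\<close> as a limit of
  pairings with difference quotients of \<open>Gk\<close>. The error of second order in
  \<open>k\<close> is kept explicit, so that no limit has to be taken under the integrals.\<close>

lemma W_fd_Gk_approx:
  assumes t: "\<tau> > 0" and b: "b \<in> L2" and f: "integrable lborel f"
      and B: "\<And>k. L1_norm (fd k f) \<le> \<bar>k\<bar> * B" "B \<ge> 0" and k: "k > 0"
  shows "\<bar>W (fd k (Gk \<tau> s)) b f - k * W (pk \<tau> s) b f\<bar> \<le> k\<^sup>2 * (L2_norm (pk \<tau> s) * L2_norm b * B)"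
proof -
  interpret U: real_distribution "Uk k" by (rule rd_Uk[OF k])
  have p: "pk \<tau> s \<in> L2" using t by (intro pk_L2) simp
  have "W (fd k (Gk \<tau> s)) b f = k * W (pk \<tau> s) b (Tm (Uk k) f)"
    unfolding fd_Gk[OF t k] W_scale_q using U.W_Tm_f[OF p b f] by simp
  then have e: "W (fd k (Gk \<tau> s)) b f - k * W (pk \<tau> s) b f = k * W (pk \<tau> s) b (\<lambda>x. Tm (Uk k) f x - f x)"
    using W_diff_f[OF p b U.L1_Tm(1)[OF f] f] by (simp add: right_diff_distrib)
  have "\<bar>W (pk \<tau> s) b (\<lambda>x. Tm (Uk k) f x - f x)\<bar> \<le> L2_norm (pk \<tau> s) * L2_norm b * L1_norm (\<lambda>x. Tm (Uk k) f x - f x)"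
    using U.L1_Tm(1)[OF f] f by (intro W_bound p b) auto
  also have "\<dots> \<le> L2_norm (pk \<tau> s) * L2_norm b * (k * B)"
    using U.Tm_near_L1[OF f B Uk_moment[OF k]] by (intro mult_left_mono) auto
  finally show ?thesis unfolding e using k by (simp add: abs_mult power2_eq_square mult_ac)
qed

text \<open>Integration by parts: one difference moves from the kernel to the forcing, which weakens
  the singularity from \<open>-3/4\<close> to \<open>-1/4\<close>. Then \<open>k\<close> tends to
  0.\<close>

lemma W_pk_bound_smooth:
  assumes t: "\<tau> > 0" and b: "b \<in> L2" and f: "integrable lborel f"
      and B: "\<And>k. L1_norm (fd k f) \<le> \<bar>k\<bar> * B" "B \<ge> 0"
  shows "\<bar>W (pk \<tau> s) b f\<bar> \<le> \<tau> powr (-1/4) * L2_norm b * B"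
proof (rule real_le_linear_eps)
  fix k :: real assume k: "k > 0"
  have "W (fd k (Gk \<tau> s)) b f = W (Gk \<tau> s) b (fd k f)"
    by (rule W_fd_q[OF Gk_L2(1)[OF t] b f])
  then have "\<bar>W (fd k (Gk \<tau> s)) b f\<bar> \<le> L2_norm (Gk \<tau> s) * L2_norm b * L1_norm (fd k f)"
    using W_bound[OF Gk_L2(1)[OF t] b L1_fd[OF f]] by simp
  also have "\<dots> \<le> \<tau> powr (-1/4) * L2_norm b * (k * B)"
    using B(1)[of k] k by (intro mult_mono Gk_L2(2)[OF t] mult_nonneg_nonneg) auto
  finally have "k * \<bar>W (pk \<tau> s) b f\<bar> \<le> \<tau> powr (-1/4) * L2_norm b * (k * B) + k\<^sup>2 * (L2_norm (pk \<tau> s) * L2_norm b * B)"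
    using W_fd_Gk_approx[OF t b f B k, of s] k abs_mult[of k "W (pk \<tau> s) b f"] by linarith
  also have "\<dots> = k * (\<tau> powr (-1/4) * L2_norm b * B + k * (L2_norm (pk \<tau> s) * L2_norm b * B))"
    by (simp add: algebra_simps power2_eq_square)
  finally show "\<bar>W (pk \<tau> s) b f\<bar> \<le> \<tau> powr (-1/4) * L2_norm b * B + k * (L2_norm (pk \<tau> s) * L2_norm b * B)"
    using k by simp
qed

context real_distribution begin

lemma L2_norm_fdn_Tm: assumes f: "f \<in> L2" shows "L2_norm ((fd k ^^ j) (Tm M f)) \<le> L2_norm ((fd k ^^ j) f)"
proof (rule L2_norm_le_dual)
  show "(fd k ^^ j) (Tm M f) \<in> L2" using f by (intro L2_fdn L2_Tm)
  fix b assume b: "b \<in> L2"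
  have "ip b ((fd k ^^ j) (Tm M f)) = ip b (Tm M ((fd k ^^ j) f))"
    using b f by (simp add: ip_fdn L2_Tm ip_fdn_Tm)
  also have "\<bar>\<dots>\<bar> \<le> L2_norm b * L2_norm (Tm M ((fd k ^^ j) f))" using b f by (intro ip_CS L2_Tm L2_fdn)
  also have "\<dots> \<le> L2_norm b * L2_norm ((fd k ^^ j) f)" using f by (intro mult_left_mono L2_Tm L2_fdn) auto
  finally show "\<bar>ip b ((fd k ^^ j) (Tm M f))\<bar> \<le> L2_norm ((fd k ^^ j) f) * L2_norm b"
    by (simp add: mult.commute)
qed simp

lemma Tr_moment: "integrable M (\<lambda>y. \<bar>y\<bar>) \<Longrightarrow> integrable (Tr M) (\<lambda>y. \<bar>y\<bar>)" "(LINT y|Tr M. \<bar>y\<bar>) = (LINT y|M. \<bar>y\<bar>)"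
  unfolding Tr_def by (auto simp: integrable_distr_eq integral_distr)

end

lemma mu_moment': assumes "s \<ge> 0"
  shows "integrable (mu s) (\<lambda>y. \<bar>y\<bar>)" "(LINT y|mu s. \<bar>y\<bar>) \<le> 2 * s"
  using assms by (auto intro: moment_le[OF rd_mu mu_moment])

text \<open>\<open>gs \<tau> s b\<close> is the adjoint of the semigroup applied to \<open>b\<close>; its difference quotients
  recover the pairing with the kernel \<open>pk\<close>.\<close>

definition gs :: "real \<Rightarrow> real \<Rightarrow> (real \<Rightarrow> real) \<Rightarrow> real \<Rightarrow> real" where
  "gs \<tau> s b y = ip b (sh (-y) (Gk \<tau> s))"

lemma gs_eq: assumes t: "\<tau> > 0" and b: "b \<in> L2"
  shows "gs \<tau> s b = Tm (Tr (gau \<tau>)) (Tm (Tr (mu s)) b)"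
proof (rule ext)
  fix y
  interpret M: real_distribution "mu s" by (rule rd_mu)
  interpret MR: real_distribution "Tr (mu s)" by (rule M.real_distribution_Tr)
  interpret G: real_distribution "gau \<tau>" by (rule rd_gau)
  let ?b = "Tm (Tr (mu s)) b"
  have m[measurable]: "?b \<in> borel_measurable borel" by (rule L2_measurable[OF MR.L2_Tm(1)[OF b]])
  have "gs \<tau> s b y = ip ?b (sh (-y) (heat_kernel \<tau>))"
    unfolding gs_def Gk_def M.Tm_sh[symmetric]
    by (rule M.Tm_adjoint[OF b L2_sh[OF heat_kernel_L2(1)[OF t]]])
  also have "\<dots> = ip (sh y ?b) (heat_kernel \<tau>)" by (simp add: ip_sh)
  also have "\<dots> = (LINT z|lborel. heat_kernel \<tau> z * ?b (y + z))"
    by (simp add: ip_def sh_def mult.commute add.commute)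
  also have "\<dots> = (LINT z|gau \<tau>. ?b (y + z))" by (rule integral_gau[symmetric, OF t]) measurable
  also have "\<dots> = Tm (Tr (gau \<tau>)) ?b y" by (rule G.Tm_Tr[symmetric]) measurable
  finally show "gs \<tau> s b y = Tm (Tr (gau \<tau>)) ?b y" .
qed

text \<open>As an average of \<open>b\<close>, the function keeps its norm and Lipschitz bounds; as
  a pairing with the \<open>L2\<close> kernel \<open>Gk\<close>, it is bounded pointwise, at the
  price \<open>\<tau> powr (-1/4)\<close>.\<close>

lemma gs_props: assumes t: "\<tau> > 0" and s: "s \<ge> 0" and b: "b \<in> L2"
  and B: "\<And>k. L2_norm (fd k b) \<le> \<bar>k\<bar> * B" "B \<ge> 0"
  shows "gs \<tau> s b \<in> L2" "L2_norm (gs \<tau> s b) \<le> L2_norm b" "L2_norm (fd k (gs \<tau> s b)) \<le> \<bar>k\<bar> * B"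
    "L2_norm (\<lambda>x. gs \<tau> s b x - b x) \<le> (sqrt (2 * \<tau>) + 2 * s) * B"
    "\<bar>gs \<tau> s b y\<bar> \<le> \<tau> powr (-1/4) * L2_norm b"
    "\<bar>fd k (gs \<tau> s b) y\<bar> \<le> \<tau> powr (-1/4) * (\<bar>k\<bar> * B)"
proof -
  interpret M: real_distribution "mu s" by (rule rd_mu)
  interpret MR: real_distribution "Tr (mu s)" by (rule M.real_distribution_Tr)
  interpret G: real_distribution "gau \<tau>" by (rule rd_gau)
  interpret GR: real_distribution "Tr (gau \<tau>)" by (rule G.real_distribution_Tr)
  define b' where "b' = Tm (Tr (mu s)) b"
  have e: "gs \<tau> s b = Tm (Tr (gau \<tau>)) b'" using gs_eq[OF t b] by (simp add: b'_def)
  have b': "b' \<in> L2" "L2_norm b' \<le> L2_norm b" unfolding b'_def by (intro MR.L2_Tm b)+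
  have B': "L2_norm (fd k b') \<le> \<bar>k\<bar> * B" for k
    unfolding b'_def using order_trans[OF MR.L2_norm_fdn_Tm[OF b, where k=k and j=1]] B(1)[of k] by simp
  show g: "gs \<tau> s b \<in> L2" unfolding e by (rule GR.L2_Tm(1)[OF b'(1)])
  show "L2_norm (gs \<tau> s b) \<le> L2_norm b" unfolding e using GR.L2_Tm(2)[OF b'(1)] b'(2) by linarith
  show "L2_norm (fd k (gs \<tau> s b)) \<le> \<bar>k\<bar> * B" for k
    unfolding e using order_trans[OF GR.L2_norm_fdn_Tm[OF b'(1), where k=k and j=1]] B'[of k] by simp
  have n1: "L2_norm (\<lambda>x. Tm (Tr (gau \<tau>)) b' x - b' x) \<le> sqrt (2 * \<tau>) * B"
    using gau_moment[OF less_imp_le[OF t]] by (intro GR.Tm_near b' B' B(2)) (auto simp: G.Tr_moment)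
  have n2: "L2_norm (\<lambda>x. b' x - b x) \<le> (2 * s) * B"
    unfolding b'_def using mu_moment'[OF s] by (intro MR.Tm_near b B) (auto simp: M.Tr_moment)
  show "L2_norm (\<lambda>x. gs \<tau> s b x - b x) \<le> (sqrt (2 * \<tau>) + 2 * s) * B"
    using L2_norm_triangle3[OF g b'(1) b] n1 n2 by (simp add: e distrib_right)
  have gl: "Gk \<tau> s \<in> L2" "L2_norm (Gk \<tau> s) \<le> \<tau> powr (-1/4)" by (rule Gk_L2[OF t])+
  have "\<bar>gs \<tau> s b y\<bar> \<le> L2_norm b * L2_norm (Gk \<tau> s)" unfolding gs_def
    by (rule ip_sh_bound[OF b gl(1)])
  also have "\<dots> \<le> L2_norm b * \<tau> powr (-1/4)" using gl(2) by (intro mult_left_mono) auto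
  finally show "\<bar>gs \<tau> s b y\<bar> \<le> \<tau> powr (-1/4) * L2_norm b" by (simp add: mult.commute)
  have "fd k (gs \<tau> s b) y = ip (sh k b) (sh (-y) (Gk \<tau> s)) - ip b (sh (-y) (Gk \<tau> s))"
    by (simp add: fd_def gs_def ip_sh sh_sh minus_diff_commute[of y])
  also have "\<dots> = ip (fd k b) (sh (-y) (Gk \<tau> s))"
    using ip_diff_right[OF L2_sh[OF gl(1)] L2_sh[OF b] b, of "-y" k] by (simp add: fd_sh ip_commute[of _ "sh (-y) _"])
  also have "\<bar>\<dots>\<bar> \<le> L2_norm (fd k b) * L2_norm (Gk \<tau> s)" by (rule ip_sh_bound[OF L2_fd[OF b] gl(1)])
  also have "\<dots> \<le> (\<bar>k\<bar> * B) * \<tau> powr (-1/4)" using gl(2) B by (intro mult_mono) auto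
  finally show "\<bar>fd k (gs \<tau> s b) y\<bar> \<le> \<tau> powr (-1/4) * (\<bar>k\<bar> * B)"
    by (simp add: mult.commute)
qed

text \<open>Discrete form of \<open>\<integral> g\<^sup>2 g' = 0\<close>.\<close>

lemma cubic_fd: assumes g: "g \<in> L2" and S: "\<And>x. \<bar>g x\<bar> \<le> S"
  shows "\<bar>LINT x|lborel. (g x)\<^sup>2 * fd k g x\<bar> \<le> S * (L2_norm (fd k g))\<^sup>2"
proof -
  let ?d = "fd k g"
  have m[measurable]: "g \<in> borel_measurable borel" "?d \<in> borel_measurable borel" using g L2_fd[OF g]
    by (auto dest: L2_measurable)
  have S0: "S \<ge> 0" using S[of 0] by linarith
  have d2: "\<bar>?d x\<bar> \<le> 2 * S" for x using S[of x] S[of "x + k"] unfolding fd_def by linarith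
  have i1: "integrable lborel (\<lambda>x. (g x)\<^sup>2 * ?d x)"
    by (rule L1_bdd_integrable(1)[OF L2_integrable_sq[OF g] m(2) d2])
  have i3: "integrable lborel (\<lambda>x. (g x)\<^sup>2 * g x)"
    by (rule L1_bdd_integrable(1)[OF L2_integrable_sq[OF g] m(1) S])
  have m2: "(\<lambda>x. g (x + k) + 2 * g x) \<in> borel_measurable borel" by measurable
  have b2: "\<bar>g (x + k) + 2 * g x\<bar> \<le> 3 * S" for x using S[of x] S[of "x + k"] by linarith
  note i2 = L1_bdd_integrable[OF L2_integrable_sq[OF L2_fd[OF g]] m2 b2]
  have z: "(LINT x|lborel. (g (x + k))\<^sup>2 * g (x + k) - (g x)\<^sup>2 * g x) = 0"
    using lborel_shift[of "\<lambda>x. (g x)\<^sup>2 * g x" k] i3 lborel_shift_integrable[of "\<lambda>x. (g x)\<^sup>2 * g x" k] by simp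
  have "3 * (LINT x|lborel. (g x)\<^sup>2 * ?d x) = (LINT x|lborel. ((g (x + k))\<^sup>2 * g (x + k) - (g x)\<^sup>2 * g x) - (?d x)\<^sup>2 * (g (x + k) + 2 * g x))"
    unfolding integral_mult_right_zero[symmetric]
    by (rule Bochner_Integration.integral_cong) (auto simp: fd_def power2_eq_square algebra_simps)
  also have "\<dots> = - (LINT x|lborel. (?d x)\<^sup>2 * (g (x + k) + 2 * g x))"
    using z i3 i2(1) lborel_shift_integrable[of "\<lambda>x. (g x)\<^sup>2 * g x" k] by simp
  also have "\<bar>\<dots>\<bar> \<le> (LINT x|lborel. \<bar>(?d x)\<^sup>2 * (g (x + k) + 2 * g x)\<bar>)"
    unfolding abs_minus_cancel by (rule integral_abs_bound)
  also have "\<dots> \<le> (L2_norm ?d)\<^sup>2 * (3 * S)" using i2(2) unfolding L1_norm_square by simp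
  finally show ?thesis by (simp add: abs_mult mult.commute)
qed

text \<open>With \<open>g\<close> the smoothed \<open>b\<close>, the pairing is up to sign the
  integral of \<open>v^2\<close> against the derivative of \<open>g\<close>. The integral of
  \<open>g^2\<close> against it vanishes, so \<open>v^2\<close> may be replaced by
  \<open>v^2 - g^2\<close>. The last factor bounds the distance from \<open>v\<close> to
  \<open>g\<close>; it makes the pairing small when \<open>v\<close> is close to \<open>b\<close>
  and \<open>\<tau>\<close> and \<open>s\<close> are small.\<close>

lemma W_pk_energy:
  assumes t: "\<tau> > 0" and s: "s \<ge> 0" and b: "b \<in> L2"
      and B: "\<And>k. L2_norm (fd k b) \<le> \<bar>k\<bar> * B" "B \<ge> 0"
    and v: "v \<in> L2" and V: "\<And>k. L2_norm (fd k v) \<le> \<bar>k\<bar> * V" "V \<ge> 0"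
  shows "\<bar>W (pk \<tau> s) b (\<lambda>x. (v x)\<^sup>2)\<bar> \<le> \<tau> powr (-1/4) * B * (L2_norm v + L2_norm b) * (L2_norm (\<lambda>x. v x - b x) + (sqrt (2 * \<tau>) + 2 * s) * B)"
proof -
  define g where "g = gs \<tau> s b"
  note gp = gs_props[OF t s b B, folded g_def]
  define c where "c = \<tau> powr (-1/4)"
  have c: "c \<ge> 0" by (simp add: c_def)
  define S where "S = c * L2_norm b"
  have S: "\<bar>g x\<bar> \<le> S" for x unfolding S_def c_def by (rule gp)
  define E where "E = c * B * (L2_norm v + L2_norm b) * (L2_norm (\<lambda>x. v x - b x) + (sqrt (2 * \<tau>) + 2 * s) * B)"
  let ?f = "\<lambda>x. (v x)\<^sup>2"
  have f: "integrable lborel ?f" using v by (rule L2_integrable_sq)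
  have fB: "L1_norm (fd k ?f) \<le> \<bar>k\<bar> * (4 * L2_norm v * V)" for k
  proof -
    have "L1_norm (fd k ?f) \<le> 4 * L2_norm v * L2_norm (fd k v)" using fd_square_L1[OF v, of 1 k] by simp
    also have "\<dots> \<le> 4 * L2_norm v * (\<bar>k\<bar> * V)" using V by (intro mult_left_mono) auto
    finally show ?thesis by (simp add: mult_ac)
  qed
  have fB0: "4 * L2_norm v * V \<ge> 0" using V by simp
  have vg: "L2_norm (\<lambda>x. v x - g x) \<le> L2_norm (\<lambda>x. v x - b x) + (sqrt (2 * \<tau>) + 2 * s) * B"
    using L2_norm_triangle3[OF v b gp(1)] gp(4) by (simp add: L2_norm_diff_commute[of b])
  have "\<bar>W (pk \<tau> s) b ?f\<bar> \<le> E"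
  proof (rule real_le_linear_eps)
    fix k :: real assume k: "k > 0"
    let ?d = "fd (-k) g"
    have d: "?d \<in> L2" by (rule L2_fd[OF gp(1)])
    have dm: "?d \<in> borel_measurable borel" by (rule L2_measurable[OF d])
    have db: "\<bar>?d x\<bar> \<le> c * (k * B)" for x using gp(6)[of "-k" x] k by (simp add: c_def)
    have dn: "L2_norm ?d \<le> k * B" using gp(3)[of "-k"] k by simp
    have sg: "integrable lborel (\<lambda>x. (g x)\<^sup>2)" by (rule L2_integrable_sq[OF gp(1)])
    have "W (fd k (Gk \<tau> s)) b ?f = (LINT y|lborel. (v y)\<^sup>2 * ?d y)"
    proof -
      have "ip b (sh (-y) (fd k (Gk \<tau> s))) = ?d y" for y
      proof -
        have gl: "Gk \<tau> s \<in> L2" by (rule Gk_L2[OF t])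
        have "sh (-y) (fd k (Gk \<tau> s)) = (\<lambda>x. sh (-(y - k)) (Gk \<tau> s) x - sh (-y) (Gk \<tau> s) x)"
          by (auto simp: sh_def fd_def algebra_simps)
        then show ?thesis using ip_diff_right[OF b L2_sh[OF gl] L2_sh[OF gl], of "-(y-k)" "-y"]
          by (simp add: fd_def g_def gs_def)
      qed
      then show ?thesis by (simp add: W_def)
    qed
    also have "\<dots> = (LINT y|lborel. ((v y)\<^sup>2 - (g y)\<^sup>2) * ?d y) + (LINT y|lborel. (g y)\<^sup>2 * ?d y)"
      using L1_bdd_integrable(1)[OF f dm db] L1_bdd_integrable(1)[OF sg dm db]
      by (simp add: left_diff_distrib)
    finally have w: "W (fd k (Gk \<tau> s)) b ?f = (LINT y|lborel. ((v y)\<^sup>2 - (g y)\<^sup>2) * ?d y) + (LINT y|lborel. (g y)\<^sup>2 * ?d y)" .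
    have "\<bar>LINT y|lborel. ((v y)\<^sup>2 - (g y)\<^sup>2) * ?d y\<bar> \<le> L1_norm (\<lambda>y. (v y)\<^sup>2 - (g y)\<^sup>2) * (c * (k * B))"
      by (rule order_trans[OF integral_abs_bound L1_bdd_integrable(2)[OF Bochner_Integration.integrable_diff[OF f sg] dm db]])
    also have "\<dots> \<le> (L2_norm (\<lambda>x. v x - g x) * (L2_norm v + L2_norm g)) * (c * (k * B))"
      using c k B(2) by (intro mult_right_mono L1_norm_square_diff v gp) auto
    also have "\<dots> \<le> ((L2_norm (\<lambda>x. v x - b x) + (sqrt (2 * \<tau>) + 2 * s) * B) * (L2_norm v + L2_norm b)) * (c * (k * B))"
      using c k B(2) vg gp(2) s t by (intro mult_right_mono mult_mono) (auto intro!: add_nonneg_nonneg mult_nonneg_nonneg)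
    also have "\<dots> = k * E" by (simp add: E_def mult_ac)
    finally have p1: "\<bar>LINT y|lborel. ((v y)\<^sup>2 - (g y)\<^sup>2) * ?d y\<bar> \<le> k * E" .
    have "\<bar>LINT y|lborel. (g y)\<^sup>2 * ?d y\<bar> \<le> S * (L2_norm ?d)\<^sup>2" by (rule cubic_fd[OF gp(1) S])
    also have "\<dots> \<le> S * (k * B)\<^sup>2" using dn c by (intro mult_left_mono power_mono) (auto simp: S_def)
    finally have p2: "\<bar>LINT y|lborel. (g y)\<^sup>2 * ?d y\<bar> \<le> S * (k * B)\<^sup>2" .
    \<comment> \<open>\<open>D\<close> collects the error of the difference quotient; it and the
      cubic term carry an additional factor \<open>k\<close> and disappear in the limit.\<close>
    define D where "D = L2_norm (pk \<tau> s) * L2_norm b * (4 * L2_norm v * V)"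
    have "\<bar>W (fd k (Gk \<tau> s)) b ?f - k * W (pk \<tau> s) b ?f\<bar> \<le> k\<^sup>2 * D"
      unfolding D_def by (rule W_fd_Gk_approx[OF t b f fB fB0 k])
    then have "k * \<bar>W (pk \<tau> s) b ?f\<bar> \<le> k * E + S * (k * B)\<^sup>2 + k\<^sup>2 * D"
      using p1 p2 w k abs_mult[of k "W (pk \<tau> s) b ?f"] by linarith
    also have "\<dots> = k * (E + k * (S * B\<^sup>2 + D))" by (simp add: power2_eq_square algebra_simps)
    finally show "\<bar>W (pk \<tau> s) b ?f\<bar> \<le> E + k * (S * B\<^sup>2 + D)" using k by simp
  qed
  then show ?thesis by (simp add: E_def c_def)
qed

section \<open>Integrals with power singularities in time\<close>

lemma powr_kernel_integral:
  fixes a t :: real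
  assumes a: "a > -1" and t: "t \<ge> 0"
  shows "set_integrable lborel {0..t} (\<lambda>s. (t - s) powr a)" "(LBINT s:{0..t}. (t - s) powr a) = t powr (a + 1) / (a + 1)"
proof -
  have hi: "((\<lambda>x. x powr a) has_integral (t powr (a+1) / (a+1))) {0..t}"
    using has_integral_powr_from_0[OF a t] .
  have "(\<lambda>x. x powr a) absolutely_integrable_on {0..t}"
    using hi by (intro nonnegative_absolutely_integrable_1) (auto simp: integrable_on_def)
  then have s: "set_integrable lborel {0..t} (\<lambda>x. x powr a)"
    unfolding set_integrable_def by (subst (asm) integrable_completion) auto
  have v: "(LBINT x:{0..t}. x powr a) = t powr (a+1) / (a+1)"
    using set_borel_integral_eq_integral(2)[OF s] hi by (simp add: integral_unique)
  have e: "indicator {0..t} (t - s) *\<^sub>R (t - s) powr a = indicator {0..t} s *\<^sub>R (t - s) powr a" for s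
    by (auto simp: indicator_def)
  show "set_integrable lborel {0..t} (\<lambda>s. (t - s) powr a)"
    using s lborel_reflect_integrable[of "\<lambda>x. indicator {0..t} x *\<^sub>R x powr a" t]
    unfolding set_integrable_def e by simp
  show "(LBINT s:{0..t}. (t - s) powr a) = t powr (a + 1) / (a + 1)"
    using v lborel_reflect[of "\<lambda>x. indicator {0..t} x *\<^sub>R x powr a" t] unfolding set_lebesgue_integral_def e
    by simp
qed

lemma set_integral_abs_le:
  fixes g h :: "real \<Rightarrow> real"
  assumes "set_integrable lborel A h" "\<And>s. s \<in> A \<Longrightarrow> \<bar>g s\<bar> \<le> h s"
  shows "\<bar>LBINT s:A. g s\<bar> \<le> (LBINT s:A. h s)"
proof (cases "set_integrable lborel A g")
  case True
  have "\<bar>LBINT s:A. g s\<bar> \<le> (LBINT s:A. \<bar>g s\<bar>)"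
    using set_integral_norm_bound[OF True] by simp
  also have "\<dots> \<le> (LBINT s:A. h s)"
    by (rule set_integral_mono[OF _ assms(1)]) (use True assms(2) in \<open>auto intro: set_integrable_abs\<close>)
  finally show ?thesis .
next
  case False
  \<comment> \<open>The integral of a non-integrable function is 0 by convention, and the bound
    persists.\<close>
  then have "(LBINT s:A. g s) = 0" unfolding set_lebesgue_integral_def set_integrable_def
    by (rule not_integrable_integral_eq)
  moreover have "0 \<le> (LBINT s:A. h s)"
    unfolding set_lebesgue_integral_def using assms(2)
    by (intro Bochner_Integration.integral_nonneg) (auto simp: indicator_def intro: order_trans[OF abs_ge_zero])
  ultimately show ?thesis by simp
qed

lemma exp_le_powr: fixes y :: real assumes "y > 0" shows "exp (- y) \<le> y powr (-1/8)"
proof -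
  have "y powr (1/8) \<le> exp y"
  proof (cases "y \<le> 1")
    case True
    then have "y powr (1/8) \<le> 1" using assms powr_mono2[of "1/8" y 1] by simp
    also have "1 \<le> exp y" using assms by simp
    finally show ?thesis .
  next
    case False
    then have "y powr (1/8) \<le> y powr 1" by (intro powr_mono) auto
    also have "y powr 1 = y" using assms by simp
    also have "y \<le> exp y" using exp_ge_add_one_self[of y] by linarith
    finally show ?thesis .
  qed
  then have "inverse (exp y) \<le> inverse (y powr (1/8))" using assms by (intro le_imp_inverse_le) auto
  then show ?thesis by (simp add: exp_minus powr_minus[symmetric])
qed

text \<open>The weight makes the singular integral operator small:
  \<open>exp (- (l * (t - s))) \<le> (l * (t - s)) powr (-1/8)\<close> worsens the exponent only to
  \<open>-7/8\<close>, still integrable, and gains the factor \<open>l powr (-1/8)\<close>.\<close>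

lemma weighted_kernel_small:
  fixes T \<epsilon> :: real
  assumes T: "T > 0" and e: "\<epsilon> > 0"
  shows "\<exists>l>0. \<forall>t\<in>{0..T}. set_integrable lborel {0..t} (\<lambda>s. (t - s) powr (-3/4) * exp (l * s)) \<and>
     (LBINT s:{0..t}. (t - s) powr (-3/4) * exp (l * s)) \<le> \<epsilon> * exp (l * t)"
proof -
  \<comment> \<open>Solves \<open>8 * T powr (1/8) * l powr (-1/8) = \<epsilon>\<close>; the 8 comes
    from integrating the power \<open>-7/8\<close>.\<close>
  define l where "l = T * (8 / \<epsilon>) ^ 8"
  have l: "l > 0" using T e by (simp add: l_def)
  have "set_integrable lborel {0..t} (\<lambda>s. (t - s) powr (-3/4) * exp (l * s)) \<and>
     (LBINT s:{0..t}. (t - s) powr (-3/4) * exp (l * s)) \<le> \<epsilon> * exp (l * t)" if t: "t \<in> {0..T}" for t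
  proof -
    have t0: "t \<ge> 0" "t \<le> T" using t by auto
    have p1: "set_integrable lborel {0..t} (\<lambda>s. (t - s) powr (-7/8))" "(LBINT s:{0..t}. (t - s) powr (-7/8)) = 8 * t powr (1/8)"
      using powr_kernel_integral[of "-7/8" t] t0 by auto
    have p2: "set_integrable lborel {0..t} (\<lambda>s. (t - s) powr (-7/8) * (exp (l * t) * l powr (-1/8)))"
      using p1(1) by (intro set_integrable_mult_left) auto
    have le: "(t - s) powr (-3/4) * exp (l * s) \<le> (t - s) powr (-7/8) * (exp (l * t) * l powr (-1/8))"
      if "s \<in> {0..t}" for s
    proof (cases "s = t")
      case False
      then have st: "t - s > 0" using that by auto
      have "exp (l * s) = exp (l * t) * exp (- (l * (t - s)))" by (simp add: exp_add[symmetric] algebra_simps)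
      also have "\<dots> \<le> exp (l * t) * (l * (t - s)) powr (-1/8)"
        using l st by (intro mult_left_mono exp_le_powr) auto
      also have "(l * (t - s)) powr (-1/8) = l powr (-1/8) * (t - s) powr (-1/8)" using l st by (simp add: powr_mult)
      finally have "(t - s) powr (-3/4) * exp (l * s) \<le> (t - s) powr (-3/4) * (exp (l * t) * (l powr (-1/8) * (t - s) powr (-1/8)))"
        by (rule mult_left_mono) simp
      also have "\<dots> = ((t - s) powr (-3/4) * (t - s) powr (-1/8)) * (exp (l * t) * l powr (-1/8))"
        by (simp only: mult_ac)
      also have "(t - s) powr (-3/4) * (t - s) powr (-1/8) = (t - s) powr (-7/8)" by (simp add: powr_add[symmetric])
      finally show ?thesis .
    qed simp
    have i: "set_integrable lborel {0..t} (\<lambda>s. (t - s) powr (-3/4) * exp (l * s))"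
    proof (rule set_integrable_bound[OF p2])
      show "set_borel_measurable lborel {0..t} (\<lambda>s. (t - s) powr (-3/4) * exp (l * s))"
        unfolding set_borel_measurable_def by measurable
      show "AE s in lborel. s \<in> {0..t} \<longrightarrow> norm ((t - s) powr (-3/4) * exp (l * s)) \<le> norm ((t - s) powr (-7/8) * (exp (l * t) * l powr (-1/8)))"
      proof (intro AE_I2 impI)
        fix s assume "s \<in> {0..t}"
        from le[OF this] show "norm ((t - s) powr (-3/4) * exp (l * s)) \<le> norm ((t - s) powr (-7/8) * (exp (l * t) * l powr (-1/8)))"
          unfolding real_norm_def by (subst (1 2) abs_of_nonneg) auto
      qed
    qed
    have "(LBINT s:{0..t}. (t - s) powr (-3/4) * exp (l * s)) \<le> (LBINT s:{0..t}. (t - s) powr (-7/8) * (exp (l * t) * l powr (-1/8)))"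
      by (rule set_integral_mono[OF i p2 le])
    also have "\<dots> = 8 * t powr (1/8) * (exp (l * t) * l powr (-1/8))"
      unfolding p1(2)[symmetric] by (rule set_integral_mult_left)
    also have "\<dots> = 8 * (t powr (1/8) * l powr (-1/8)) * exp (l * t)" by (simp only: mult_ac)
    also have "\<dots> \<le> \<epsilon> * exp (l * t)"
    proof (intro mult_right_mono)
      have p: "8 / \<epsilon> > 0" using e by simp
      have "((8/\<epsilon>)^8) powr (-1/8) = ((8/\<epsilon>) powr 8) powr (-1/8)"
        using powr_numeral[OF less_imp_le[OF p], of "Num.Bit0 (Num.Bit0 (Num.Bit0 Num.One))"] by simp
      also have "\<dots> = (8/\<epsilon>) powr (-1)" by (subst powr_powr) simp
      also have "\<dots> = \<epsilon> / 8" using p by (simp add: powr_minus)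
      finally have q: "((8/\<epsilon>)^8) powr (-1/8) = \<epsilon> / 8" .
      have "l powr (-1/8) = T powr (-1/8) * (\<epsilon> / 8)" unfolding l_def q[symmetric] using T e by (simp add: powr_mult)
      moreover have "T powr (1/8) * T powr (-1/8) = 1" using T by (simp add: powr_add[symmetric])
      ultimately have r: "T powr (1/8) * l powr (-1/8) = \<epsilon> / 8" by (simp only: mult.assoc[symmetric] mult_1_left)
      have "t powr (1/8) * l powr (-1/8) \<le> T powr (1/8) * l powr (-1/8)" using t0
        by (intro mult_right_mono powr_mono2) auto
      then show "8 * (t powr (1/8) * l powr (-1/8)) \<le> \<epsilon>" unfolding r by linarith
    qed simp
    finally show ?thesis using i by simp
  qed
  then show ?thesis using l by blast
qed

section \<open>Duhamel formulas with two clocks\<close>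

text \<open>The function \<open>f s\<close> entering at Burgers time \<open>s\<close> has been transported by \<open>X\<close> for the time \<open>\<theta> s\<close>; at
  Burgers time \<open>t\<close> the transport time is \<open>q\<close>.\<close>

definition duhamel :: "(real \<Rightarrow> real) \<Rightarrow> (real \<Rightarrow> real) \<Rightarrow> (real \<Rightarrow> real \<Rightarrow> real) \<Rightarrow> real \<Rightarrow> real \<Rightarrow> (real \<Rightarrow> real) \<Rightarrow> bool" where
  "duhamel u0 \<theta> f t q v \<longleftrightarrow> v \<in> L2 \<and> (\<forall>b\<in>L2.
     set_integrable lborel {0..t} (\<lambda>s. W (pk (t - s) (q - \<theta> s)) b (f s)) \<and>
     ip b v = ip b (Tm (Q t q) u0) + 1/2 * (LBINT s:{0..t}. W (pk (t - s) (q - \<theta> s)) b (f s)))"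

definition small_weight :: "real \<Rightarrow> real \<Rightarrow> real \<Rightarrow> bool" where
  "small_weight T \<epsilon> l \<longleftrightarrow> (\<forall>t\<in>{0..T}. set_integrable lborel {0..t} (\<lambda>s. (t - s) powr (-3/4) * exp (l * s)) \<and>
     (LBINT s:{0..t}. (t - s) powr (-3/4) * exp (l * s)) \<le> \<epsilon> * exp (l * t))"

lemma small_weight_exists: "T > 0 \<Longrightarrow> \<epsilon> > 0 \<Longrightarrow> \<exists>l>0. small_weight T \<epsilon> l"
  unfolding small_weight_def by (rule weighted_kernel_small)

lemma small_weight_bound:
  assumes small_weight: "small_weight T \<epsilon> l" and t: "t \<in> {0..T}" and M: "M \<ge> 0"
    and g: "\<And>s. s \<in> {0..t} \<Longrightarrow> \<bar>g s\<bar> \<le> (t - s) powr (-3/4) * (M * exp (l * s))"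
  shows "\<bar>LBINT s:{0..t}. g s\<bar> \<le> \<epsilon> * M * exp (l * t)"
proof -
  have i: "set_integrable lborel {0..t} (\<lambda>s. ((t - s) powr (-3/4) * exp (l * s)) * M)"
    using small_weight t by (intro set_integrable_mult_left) (auto simp: small_weight_def)
  have "\<bar>LBINT s:{0..t}. g s\<bar> \<le> (LBINT s:{0..t}. ((t - s) powr (-3/4) * exp (l * s)) * M)"
    by (rule set_integral_abs_le[OF i]) (use g in \<open>simp add: mult_ac\<close>)
  also have "\<dots> = (LBINT s:{0..t}. (t - s) powr (-3/4) * exp (l * s)) * M" by (rule set_integral_mult_left)
  also have "\<dots> \<le> (\<epsilon> * exp (l * t)) * M" using small_weight t M
    by (intro mult_right_mono) (auto simp: small_weight_def)
  finally show ?thesis by (simp only: mult_ac)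
qed

lemma duhamel_L2: "duhamel u0 \<theta> f t q v \<Longrightarrow> v \<in> L2" by (simp add: duhamel_def)

text \<open>The formula commutes with translations: testing with \<open>j\<close> backward
  differences of \<open>b\<close> moves \<open>j\<close> forward differences onto \<open>u0\<close>
  and the forcing. The singular kernel is then paid for by the small weight. The case
  \<open>j = 0\<close> is a plain norm bound.\<close>

lemma duhamel_fdn:
  assumes d: "duhamel u0 \<theta> f t q v" and u0: "u0 \<in> L2" and small_weight: "small_weight T \<epsilon> l"
      and t: "t \<in> {0..T}" and M: "M \<ge> 0" and e: "\<epsilon> \<ge> 0"
    and f: "\<And>s. s \<in> {0..t} \<Longrightarrow> integrable lborel (f s)"
    and fM: "\<And>s. s \<in> {0..t} \<Longrightarrow> L1_norm ((fd k ^^ j) (f s)) \<le> M * exp (l * s)"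
  shows "L2_norm ((fd k ^^ j) v) \<le> L2_norm ((fd k ^^ j) u0) + 1/2 * (\<epsilon> * M * exp (l * t))"
proof (rule L2_norm_le_dual)
  interpret q: real_distribution "Q t q" by (rule rd_Q)
  show "(fd k ^^ j) v \<in> L2" using d by (intro L2_fdn duhamel_L2)
  show "0 \<le> L2_norm ((fd k ^^ j) u0) + 1 / 2 * (\<epsilon> * M * exp (l * t))" using M e by simp
  fix b assume b: "b \<in> L2"
  let ?b = "(fd (-k) ^^ j) b"
  have b': "?b \<in> L2" using b by (rule L2_fdn)
  let ?I = "LBINT s:{0..t}. W (pk (t - s) (q - \<theta> s)) ?b (f s)"
  have "ip b ((fd k ^^ j) v) = ip ?b v" using b d by (simp add: ip_fdn duhamel_L2)
  also have "\<dots> = ip ?b (Tm (Q t q) u0) + 1/2 * ?I" using d b' by (simp add: duhamel_def)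
  also have "ip ?b (Tm (Q t q) u0) = ip b (Tm (Q t q) ((fd k ^^ j) u0))" by (rule q.ip_fdn_Tm[OF b u0])
  finally have e1: "ip b ((fd k ^^ j) v) = ip b (Tm (Q t q) ((fd k ^^ j) u0)) + 1/2 * ?I" .
  have "\<bar>ip b (Tm (Q t q) ((fd k ^^ j) u0))\<bar> \<le> L2_norm b * L2_norm (Tm (Q t q) ((fd k ^^ j) u0))"
    using b u0 by (intro ip_CS q.L2_Tm L2_fdn)
  also have "\<dots> \<le> L2_norm b * L2_norm ((fd k ^^ j) u0)"
    using u0 by (intro mult_left_mono q.L2_Tm L2_fdn) auto
  finally have e2: "\<bar>ip b (Tm (Q t q) ((fd k ^^ j) u0))\<bar> \<le> L2_norm b * L2_norm ((fd k ^^ j) u0)" .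
  have "\<bar>?I\<bar> \<le> \<epsilon> * (L2_norm b * M) * exp (l * t)"
  proof (rule small_weight_bound[OF small_weight t])
    show "0 \<le> L2_norm b * M" using M by simp
    fix s assume s: "s \<in> {0..t}"
    have "W (pk (t - s) (q - \<theta> s)) ?b (f s) = W (pk (t - s) (q - \<theta> s)) b ((fd k ^^ j) (f s))"
      using s by (intro W_fdn_b pk_L2 b f) auto
    also have "\<bar>\<dots>\<bar> \<le> (t - s) powr (-3/4) * L2_norm b * L1_norm ((fd k ^^ j) (f s))"
      using s by (intro W_pk_bound b L1_fdn f) auto
    also have "\<dots> \<le> (t - s) powr (-3/4) * L2_norm b * (M * exp (l * s))"
      using fM[OF s] by (intro mult_left_mono) auto
    finally show "\<bar>W (pk (t - s) (q - \<theta> s)) ?b (f s)\<bar> \<le> (t - s) powr (-3/4) * (L2_norm b * M * exp (l * s))"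
      by (simp only: mult_ac)
  qed
  then have "\<bar>ip b ((fd k ^^ j) v)\<bar> \<le> L2_norm b * L2_norm ((fd k ^^ j) u0) + 1/2 * (\<epsilon> * (L2_norm b * M) * exp (l * t))"
    using e2 unfolding e1 by linarith
  then show "\<bar>ip b ((fd k ^^ j) v)\<bar> \<le> (L2_norm ((fd k ^^ j) u0) + 1 / 2 * (\<epsilon> * M * exp (l * t))) * L2_norm b"
    by (simp add: algebra_simps)
qed

text \<open>Equal data, clock and kernel make the linear parts cancel, so only the forcings are
  compared.\<close>

lemma duhamel_diff:
  assumes d: "duhamel u0 \<theta> f t q v" "duhamel u0 \<theta> g t q w" and small_weight: "small_weight T \<epsilon> l"
      and t: "t \<in> {0..T}" and M: "M \<ge> 0" and e: "\<epsilon> \<ge> 0"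
    and f: "\<And>s. s \<in> {0..t} \<Longrightarrow> integrable lborel (f s)" "\<And>s. s \<in> {0..t} \<Longrightarrow> integrable lborel (g s)"
    and fM: "\<And>s. s \<in> {0..t} \<Longrightarrow> L1_norm (\<lambda>x. f s x - g s x) \<le> M * exp (l * s)"
  shows "L2_norm (\<lambda>x. v x - w x) \<le> 1/2 * (\<epsilon> * M * exp (l * t))"
proof (rule L2_norm_le_dual)
  have L: "v \<in> L2" "w \<in> L2" using d by (auto dest: duhamel_L2)
  then show "(\<lambda>x. v x - w x) \<in> L2" by (rule L2_diff)
  show "0 \<le> 1 / 2 * (\<epsilon> * M * exp (l * t))" using M e by simp
  fix b assume b: "b \<in> L2"
  let ?I = "\<lambda>f. LBINT s:{0..t}. W (pk (t - s) (q - \<theta> s)) b (f s)"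
  have "ip b (\<lambda>x. v x - w x) = 1/2 * (?I f - ?I g)"
    using d b L by (simp add: ip_diff_right duhamel_def right_diff_distrib)
  also have "?I f - ?I g = (LBINT s:{0..t}. W (pk (t - s) (q - \<theta> s)) b (f s) - W (pk (t - s) (q - \<theta> s)) b (g s))"
    using d b by (intro set_integral_diff(2)[symmetric]) (auto simp: duhamel_def)
  finally have e1: "ip b (\<lambda>x. v x - w x) = 1/2 * (LBINT s:{0..t}. W (pk (t - s) (q - \<theta> s)) b (f s) - W (pk (t - s) (q - \<theta> s)) b (g s))" .
  have "\<bar>LBINT s:{0..t}. W (pk (t - s) (q - \<theta> s)) b (f s) - W (pk (t - s) (q - \<theta> s)) b (g s)\<bar> \<le> \<epsilon> * (L2_norm b * M) * exp (l * t)"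
  proof (rule small_weight_bound[OF small_weight t])
    show "0 \<le> L2_norm b * M" using M by simp
    fix s assume s: "s \<in> {0..t}"
    have "W (pk (t - s) (q - \<theta> s)) b (f s) - W (pk (t - s) (q - \<theta> s)) b (g s) = W (pk (t - s) (q - \<theta> s)) b (\<lambda>x. f s x - g s x)"
      using s by (intro W_diff_f[symmetric] pk_L2 b f) auto
    also have "\<bar>\<dots>\<bar> \<le> (t - s) powr (-3/4) * L2_norm b * L1_norm (\<lambda>x. f s x - g s x)"
      using s f by (intro W_pk_bound b) auto
    also have "\<dots> \<le> (t - s) powr (-3/4) * L2_norm b * (M * exp (l * s))"
      using fM[OF s] by (intro mult_left_mono) auto
    finally show "\<bar>W (pk (t - s) (q - \<theta> s)) b (f s) - W (pk (t - s) (q - \<theta> s)) b (g s)\<bar> \<le> (t - s) powr (-3/4) * (L2_norm b * M * exp (l * s))"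
      by (simp only: mult_ac)
  qed
  then show "\<bar>ip b (\<lambda>x. v x - w x)\<bar> \<le> 1 / 2 * (\<epsilon> * M * exp (l * t)) * L2_norm b"
    unfolding e1 by (simp add: mult_ac)
qed

lemma pk_Tm': assumes "\<tau> \<ge> 0" "s \<ge> 0" "r \<ge> 0" shows "Tm (mu r) (pk \<tau> s) = pk \<tau> (s + r)"
proof (cases "\<tau> = 0")
  case True then show ?thesis by (auto simp: pk_0 Tm_def)
next
  case False
  then show ?thesis using pk_Tm[of \<tau> s 0 r] assms by (simp add: Q_0)
qed

text \<open>Running \<open>X\<close> for a time \<open>r\<close> advances the transport clock of the
  kernel and leaves its heat clock alone. The clock is constrained for \<open>s < t\<close> only: at
  \<open>s = t\<close> the kernel is the junk zero, and the clock of the splitting jumps exactly at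
  the end of a step.\<close>

lemma duhamel_mu:
  assumes d: "duhamel u0 \<theta> f t q v" and u0: "u0 \<in> L2" and t: "t \<ge> 0"
      and th: "\<And>s. s \<in> {0..<t} \<Longrightarrow> \<theta> s \<le> q" "0 \<le> q" and r: "r \<ge> 0"
  shows "duhamel u0 \<theta> f t (q + r) (Tm (mu r) v)"
  unfolding duhamel_def
proof (intro conjI ballI)
  interpret M: real_distribution "mu r" by (rule rd_mu)
  interpret MR: real_distribution "Tr (mu r)" by (rule M.real_distribution_Tr)
  interpret q: real_distribution "Q t q" by (rule rd_Q)
  show "Tm (mu r) v \<in> L2" by (rule M.L2_Tm(1)[OF duhamel_L2[OF d]])
  fix b assume b: "b \<in> L2"
  let ?b = "Tm (Tr (mu r)) b"
  have b': "?b \<in> L2" by (rule MR.L2_Tm(1)[OF b])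
  have w: "W (pk (t - s) (q - \<theta> s)) ?b (f s) = W (pk (t - s) (q + r - \<theta> s)) b (f s)" if s: "s \<in> {0..t}"
    for s
  proof -
    have "W (pk (t - s) (q - \<theta> s)) ?b (f s) = W (Tm (mu r) (pk (t - s) (q - \<theta> s))) b (f s)"
      using s by (intro M.W_Tm_b pk_L2 b) auto
    also have "Tm (mu r) (pk (t - s) (q - \<theta> s)) = pk (t - s) (q - \<theta> s + r)"
    proof (cases "s = t")
      case True then show ?thesis by (auto simp: pk_0 Tm_def)
    next
      case False
      then show ?thesis using s th r by (intro pk_Tm') auto
    qed
    finally show ?thesis by (simp add: algebra_simps)
  qed
  show "set_integrable lborel {0..t} (\<lambda>s. W (pk (t - s) (q + r - \<theta> s)) b (f s))"
    using d b' by (subst set_integrable_cong[OF refl refl w[symmetric]]) (auto simp: duhamel_def)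
  have "ip b (Tm (mu r) v) = ip ?b v" by (rule M.Tm_adjoint[OF b duhamel_L2[OF d]])
  also have "\<dots> = ip ?b (Tm (Q t q) u0) + 1/2 * (LBINT s:{0..t}. W (pk (t - s) (q - \<theta> s)) ?b (f s))"
    using d b' by (simp add: duhamel_def)
  also have "ip ?b (Tm (Q t q) u0) = ip b (Tm (mu r) (Tm (Q t q) u0))"
    by (rule M.Tm_adjoint[symmetric, OF b q.L2_Tm(1)[OF u0]])
  also have "\<dots> = ip b (Tm (Q t (q + r)) u0)"
    using Tm_convolution[OF rd_mu[of r] rd_Q[of t q] b u0] Q_add[of 0 r t q] t th r by (simp add: Q_0 add.commute)
  also have "(LBINT s:{0..t}. W (pk (t - s) (q - \<theta> s)) ?b (f s)) = (LBINT s:{0..t}. W (pk (t - s) (q + r - \<theta> s)) b (f s))"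
    by (rule set_lebesgue_integral_cong) (auto simp: w)
  finally show "ip b (Tm (mu r) v) = ip b (Tm (Q t (q + r)) u0) + 1/2 * (LBINT s:{0..t}. W (pk (t - s) (q + r - \<theta> s)) b (f s))" .
qed

lemma duhamel_cong_AE: assumes "duhamel u0 \<theta> f t q v" "v' \<in> borel_measurable borel" "AE x in lborel. v' x = v x"
  shows "duhamel u0 \<theta> f t q v'"
proof -
  have "v' \<in> L2" using assms by (auto intro: L2_cong_AE dest: duhamel_L2)
  moreover have "ip b v' = ip b v" if "b \<in> L2" for b
    using assms that by (intro ip_cong_AE) (auto dest: L2_measurable duhamel_L2)
  ultimately show ?thesis using assms by (simp add: duhamel_def)
qed

lemma LBINT_split:
  fixes g :: "real \<Rightarrow> real"
  assumes "a \<le> b" "b \<le> c" "set_integrable lborel {a..b} g" "set_integrable lborel {b..c} g"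
  shows "set_integrable lborel {a..c} g" "(LBINT s:{a..c}. g s) = (LBINT s:{a..b}. g s) + (LBINT s:{b..c}. g s)"
proof -
  have e: "{a..c} = {a..b} \<union> {b..c}" using assms by auto
  show i: "set_integrable lborel {a..c} g" unfolding e by (rule set_integrable_Un) (use assms in auto)
  have "(LBINT s:{a..c}. g s) = (LBINT s:{a..b}. g s) + (LBINT s:{b<..c}. g s)"
  proof -
    have e2: "{a..c} = {a..b} \<union> {b<..c}" using assms by auto
    show ?thesis unfolding e2 using assms by (intro set_integral_Un) (auto intro: set_integrable_subset)
  qed
  also have "(LBINT s:{b<..c}. g s) = (LBINT s:{b..c}. g s)"
    unfolding set_lebesgue_integral_def
  proof (rule integral_cong_AE)
    have [measurable]: "(\<lambda>x. indicator {b..c} x *\<^sub>R g x) \<in> borel_measurable lborel"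
      using assms(4) unfolding set_integrable_def by auto
    show "(\<lambda>x. indicator {b..c} x *\<^sub>R g x) \<in> borel_measurable lborel" by measurable
    have eq: "(\<lambda>x. indicator {b<..c} x *\<^sub>R g x) = (\<lambda>x. indicator {b<..} x * (indicator {b..c} x *\<^sub>R g x))" by (auto simp: indicator_def fun_eq_iff)
    show "(\<lambda>x. indicator {b<..c} x *\<^sub>R g x) \<in> borel_measurable lborel" unfolding eq by measurable
    show "AE x in lborel. indicator {b<..c} x *\<^sub>R g x = indicator {b..c} x *\<^sub>R g x"
      using AE_lborel_singleton[of b] by eventually_elim (auto simp: indicator_def)
  qed
  finally show "(LBINT s:{a..c}. g s) = (LBINT s:{a..b}. g s) + (LBINT s:{b..c}. g s)" .
qed

text \<open>Applied with \<open>c\<close> the endpoint at which the kernel \<open>pk 0\<close> is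
  the junk zero: identities between kernels can fail there, and the integrals do not notice.\<close>

lemma LBINT_cong_except:
  fixes g h :: "real \<Rightarrow> real"
  assumes g: "set_integrable lborel {a..b} g"
      and e: "\<And>s. s \<in> {a..b} \<Longrightarrow> s \<noteq> c \<Longrightarrow> h s = g s"
  shows "set_integrable lborel {a..b} h" "(LBINT s:{a..b}. h s) = (LBINT s:{a..b}. g s)"
proof -
  have gm[measurable]: "(\<lambda>x. indicator {a..b} x *\<^sub>R g x) \<in> borel_measurable lborel"
    using g unfolding set_integrable_def by auto
  have eq: "(\<lambda>x. indicator {a..b} x *\<^sub>R h x) = (\<lambda>x. if x = c then indicator {a..b} c * h c else indicator {a..b} x *\<^sub>R g x)"
    using e by (auto simp: indicator_def)
  have hm: "(\<lambda>x. indicator {a..b} x *\<^sub>R h x) \<in> borel_measurable lborel" unfolding eq by measurable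
  have ae: "AE x in lborel. indicator {a..b} x *\<^sub>R h x = indicator {a..b} x *\<^sub>R g x"
    using AE_lborel_singleton[of c] by eventually_elim (use e in \<open>auto simp: indicator_def\<close>)
  show "set_integrable lborel {a..b} h"
    using g unfolding set_integrable_def by (subst integrable_cong_AE[OF hm gm ae])
  show "(LBINT s:{a..b}. h s) = (LBINT s:{a..b}. g s)"
    unfolding set_lebesgue_integral_def by (rule integral_cong_AE[OF hm gm ae])
qed

text \<open>The propagator acts on the integrand through \<open>pk_Tm\<close>, so the past forcing
  is carried on with the kernel of the later time. The point \<open>s = t\<close> is exceptional:
  the zero \<open>pk 0\<close> does not propagate to \<open>pk r\<close>.\<close>

lemma duhamel_propagate:
  assumes d: "duhamel u0 \<theta> f t q v" and u0: "u0 \<in> L2" and t: "t \<ge> 0"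
      and th: "\<And>s. s \<in> {0..t} \<Longrightarrow> \<theta> s \<le> q" "0 \<le> q" and r: "r \<ge> 0" "p \<ge> 0"
    and b: "b \<in> L2"
  shows "ip b (Tm (Q r p) v) = ip b (Tm (Q (t + r) (q + p)) u0) + 1/2 * (LBINT s:{0..t}. W (pk (t + r - s) (q + p - \<theta> s)) b (f s))"
    "set_integrable lborel {0..t} (\<lambda>s. W (pk (t + r - s) (q + p - \<theta> s)) b (f s))"
proof -
  interpret M: real_distribution "Q r p" by (rule rd_Q)
  interpret MR: real_distribution "Tr (Q r p)" by (rule M.real_distribution_Tr)
  interpret q: real_distribution "Q t q" by (rule rd_Q)
  let ?b = "Tm (Tr (Q r p)) b"
  have b': "?b \<in> L2" by (rule MR.L2_Tm(1)[OF b])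
  have w: "W (pk (t + r - s) (q + p - \<theta> s)) b (f s) = W (pk (t - s) (q - \<theta> s)) ?b (f s)"
    if s: "s \<in> {0..t}" "s \<noteq> t" for s
  proof -
    have "W (pk (t - s) (q - \<theta> s)) ?b (f s) = W (Tm (Q r p) (pk (t - s) (q - \<theta> s))) b (f s)"
      using s by (intro M.W_Tm_b pk_L2 b) auto
    also have "Tm (Q r p) (pk (t - s) (q - \<theta> s)) = pk (t - s + r) (q - \<theta> s + p)"
      using s th r by (intro pk_Tm) auto
    finally show ?thesis by (simp add: algebra_simps)
  qed
  have i: "set_integrable lborel {0..t} (\<lambda>s. W (pk (t - s) (q - \<theta> s)) ?b (f s))"
    using d b' by (auto simp: duhamel_def)
  show "set_integrable lborel {0..t} (\<lambda>s. W (pk (t + r - s) (q + p - \<theta> s)) b (f s))"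
    by (rule LBINT_cong_except(1)[OF i w])
  have "ip b (Tm (Q r p) v) = ip ?b v" by (rule M.Tm_adjoint[OF b duhamel_L2[OF d]])
  also have "\<dots> = ip ?b (Tm (Q t q) u0) + 1/2 * (LBINT s:{0..t}. W (pk (t - s) (q - \<theta> s)) ?b (f s))"
    using d b' by (simp add: duhamel_def)
  also have "ip ?b (Tm (Q t q) u0) = ip b (Tm (Q r p) (Tm (Q t q) u0))"
    by (rule M.Tm_adjoint[symmetric, OF b q.L2_Tm(1)[OF u0]])
  also have "\<dots> = ip b (Tm (Q (t + r) (q + p)) u0)"
    using Tm_convolution[OF rd_Q[of r p] rd_Q[of t q] b u0] Q_add[of r p t q] t th r by (simp add: add.commute)
  also have "(LBINT s:{0..t}. W (pk (t - s) (q - \<theta> s)) ?b (f s)) = (LBINT s:{0..t}. W (pk (t + r - s) (q + p - \<theta> s)) b (f s))"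
    by (rule LBINT_cong_except(2)[OF i w, symmetric])
  finally show "ip b (Tm (Q r p) v) = ip b (Tm (Q (t + r) (q + p)) u0) + 1/2 * (LBINT s:{0..t}. W (pk (t + r - s) (q + p - \<theta> s)) b (f s))" .
qed

text \<open>Cocycle property: the part of the integral before \<open>t\<close> is absorbed in the
  propagated \<open>v\<close>.\<close>

lemma duhamel_restart:
  assumes d: "duhamel u0 \<theta> f t q v" "duhamel u0 \<theta> f (t + r) (q + p) v'" and u0: "u0 \<in> L2"
      and t: "t \<ge> 0"
    and th: "\<And>s. s \<in> {0..t} \<Longrightarrow> \<theta> s \<le> q" "0 \<le> q" and r: "r \<ge> 0" "p \<ge> 0"
    and b: "b \<in> L2"
  shows "ip b v' = ip b (Tm (Q r p) v) + 1/2 * (LBINT s:{t..t+r}. W (pk (t + r - s) (q + p - \<theta> s)) b (f s))"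
proof -
  have i: "set_integrable lborel {0..t+r} (\<lambda>s. W (pk (t + r - s) (q + p - \<theta> s)) b (f s))"
    using d(2) b by (auto simp: duhamel_def)
  then have i2: "set_integrable lborel {t..t+r} (\<lambda>s. W (pk (t + r - s) (q + p - \<theta> s)) b (f s))"
    using t by (auto intro: set_integrable_subset)
  note P = duhamel_propagate[OF d(1) u0 t th r b]
  show ?thesis using P(1) d(2) b LBINT_split(2)[OF t _ P(2) i2] r by (simp add: duhamel_def)
qed

text \<open>Concatenation with a Burgers run started from \<open>v\<close>, during which the
  transport clock stands still at \<open>q\<close>. Forcing and clock are matched on the half open
  interval because both may jump at the end of a splitting step.\<close>

lemma duhamel_glue:
  assumes d: "duhamel u0 \<theta> f t q v" and w: "duhamel v (\<lambda>s. 0) g r 0 w" and u0: "u0 \<in> L2"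
      and t: "t \<ge> 0"
    and th: "\<And>s. s \<in> {0..t} \<Longrightarrow> \<theta> s \<le> q" "0 \<le> q" and r: "r \<ge> 0"
    and c: "\<And>s. s \<in> {0..<r} \<Longrightarrow> f (t + s) = g s" "\<And>s. s \<in> {0..<r} \<Longrightarrow> \<theta> (t + s) = q"
  shows "duhamel u0 \<theta> f (t + r) q w"
  unfolding duhamel_def
proof (intro conjI ballI)
  show "w \<in> L2" by (rule duhamel_L2[OF w])
  fix b assume b: "b \<in> L2"
  let ?F = "\<lambda>s. W (pk (t + r - s) (q - \<theta> s)) b (f s)"
  let ?G = "\<lambda>s. W (pk (r - s) (0 - 0)) b (g s)"
  note P = duhamel_propagate[OF d u0 t th r order_refl b, simplified]
  have gi: "set_integrable lborel {0..r} ?G" using w b by (auto simp: duhamel_def)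
  have e: "indicator {t..t+r} s *\<^sub>R ?G (s - t) = indicator {0..r} (s - t) *\<^sub>R ?G (s - t)" for s
    by (auto simp: indicator_def)
  have gi': "set_integrable lborel {t..t+r} (\<lambda>s. ?G (s - t))"
    using gi lborel_shift_integrable[of "\<lambda>s. indicator {0..r} s *\<^sub>R ?G s" "-t"] unfolding set_integrable_def e
    by simp
  have gv: "(LBINT s:{t..t+r}. ?G (s - t)) = (LBINT s:{0..r}. ?G s)"
    using lborel_shift[of "\<lambda>s. indicator {0..r} s *\<^sub>R ?G s" "-t"] unfolding set_lebesgue_integral_def e by simp
  have fg: "?F s = ?G (s - t)" if "s \<in> {t..t+r}" "s \<noteq> t + r" for s
    using c[of "s - t"] that by (simp add: algebra_simps)
  note F = LBINT_cong_except[OF gi' fg]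
  have tr: "t \<le> t + r" using r by simp
  show "set_integrable lborel {0..t+r} ?F" by (rule LBINT_split(1)[OF t tr P(2) F(1)])
  have "ip b w = ip b (Tm (Q r 0) v) + 1/2 * (LBINT s:{0..r}. ?G s)" using w b by (simp add: duhamel_def)
  also have "\<dots> = ip b (Tm (Q (t + r) q) u0) + 1/2 * ((LBINT s:{0..t}. ?F s) + (LBINT s:{t..t+r}. ?F s))"
    using P(1) F(2) gv by simp
  also have "(LBINT s:{0..t}. ?F s) + (LBINT s:{t..t+r}. ?F s) = (LBINT s:{0..t+r}. ?F s)"
    by (rule LBINT_split(2)[OF t tr P(2) F(1), symmetric])
  finally show "ip b w = ip b (Tm (Q (t + r) q) u0) + 1/2 * (LBINT s:{0..t+r}. ?F s)" .
qed

text \<open>Fixed point form of Gronwall: with \<open>M\<close> the supremum of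
  \<open>q s * exp (- (l * s))\<close>, the step hypothesis gives \<open>M \<le> A + M/2\<close>.
  The crude bound \<open>Bd\<close> makes \<open>M\<close> finite, so that \<open>M/2\<close> can be
  subtracted.\<close>

lemma gronwall_sup:
  fixes q :: "real \<Rightarrow> real"
  assumes q: "\<And>t. t \<in> {0..T} \<Longrightarrow> 0 \<le> q t" "\<And>t. t \<in> {0..T} \<Longrightarrow> q t \<le> Bd"
      and l: "l \<ge> 0" and A: "A \<ge> 0"
    and s: "\<And>M t. M \<ge> 0 \<Longrightarrow> (\<And>s. s \<in> {0..T} \<Longrightarrow> q s \<le> M * exp (l * s)) \<Longrightarrow> t \<in> {0..T} \<Longrightarrow> q t \<le> A + 1/2 * (M * exp (l * t))"
    and t: "t \<in> {0..T}"
  shows "q t \<le> 2 * A * exp (l * t)"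
proof -
  define M where "M = (SUP s\<in>{0..T}. q s * exp (- (l * s)))"
  have ne: "{0..T} \<noteq> {}" using t by auto
  have bd: "bdd_above ((\<lambda>s. q s * exp (- (l * s))) ` {0..T})"
  proof (rule bdd_aboveI2)
    fix s assume s: "s \<in> {0..T}"
    then have "q s * exp (- (l * s)) \<le> q s * 1" using q(1)[OF s] l by (intro mult_left_mono) auto
    then show "q s * exp (- (l * s)) \<le> Bd" using q(2)[OF s] by simp
  qed
  have le: "q s * exp (- (l * s)) \<le> M" if "s \<in> {0..T}" for s unfolding M_def by (rule cSUP_upper[OF that bd])
  have M0: "M \<ge> 0" using le[OF t] q(1)[OF t] by (meson exp_ge_zero mult_nonneg_nonneg order_trans)
  have qM: "q s \<le> M * exp (l * s)" if "s \<in> {0..T}" for s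
    using le[OF that] by (simp add: exp_minus field_simps)
  have "M \<le> A + 1/2 * M" unfolding M_def
  proof (rule cSUP_least[OF ne])
    fix s assume sT: "s \<in> {0..T}"
    have "q s \<le> A + 1/2 * (M * exp (l * s))" by (rule s[OF M0 qM sT])
    then have "q s * exp (- (l * s)) \<le> (A + 1/2 * (M * exp (l * s))) * exp (- (l * s))" by (rule mult_right_mono) simp
    also have "\<dots> = A * exp (- (l * s)) + 1/2 * M" by (simp add: exp_minus field_simps)
    also have "\<dots> \<le> A * 1 + 1/2 * M" using A l sT by (intro add_right_mono mult_left_mono) auto
    finally show "q s * exp (- (l * s)) \<le> A + 1/2 * (SUP s\<in>{0..T}. q s * exp (- (l * s)))" by (simp add: M_def)
  qed
  then have "M \<le> 2 * A" by simp
  then have "M * exp (l * t) \<le> 2 * A * exp (l * t)" by (intro mult_right_mono) auto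
  then show ?thesis using qM[OF t] by linarith
qed

lemma L1_fdn_scale: "L1_norm ((fd k ^^ j) (\<lambda>x. c * f x)) = \<bar>c\<bar> * L1_norm ((fd k ^^ j) f)"
proof -
  have "(fd k ^^ j) (\<lambda>x. c * f x) = (\<lambda>x. c * (fd k ^^ j) f x)"
  proof (induct j)
    case (Suc j) then show ?case by (auto simp: fd_def right_diff_distrib)
  qed simp
  then show ?thesis by (simp add: L1_norm_scale)
qed

text \<open>One constant for all clocks \<open>\<theta>\<close> and all coefficients
  \<open>c\<close>: the exact solution, the truncated equation and the splitting are instances. It
  depends on \<open>T\<close> and \<open>R\<close> alone, since the weight, and with it the constant
  \<open>2 * exp (l * T)\<close>, is chosen from them.\<close>

lemma duhamel_regularity:
  assumes T: "T > 0" and R: "R \<ge> 0"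
  shows "\<exists>C\<ge>1. \<forall>u0 \<theta> c z. u0 \<in> L2 \<longrightarrow> (\<forall>s\<in>{0..T}. 0 \<le> c s \<and> c s \<le> 1 \<and> L2_norm (z s) \<le> R \<and> duhamel u0 \<theta> (\<lambda>s x. c s * (z s x)\<^sup>2) s (\<theta> s) (z s)) \<longrightarrow>
    (\<forall>t\<in>{0..T}. \<forall>j\<in>{1,2}. \<forall>k. L2_norm ((fd k ^^ j) (z t)) \<le> C * L2_norm ((fd k ^^ j) u0))"
proof -
  \<comment> \<open>The forcing costs a factor \<open>4 * R\<close> in \<open>fd_square_L1\<close>;
    this \<open>\<epsilon>\<close> compensates it, and the factor 1/2 of the equation remains to
    absorb half of the supremum.\<close>
  define \<epsilon> where "\<epsilon> = 1 / (4 * R + 1)"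
  have e: "\<epsilon> > 0" "\<epsilon> * (4 * R) \<le> 1" using R by (auto simp: \<epsilon>_def field_simps)
  obtain l where l: "l > 0" "small_weight T \<epsilon> l" using small_weight_exists[OF T e(1)] by blast
  have main: "L2_norm ((fd k ^^ j) (z t)) \<le> 2 * exp (l * T) * L2_norm ((fd k ^^ j) u0)"
    if u0: "u0 \<in> L2"
      and z: "\<forall>s\<in>{0..T}. 0 \<le> c s \<and> c s \<le> 1 \<and> L2_norm (z s) \<le> R \<and> duhamel u0 \<theta> (\<lambda>s x. c s * (z s x)\<^sup>2) s (\<theta> s) (z s)"
      and t: "t \<in> {0..T}" and j: "j \<in> {1,2}" for u0 \<theta> z t j k and c :: "real \<Rightarrow> real"
  proof -
    have zL: "z s \<in> L2" if "s \<in> {0..T}" for s using z that by (auto dest: duhamel_L2)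
    have "L2_norm ((fd k ^^ j) (z t)) \<le> 2 * L2_norm ((fd k ^^ j) u0) * exp (l * t)"
    proof (rule gronwall_sup[where T=T and Bd = "2 ^ j * R"])
      show "L2_norm ((fd k ^^ j) (z s)) \<le> 2 ^ j * R" if "s \<in> {0..T}" for s
        using L2_norm_fdn_le[OF zL[OF that], of j k] z that
        by (meson mult_left_mono order_trans zero_le_numeral zero_le_power)
      fix M t assume M: "M \<ge> 0" "\<And>s. s \<in> {0..T} \<Longrightarrow> L2_norm ((fd k ^^ j) (z s)) \<le> M * exp (l * s)" and t: "t \<in> {0..T}"
      have "L2_norm ((fd k ^^ j) (z t)) \<le> L2_norm ((fd k ^^ j) u0) + 1/2 * (\<epsilon> * (4 * R * M) * exp (l * t))"
      proof (rule duhamel_fdn[OF _ u0 l(2) t])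
        show "duhamel u0 \<theta> (\<lambda>s x. c s * (z s x)\<^sup>2) t (\<theta> t) (z t)" using z t by blast
        fix s assume s: "s \<in> {0..t}"
        then have s': "s \<in> {0..T}" using t by auto
        show "integrable lborel (\<lambda>x. c s * (z s x)\<^sup>2)" using L2_integrable_sq[OF zL[OF s']] by simp
        have c: "\<bar>c s\<bar> \<le> 1" using z s' by auto
        have "L1_norm ((fd k ^^ j) (\<lambda>x. c s * (z s x)\<^sup>2)) \<le> 1 * L1_norm ((fd k ^^ j) (\<lambda>x. (z s x)\<^sup>2))"
          unfolding L1_fdn_scale using c by (intro mult_right_mono) auto
        also have "\<dots> \<le> 4 * L2_norm (z s) * L2_norm ((fd k ^^ j) (z s))" using fd_square_L1[OF zL[OF s'] j] by simp
        also have "\<dots> \<le> 4 * R * (M * exp (l * s))" using z s' M R by (intro mult_mono) auto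
        finally show "L1_norm ((fd k ^^ j) (\<lambda>x. c s * (z s x)\<^sup>2)) \<le> 4 * R * M * exp (l * s)" by simp
      qed (use M e R in auto)
      also have "\<epsilon> * (4 * R * M) * exp (l * t) = (\<epsilon> * (4 * R)) * (M * exp (l * t))" by simp
      also have "\<dots> \<le> 1 * (M * exp (l * t))" using e M by (intro mult_right_mono) auto
      finally show "L2_norm ((fd k ^^ j) (z t)) \<le> L2_norm ((fd k ^^ j) u0) + 1/2 * (M * exp (l * t))" by simp
    qed (use l t in auto)
    also have "\<dots> \<le> 2 * L2_norm ((fd k ^^ j) u0) * exp (l * T)" using t l by (intro mult_left_mono) auto
    finally show ?thesis by (simp add: mult_ac)
  qed
  have "1 \<le> exp (l * T)" using l T by simp
  then have "2 * exp (l * T) \<ge> 1" by linarith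
  then show ?thesis using main by blast
qed

section \<open>Energy inequality\<close>

lemma powr_kernel_integral':
  fixes a t :: real
  assumes a: "a > -1" and h: "h \<ge> 0"
  shows "set_integrable lborel {t..t+h} (\<lambda>s. (t + h - s) powr a)" "(LBINT s:{t..t+h}. (t + h - s) powr a) = h powr (a + 1) / (a + 1)"
proof -
  note P = powr_kernel_integral[OF a h]
  have e: "indicator {0..h} (s + - t) *\<^sub>R (h - (s + - t)) powr a = indicator {t..t+h} s *\<^sub>R (t + h - s) powr a"
    for s
    by (auto simp: indicator_def algebra_simps)
  show "set_integrable lborel {t..t+h} (\<lambda>s. (t + h - s) powr a)"
    using P(1) lborel_shift_integrable[of "\<lambda>s. indicator {0..h} s *\<^sub>R (h - s) powr a" "-t"]
    unfolding set_integrable_def e by simp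
  show "(LBINT s:{t..t+h}. (t + h - s) powr a) = h powr (a + 1) / (a + 1)"
    using P(2) lborel_shift[of "\<lambda>s. indicator {0..h} s *\<^sub>R (h - s) powr a" "-t"]
    unfolding set_lebesgue_integral_def e by simp
qed

lemma duhamel_0: assumes d: "duhamel u0 \<theta> f 0 0 v" and u0: "u0 \<in> L2" and b: "b \<in> L2"
  shows "ip b v = ip b u0"
proof -
  have z: "indicator {0..0} s *\<^sub>R W (pk (0 - s) (0 - \<theta> s)) b (f s) = 0" for s :: real
    by (cases "s = 0") (auto simp: pk_0 W_def ip_def sh_def)
  have "ip b v = ip b (Tm (Q 0 0) u0) + 1/2 * (LBINT s:{0..0}. W (pk (0 - s) (0 - \<theta> s)) b (f s))"
    using d b by (simp only: duhamel_def)
  then show ?thesis unfolding set_lebesgue_integral_def z Q_0(3) using u0 by (simp add: Tm_return L2_measurable)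
qed

lemma sqrt_bound:
  fixes a h :: real
  assumes h: "0 \<le> h" "h \<le> 1" and a: "a \<le> 1" shows "sqrt (2 * h) + 2 * (a * h) \<le> 4 * sqrt h"
proof -
  have "sqrt 2 \<le> 2" by (rule real_le_lsqrt) auto
  then have "sqrt (2 * h) \<le> 2 * sqrt h" using h by (simp add: real_sqrt_mult mult_right_mono)
  moreover have "a * h \<le> 1 * h" using a h by (intro mult_right_mono) auto
  moreover have "h \<le> sqrt h" using h by (intro real_le_rsqrt) (simp add: power2_eq_square mult_left_le)
  ultimately show ?thesis by linarith
qed

lemma duhamel_restart_linear:
  assumes u0: "u0 \<in> L2" and a: "0 \<le> a" and t: "0 \<le> t" "0 \<le> h" and b: "b \<in> L2"
    and d: "duhamel u0 (\<lambda>s. a * s) f t (a * t) v" "duhamel u0 (\<lambda>s. a * s) f (t + h) (a * (t + h)) v'"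
  shows "ip b v' = ip b (Tm (Q h (a * h)) v) + 1/2 * (LBINT s:{t..t+h}. W (pk (t + h - s) (a * (t + h - s))) b (f s))"
proof -
  have d2: "duhamel u0 (\<lambda>s. a * s) f (t + h) (a * t + a * h) v'" using d(2) by (simp add: distrib_left)
  have th: "a * s \<le> a * t" if "s \<in> {0..t}" for s using that a by (intro mult_left_mono) auto
  have p: "0 \<le> a * t" "0 \<le> a * h" using a t by auto
  have e: "a * t + a * h - a * s = a * (t + h - s)" for s by (simp add: algebra_simps)
  show ?thesis using duhamel_restart[OF d(1) d2 u0 t(1) th p(1) t(2) p(2) b] unfolding e .
qed

text \<open>Restart at \<open>t\<close>: the linear propagator over \<open>h\<close> moves
  \<open>v\<close> by its first moment times \<open>B\<close>, of order \<open>sqrt h\<close>, and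
  the integrated forcing with singularity \<open>-1/4\<close> contributes
  \<open>h powr (3/4)\<close>, which is at most \<open>sqrt h\<close>. The coefficient
  \<open>2/3\<close> is \<open>1/2 * 4/3\<close>.\<close>

lemma duhamel_holder:
  assumes u0: "u0 \<in> L2" and a: "0 \<le> a" "a \<le> 1" and t: "0 \<le> t" "0 \<le> h" "h \<le> 1"
    and d: "duhamel u0 (\<lambda>s. a * s) f t (a * t) v" "duhamel u0 (\<lambda>s. a * s) f (t + h) (a * (t + h)) v'"
    and vB: "\<And>k. L2_norm (fd k v) \<le> \<bar>k\<bar> * B" and B: "B \<ge> 0"
    and f: "\<And>s. s \<in> {t..t+h} \<Longrightarrow> integrable lborel (f s)"
    and fB: "\<And>s k. s \<in> {t..t+h} \<Longrightarrow> L1_norm (fd k (f s)) \<le> \<bar>k\<bar> * B1"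
    and B1: "B1 \<ge> 0"
  shows "L2_norm (\<lambda>x. v' x - v x) \<le> (4 * B + 2/3 * B1) * sqrt h"
proof (rule L2_norm_le_dual)
  interpret q: real_distribution "Q h (a * h)" by (rule rd_Q)
  note L = d[THEN duhamel_L2]
  show "(\<lambda>x. v' x - v x) \<in> L2" using L by (intro L2_diff)
  show "0 \<le> (4 * B + 2/3 * B1) * sqrt h" using B B1 t by simp
  fix b assume b: "b \<in> L2"
  let ?I = "LBINT s:{t..t+h}. W (pk (t + h - s) (a * (t + h - s))) b (f s)"
  have e: "ip b (\<lambda>x. v' x - v x) = ip b (\<lambda>x. Tm (Q h (a * h)) v x - v x) + 1/2 * ?I"
    using duhamel_restart_linear[OF u0 a(1) t(1,2) b d] L b by (simp add: ip_diff_right q.L2_Tm)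
  have 1: "\<bar>ip b (\<lambda>x. Tm (Q h (a * h)) v x - v x)\<bar> \<le> L2_norm b * (4 * sqrt h * B)"
  proof -
    have "L2_norm (\<lambda>x. Tm (Q h (a * h)) v x - v x) \<le> (sqrt (2 * h) + 2 * (a * h)) * B"
      using Q_moment[of h "a * h"] t a by (intro q.Tm_near L(1) vB B) auto
    also have "\<dots> \<le> (4 * sqrt h) * B" using sqrt_bound[OF t(2,3) a(2)] B by (rule mult_right_mono)
    finally have "L2_norm b * L2_norm (\<lambda>x. Tm (Q h (a * h)) v x - v x) \<le> L2_norm b * (4 * sqrt h * B)"
      by (rule mult_left_mono) simp
    then show ?thesis
      using ip_CS[OF b L2_diff[OF q.L2_Tm(1)[OF L(1)] L(1)]] by (rule order_trans[rotated])
  qed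
  have 2: "\<bar>?I\<bar> \<le> (4/3) * sqrt h * (L2_norm b * B1)"
  proof -
    have "\<bar>?I\<bar> \<le> (LBINT s:{t..t+h}. (t + h - s) powr (-1/4) * (L2_norm b * B1))"
    proof (rule set_integral_abs_le)
      show "set_integrable lborel {t..t + h} (\<lambda>s. (t + h - s) powr (- 1 / 4) * (L2_norm b * B1))"
        using powr_kernel_integral'(1)[of "-1/4" h t] t by (intro set_integrable_mult_left) auto
      fix s assume s: "s \<in> {t..t+h}"
      show "\<bar>W (pk (t + h - s) (a * (t + h - s))) b (f s)\<bar> \<le> (t + h - s) powr (-1/4) * (L2_norm b * B1)"
      proof (cases "s = t + h")
        case True then show ?thesis by (simp add: pk_0 W_def ip_def sh_def)
      next
        case False
        then have "t + h - s > 0" using s by auto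
        from W_pk_bound_smooth[OF this b f[OF s] fB[OF s] B1] show ?thesis by (simp only: mult.assoc)
      qed
    qed
    also have "\<dots> = (LBINT s:{t..t+h}. (t + h - s) powr (-1/4)) * (L2_norm b * B1)" by (rule set_integral_mult_left)
    also have "(LBINT s:{t..t+h}. (t + h - s) powr (-1/4)) = (4/3) * h powr (3/4)"
      using powr_kernel_integral'(2)[of "-1/4" h t] t by simp
    also have "(4/3) * h powr (3/4) * (L2_norm b * B1) \<le> (4/3) * sqrt h * (L2_norm b * B1)"
    proof (rule mult_right_mono)
      have "h powr (3/4) \<le> h powr (1/2)" using t by (intro powr_mono') auto
      then show "(4/3) * h powr (3/4) \<le> (4/3) * sqrt h" using t by (simp add: powr_half_sqrt)
    qed (use B1 in simp)
    finally show ?thesis .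
  qed
  have "\<bar>ip b (\<lambda>x. v' x - v x)\<bar> \<le> L2_norm b * (4 * sqrt h * B) + 1/2 * ((4/3) * sqrt h * (L2_norm b * B1))"
    using 1 2 unfolding e by linarith
  then show "\<bar>ip b (\<lambda>x. v' x - v x)\<bar> \<le> (4 * B + 2/3 * B1) * sqrt h * L2_norm b"
    by (simp add: algebra_simps)
qed

text \<open>\<open>a\<close> is the speed of the transport clock relative to the heat clock, and
  \<open>c\<close> the coefficient that a truncation puts before the square.\<close>

locale duhamel_path =
  fixes u0 :: "real \<Rightarrow> real" and a T R B :: real and c :: "real \<Rightarrow> real"
    and w :: "real \<Rightarrow> real \<Rightarrow> real"
  assumes u0: "u0 \<in> L2" and a: "0 \<le> a" "a \<le> 1" and R: "R \<ge> 0" and B: "B \<ge> 0"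
    and c: "\<And>s. s \<in> {0..T} \<Longrightarrow> 0 \<le> c s \<and> c s \<le> 1"
    and wR: "\<And>s. s \<in> {0..T} \<Longrightarrow> L2_norm (w s) \<le> R"
    and wB: "\<And>s k. s \<in> {0..T} \<Longrightarrow> L2_norm (fd k (w s)) \<le> \<bar>k\<bar> * B"
    and w: "\<And>s. s \<in> {0..T} \<Longrightarrow> duhamel u0 (\<lambda>s. a * s) (\<lambda>s x. c s * (w s x)\<^sup>2) s (a * s) (w s)"
begin

lemma wL: "s \<in> {0..T} \<Longrightarrow> w s \<in> L2" using w by (auto dest: duhamel_L2)

lemma restart:
  assumes t: "0 \<le> t" "0 \<le> h" "t + h \<le> T" and b: "b \<in> L2"
  shows "ip b (w (t + h)) = ip b (Tm (Q h (a * h)) (w t)) + 1/2 * (LBINT s:{t..t+h}. W (pk (t + h - s) (a * (t + h - s))) b (\<lambda>x. c s * (w s x)\<^sup>2))"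
  by (rule duhamel_restart_linear[OF u0 a(1) t(1,2) b w w]) (use t in auto)

lemma forcing: assumes s: "s \<in> {0..T}"
  shows "integrable lborel (\<lambda>x. c s * (w s x)\<^sup>2)" "L1_norm (fd k (\<lambda>x. c s * (w s x)\<^sup>2)) \<le> \<bar>k\<bar> * (4 * R * B)"
proof -
  show "integrable lborel (\<lambda>x. c s * (w s x)\<^sup>2)" using L2_integrable_sq[OF wL[OF s]] by simp
  have cs: "\<bar>c s\<bar> \<le> 1" using c[OF s] by auto
  have "L1_norm (fd k (\<lambda>x. c s * (w s x)\<^sup>2)) = \<bar>c s\<bar> * L1_norm (fd k (\<lambda>x. (w s x)\<^sup>2))"
    using L1_fdn_scale[where j=1] by simp
  also have "\<dots> \<le> 1 * (4 * L2_norm (w s) * L2_norm (fd k (w s)))"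
    using cs fd_square_L1[OF wL[OF s], of 1 k] by (intro mult_mono) auto
  also have "\<dots> \<le> 1 * (4 * R * (\<bar>k\<bar> * B))" using wR[OF s] wB[OF s, of k] R by (intro mult_mono) auto
  finally show "L1_norm (fd k (\<lambda>x. c s * (w s x)\<^sup>2)) \<le> \<bar>k\<bar> * (4 * R * B)" by (simp add: mult_ac)
qed

definition Hc :: real where "Hc = (4 + 3 * R) * B"

lemma Hc_nonneg: "Hc \<ge> 0" using R B by (simp add: Hc_def)

lemma holder:
  assumes t: "0 \<le> t" "0 \<le> h" "t + h \<le> T" "h \<le> 1"
  shows "L2_norm (\<lambda>x. w (t + h) x - w t x) \<le> Hc * sqrt h"
proof -
  have "L2_norm (\<lambda>x. w (t + h) x - w t x) \<le> (4 * B + 2/3 * (4 * R * B)) * sqrt h"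
    by (rule duhamel_holder[OF u0 a t(1,2,4) w w wB B]) (use t forcing R B in auto)
  also have "\<dots> \<le> Hc * sqrt h"
  proof (rule mult_right_mono)
    have "0 \<le> R * B" using R B by simp
    moreover have "Hc = 4 * B + 3 * (R * B)" by (simp add: Hc_def algebra_simps)
    moreover have "2/3 * (4 * R * B) = 8/3 * (R * B)" by simp
    ultimately show "4 * B + 2/3 * (4 * R * B) \<le> Hc" by linarith
  qed (use t in simp)
  finally show ?thesis .
qed

text \<open>Twice the factor before \<open>sqrt h\<close> in the energy estimate; the 2 bounds the
  \<open>4/3\<close> that comes from integrating the power \<open>-1/4\<close>.\<close>

definition Dc :: real where "Dc = 4 * R * B * (Hc + 4 * B)"

text \<open>The restart formula is tested with \<open>w (t + h)\<close> itself. The linear part is a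
  contraction and is split by the arithmetic-geometric mean; in the nonlinear part every
  \<open>w s\<close> is within order \<open>sqrt h\<close> of the test function by
  \<open>holder\<close>, so \<open>W_pk_energy\<close> yields \<open>sqrt h\<close> times an
  integral of order \<open>h powr (3/4)\<close>. The total exponent exceeds 1, which is what
  \<open>energy\<close> lives on.\<close>

lemma energy_step:
  assumes t: "0 \<le> t" "0 \<le> h" "t + h \<le> T" "h \<le> 1"
  shows "(L2_norm (w (t + h)))\<^sup>2 \<le> (L2_norm (w t))\<^sup>2 + Dc * h powr (5/4)"
proof -
  interpret q: real_distribution "Q h (a * h)" by (rule rd_Q)
  have tT: "t \<in> {0..T}" "t + h \<in> {0..T}" using t by auto
  note L = wL[OF tT(1)] wL[OF tT(2)]
  let ?b = "w (t + h)"
  let ?I = "LBINT s:{t..t+h}. W (pk (t + h - s) (a * (t + h - s))) ?b (\<lambda>x. c s * (w s x)\<^sup>2)"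
  define Z where "Z = B * (2 * R) * ((Hc + 4 * B) * sqrt h)"
  have Z0: "Z \<ge> 0" using B R Hc_nonneg t by (simp add: Z_def)
  have I: "\<bar>?I\<bar> \<le> Dc * h powr (5/4)"
  proof -
    have "\<bar>?I\<bar> \<le> (LBINT s:{t..t+h}. (t + h - s) powr (-1/4) * Z)"
    proof (rule set_integral_abs_le)
      show "set_integrable lborel {t..t + h} (\<lambda>s. (t + h - s) powr (- 1 / 4) * Z)"
        using powr_kernel_integral'(1)[of "-1/4" h t] t by (intro set_integrable_mult_left) auto
      fix s assume s: "s \<in> {t..t+h}"
      then have sT: "s \<in> {0..T}" using t by auto
      let ?\<tau> = "t + h - s"
      show "\<bar>W (pk ?\<tau> (a * ?\<tau>)) ?b (\<lambda>x. c s * (w s x)\<^sup>2)\<bar> \<le> ?\<tau> powr (-1/4) * Z"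
      proof (cases "s = t + h")
        case True then show ?thesis by (simp add: pk_0 W_def ip_def sh_def)
      next
        case False
        then have tau: "?\<tau> > 0" "?\<tau> \<le> h" "?\<tau> \<le> 1" using s t by auto
        have at: "a * ?\<tau> \<ge> 0" using a tau by simp
        have "L2_norm (\<lambda>x. w s x - ?b x) \<le> Hc * sqrt ?\<tau>"
          using holder[of s ?\<tau>] s t sT tau by (subst L2_norm_diff_commute) simp
        also have "\<dots> \<le> Hc * sqrt h" using tau Hc_nonneg by (intro mult_left_mono) auto
        finally have h1: "L2_norm (\<lambda>x. w s x - ?b x) \<le> Hc * sqrt h" .
        have "(sqrt (2 * ?\<tau>) + 2 * (a * ?\<tau>)) * B \<le> (4 * sqrt ?\<tau>) * B"
          using tau B by (intro mult_right_mono sqrt_bound a) auto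
        also have "\<dots> \<le> (4 * sqrt h) * B" using tau B by (intro mult_right_mono) auto
        finally have h2: "(sqrt (2 * ?\<tau>) + 2 * (a * ?\<tau>)) * B \<le> 4 * sqrt h * B" .
        have "\<bar>W (pk ?\<tau> (a * ?\<tau>)) ?b (\<lambda>x. c s * (w s x)\<^sup>2)\<bar> = \<bar>c s\<bar> * \<bar>W (pk ?\<tau> (a * ?\<tau>)) ?b (\<lambda>x. (w s x)\<^sup>2)\<bar>"
          by (simp add: W_scale_f abs_mult)
        also have "\<dots> \<le> 1 * \<bar>W (pk ?\<tau> (a * ?\<tau>)) ?b (\<lambda>x. (w s x)\<^sup>2)\<bar>"
          using c[OF sT] by (intro mult_right_mono) auto
        also have "\<dots> \<le> 1 * (?\<tau> powr (-1/4) * B * (L2_norm (w s) + L2_norm ?b) * (L2_norm (\<lambda>x. w s x - ?b x) + (sqrt (2 * ?\<tau>) + 2 * (a * ?\<tau>)) * B))"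
          by (rule mult_left_mono[OF W_pk_energy[OF tau(1) at L(2) wB[OF tT(2)] B wL[OF sT] wB[OF sT] B]]) simp
        also have "\<dots> \<le> 1 * (?\<tau> powr (-1/4) * B * (R + R) * (Hc * sqrt h + 4 * sqrt h * B))"
        proof (rule mult_left_mono, rule mult_mono)
          show "?\<tau> powr (-1/4) * B * (L2_norm (w s) + L2_norm ?b) \<le> ?\<tau> powr (-1/4) * B * (R + R)"
            using wR[OF sT] wR[OF tT(2)] B by (intro mult_left_mono add_mono) auto
          show "L2_norm (\<lambda>x. w s x - ?b x) + (sqrt (2 * ?\<tau>) + 2 * (a * ?\<tau>)) * B \<le> Hc * sqrt h + 4 * sqrt h * B"
            using h1 h2 by linarith
          show "0 \<le> L2_norm (\<lambda>x. w s x - ?b x) + (sqrt (2 * ?\<tau>) + 2 * (a * ?\<tau>)) * B"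
          proof -
            have "0 \<le> sqrt (2 * ?\<tau>)" using tau by simp
            then have z: "0 \<le> sqrt (2 * ?\<tau>) + 2 * (a * ?\<tau>)" using at by linarith
            show ?thesis by (rule add_nonneg_nonneg[OF L2_norm_nonneg mult_nonneg_nonneg[OF z B]])
          qed
        qed (use B R in auto)
        also have "\<dots> = ?\<tau> powr (-1/4) * Z" by (simp add: Z_def algebra_simps)
        finally show ?thesis .
      qed
    qed
    also have "\<dots> = (LBINT s:{t..t+h}. (t + h - s) powr (-1/4)) * Z" by (rule set_integral_mult_left)
    also have "(LBINT s:{t..t+h}. (t + h - s) powr (-1/4)) = (4/3) * h powr (3/4)"
      using powr_kernel_integral'(2)[of "-1/4" h t] t by simp
    also have "(4/3) * h powr (3/4) * Z \<le> 2 * h powr (3/4) * Z" using Z0 by (intro mult_right_mono) auto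
    also have "\<dots> = Dc * (h powr (3/4) * h powr (1/2))" using t by (simp add: Dc_def Z_def powr_half_sqrt)
    also have "h powr (3/4) * h powr (1/2) = h powr (5/4)" by (simp add: powr_add[symmetric])
    finally show ?thesis .
  qed
  have "(L2_norm ?b)\<^sup>2 = ip ?b (Tm (Q h (a * h)) (w t)) + 1/2 * ?I"
    unfolding L2_norm_sq_ip by (rule restart[OF t(1-3) L(2)])
  also have "ip ?b (Tm (Q h (a * h)) (w t)) \<le> L2_norm ?b * L2_norm (w t)"
  proof -
    have "ip ?b (Tm (Q h (a * h)) (w t)) \<le> L2_norm ?b * L2_norm (Tm (Q h (a * h)) (w t))"
      using ip_CS[OF L(2) q.L2_Tm(1)[OF L(1)]] by linarith
    also have "\<dots> \<le> L2_norm ?b * L2_norm (w t)" by (intro mult_left_mono q.L2_Tm L) auto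
    finally show ?thesis .
  qed
  also have "L2_norm ?b * L2_norm (w t) \<le> 1/2 * (L2_norm ?b)\<^sup>2 + 1/2 * (L2_norm (w t))\<^sup>2"
    using sum_squares_bound[of "L2_norm ?b" "L2_norm (w t)"] by simp
  finally show ?thesis using I by linarith
qed

text \<open>Over \<open>n\<close> steps of length \<open>t / n\<close> the total error is of order
  \<open>n powr (-1/4)\<close> and vanishes in the limit.\<close>

lemma energy:
  assumes t: "t \<in> {0..T}"
  shows "L2_norm (w t) \<le> L2_norm u0"
proof -
  have T0: "0 \<in> {0..T}" using t by auto
  have w0: "L2_norm (w 0) \<le> L2_norm u0"
  proof (rule L2_norm_le_dual[OF wL[OF T0]])
    fix b assume b: "b \<in> L2"
    have "ip b (w 0) = ip b u0"
      using duhamel_0[OF _ u0 b] w[OF T0] by simp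
    then show "\<bar>ip b (w 0)\<bar> \<le> L2_norm u0 * L2_norm b" using ip_CS[OF b u0] by (simp add: mult.commute)
  qed simp
  have step: "(L2_norm (w t))\<^sup>2 \<le> (L2_norm u0)\<^sup>2 + Dc * (t powr (5/4) * real n powr (-1/4))"
    if n: "n \<ge> 1" "t \<le> real n" for n
  proof -
    define h where "h = t / real n"
    have h: "0 \<le> h" "h \<le> 1" "real n * h = t" using n t by (auto simp: h_def)
    have "(L2_norm (w (real i * h)))\<^sup>2 \<le> (L2_norm u0)\<^sup>2 + real i * (Dc * h powr (5/4))" if "i \<le> n" for i
      using that
    proof (induct i)
      case 0 then show ?case using w0 by (simp add: power_mono)
    next
      case (Suc i)
      have "real (Suc i) * h \<le> real n * h" using Suc(2) h by (intro mult_right_mono) auto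
      then have "real i * h + h \<le> T" using h(3) t by (simp add: algebra_simps)
      then have "(L2_norm (w (real i * h + h)))\<^sup>2 \<le> (L2_norm (w (real i * h)))\<^sup>2 + Dc * h powr (5/4)"
        using h by (intro energy_step) auto
      then show ?case using Suc by (simp add: algebra_simps)
    qed
    from this[of n] have "(L2_norm (w t))\<^sup>2 \<le> (L2_norm u0)\<^sup>2 + Dc * (real n * h powr (5/4))"
      using h by (simp add: mult_ac)
    also have "real n * h powr (5/4) = t powr (5/4) * real n powr (-1/4)"
    proof -
      have p1: "h powr (5/4) = t powr (5/4) / real n powr (5/4)" unfolding h_def using t n by (simp add: powr_divide)
      have p2: "real n * (1 / real n powr (5/4)) = real n powr (-1/4)"
      proof -
        have "real n powr (-1/4) = real n powr (1 + -(5/4))" by simp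
        also have "\<dots> = real n powr 1 * real n powr (-(5/4))" by (rule powr_add)
        also have "\<dots> = real n * (1 / real n powr (5/4))" using n by (simp only: powr_minus_divide powr_one)
        finally show ?thesis by (rule sym)
      qed
      show ?thesis unfolding p1 p2[symmetric] by simp
    qed
    finally show ?thesis .
  qed
  have "(\<lambda>n. real n powr (-1/4)) \<longlonglongrightarrow> 0"
    by (rule tendsto_neg_powr[OF _ filterlim_real_sequentially]) simp
  then have lim: "(\<lambda>n. (L2_norm u0)\<^sup>2 + Dc * (t powr (5/4) * real n powr (-1/4))) \<longlonglongrightarrow> (L2_norm u0)\<^sup>2 + Dc * (t powr (5/4) * 0)"
    by (intro tendsto_intros)
  obtain N where N: "t \<le> real N" using real_arch_simple by blast
  have "(L2_norm (w t))\<^sup>2 \<le> (L2_norm u0)\<^sup>2 + Dc * (t powr (5/4) * 0)"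
  proof (rule tendsto_lowerbound[OF lim])
    show "\<forall>\<^sub>F n in sequentially. (L2_norm (w t))\<^sup>2 \<le> (L2_norm u0)\<^sup>2 + Dc * (t powr (5/4) * real n powr (-1/4))"
    proof (rule eventually_sequentiallyI[of "max N 1"])
      fix n assume "max N 1 \<le> n"
      then have "n \<ge> 1" "real N \<le> real n" by auto
      then show "(L2_norm (w t))\<^sup>2 \<le> (L2_norm u0)\<^sup>2 + Dc * (t powr (5/4) * real n powr (-1/4))"
        using N by (intro step) auto
    qed
  qed simp
  then have "(L2_norm (w t))\<^sup>2 \<le> (L2_norm u0)\<^sup>2" by simp
  then show ?thesis by (rule power2_le_imp_le) simp
qed

end

section \<open>Mild solutions satisfy the weak Duhamel formula\<close>

text \<open>Converse of Cauchy-Schwarz for a function not yet known to lie in \<open>L2\<close>: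
  test with its truncations \<open>h n\<close> in domain and range, then apply Fatou. It gives
  square integrability of the Duhamel integral, which is defined only pointwise.\<close>

lemma L2_from_dual:
  assumes [measurable]: "g \<in> borel_measurable borel" and C: "C \<ge> 0"
    and b: "\<And>b. b \<in> L2 \<Longrightarrow> (\<integral>\<^sup>+x. ennreal \<bar>b x * g x\<bar> \<partial>lborel) \<le> ennreal (C * L2_norm b)"
  shows "g \<in> L2" "L2_norm g \<le> C"
proof -
  define h where "h n x = (if \<bar>x\<bar> \<le> real n \<and> \<bar>g x\<bar> \<le> real n then g x else 0)" for n x
  have [measurable]: "h n \<in> borel_measurable borel" for n unfolding h_def[abs_def] by measurable
  have hL: "h n \<in> L2" for n
  proof (rule L2I)
    show "integrable lborel (\<lambda>x. (h n x)\<^sup>2)"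
    proof (rule Bochner_Integration.integrable_bound[of lborel "\<lambda>x. indicator {- real n..real n} x *\<^sub>R (real n)\<^sup>2"])
      show "integrable lborel (\<lambda>x. indicator {- real n..real n} x *\<^sub>R (real n)\<^sup>2)"
        by (rule integrable_indicator) auto
      have "\<bar>g x\<bar> \<le> real n \<Longrightarrow> (g x)\<^sup>2 \<le> (real n)\<^sup>2" for x
        using power_mono[of "\<bar>g x\<bar>" "real n" 2] by simp
      then show "AE x in lborel. norm ((h n x)\<^sup>2) \<le> norm (indicator {- real n..real n} x *\<^sub>R (real n)\<^sup>2)"
        by (auto simp: h_def indicator_def)
    qed simp
  qed simp
  have hn: "L2_norm (h n) \<le> C" for n
  proof -
    have "ennreal ((L2_norm (h n))\<^sup>2) = (\<integral>\<^sup>+x. ennreal \<bar>h n x * g x\<bar> \<partial>lborel)"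
      unfolding nn_integral_L2[OF hL, symmetric]
      by (intro nn_integral_cong) (auto simp: h_def power2_eq_square)
    also have "\<dots> \<le> ennreal (C * L2_norm (h n))" by (rule b[OF hL])
    finally have "L2_norm (h n) * L2_norm (h n) \<le> C * L2_norm (h n)" using C by (simp add: power2_eq_square)
    then show ?thesis using C L2_norm_nonneg[of "h n"] by (cases "L2_norm (h n) = 0") (auto simp: less_le)
  qed
  have "(\<integral>\<^sup>+x. ennreal ((g x)\<^sup>2) \<partial>lborel) = (\<integral>\<^sup>+x. liminf (\<lambda>n. ennreal ((h n x)\<^sup>2)) \<partial>lborel)"
  proof (rule nn_integral_cong)
    fix x
    obtain N where N: "max \<bar>x\<bar> \<bar>g x\<bar> \<le> real N" using real_arch_simple by blast
    have "(\<lambda>n. ennreal ((h n x)\<^sup>2)) \<longlonglongrightarrow> ennreal ((g x)\<^sup>2)"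
      by (rule tendsto_eventually, rule eventually_sequentiallyI[of N]) (use N in \<open>auto simp: h_def\<close>)
    then show "ennreal ((g x)\<^sup>2) = liminf (\<lambda>n. ennreal ((h n x)\<^sup>2))"
      by (intro lim_imp_Liminf[symmetric]) auto
  qed
  also have "\<dots> \<le> liminf (\<lambda>n. \<integral>\<^sup>+x. ennreal ((h n x)\<^sup>2) \<partial>lborel)"
    by (rule nn_integral_liminf) simp
  also have "\<dots> \<le> limsup (\<lambda>n. \<integral>\<^sup>+x. ennreal ((h n x)\<^sup>2) \<partial>lborel)"
    by (rule Liminf_le_Limsup) simp
  also have "\<dots> \<le> ennreal (C\<^sup>2)"
    by (rule Limsup_bounded, rule always_eventually) (auto simp: nn_integral_L2[OF hL] intro!: ennreal_leI power_mono hn)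
  finally have "(\<integral>\<^sup>+x. ennreal ((g x)\<^sup>2) \<partial>lborel) \<le> ennreal (C\<^sup>2)" .
  then show "g \<in> L2" "L2_norm g \<le> C" using L2_norm_nn[of g C] C by auto
qed

lemma conv_dual:
  assumes q: "q \<in> L2" and b: "b \<in> L2" and f: "integrable lborel f"
  shows "(\<integral>\<^sup>+x. ennreal \<bar>b x * (LINT y|lborel. q (x - y) * f y)\<bar> \<partial>lborel) \<le> ennreal (L2_norm q * L2_norm b * L1_norm f)"
    and "(LINT x|lborel. b x * (LINT y|lborel. q (x - y) * f y)) = W q b f"
proof -
  have [measurable]: "q \<in> borel_measurable borel" "b \<in> borel_measurable borel" "f \<in> borel_measurable borel"
    using q b f by (auto dest: L2_measurable)
  let ?F = "\<lambda>x y. b x * (q (x - y) * f y)"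
  have n: "(\<integral>\<^sup>+x. (\<integral>\<^sup>+y. ennreal \<bar>?F x y\<bar> \<partial>lborel) \<partial>lborel) \<le> ennreal (L2_norm q * L2_norm b * L1_norm f)"
  proof -
    have "(\<integral>\<^sup>+x. (\<integral>\<^sup>+y. ennreal \<bar>?F x y\<bar> \<partial>lborel) \<partial>lborel) = (\<integral>\<^sup>+y. (\<integral>\<^sup>+x. ennreal \<bar>f y\<bar> * ennreal \<bar>b x * q (x - y)\<bar> \<partial>lborel) \<partial>lborel)"
      by (subst lborel_pair.Fubini'[symmetric]) (auto simp: ennreal_mult'[symmetric] abs_mult mult_ac)
    also have "\<dots> = (\<integral>\<^sup>+y. ennreal \<bar>f y\<bar> * (\<integral>\<^sup>+x. ennreal \<bar>b x * q (x - y)\<bar> \<partial>lborel) \<partial>lborel)"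
      by (intro nn_integral_cong nn_integral_cmult) auto
    also have "\<dots> \<le> (\<integral>\<^sup>+y. ennreal \<bar>f y\<bar> * ennreal (L2_norm b * L2_norm q) \<partial>lborel)"
      by (intro nn_integral_mono mult_left_mono real_distribution.nn_ip_bound[OF rd_return b q]) auto
    also have "\<dots> = (\<integral>\<^sup>+y. ennreal (\<bar>f y\<bar> * (L2_norm b * L2_norm q)) \<partial>lborel)"
      by (intro nn_integral_cong) (simp add: ennreal_mult)
    also have "\<dots> = ennreal (LINT y|lborel. \<bar>f y\<bar> * (L2_norm b * L2_norm q))"
      using f by (intro nn_integral_eq_integral) auto
    also have "(LINT y|lborel. \<bar>f y\<bar> * (L2_norm b * L2_norm q)) = L2_norm q * L2_norm b * L1_norm f"
      by (simp add: L1_norm_def mult_ac)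
    finally show ?thesis .
  qed
  have i: "integrable (lborel \<Otimes>\<^sub>M lborel) (\<lambda>(x, y). ?F x y)"
  proof (rule integrableI_bounded)
    have "(\<integral>\<^sup>+p. ennreal (norm (case p of (x, y) \<Rightarrow> ?F x y)) \<partial>(lborel \<Otimes>\<^sub>M lborel)) = (\<integral>\<^sup>+x. (\<integral>\<^sup>+y. ennreal \<bar>?F x y\<bar> \<partial>lborel) \<partial>lborel)"
      by (subst lborel.nn_integral_fst[symmetric]) (auto simp: split_beta')
    also have "\<dots> < \<infinity>" using n by (rule le_less_trans) simp
    finally show "(\<integral>\<^sup>+p. ennreal (norm (case p of (x, y) \<Rightarrow> ?F x y)) \<partial>(lborel \<Otimes>\<^sub>M lborel)) < \<infinity>" .
  qed simp
  have e: "b x * (LINT y|lborel. q (x - y) * f y) = (LINT y|lborel. ?F x y)" for x by simp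
  have ae: "AE x in lborel. integrable lborel (\<lambda>y. ?F x y)"
    using lborel_pair.AE_integrable_fst'[OF i] by simp
  have "(\<integral>\<^sup>+x. ennreal \<bar>b x * (LINT y|lborel. q (x - y) * f y)\<bar> \<partial>lborel) \<le> (\<integral>\<^sup>+x. (\<integral>\<^sup>+y. ennreal \<bar>?F x y\<bar> \<partial>lborel) \<partial>lborel)"
    unfolding e
  proof (rule nn_integral_mono_AE, use ae in eventually_elim)
    fix x assume i: "integrable lborel (\<lambda>y. ?F x y)"
    show "ennreal \<bar>LINT y|lborel. ?F x y\<bar> \<le> (\<integral>\<^sup>+y. ennreal \<bar>?F x y\<bar> \<partial>lborel)"
      using integral_norm_bound_ennreal[OF i] by simp
  qed
  then show "(\<integral>\<^sup>+x. ennreal \<bar>b x * (LINT y|lborel. q (x - y) * f y)\<bar> \<partial>lborel) \<le> ennreal (L2_norm q * L2_norm b * L1_norm f)"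
    using n by (rule order_trans)
  have "(LINT x|lborel. b x * (LINT y|lborel. q (x - y) * f y)) = (LINT y|lborel. LINT x|lborel. ?F x y)"
    unfolding e by (rule lborel_pair.Fubini_integral[OF i, symmetric])
  also have "\<dots> = W q b f"
    unfolding W_def ip_def sh_def integral_mult_right_zero[symmetric]
    by (intro Bochner_Integration.integral_cong) (auto simp: mult_ac)
  finally show "(LINT x|lborel. b x * (LINT y|lborel. q (x - y) * f y)) = W q b f" .
qed

text \<open>The Duhamel integrand with \<open>X\<close> moved from the forcing into the kernel;
  extended by zero so that Fubini can run over the whole line.\<close>

definition Fk :: "real \<Rightarrow> (real \<Rightarrow> real \<Rightarrow> real) \<Rightarrow> real \<Rightarrow> real \<Rightarrow> real \<Rightarrow> real" where
  "Fk a f t s x = (if 0 \<le> s \<and> s < t then (LINT y|lborel. pk (t - s) (a * (t - s)) (x - y) * f s y) else 0)"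

text \<open>Holds at every \<open>x\<close>: for \<open>s < t\<close> the kernel is bounded, so the
  exchange of averages converges absolutely, and at \<open>s = t\<close> both sides are zero because
  \<open>heat_kernel 0\<close> is.\<close>

lemma conv_eq_Fk:
  assumes a: "a \<ge> 0" and s: "0 \<le> s" "s \<le> t" and f: "integrable lborel (f s)"
  shows "conv (deriv (heat_kernel (t - s))) (X_flow (a * (t - s)) (f s)) x = Fk a f t s x"
proof (cases "s = t")
  case True
  then show ?thesis by (simp add: Fk_def conv_def dG_def[symmetric] dG_0)
next
  case False
  define \<tau> where "\<tau> = t - s"
  have t: "\<tau> > 0" using s False by (simp add: \<tau>_def)
  have at: "a * \<tau> \<ge> 0" using a t by simp
  interpret M: real_distribution "mu (a * \<tau>)" by (rule rd_mu)
  obtain L where L: "\<And>x. \<bar>dG \<tau> x\<bar> \<le> L" using dG_bounds[OF t] by blast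
  note m[measurable] = dG_measurable[OF less_imp_le[OF t]]
  have [measurable]: "f s \<in> borel_measurable borel" using f by auto
  have [measurable]: "Tm (mu (a * \<tau>)) (f s) \<in> borel_measurable borel" by (rule M.Tm_measurable) simp
  note X = X_flow_L1[OF at f]
  note [measurable] = X(1)
  have "conv (dG \<tau>) (X_flow (a * \<tau>) (f s)) x = (LINT y|lborel. dG \<tau> (x - y) * Tm (mu (a * \<tau>)) (f s) y)"
    unfolding conv_def by (rule integral_cong_AE) (use X(2) in auto)
  also have "\<dots> = (LINT y|lborel. f s y * Tm (Tr (mu (a * \<tau>))) (\<lambda>y. dG \<tau> (x - y)) y)"
    by (rule M.Tm_dual_bdd[OF _ L f]) measurable
  also have "\<dots> = (LINT y|lborel. pk \<tau> (a * \<tau>) (x - y) * f s y)"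
  proof (rule Bochner_Integration.integral_cong)
    fix y
    have "Tm (Tr (mu (a * \<tau>))) (\<lambda>y. dG \<tau> (x - y)) y = pk \<tau> (a * \<tau>) (x - y)"
      by (subst M.Tm_Tr) (auto simp: pk_def Tm_def diff_diff_add)
    then show "f s y * Tm (Tr (mu (a * \<tau>))) (\<lambda>y. dG \<tau> (x - y)) y = pk \<tau> (a * \<tau>) (x - y) * f s y"
      by simp
  qed simp
  finally show ?thesis using s False by (simp add: Fk_def \<tau>_def dG_def)
qed

text \<open>Continuity in time from the left, uniform in \<open>x\<close>. For
  \<open>r \<le> s\<close> the distance to \<open>t\<close> is at least \<open>t - s\<close>, so one
  constant from \<open>pk_bounds\<close> serves all \<open>r\<close>; the two terms account for the
  change of kernel and of forcing.\<close>

lemma Fk_near: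
  assumes a: "a \<ge> 0" and s: "0 \<le> s" "s < t" and f: "\<And>s. s \<ge> 0 \<Longrightarrow> integrable lborel (f s)"
  shows "\<exists>L\<ge>0. \<forall>r\<in>{0..s}. \<forall>x. \<bar>Fk a f t r x - Fk a f t s x\<bar> \<le> L * (sqrt (2 * (s - r)) + 2 * (a * (s - r))) * L1_norm (f s) + L * L1_norm (\<lambda>x. f r x - f s x)"
proof -
  have t: "t - s > 0" using s by simp
  obtain L where L0: "L \<ge> 0"
    and LL: "\<forall>\<tau>\<ge>t - s. \<forall>q\<ge>0. (\<forall>x. \<bar>pk \<tau> q x\<bar> \<le> L) \<and>
      (\<forall>h\<ge>0. \<forall>r\<ge>0. \<forall>x. \<bar>pk (\<tau> + h) (q + r) x - pk \<tau> q x\<bar> \<le> L * (sqrt (2 * h) + 2 * r))"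
    using pk_bounds[OF t] by (elim exE conjE)
  have L: "\<bar>pk \<tau> q x\<bar> \<le> L" if "t - s \<le> \<tau>" "0 \<le> q" for \<tau> q x
    using LL[rule_format, OF that] by simp
  have L': "\<bar>pk (\<tau> + h) (q + r) x - pk \<tau> q x\<bar> \<le> L * (sqrt (2 * h) + 2 * r)"
    if "t - s \<le> \<tau>" "0 \<le> q" "h \<ge> 0" "r \<ge> 0" for \<tau> q h r x
    using LL[rule_format, OF that(1,2)] that(3,4) by simp
  have "\<bar>Fk a f t r x - Fk a f t s x\<bar> \<le> L * (sqrt (2 * (s - r)) + 2 * (a * (s - r))) * L1_norm (f s) + L * L1_norm (\<lambda>x. f r x - f s x)"
    if r: "r \<in> {0..s}" for r x
  proof -
    let ?pr = "pk (t - r) (a * (t - r))" and ?ps = "pk (t - s) (a * (t - s))"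
    have r0: "0 \<le> t - r" "0 \<le> t - s" "t - s \<le> t - r" "r \<ge> 0" "r < t" "0 \<le> a * (t - r)" "0 \<le> a * (t - s)" "0 \<le> a * (s - r)"
      using r s a by auto
    note [measurable] = pk_measurable[OF r0(1), of "a * (t - r)"] pk_measurable[OF r0(2), of "a * (t - s)"]
    define m where "m = L * (sqrt (2 * (s - r)) + 2 * (a * (s - r)))"
    have pb: "\<bar>?pr z\<bar> \<le> L" "\<bar>?ps z\<bar> \<le> L" for z using L r0 by auto
    have pd: "\<bar>?pr z - ?ps z\<bar> \<le> m" for z
      using L'[OF order_refl r0(7), of "s - r" "a * (s - r)" z] r r0(8) by (simp add: m_def algebra_simps)
    have fr: "integrable lborel (f r)" "integrable lborel (f s)" using f r0 s by auto
    have frs: "integrable lborel (\<lambda>x. f r x - f s x)" using fr by simp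
    have i1: "integrable lborel (\<lambda>y. f r y * ?pr (x - y))"
      by (rule L1_bdd_integrable(1)[OF fr(1) _ pb(1)]) measurable
    have i2: "integrable lborel (\<lambda>y. f s y * ?ps (x - y))"
      by (rule L1_bdd_integrable(1)[OF fr(2) _ pb(2)]) measurable
    have j1: "integrable lborel (\<lambda>y. (f r y - f s y) * ?pr (x - y))" "(LINT y|lborel. \<bar>(f r y - f s y) * ?pr (x - y)\<bar>) \<le> L1_norm (\<lambda>x. f r x - f s x) * L"
      by (rule L1_bdd_integrable[OF frs _ pb(1)], measurable)+
    have j2: "integrable lborel (\<lambda>y. f s y * (?pr (x - y) - ?ps (x - y)))" "(LINT y|lborel. \<bar>f s y * (?pr (x - y) - ?ps (x - y))\<bar>) \<le> L1_norm (f s) * m"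
      by (rule L1_bdd_integrable[OF fr(2) _ pd], measurable)+
    have "Fk a f t r x - Fk a f t s x = (LINT y|lborel. f r y * ?pr (x - y)) - (LINT y|lborel. f s y * ?ps (x - y))"
      using r0 s by (simp add: Fk_def mult.commute)
    also have "\<dots> = (LINT y|lborel. (f r y - f s y) * ?pr (x - y) + f s y * (?pr (x - y) - ?ps (x - y)))"
      unfolding Bochner_Integration.integral_diff[OF i1 i2, symmetric]
      by (rule Bochner_Integration.integral_cong) (auto simp: algebra_simps)
    also have "\<dots> = (LINT y|lborel. (f r y - f s y) * ?pr (x - y)) + (LINT y|lborel. f s y * (?pr (x - y) - ?ps (x - y)))"
      by (rule Bochner_Integration.integral_add[OF j1(1) j2(1)])
    finally have "\<bar>Fk a f t r x - Fk a f t s x\<bar> \<le> L1_norm (\<lambda>x. f r x - f s x) * L + L1_norm (f s) * m"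
      using j1(2) j2(2) integral_abs_bound[of lborel "\<lambda>y. (f r y - f s y) * ?pr (x - y)"]
        integral_abs_bound[of lborel "\<lambda>y. f s y * (?pr (x - y) - ?ps (x - y))"] by linarith
    then show ?thesis by (simp add: m_def mult_ac add.commute)
  qed
  then show ?thesis using L0 by blast
qed

lemma floor_approx:
  fixes s :: real assumes "s \<ge> 0"
  shows "0 \<le> real_of_int \<lfloor>s * real (Suc n)\<rfloor> / real (Suc n)" "real_of_int \<lfloor>s * real (Suc n)\<rfloor> / real (Suc n) \<le> s"
    "s - 1 / real (Suc n) \<le> real_of_int \<lfloor>s * real (Suc n)\<rfloor> / real (Suc n)"
proof -
  have n: "real (Suc n) > 0" by simp
  show "0 \<le> real_of_int \<lfloor>s * real (Suc n)\<rfloor> / real (Suc n)" using assms by simp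
  show "real_of_int \<lfloor>s * real (Suc n)\<rfloor> / real (Suc n) \<le> s" using n
    by (simp only: pos_divide_le_eq) linarith
  have "s * real (Suc n) - 1 \<le> real_of_int \<lfloor>s * real (Suc n)\<rfloor>" by linarith
  then have "(s * real (Suc n) - 1) / real (Suc n) \<le> real_of_int \<lfloor>s * real (Suc n)\<rfloor> / real (Suc n)"
    by (rule divide_right_mono) simp
  then show "s - 1 / real (Suc n) \<le> real_of_int \<lfloor>s * real (Suc n)\<rfloor> / real (Suc n)" using n
    by (simp add: diff_divide_distrib del: of_nat_Suc)
qed

text \<open>The mild formulation is a family of pointwise integrals, so joint measurability has to
  be produced. Rounding \<open>s\<close> down to a grid gives countably many slices, each measurable
  in \<open>x\<close>, and \<open>Fk_near\<close> gives their pointwise limit.\<close>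

lemma Fk_measurable:
  assumes a: "a \<ge> 0" and f: "\<And>s. s \<ge> 0 \<Longrightarrow> integrable lborel (f s)"
    and c: "\<And>s. s \<ge> 0 \<Longrightarrow> ((\<lambda>r. L1_norm (\<lambda>x. f r x - f s x)) \<longlongrightarrow> 0) (at s within {0..})"
  shows "(\<lambda>p. Fk a f t (fst p) (snd p)) \<in> borel_measurable (borel \<Otimes>\<^sub>M borel)"
proof -
  have m1: "(\<lambda>x. Fk a f t r x) \<in> borel_measurable borel" for r
  proof (cases "0 \<le> r \<and> r < t")
    case True
    have [measurable]: "f r \<in> borel_measurable borel" using f[of r] True by auto
    have [measurable]: "pk (t - r) (a * (t - r)) \<in> borel_measurable borel" using True by (intro pk_measurable) auto
    show ?thesis using True unfolding Fk_def by simp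
  next
    case False then show ?thesis by (auto simp: Fk_def)
  qed
  define F where "F n p = (if 0 \<le> fst p \<and> fst p < t then Fk a f t (real_of_int \<lfloor>fst p * real (Suc n)\<rfloor> / real (Suc n)) (snd p) else 0)" for n and p :: "real \<times> real"
  have Fm: "F n \<in> borel_measurable (borel \<Otimes>\<^sub>M borel)" for n
  proof -
    have [measurable]: "(\<lambda>p::real \<times> real. Fk a f t (real_of_int i / real (Suc n)) (snd p)) \<in> borel_measurable (borel \<Otimes>\<^sub>M borel)" for i
      using measurable_compose[OF measurable_snd m1] by simp
    have g: "(\<lambda>p::real \<times> real. \<lfloor>fst p * real (Suc n)\<rfloor>) \<in> measurable (borel \<Otimes>\<^sub>M borel) (count_space UNIV)" by measurable
    have [measurable]: "(\<lambda>p::real \<times> real. Fk a f t (real_of_int \<lfloor>fst p * real (Suc n)\<rfloor> / real (Suc n)) (snd p)) \<in> borel_measurable (borel \<Otimes>\<^sub>M borel)"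
      by (rule measurable_compose_countable[OF _ g,
      where f="\<lambda>i p. Fk a f t (real_of_int i / real (Suc n)) (snd p)"]) measurable
    show ?thesis unfolding F_def[abs_def] by measurable
  qed
  show ?thesis
  proof (rule borel_measurable_LIMSEQ_real[OF _ Fm])
    fix p :: "real \<times> real"
    obtain s x where p: "p = (s, x)" by (cases p)
    show "(\<lambda>n. F n p) \<longlonglongrightarrow> Fk a f t (fst p) (snd p)"
    proof (cases "0 \<le> s \<and> s < t")
      case True
      then have s: "0 \<le> s" "s < t" by auto
      define r where "r n = real_of_int \<lfloor>s * real (Suc n)\<rfloor> / real (Suc n)" for n
      note fl = floor_approx[OF s(1)]
      have r: "r n \<in> {0..s}" for n unfolding r_def using fl(1,2)[of n] by simp
      have l0: "(\<lambda>n. s - inverse (real (Suc n))) \<longlonglongrightarrow> s - 0"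
        by (intro tendsto_diff tendsto_const LIMSEQ_inverse_real_of_nat)
      have rl: "r \<longlonglongrightarrow> s"
      proof (rule tendsto_sandwich)
        show "(\<lambda>n. s - inverse (real (Suc n))) \<longlonglongrightarrow> s" using l0 by (simp only: diff_zero)
        show "(\<lambda>n. s) \<longlonglongrightarrow> s" by simp
        show "\<forall>\<^sub>F n in sequentially. s - inverse (real (Suc n)) \<le> r n"
          by (rule always_eventually) (use fl(3) in \<open>simp only: r_def inverse_eq_divide simp_thms\<close>)
        show "\<forall>\<^sub>F n in sequentially. r n \<le> s"
          by (rule always_eventually) (use r in simp)
      qed
      obtain L where L: "\<forall>r\<in>{0..s}. \<forall>x. \<bar>Fk a f t r x - Fk a f t s x\<bar> \<le> L * (sqrt (2 * (s - r)) + 2 * (a * (s - r))) * L1_norm (f s) + L * L1_norm (\<lambda>x. f r x - f s x)"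
      proof -
        have "\<exists>L\<ge>0. \<forall>r\<in>{0..s}. \<forall>x. \<bar>Fk a f t r x - Fk a f t s x\<bar> \<le> L * (sqrt (2 * (s - r)) + 2 * (a * (s - r))) * L1_norm (f s) + L * L1_norm (\<lambda>x. f r x - f s x)"
          by (rule Fk_near[OF a s]) (rule f)
        then show ?thesis using that by (elim exE conjE)
      qed
      have l1: "(\<lambda>n. L1_norm (\<lambda>x. f (r n) x - f s x)) \<longlonglongrightarrow> 0"
      proof -
        have "((\<lambda>r. L1_norm (\<lambda>x. f r x - f s x)) \<longlongrightarrow> L1_norm (\<lambda>x. f s x - f s x)) (at s within {0..})"
          using c[OF s(1)] by (simp add: L1_norm_def)
        then have "continuous (at s within {0..}) (\<lambda>r. L1_norm (\<lambda>x. f r x - f s x))"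
          by (simp add: continuous_within)
        then have "(\<lambda>n. L1_norm (\<lambda>x. f (r n) x - f s x)) \<longlonglongrightarrow> L1_norm (\<lambda>x. f s x - f s x)"
          using rl r s unfolding continuous_within_sequentially by (auto simp: o_def)
        then show ?thesis by (simp add: L1_norm_def)
      qed
      have "(\<lambda>n. L * (sqrt (2 * (s - r n)) + 2 * (a * (s - r n))) * L1_norm (f s) + L * L1_norm (\<lambda>x. f (r n) x - f s x)) \<longlonglongrightarrow>
          L * (sqrt (2 * (s - s)) + 2 * (a * (s - s))) * L1_norm (f s) + L * 0"
        by (intro tendsto_intros rl l1)
      then have "(\<lambda>n. L * (sqrt (2 * (s - r n)) + 2 * (a * (s - r n))) * L1_norm (f s) + L * L1_norm (\<lambda>x. f (r n) x - f s x)) \<longlonglongrightarrow> 0" by simp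
      then have "(\<lambda>n. Fk a f t (r n) x - Fk a f t s x) \<longlonglongrightarrow> 0"
        by (rule Lim_null_comparison[rotated]) (use L[rule_format, OF r] in simp)
      then have "(\<lambda>n. Fk a f t (r n) x) \<longlonglongrightarrow> Fk a f t s x" by (simp add: LIM_zero_iff)
      then show ?thesis using s by (simp add: F_def p r_def)
    next
      case False
      then show ?thesis by (auto simp: F_def p Fk_def)
    qed
  qed
qed

text \<open>Fubini, justified by the kernel bound \<open>(t - s) powr (-3/4)\<close>, passes from
  the pointwise integral in \<open>s\<close> to the integral of pairings.\<close>

lemma mild_imp_dh:
  assumes u0: "u0 \<in> L2" and a: "a \<ge> 0" and t: "t > 0"
      and f: "\<And>s. s \<ge> 0 \<Longrightarrow> integrable lborel (f s)"
    and c: "\<And>s. s \<ge> 0 \<Longrightarrow> ((\<lambda>r. L1_norm (\<lambda>x. f r x - f s x)) \<longlongrightarrow> 0) (at s within {0..})"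
    and Mf: "\<And>s. s \<in> {0..t} \<Longrightarrow> L1_norm (f s) \<le> Mf"
  shows "duhamel u0 (\<lambda>s. a * s) f t (a * t) (\<lambda>x. conv (heat_kernel t) (X_flow (a * t) u0) x
        + 1/2 * (LBINT s:{0..t}. conv (deriv (heat_kernel (t - s))) (X_flow (a * (t - s)) (f s)) x))"
proof -
  define H where "H s x = Fk a f t s x" for s x
  have Mf0: "Mf \<ge> 0" using order_trans[OF L1_norm_nonneg Mf[of 0]] t by simp
  have Hm[measurable]: "(\<lambda>p. H (fst p) (snd p)) \<in> borel_measurable (borel \<Otimes>\<^sub>M borel)"
    unfolding H_def by (rule Fk_measurable[OF a]; rule f c; assumption)
  have Hm'[measurable]: "(\<lambda>(x, s). H s x) \<in> borel_measurable (borel \<Otimes>\<^sub>M borel)"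
    using measurable_compose[OF measurable_pair_swap' Hm] by (simp add: split_beta')
  define G where "G x = (LINT s|lborel. H s x)" for x
  have Gm[measurable]: "G \<in> borel_measurable borel" unfolding G_def by measurable
  have Ge: "(LBINT s:{0..t}. conv (deriv (heat_kernel (t - s))) (X_flow (a * (t - s)) (f s)) x) = G x" for x
    unfolding G_def H_def set_lebesgue_integral_def
    by (intro Bochner_Integration.integral_cong) (auto simp: indicator_def conv_eq_Fk[where f=f and t=t, OF a _ _ f] Fk_def)
  have HW: "(LINT x|lborel. b x * H s x) = indicator {0..t} s *\<^sub>R W (pk (t - s) (a * t - a * s)) b (f s)"
    if b: "b \<in> L2" for b s
  proof (cases "0 \<le> s \<and> s < t")
    case True
    then show ?thesis unfolding H_def Fk_def
      using conv_dual(2)[OF pk_L2 b f, of "t - s" s "a * (t - s)"] by (simp add: right_diff_distrib)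
  next
    case False
    then show ?thesis by (cases "s = t") (auto simp: H_def Fk_def pk_0 W_def ip_def sh_def)
  qed
  have Hb: "(\<integral>\<^sup>+x. ennreal \<bar>b x * H s x\<bar> \<partial>lborel) \<le> ennreal (indicator {0..t} s *\<^sub>R ((t - s) powr (-3/4) * (L2_norm b * Mf)))" if b: "b \<in> L2" for b s
  proof (cases "0 \<le> s \<and> s < t")
    case True
    then have "(\<integral>\<^sup>+x. ennreal \<bar>b x * H s x\<bar> \<partial>lborel) \<le> ennreal (L2_norm (pk (t - s) (a * (t - s))) * L2_norm b * L1_norm (f s))"
      unfolding H_def Fk_def using conv_dual(1)[OF pk_L2 b f, of "t - s" s "a * (t - s)"] by simp
    also have "\<dots> \<le> ennreal ((t - s) powr (-3/4) * L2_norm b * Mf)"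
      using True Mf[of s] by (intro ennreal_leI mult_mono pk_norm) auto
    finally show ?thesis using True by (simp add: mult_ac)
  next
    case False
    then have "H s x = 0" for x by (auto simp: H_def Fk_def)
    then show ?thesis by simp
  qed
  define A where "A = (LBINT s:{0..t}. (t - s) powr (-3/4))"
  have A: "set_integrable lborel {0..t} (\<lambda>s. (t - s) powr (-3/4))" using powr_kernel_integral(1)[of "-3/4" t] t
    by simp
  have A0: "A \<ge> 0" unfolding A_def set_lebesgue_integral_def by (intro Bochner_Integration.integral_nonneg) auto
  have Hbb: "(\<integral>\<^sup>+s. (\<integral>\<^sup>+x. ennreal \<bar>b x * H s x\<bar> \<partial>lborel) \<partial>lborel) \<le> ennreal (A * Mf * L2_norm b)" if b: "b \<in> L2" for b
  proof -
    have i: "set_integrable lborel {0..t} (\<lambda>s. (t - s) powr (-3/4) * (L2_norm b * Mf))" using A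
      by (intro set_integrable_mult_left) auto
    have "(\<integral>\<^sup>+s. (\<integral>\<^sup>+x. ennreal \<bar>b x * H s x\<bar> \<partial>lborel) \<partial>lborel) \<le> (\<integral>\<^sup>+s. ennreal (indicator {0..t} s *\<^sub>R ((t - s) powr (-3/4) * (L2_norm b * Mf))) \<partial>lborel)"
      by (intro nn_integral_mono Hb b)
    also have "\<dots> = ennreal (LBINT s:{0..t}. (t - s) powr (-3/4) * (L2_norm b * Mf))"
      unfolding set_lebesgue_integral_def using i Mf0 unfolding set_integrable_def by (intro nn_integral_eq_integral) auto
    also have "(LBINT s:{0..t}. (t - s) powr (-3/4) * (L2_norm b * Mf)) = A * (L2_norm b * Mf)"
      unfolding A_def by (rule set_integral_mult_left)
    finally show ?thesis by (simp add: mult_ac)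
  qed
  have Hi: "integrable (lborel \<Otimes>\<^sub>M lborel) (\<lambda>(s, x). b x * H s x)" if b: "b \<in> L2" for b
  proof (rule integrableI_bounded)
    have [measurable]: "b \<in> borel_measurable borel" using b by (rule L2_measurable)
    show "(\<lambda>(s, x). b x * H s x) \<in> borel_measurable (lborel \<Otimes>\<^sub>M lborel)"
      using Hm by (simp add: split_beta')
    have "(\<integral>\<^sup>+p. ennreal (norm (case p of (s, x) \<Rightarrow> b x * H s x)) \<partial>(lborel \<Otimes>\<^sub>M lborel)) = (\<integral>\<^sup>+s. (\<integral>\<^sup>+x. ennreal \<bar>b x * H s x\<bar> \<partial>lborel) \<partial>lborel)"
      by (subst lborel.nn_integral_fst[symmetric]) (use Hm in \<open>auto simp: split_beta'\<close>)
    also have "\<dots> < \<infinity>" using Hbb[OF b] by (rule le_less_trans) simp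
    finally show "(\<integral>\<^sup>+p. ennreal (norm (case p of (s, x) \<Rightarrow> b x * H s x)) \<partial>(lborel \<Otimes>\<^sub>M lborel)) < \<infinity>" .
  qed
  have GL: "G \<in> L2"
  proof (rule L2_from_dual(1)[OF Gm])
    show "0 \<le> A * Mf" using A0 Mf0 by simp
    fix b assume b: "b \<in> L2"
    have bm[measurable]: "b \<in> borel_measurable borel" using b by (rule L2_measurable)
    have ae: "AE x in lborel. integrable lborel (\<lambda>s. b x * H s x)"
      using lborel_pair.AE_integrable_snd[OF Hi[OF b]] by simp
    have "(\<integral>\<^sup>+x. ennreal \<bar>b x * G x\<bar> \<partial>lborel) \<le> (\<integral>\<^sup>+x. (\<integral>\<^sup>+s. ennreal \<bar>b x * H s x\<bar> \<partial>lborel) \<partial>lborel)"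
    proof (rule nn_integral_mono_AE, use ae in eventually_elim)
      fix x assume i: "integrable lborel (\<lambda>s. b x * H s x)"
      have bG: "b x * G x = (LINT s|lborel. b x * H s x)" by (simp add: G_def)
      show "ennreal \<bar>b x * G x\<bar> \<le> (\<integral>\<^sup>+s. ennreal \<bar>b x * H s x\<bar> \<partial>lborel)"
        unfolding bG using integral_norm_bound_ennreal[OF i] by (simp only: real_norm_def)
    qed
    also have "\<dots> = (\<integral>\<^sup>+s. (\<integral>\<^sup>+x. ennreal \<bar>b x * H s x\<bar> \<partial>lborel) \<partial>lborel)"
      by (rule lborel_pair.Fubini') (use Hm in \<open>simp add: split_beta'\<close>)
    also have "\<dots> \<le> ennreal (A * Mf * L2_norm b)" by (rule Hbb[OF b])
    finally show "(\<integral>\<^sup>+x. ennreal \<bar>b x * G x\<bar> \<partial>lborel) \<le> ennreal (A * Mf * L2_norm b)" .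
  qed
  have Gip: "ip b G = (LBINT s:{0..t}. W (pk (t - s) (a * t - a * s)) b (f s))"
    and Wi: "set_integrable lborel {0..t} (\<lambda>s. W (pk (t - s) (a * t - a * s)) b (f s))" if b: "b \<in> L2" for b
  proof -
    have "ip b G = (LINT x|lborel. LINT s|lborel. b x * H s x)" by (simp add: ip_def G_def)
    also have "\<dots> = (LINT s|lborel. LINT x|lborel. b x * H s x)"
      by (rule lborel_pair.Fubini_integral[OF Hi[OF b]])
    finally show "ip b G = (LBINT s:{0..t}. W (pk (t - s) (a * t - a * s)) b (f s))"
      unfolding HW[OF b] set_lebesgue_integral_def .
    show "set_integrable lborel {0..t} (\<lambda>s. W (pk (t - s) (a * t - a * s)) b (f s))"
      unfolding set_integrable_def HW[OF b, symmetric] using lborel_pair.integrable_fst'[OF Hi[OF b]] by simp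
  qed
  interpret g: real_distribution "gau t" by (rule rd_gau)
  interpret m: real_distribution "mu (a * t)" by (rule rd_mu)
  have at: "a * t \<ge> 0" using a t by simp
  define lin where "lin = Tm (gau t) (Tm (mu (a * t)) u0)"
  have muL: "Tm (mu (a * t)) u0 \<in> L2" by (rule m.L2_Tm(1)[OF u0])
  have linL: "lin \<in> L2" unfolding lin_def by (rule g.L2_Tm(1)[OF muL])
  have lin_eq: "conv (heat_kernel t) (X_flow (a * t) u0) x = lin x" for x
  proof -
    note X = X_flow_L2[OF at u0]
    have [measurable]: "X_flow (a * t) u0 \<in> borel_measurable borel" "Tm (mu (a * t)) u0 \<in> borel_measurable borel"
      using X(1) muL by (auto dest: L2_measurable)
    have "conv (heat_kernel t) (X_flow (a * t) u0) x = (LINT y|lborel. heat_kernel t (x - y) * Tm (mu (a * t)) u0 y)"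
      unfolding conv_def by (rule integral_cong_AE) (use X(2) in auto)
    also have "\<dots> = (LINT y|lborel. heat_kernel t y * Tm (mu (a * t)) u0 (x - y))"
      using lborel_reflect[of "\<lambda>y. heat_kernel t (x - y) * Tm (mu (a * t)) u0 y" x] by simp
    also have "\<dots> = lin x" unfolding lin_def Tm_def[of "gau t"] by (rule integral_gau[OF t, symmetric]) measurable
    finally show ?thesis .
  qed
  have lin_ip: "ip b lin = ip b (Tm (Q t (a * t)) u0)" if b: "b \<in> L2" for b
    unfolding lin_def Q_def by (rule Tm_convolution[symmetric, OF rd_gau rd_mu b u0])
  have hG: "(\<lambda>x. 1/2 * G x) \<in> L2" by (rule L2_scale[OF GL])
  show ?thesis
    unfolding Ge lin_eq duhamel_def
  proof (intro conjI ballI)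
    show "(\<lambda>x. lin x + 1/2 * G x) \<in> L2" by (rule L2_add[OF linL hG])
    fix b assume b: "b \<in> L2"
    show "set_integrable lborel {0..t} (\<lambda>s. W (pk (t - s) (a * t - a * s)) b (f s))" by (rule Wi[OF b])
    show "ip b (\<lambda>x. lin x + 1/2 * G x) = ip b (Tm (Q t (a * t)) u0) + 1/2 * (LBINT s:{0..t}. W (pk (t - s) (a * t - a * s)) b (f s))"
      unfolding ip_add_right[OF b linL hG] ip_scale_right Gip[OF b] lin_ip[OF b] ..
  qed
qed

section \<open>Existence of mild solutions\<close>

text \<open>\<open>a = 0\<close> is the viscous Burgers equation and \<open>a = 1\<close> the augmented one.\<close>

definition mild :: "real \<Rightarrow> (real \<Rightarrow> real) \<Rightarrow> (real \<Rightarrow> real \<Rightarrow> real) \<Rightarrow> bool" where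
  "mild a w0 w \<longleftrightarrow> continuous_in_L2 w \<and> (AE x in lborel. w 0 x = w0 x) \<and>
    (\<forall>t>0. AE x in lborel. w t x = conv (heat_kernel t) (X_flow (a * t) w0) x
        + 1/2 * (LBINT s:{0..t}. conv (deriv (heat_kernel (t - s))) (X_flow (a * (t - s)) (\<lambda>y. (w s y)\<^sup>2)) x))"

lemma mild_burgers_mild: "mild_burgers w0 w = mild 0 w0 w"
  by (simp add: mild_def mild_burgers_def X_flow_0)

lemma mild_augmented_burgers_mild: "mild_augmented_burgers w0 w = mild 1 w0 w"
  by (simp add: mild_def mild_augmented_burgers_def)

lemma continuous_in_L2_L2: "continuous_in_L2 w \<Longrightarrow> t \<ge> 0 \<Longrightarrow> w t \<in> L2"
  by (simp add: continuous_in_L2_def)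

lemma continuous_in_L2_norm_tendsto:
  assumes w: "continuous_in_L2 w" and t: "t \<ge> 0"
  shows "((\<lambda>s. L2_norm (w s)) \<longlongrightarrow> L2_norm (w t)) (at t within {0..})"
proof -
  have "((\<lambda>s. L2_norm (w s) - L2_norm (w t)) \<longlongrightarrow> 0) (at t within {0..})"
  proof (rule Lim_null_comparison)
    show "((\<lambda>s. L2_norm (\<lambda>x. w s x - w t x)) \<longlongrightarrow> 0) (at t within {0..})"
      using w t by (simp add: continuous_in_L2_def)
    have "norm (L2_norm (w s) - L2_norm (w t)) \<le> L2_norm (\<lambda>x. w s x - w t x)" if "s \<in> {0..}" for s
      using L2_norm_le_diff[of "w s" "w t"] L2_norm_le_diff[of "w t" "w s"] that t continuous_in_L2_L2[OF w]
      by (simp add: L2_norm_diff_commute[of "w t" "w s"])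
    then show "\<forall>\<^sub>F s in at t within {0..}. norm (L2_norm (w s) - L2_norm (w t)) \<le> L2_norm (\<lambda>x. w s x - w t x)"
      by (auto simp: eventually_at_filter)
  qed
  then show ?thesis by (simp add: LIM_zero_iff)
qed

lemma continuous_in_L2_bounded:
  assumes w: "continuous_in_L2 w"
  shows "\<exists>R\<ge>0. \<forall>t\<in>{0..T}. L2_norm (w t) \<le> R"
proof -
  have "continuous_on {0..} (\<lambda>t. L2_norm (w t))"
    unfolding continuous_on_def using continuous_in_L2_norm_tendsto[OF w] by auto
  then have "continuous_on {0..T} (\<lambda>t. L2_norm (w t))" by (rule continuous_on_subset) auto
  then have "compact ((\<lambda>t. L2_norm (w t)) ` {0..T})" by (rule compact_continuous_image) simp
  then have "bounded ((\<lambda>t. L2_norm (w t)) ` {0..T})" by (rule compact_imp_bounded)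
  then obtain R where R: "\<forall>t\<in>{0..T}. L2_norm (w t) \<le> R" by (auto simp: bounded_iff)
  show ?thesis by (rule exI[of _ "max R 0"]) (use R in auto)
qed

lemma square_continuous_L1:
  assumes w: "continuous_in_L2 w" and t: "t \<ge> 0"
  shows "((\<lambda>s. L1_norm (\<lambda>x. (w s x)\<^sup>2 - (w t x)\<^sup>2)) \<longlongrightarrow> 0) (at t within {0..})"
proof (rule Lim_null_comparison)
  have "((\<lambda>s. L2_norm (\<lambda>x. w s x - w t x) * (L2_norm (w s) + L2_norm (w t))) \<longlongrightarrow> 0 * (L2_norm (w t) + L2_norm (w t))) (at t within {0..})"
    using w t by (intro tendsto_intros continuous_in_L2_norm_tendsto) (auto simp: continuous_in_L2_def)
  then show "((\<lambda>s. L2_norm (\<lambda>x. w s x - w t x) * (L2_norm (w s) + L2_norm (w t))) \<longlongrightarrow> 0) (at t within {0..})" by simp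
  have "norm (L1_norm (\<lambda>x. (w s x)\<^sup>2 - (w t x)\<^sup>2)) \<le> L2_norm (\<lambda>x. w s x - w t x) * (L2_norm (w s) + L2_norm (w t))" if "s \<in> {0..}" for s
    using L1_norm_square_diff[of "w s" "w t"] that t continuous_in_L2_L2[OF w] by simp
  then show "\<forall>\<^sub>F s in at t within {0..}. norm (L1_norm (\<lambda>x. (w s x)\<^sup>2 - (w t x)\<^sup>2)) \<le> L2_norm (\<lambda>x. w s x - w t x) * (L2_norm (w s) + L2_norm (w t))"
    by (auto simp: eventually_at_filter)
qed

lemma duhamel_0_intro: assumes u0: "u0 \<in> L2" shows "duhamel u0 \<theta> f 0 0 u0"
  unfolding duhamel_def
proof (intro conjI ballI)
  fix b :: "real \<Rightarrow> real" assume b: "b \<in> L2"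
  have z: "indicator {0..0} s *\<^sub>R W (pk (0 - s) (0 - \<theta> s)) b (f s) = 0" for s :: real
    by (cases "s = 0") (auto simp: pk_0 W_def ip_def sh_def)
  show "set_integrable lborel {0..0} (\<lambda>s. W (pk (0 - s) (0 - \<theta> s)) b (f s))"
    unfolding set_integrable_def z by simp
  show "ip b u0 = ip b (Tm (Q 0 0) u0) + 1/2 * (LBINT s:{0..0}. W (pk (0 - s) (0 - \<theta> s)) b (f s))"
    unfolding set_lebesgue_integral_def z Q_0(3) using u0 by (simp add: Tm_return L2_measurable)
qed (rule u0)

lemma mild_dh:
  assumes m: "mild a w0 w" and w0: "w0 \<in> L2" and a: "a \<ge> 0" and t: "t \<ge> 0"
  shows "duhamel w0 (\<lambda>s. a * s) (\<lambda>s x. (w s x)\<^sup>2) t (a * t) (w t)"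
proof -
  have c: "continuous_in_L2 w" using m by (simp add: mild_def)
  have wm: "w t \<in> borel_measurable borel" by (rule L2_measurable[OF continuous_in_L2_L2[OF c t]])
  show ?thesis
  proof (cases "t = 0")
    case True
    show ?thesis
      using duhamel_cong_AE[OF duhamel_0_intro[OF w0] wm] m True by (simp add: mild_def)
  next
    case False
    then have t0: "t > 0" using t by simp
    obtain R where R: "R \<ge> 0" "\<forall>s\<in>{0..t}. L2_norm (w s) \<le> R" using continuous_in_L2_bounded[OF c]
      by blast
    have "duhamel w0 (\<lambda>s. a * s) (\<lambda>s x. (w s x)\<^sup>2) t (a * t) (\<lambda>x. conv (heat_kernel t) (X_flow (a * t) w0) x
        + 1/2 * (LBINT s:{0..t}. conv (deriv (heat_kernel (t - s))) (X_flow (a * (t - s)) (\<lambda>y. (w s y)\<^sup>2)) x))"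
    proof (rule mild_imp_dh[OF w0 a t0, where Mf="R\<^sup>2"])
      show "integrable lborel (\<lambda>x. (w s x)\<^sup>2)" if "s \<ge> 0" for s
        using L2_integrable_sq[OF continuous_in_L2_L2[OF c that]] .
      show "((\<lambda>r. L1_norm (\<lambda>x. (w r x)\<^sup>2 - (w s x)\<^sup>2)) \<longlongrightarrow> 0) (at s within {0..})" if "s \<ge> 0" for s
        by (rule square_continuous_L1[OF c that])
      show "L1_norm (\<lambda>x. (w s x)\<^sup>2) \<le> R\<^sup>2" if "s \<in> {0..t}" for s
        unfolding L1_norm_square using R that by (intro power_mono) auto
    qed
    then show ?thesis by (rule duhamel_cong_AE[OF _ wm]) (use m t0 in \<open>simp add: mild_def\<close>)
  qed
qed

text \<open>Any bound \<open>R\<close> starts the chain: \<open>duhamel_regularity\<close> makes the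
  path Lipschitz under translations with a constant depending on \<open>R\<close>, which is all that
  the energy argument asks, and the resulting energy bound no longer contains
  \<open>R\<close>.\<close>

lemma duhamel_energy:
  assumes u0: "u0 \<in> L2" and B0: "\<And>k. L2_norm (fd k u0) \<le> \<bar>k\<bar> * B0" "B0 \<ge> 0"
      and a: "0 \<le> a" "a \<le> 1" and T: "T > 0"
    and c: "\<And>s. s \<in> {0..T} \<Longrightarrow> 0 \<le> c s \<and> c s \<le> 1"
    and R: "R \<ge> 0" "\<And>s. s \<in> {0..T} \<Longrightarrow> L2_norm (w s) \<le> R"
    and w: "\<And>s. s \<in> {0..T} \<Longrightarrow> duhamel u0 (\<lambda>s. a * s) (\<lambda>s x. c s * (w s x)\<^sup>2) s (a * s) (w s)"
  shows "\<forall>t\<in>{0..T}. L2_norm (w t) \<le> L2_norm u0" "\<exists>B\<ge>0. \<forall>t\<in>{0..T}. \<forall>k. L2_norm (fd k (w t)) \<le> \<bar>k\<bar> * B"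
proof -
  obtain C where C: "C \<ge> 1"
    and reg: "\<forall>u0 \<theta> c z. u0 \<in> L2 \<longrightarrow> (\<forall>s\<in>{0..T}. 0 \<le> c s \<and> c s \<le> 1 \<and> L2_norm (z s) \<le> R \<and> duhamel u0 \<theta> (\<lambda>s x. c s * (z s x)\<^sup>2) s (\<theta> s) (z s)) \<longrightarrow>
    (\<forall>t\<in>{0..T}. \<forall>j\<in>{1,2}. \<forall>k. L2_norm ((fd k ^^ j) (z t)) \<le> C * L2_norm ((fd k ^^ j) u0))"
    using duhamel_regularity[OF T R(1)] by (elim exE conjE)
  have all: "\<forall>t\<in>{0..T}. \<forall>j\<in>{1,2}. \<forall>k. L2_norm ((fd k ^^ j) (w t)) \<le> C * L2_norm ((fd k ^^ j) u0)"
    using reg[rule_format, of u0 c w "\<lambda>s. a * s"] u0 c R w by simp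
  have wB1: "L2_norm (fd k (w t)) \<le> C * L2_norm (fd k u0)" if "t \<in> {0..T}" for t k
    using all[rule_format, OF that, of 1 k] by simp
  have wB: "L2_norm (fd k (w t)) \<le> \<bar>k\<bar> * (C * B0)" if "t \<in> {0..T}" for t k
  proof -
    have "C * L2_norm (fd k u0) \<le> C * (\<bar>k\<bar> * B0)" using C B0 by (intro mult_left_mono) auto
    then show ?thesis using wB1[OF that, of k] by (simp add: mult_ac)
  qed
  have CB: "C * B0 \<ge> 0" using C B0 by simp
  interpret duhamel_path u0 a T R "C * B0" c w
    by unfold_locales (use u0 a R CB c wB w in auto)
  show "\<forall>t\<in>{0..T}. L2_norm (w t) \<le> L2_norm u0" using energy by blast
  show "\<exists>B\<ge>0. \<forall>t\<in>{0..T}. \<forall>k. L2_norm (fd k (w t)) \<le> \<bar>k\<bar> * B" using wB CB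
    by blast
qed

lemma mild_energy:
  assumes m: "mild a w0 w" and w0: "w0 \<in> L2" and B0: "\<And>k. L2_norm (fd k w0) \<le> \<bar>k\<bar> * B0" "B0 \<ge> 0"
      and a: "0 \<le> a" "a \<le> 1" and t: "t \<ge> 0"
  shows "L2_norm (w t) \<le> L2_norm w0"
proof -
  have c: "continuous_in_L2 w" using m by (simp add: mild_def)
  obtain R where R: "R \<ge> 0" "\<forall>s\<in>{0..t+1}. L2_norm (w s) \<le> R" using continuous_in_L2_bounded[OF c]
    by blast
  have "\<forall>s\<in>{0..t+1}. L2_norm (w s) \<le> L2_norm w0"
    by (rule duhamel_energy(1)[OF w0 B0 a _ _ R(1), where c="\<lambda>s. 1"]) (use R t mild_dh[OF m w0 a(1)] in auto)
  then show ?thesis using t by simp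
qed

text \<open>The quadratic nonlinearity, truncated outside the ball of radius \<open>R\<close> of \<open>L\<^sup>2\<close>, is globally
  Lipschitz from \<open>L\<^sup>2\<close> to \<open>L\<^sup>1\<close>; the energy inequality shows a posteriori that the truncation is
  inactive.\<close>

definition cut :: "real \<Rightarrow> (real \<Rightarrow> real) \<Rightarrow> real" where
  "cut R v = (if L2_norm v \<le> R then 1 else R / L2_norm v)"

definition cut_square :: "real \<Rightarrow> (real \<Rightarrow> real) \<Rightarrow> real \<Rightarrow> real" where
  "cut_square R v = (\<lambda>x. (cut R v)\<^sup>2 * (v x)\<^sup>2)"

lemma cut_bounds: assumes "R \<ge> 0" shows "0 \<le> cut R v" "cut R v \<le> 1" "cut R v * L2_norm v \<le> R"
  using assms by (auto simp: cut_def field_simps)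

lemma cut_square_L1: "v \<in> L2 \<Longrightarrow> integrable lborel (cut_square R v)"
  by (simp add: cut_square_def L2_integrable_sq)

lemma cut_square_norm: assumes "R \<ge> 0" shows "L1_norm (cut_square R v) \<le> R\<^sup>2"
proof -
  have "L1_norm (cut_square R v) = (cut R v * L2_norm v)\<^sup>2"
    by (simp add: cut_square_def L1_norm_scale L1_norm_square power_mult_distrib)
  also have "\<dots> \<le> R\<^sup>2" using cut_bounds[OF assms] by (intro power_mono) auto
  finally show ?thesis .
qed

text \<open>\<open>cut R v * v\<close> is the radial retraction onto the ball of radius
  \<open>R\<close>. It is Lipschitz with constant 2 by the triangle inequality, and the difference
  of squares of two functions in the ball adds the factor \<open>2 * R\<close>.\<close>

lemma cut_square_lip:
  assumes R: "R \<ge> 0" and u: "u \<in> L2" and v: "v \<in> L2"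
  shows "L1_norm (\<lambda>x. cut_square R u x - cut_square R v x) \<le> 4 * R * L2_norm (\<lambda>x. u x - v x)"
proof -
  have *: "L1_norm (\<lambda>x. cut_square R u x - cut_square R v x) \<le> 4 * R * L2_norm (\<lambda>x. u x - v x)"
    if u: "u \<in> L2" and v: "v \<in> L2" and le: "L2_norm u \<le> L2_norm v" for u v
  proof -
    let ?U = "\<lambda>x. cut R u * u x" and ?V = "\<lambda>x. cut R v * v x"
    have L: "?U \<in> L2" "?V \<in> L2" using u v by (auto intro: L2_scale)
    have d: "L2_norm v - L2_norm u \<le> L2_norm (\<lambda>x. u x - v x)"
      using L2_norm_le_diff[OF v u] by (simp add: L2_norm_diff_commute[of v u])
    \<comment> \<open>Three cases, according to which of the two functions lie outside the ball;
      \<open>d\<close> then converts the difference of norms into the norm of the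
      difference.\<close>
    have key: "\<bar>cut R u - cut R v\<bar> * L2_norm u \<le> L2_norm v - L2_norm u"
    proof (cases "L2_norm v \<le> R")
      case True then show ?thesis using le by (simp add: cut_def)
    next
      case False
      then have vp: "L2_norm v > 0" using R by simp
      show ?thesis
      proof (cases "L2_norm u \<le> R")
        case True
        have "\<bar>cut R u - cut R v\<bar> = (L2_norm v - R) / L2_norm v"
          using True False R vp by (simp add: cut_def field_simps)
        then have "\<bar>cut R u - cut R v\<bar> * L2_norm u = (L2_norm v - R) * (L2_norm u / L2_norm v)" by simp
        also have "\<dots> \<le> (L2_norm v - R) * 1" using le vp False by (intro mult_left_mono) auto
        finally show ?thesis using True by simp
      next
        case uR: False
        then have up: "L2_norm u > 0" using R by simp
        have "R / L2_norm v \<le> R / L2_norm u" using le R up by (intro divide_left_mono) auto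
        then have "\<bar>cut R u - cut R v\<bar> * L2_norm u = (R / L2_norm u - R / L2_norm v) * L2_norm u"
          using False uR by (simp add: cut_def)
        also have "\<dots> = (L2_norm v - L2_norm u) * (R / L2_norm v)" using up vp by (simp add: field_simps)
        also have "\<dots> \<le> (L2_norm v - L2_norm u) * 1" using le False vp by (intro mult_left_mono) auto
        finally show ?thesis by simp
      qed
    qed
    have "L2_norm (\<lambda>x. ?U x - ?V x) \<le> 2 * L2_norm (\<lambda>x. u x - v x)"
    proof -
      have "(\<lambda>x. ?U x - ?V x) = (\<lambda>x. cut R v * (u x - v x) + (cut R u - cut R v) * u x)"
        by (auto simp: algebra_simps)
      then have "L2_norm (\<lambda>x. ?U x - ?V x) \<le> \<bar>cut R v\<bar> * L2_norm (\<lambda>x. u x - v x) + \<bar>cut R u - cut R v\<bar> * L2_norm u"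
        using L2_norm_triangle[OF L2_scale[OF L2_diff[OF u v], of "cut R v"] L2_scale[OF u, of "cut R u - cut R v"]]
        by (simp add: L2_norm_scale)
      also have "\<dots> \<le> 1 * L2_norm (\<lambda>x. u x - v x) + L2_norm (\<lambda>x. u x - v x)"
        using cut_bounds[OF R, of v] key d by (intro add_mono mult_right_mono) auto
      finally show ?thesis by simp
    qed
    moreover have "L2_norm ?U + L2_norm ?V \<le> 2 * R"
      using cut_bounds[OF R, of u] cut_bounds[OF R, of v] by (simp add: L2_norm_scale)
    moreover have "L1_norm (\<lambda>x. cut_square R u x - cut_square R v x) \<le> L2_norm (\<lambda>x. ?U x - ?V x) * (L2_norm ?U + L2_norm ?V)"
      using L1_norm_square_diff[OF L] by (simp add: cut_square_def power_mult_distrib)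
    moreover have "L2_norm (\<lambda>x. ?U x - ?V x) * (L2_norm ?U + L2_norm ?V) \<le> (2 * L2_norm (\<lambda>x. u x - v x)) * (2 * R)"
      using calculation(1,2) by (intro mult_mono) auto
    ultimately have "L1_norm (\<lambda>x. cut_square R u x - cut_square R v x) \<le> (2 * L2_norm (\<lambda>x. u x - v x)) * (2 * R)" by linarith
    then show ?thesis by (simp add: mult_ac)
  qed
  show ?thesis
  proof (cases "L2_norm u \<le> L2_norm v")
    case True then show ?thesis using *[OF u v] by simp
  next
    case False then show ?thesis using *[OF v u]
      by (simp add: L1_norm_diff_commute[of "cut_square R u"] L2_norm_diff_commute[of u])
  qed
qed

text \<open>Of the two factors \<open>cut R v\<close>, one reduces \<open>L2_norm v\<close> to at
  most \<open>R\<close> and the other is at most 1.\<close>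

lemma cut_square_fd: assumes R: "R \<ge> 0" and v: "v \<in> L2"
  shows "L1_norm (fd k (cut_square R v)) \<le> 4 * R * L2_norm (fd k v)"
proof -
  have "L1_norm (fd k (cut_square R v)) = (cut R v)\<^sup>2 * L1_norm (fd k (\<lambda>x. (v x)\<^sup>2))"
    unfolding cut_square_def using L1_fdn_scale[where j=1] by simp
  also have "\<dots> \<le> (cut R v)\<^sup>2 * (4 * L2_norm v * L2_norm (fd k v))"
    using fd_square_L1[OF v, of 1 k] by (intro mult_left_mono) auto
  also have "\<dots> = cut R v * (cut R v * L2_norm v) * (4 * L2_norm (fd k v))" by (simp add: power2_eq_square)
  also have "\<dots> \<le> 1 * R * (4 * L2_norm (fd k v))"
    using cut_bounds[OF R, of v] R by (intro mult_right_mono mult_mono) auto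
  finally show ?thesis by simp
qed

lemma cut_square_continuous:
  assumes R: "R \<ge> 0" and w: "continuous_in_L2 w" and t: "t \<ge> 0"
  shows "((\<lambda>s. L1_norm (\<lambda>x. cut_square R (w s) x - cut_square R (w t) x)) \<longlongrightarrow> 0) (at t within {0..})"
proof (rule Lim_null_comparison)
  have "((\<lambda>s. 4 * R * L2_norm (\<lambda>x. w s x - w t x)) \<longlongrightarrow> 4 * R * 0) (at t within {0..})"
    using w t by (intro tendsto_intros) (auto simp: continuous_in_L2_def)
  then show "((\<lambda>s. 4 * R * L2_norm (\<lambda>x. w s x - w t x)) \<longlongrightarrow> 0) (at t within {0..})" by simp
  have "norm (L1_norm (\<lambda>x. cut_square R (w s) x - cut_square R (w t) x)) \<le> 4 * R * L2_norm (\<lambda>x. w s x - w t x)" if "s \<in> {0..}" for s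
    using cut_square_lip[OF R, of "w s" "w t"] that t continuous_in_L2_L2[OF w] by simp
  then show "\<forall>\<^sub>F s in at t within {0..}. norm (L1_norm (\<lambda>x. cut_square R (w s) x - cut_square R (w t) x)) \<le> 4 * R * L2_norm (\<lambda>x. w s x - w t x)"
    by (auto simp: eventually_at_filter)
qed

text \<open>The Picard map of the truncated mild equation. At \<open>t = 0\<close> the value is set
  by hand, since convolution with \<open>heat_kernel 0\<close> gives zero.\<close>

definition Phi :: "real \<Rightarrow> real \<Rightarrow> (real \<Rightarrow> real) \<Rightarrow> (real \<Rightarrow> real \<Rightarrow> real) \<Rightarrow> real \<Rightarrow> real \<Rightarrow> real" where
  "Phi a R w0 w t = (if t \<le> 0 then w0 else (\<lambda>x. conv (heat_kernel t) (X_flow (a * t) w0) x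
        + 1/2 * (LBINT s:{0..t}. conv (deriv (heat_kernel (t - s))) (X_flow (a * (t - s)) (cut_square R (w s))) x)))"

lemma Phi_dh:
  assumes w0: "w0 \<in> L2" and a: "a \<ge> 0" and R: "R \<ge> 0" and w: "continuous_in_L2 w" and t: "t \<ge> 0"
  shows "duhamel w0 (\<lambda>s. a * s) (\<lambda>s. cut_square R (w s)) t (a * t) (Phi a R w0 w t)"
proof (cases "t = 0")
  case True then show ?thesis using duhamel_0_intro[OF w0] by (simp add: Phi_def)
next
  case False
  then have t0: "t > 0" using t by simp
  have "duhamel w0 (\<lambda>s. a * s) (\<lambda>s. cut_square R (w s)) t (a * t) (\<lambda>x. conv (heat_kernel t) (X_flow (a * t) w0) x
        + 1/2 * (LBINT s:{0..t}. conv (deriv (heat_kernel (t - s))) (X_flow (a * (t - s)) (cut_square R (w s))) x))"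
    by (rule mild_imp_dh[OF w0 a t0, where Mf="R\<^sup>2"])
       (auto intro: cut_square_L1 continuous_in_L2_L2[OF w] cut_square_continuous[OF R w] cut_square_norm[OF R])
  then show ?thesis using t0 by (simp add: Phi_def)
qed

text \<open>The class in which Picard iteration runs. The translation bound belongs to it because
  continuity in time of the next iterate is read off from \<open>duhamel_holder\<close>, which asks
  for this bound on the forcing.\<close>

definition good :: "(real \<Rightarrow> real \<Rightarrow> real) \<Rightarrow> bool" where
  "good w \<longleftrightarrow> continuous_in_L2 w \<and> (\<forall>T>0. \<exists>B\<ge>0. \<forall>t\<in>{0..T}. \<forall>k. L2_norm (fd k (w t)) \<le> \<bar>k\<bar> * B)"

lemma Phi_good:
  assumes w0: "w0 \<in> L2" and B0: "\<And>k. L2_norm (fd k w0) \<le> \<bar>k\<bar> * B0" "B0 \<ge> 0"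
      and a: "0 \<le> a" "a \<le> 1" and R: "R \<ge> 0" and w: "good w"
  shows "good (Phi a R w0 w)"
proof -
  have c: "continuous_in_L2 w" using w by (simp add: good_def)
  note d = Phi_dh[OF w0 a(1) R c]
  have Ni: "integrable lborel (cut_square R (w s))" if "s \<ge> 0" for s
    by (intro cut_square_L1 continuous_in_L2_L2[OF c] that)
  have bnd: "\<exists>B\<ge>0. \<exists>B1\<ge>0. \<forall>t\<in>{0..T}. \<forall>k. L2_norm (fd k (Phi a R w0 w t)) \<le> \<bar>k\<bar> * B \<and> L1_norm (fd k (cut_square R (w t))) \<le> \<bar>k\<bar> * B1" if T: "T > 0" for T
  proof -
    obtain B where B: "B \<ge> 0" "\<forall>t\<in>{0..T}. \<forall>k. L2_norm (fd k (w t)) \<le> \<bar>k\<bar> * B" using w T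
      unfolding good_def by blast
    \<comment> \<open>The value 1 is arbitrary: here the weight serves only to bound the singular
      integral by a finite constant.\<close>
    obtain l where l: "l > 0" "small_weight T 1 l" using small_weight_exists[OF T zero_less_one] by blast
    have f1: "L1_norm (fd k (cut_square R (w t))) \<le> \<bar>k\<bar> * (4 * R * B)" if t: "t \<in> {0..T}" for t k
    proof -
      have "L1_norm (fd k (cut_square R (w t))) \<le> 4 * R * L2_norm (fd k (w t))" using t
        by (intro cut_square_fd R continuous_in_L2_L2[OF c]) auto
      also have "\<dots> \<le> 4 * R * (\<bar>k\<bar> * B)" using B t R by (intro mult_left_mono) auto
      finally show ?thesis by (simp add: mult_ac)
    qed
    have f2: "L2_norm (fd k (Phi a R w0 w t)) \<le> \<bar>k\<bar> * (B0 + 2 * R * B * exp (l * T))" if t: "t \<in> {0..T}"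
      for t k
    proof -
      have t0: "t \<ge> 0" using t by simp
      have "L2_norm ((fd k ^^ 1) (Phi a R w0 w t)) \<le> L2_norm ((fd k ^^ 1) w0) + 1/2 * (1 * (\<bar>k\<bar> * (4 * R * B)) * exp (l * t))"
      proof (rule duhamel_fdn[OF d[OF t0] w0 l(2) t])
        fix s assume s: "s \<in> {0..t}"
        then have sT: "s \<in> {0..T}" using t by auto
        show "integrable lborel (cut_square R (w s))" using s by (intro cut_square_L1 continuous_in_L2_L2[OF c]) auto
        have "\<bar>k\<bar> * (4 * R * B) * 1 \<le> \<bar>k\<bar> * (4 * R * B) * exp (l * s)"
          using l s R B by (intro mult_left_mono) auto
        then have "L1_norm (fd k (cut_square R (w s))) \<le> \<bar>k\<bar> * (4 * R * B) * exp (l * s)"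
          using f1[OF sT, of k] by linarith
        then show "L1_norm ((fd k ^^ 1) (cut_square R (w s))) \<le> \<bar>k\<bar> * (4 * R * B) * exp (l * s)" by simp
      qed (use R B in auto)
      also have "\<dots> \<le> \<bar>k\<bar> * B0 + 1/2 * (1 * (\<bar>k\<bar> * (4 * R * B)) * exp (l * T))"
        using B0(1)[of k] t l R B by (intro add_mono mult_left_mono) auto
      finally show ?thesis by (simp add: algebra_simps)
    qed
    have "B0 + 2 * R * B * exp (l * T) \<ge> 0" "4 * R * B \<ge> 0" using B0 R B by auto
    then show ?thesis using f1 f2 by blast
  qed
  have cont: "((\<lambda>s. L2_norm (\<lambda>x. Phi a R w0 w s x - Phi a R w0 w t x)) \<longlongrightarrow> 0) (at t within {0..})" if t: "t \<ge> 0" for t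
  proof -
    define T where "T = t + 1"
    have T: "T > 0" using t by (simp add: T_def)
    obtain B B1 where B: "B \<ge> 0" "B1 \<ge> 0"
      and Bb: "\<And>s k. s \<in> {0..T} \<Longrightarrow> L2_norm (fd k (Phi a R w0 w s)) \<le> \<bar>k\<bar> * B"
      "\<And>s k. s \<in> {0..T} \<Longrightarrow> L1_norm (fd k (cut_square R (w s))) \<le> \<bar>k\<bar> * B1"
        using bnd[OF T] by metis
    have h: "L2_norm (\<lambda>x. Phi a R w0 w (s + h) x - Phi a R w0 w s x) \<le> (4 * B + 2/3 * B1) * sqrt h"
      if "0 \<le> s" "0 \<le> h" "h \<le> 1" "s + h \<le> T" for s h
      by (rule duhamel_holder[OF w0 a that(1-3) d d, where B=B and ?B1.0=B1])
         (use that B Bb Ni in auto)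
    show ?thesis
    proof (rule Lim_null_comparison)
      have "((\<lambda>s. (4 * B + 2/3 * B1) * sqrt \<bar>s - t\<bar>) \<longlongrightarrow> (4 * B + 2/3 * B1) * sqrt \<bar>t - t\<bar>) (at t within {0..})"
        by (intro tendsto_intros)
      then show "((\<lambda>s. (4 * B + 2/3 * B1) * sqrt \<bar>s - t\<bar>) \<longlongrightarrow> 0) (at t within {0..})"
        by simp
      have le: "norm (L2_norm (\<lambda>x. Phi a R w0 w s x - Phi a R w0 w t x)) \<le> (4 * B + 2/3 * B1) * sqrt \<bar>s - t\<bar>"
        if s: "s \<in> {0..}" "dist s t < 1" for s
      proof (cases "s \<ge> t")
        case True
        then show ?thesis using h[of t "s - t"] t s by (simp add: dist_real_def T_def)
      next
        case False
        then show ?thesis using h[of s "t - s"] t s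
          by (simp add: dist_real_def T_def L2_norm_diff_commute[of "Phi a R w0 w s"])
      qed
      show "\<forall>\<^sub>F s in at t within {0..}. norm (L2_norm (\<lambda>x. Phi a R w0 w s x - Phi a R w0 w t x)) \<le> (4 * B + 2/3 * B1) * sqrt \<bar>s - t\<bar>"
        unfolding eventually_at using le by (intro exI[of _ 1]) auto
    qed
  qed
  have "continuous_in_L2 (Phi a R w0 w)"
    unfolding continuous_in_L2_def using cont d[THEN duhamel_L2] by blast
  then show ?thesis unfolding good_def using bnd by meson
qed

text \<open>The limit at a given time must be chosen before the horizon \<open>T\<close>, while the
  constants \<open>D\<close> depend on \<open>T\<close>. So one limit is shown to satisfy every
  geometric bound that the increments satisfy, by comparing it with the limit belonging to that
  bound.\<close>

lemma L2_complete_uniform: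
  fixes F :: "nat \<Rightarrow> real \<Rightarrow> real"
  assumes F: "\<And>n. F n \<in> L2" and d: "\<And>n. L2_norm (\<lambda>x. F (Suc n) x - F n x) \<le> C * (1/2) ^ n"
      and C: "C \<ge> 0"
  shows "\<exists>f\<in>L2. \<forall>D\<ge>0. (\<forall>n. L2_norm (\<lambda>x. F (Suc n) x - F n x) \<le> D * (1/2) ^ n) \<longrightarrow> (\<forall>n. L2_norm (\<lambda>x. F n x - f x) \<le> 2 * D * (1/2) ^ n)"
proof -
  obtain f where f: "f \<in> L2" "\<And>n. L2_norm (\<lambda>x. F n x - f x) \<le> 2 * C * (1/2) ^ n"
    using L2_complete[OF F d C] by blast
  have "L2_norm (\<lambda>x. F n x - f x) \<le> 2 * D * (1/2) ^ n"
    if D: "D \<ge> 0" "\<forall>n. L2_norm (\<lambda>x. F (Suc n) x - F n x) \<le> D * (1/2) ^ n" for D n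
  proof -
    obtain g where g: "g \<in> L2" "\<And>n. L2_norm (\<lambda>x. F n x - g x) \<le> 2 * D * (1/2) ^ n"
      using L2_complete[OF F D(2)[rule_format] D(1)] by blast
    have "L2_norm (\<lambda>x. g x - f x) \<le> 0"
    proof (rule LIMSEQ_le_const)
      have "(\<lambda>n. 2 * D * (1/2) ^ n + 2 * C * (1/2) ^ n) \<longlonglongrightarrow> 2 * D * 0 + 2 * C * 0"
        by (intro tendsto_intros LIMSEQ_power_zero) auto
      then show "(\<lambda>n. 2 * D * (1/2) ^ n + 2 * C * (1/2) ^ n) \<longlonglongrightarrow> 0" by simp
      have "L2_norm (\<lambda>x. g x - f x) \<le> 2 * D * (1/2) ^ n + 2 * C * (1/2) ^ n" for n
        using L2_norm_triangle3[OF g(1) F f(1), of n] f(2)[of n] g(2)[of n]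
        by (simp add: L2_norm_diff_commute[of g])
      then show "\<exists>N. \<forall>n\<ge>N. L2_norm (\<lambda>x. g x - f x) \<le> 2 * D * (1/2) ^ n + 2 * C * (1/2) ^ n"
        by blast
    qed
    then show ?thesis using L2_norm_triangle3[OF F g(1) f(1), of n] g(2)[of n] by linarith
  qed
  then show ?thesis using f(1) by blast
qed

text \<open>Picard iteration for the truncated equation contracts by 1/2 in the weighted norm on
  every \<open>[0, T]\<close>, which gives a global solution of it. The energy inequality keeps that
  solution in the ball where the truncation is inactive.\<close>

theorem mild_exists:
  assumes w0: "w0 \<in> L2" and B0: "\<And>k. L2_norm (fd k w0) \<le> \<bar>k\<bar> * B0" "B0 \<ge> 0"
      and a: "0 \<le> a" "a \<le> 1"
  shows "\<exists>w. mild a w0 w"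
proof -
  \<comment> \<open>The truncation radius is the norm of the data itself, precisely the bound that
    energy returns.\<close>
  define R where "R = L2_norm w0"
  have R: "R \<ge> 0" by (simp add: R_def)
  define V where "V n = (Phi a R w0 ^^ n) (\<lambda>t x. 0)" for n
  have V0: "V 0 = (\<lambda>t x. 0)" and VS: "V (Suc n) = Phi a R w0 (V n)" for n by (auto simp: V_def)
  have Vg: "good (V n)" for n
  proof (induct n)
    case 0
    have "fd k (\<lambda>x. 0) = (\<lambda>x. 0)" for k by (auto simp: fd_def)
    then show ?case by (auto simp: V0 good_def continuous_in_L2_def L2_zero)
  next
    case (Suc n) then show ?case unfolding VS by (rule Phi_good[OF w0 B0 a R])
  qed
  have Vc: "continuous_in_L2 (V n)" for n using Vg by (simp add: good_def)
  have VL: "V n t \<in> L2" if "t \<ge> 0" for n t by (rule continuous_in_L2_L2[OF Vc that])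
  define \<epsilon> where "\<epsilon> = 1 / (4 * R + 1)"
  have e: "\<epsilon> > 0" "\<epsilon> * (4 * R) \<le> 1" using R by (auto simp: \<epsilon>_def field_simps)
  have contr: "L2_norm (\<lambda>x. Phi a R w0 u t x - Phi a R w0 v t x) \<le> 1/2 * (M * exp (l * t))"
    if l: "small_weight T \<epsilon> l" and t: "t \<in> {0..T}" and M: "M \<ge> 0" and u: "continuous_in_L2 u"
      and v: "continuous_in_L2 v"
      and uv: "\<And>s. s \<in> {0..t} \<Longrightarrow> L2_norm (\<lambda>x. u s x - v s x) \<le> M * exp (l * s)"
      for T l t M u v
  proof -
    have t0: "t \<ge> 0" using t by simp
    have "L2_norm (\<lambda>x. Phi a R w0 u t x - Phi a R w0 v t x) \<le> 1/2 * (\<epsilon> * (4 * R * M) * exp (l * t))"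
    proof (rule duhamel_diff[OF Phi_dh[OF w0 a(1) R u t0] Phi_dh[OF w0 a(1) R v t0] l t])
      fix s assume s: "s \<in> {0..t}"
      then have s0: "s \<ge> 0" by simp
      show "integrable lborel (cut_square R (u s))" "integrable lborel (cut_square R (v s))"
        by (intro cut_square_L1 continuous_in_L2_L2[OF u s0] continuous_in_L2_L2[OF v s0])+
      have "L1_norm (\<lambda>x. cut_square R (u s) x - cut_square R (v s) x) \<le> 4 * R * L2_norm (\<lambda>x. u s x - v s x)"
        by (intro cut_square_lip R continuous_in_L2_L2[OF u s0] continuous_in_L2_L2[OF v s0])
      also have "\<dots> \<le> 4 * R * (M * exp (l * s))" using R uv[OF s] by (intro mult_left_mono) auto
      finally show "L1_norm (\<lambda>x. cut_square R (u s) x - cut_square R (v s) x) \<le> 4 * R * M * exp (l * s)" by simp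
    qed (use R M e in auto)
    also have "\<epsilon> * (4 * R * M) * exp (l * t) = (\<epsilon> * (4 * R)) * (M * exp (l * t))" by simp
    also have "\<dots> \<le> 1 * (M * exp (l * t))" using e M by (intro mult_right_mono) auto
    finally show ?thesis by simp
  qed
  have incr: "L2_norm (\<lambda>x. V (Suc n) t x - V n t x) \<le> R * (1/2) ^ n * exp (l * t)"
    if l: "l > 0" "small_weight T \<epsilon> l" and t: "t \<in> {0..T}" for T l t n
    using t
  proof (induct n arbitrary: t)
    case 0
    \<comment> \<open>Zeroth differences: \<open>duhamel_fdn\<close> as a plain norm bound with
      forcing zero, the first iterate being the linear flow.\<close>
    have "L2_norm ((fd 0 ^^ 0) (Phi a R w0 (V 0) t)) \<le> L2_norm ((fd 0 ^^ 0) w0) + 1/2 * (\<epsilon> * 0 * exp (l * t))"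
      by (rule duhamel_fdn[OF Phi_dh[OF w0 a(1) R Vc] w0 l(2) 0]) (use 0 e in \<open>auto simp: V0 cut_square_def L1_norm_def\<close>)
    then have "L2_norm (Phi a R w0 (V 0) t) \<le> R * 1" by (simp add: R_def)
    also have "R * 1 \<le> R * exp (l * t)" using R l 0 by (intro mult_left_mono) auto
    finally show ?case by (simp add: VS V0)
  next
    case (Suc n)
    have "L2_norm (\<lambda>x. Phi a R w0 (V (Suc n)) t x - Phi a R w0 (V n) t x) \<le> 1/2 * ((R * (1/2) ^ n) * exp (l * t))"
      by (rule contr[OF l(2) Suc(2) _ Vc Vc]) (use R Suc in auto)
    then show ?case by (simp add: VS[symmetric])
  qed
  have incr': "\<exists>D\<ge>0. \<forall>t\<in>{0..T}. \<forall>n. L2_norm (\<lambda>x. V (Suc n) t x - V n t x) \<le> D * (1/2) ^ n" if T: "T > 0" for T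
  proof -
    obtain l where l: "l > 0" "small_weight T \<epsilon> l" using small_weight_exists[OF T e(1)] by blast
    have "L2_norm (\<lambda>x. V (Suc n) t x - V n t x) \<le> (R * exp (l * T)) * (1/2) ^ n" if t: "t \<in> {0..T}" for t n
    proof -
      have "R * (1/2) ^ n * exp (l * t) \<le> R * (1/2) ^ n * exp (l * T)" using t l R by (intro mult_left_mono) auto
      then show ?thesis using incr[OF l t, of n] by (simp add: mult_ac)
    qed
    then show ?thesis using R by (intro exI[of _ "R * exp (l * T)"]) auto
  qed
  have "\<forall>t. \<exists>f. t \<ge> 0 \<longrightarrow> f \<in> L2 \<and> (\<forall>D\<ge>0. (\<forall>n. L2_norm (\<lambda>x. V (Suc n) t x - V n t x) \<le> D * (1/2) ^ n) \<longrightarrow> (\<forall>n. L2_norm (\<lambda>x. V n t x - f x) \<le> 2 * D * (1/2) ^ n))"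
  proof
    fix t :: real
    show "\<exists>f. t \<ge> 0 \<longrightarrow> f \<in> L2 \<and> (\<forall>D\<ge>0. (\<forall>n. L2_norm (\<lambda>x. V (Suc n) t x - V n t x) \<le> D * (1/2) ^ n) \<longrightarrow> (\<forall>n. L2_norm (\<lambda>x. V n t x - f x) \<le> 2 * D * (1/2) ^ n))"
    proof (cases "t \<ge> 0")
      case True
      obtain D where D: "D \<ge> 0" "\<forall>n. L2_norm (\<lambda>x. V (Suc n) t x - V n t x) \<le> D * (1/2) ^ n"
        using incr'[of "t + 1"] True by auto
      show ?thesis using L2_complete_uniform[of "\<lambda>n. V n t", OF VL[OF True] D(2)[rule_format] D(1)] by blast
    qed simp
  qed
  then obtain w where w: "\<And>t. t \<ge> 0 \<Longrightarrow> w t \<in> L2"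
    and wD: "\<And>t D n. t \<ge> 0 \<Longrightarrow> D \<ge> 0 \<Longrightarrow> (\<forall>n. L2_norm (\<lambda>x. V (Suc n) t x - V n t x) \<le> D * (1/2) ^ n) \<Longrightarrow> L2_norm (\<lambda>x. V n t x - w t x) \<le> 2 * D * (1/2) ^ n"
    unfolding choice_iff by blast
  have unif: "\<exists>D\<ge>0. \<forall>t\<in>{0..T}. \<forall>n. L2_norm (\<lambda>x. V n t x - w t x) \<le> D * (1/2) ^ n"
    if T: "T > 0" for T
  proof -
    obtain D where D: "D \<ge> 0" "\<forall>t\<in>{0..T}. \<forall>n. L2_norm (\<lambda>x. V (Suc n) t x - V n t x) \<le> D * (1/2) ^ n" using incr'[OF T] by blast
    have "L2_norm (\<lambda>x. V n t x - w t x) \<le> (2 * D) * (1/2) ^ n" if t: "t \<in> {0..T}" for t n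
      using wD[of t D n] D t by auto
    then show ?thesis using D(1) by (intro exI[of _ "2 * D"]) auto
  qed
  have half: "(\<lambda>n. c * (1/2) ^ n) \<longlonglongrightarrow> 0" for c :: real
    using tendsto_mult[OF tendsto_const LIMSEQ_power_zero[of "1/2::real"], of c] by simp
  have wc: "continuous_in_L2 w"
    unfolding continuous_in_L2_def
  proof (intro conjI allI impI)
    fix t :: real assume t: "t \<ge> 0"
    show "w t \<in> L2" by (rule w[OF t])
    obtain D where D: "D \<ge> 0" "\<forall>s\<in>{0..t+1}. \<forall>n. L2_norm (\<lambda>x. V n s x - w s x) \<le> D * (1/2) ^ n" using unif[of "t + 1"] t by auto
    show "((\<lambda>s. L2_norm (\<lambda>x. w s x - w t x)) \<longlongrightarrow> 0) (at t within {0..})"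
    proof (rule tendstoI)
      fix e :: real assume e: "e > 0"
      obtain n where n: "D * (1/2) ^ n < e / 3" using order_tendstoD(2)[OF half[of D], of "e/3"] e
        by (auto simp: eventually_sequentially)
      have "((\<lambda>s. L2_norm (\<lambda>x. V n s x - V n t x)) \<longlongrightarrow> 0) (at t within {0..})"
        using Vc[of n] t by (simp add: continuous_in_L2_def)
      then have ev: "\<forall>\<^sub>F s in at t within {0..}. L2_norm (\<lambda>x. V n s x - V n t x) < e / 3"
        using order_tendstoD(2)[of _ 0 _ "e/3"] e by auto
      have ev2: "\<forall>\<^sub>F s in at t within {0..}. s \<in> {0..t+1}"
        unfolding eventually_at by (intro exI[of _ 1]) (auto simp: dist_real_def)
      show "\<forall>\<^sub>F s in at t within {0..}. dist (L2_norm (\<lambda>x. w s x - w t x)) 0 < e"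
        using ev ev2
      proof eventually_elim
        case (elim s)
        then have s0: "s \<ge> 0" by simp
        have "L2_norm (\<lambda>x. w s x - w t x) \<le> L2_norm (\<lambda>x. w s x - V n s x) + L2_norm (\<lambda>x. V n s x - w t x)"
          by (rule L2_norm_triangle3[OF w[OF s0] VL[OF s0] w[OF t]])
        also have "L2_norm (\<lambda>x. V n s x - w t x) \<le> L2_norm (\<lambda>x. V n s x - V n t x) + L2_norm (\<lambda>x. V n t x - w t x)"
          by (rule L2_norm_triangle3[OF VL[OF s0] VL[OF t] w[OF t]])
        finally have "L2_norm (\<lambda>x. w s x - w t x) < e / 3 + e / 3 + e / 3"
          using elim D(2)[rule_format, of s n] D(2)[rule_format, of t n] n t
          by (simp add: L2_norm_diff_commute[of "w s" "V n s"])
        then show ?case by (simp add: dist_real_def)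
      qed
    qed
  qed
  \<comment> \<open>\<open>w\<close> and \<open>Phi a R w0 w\<close> are both limits of
    \<open>V (Suc n)\<close>, the latter by the contraction estimate.\<close>
  have fix_AE: "AE x in lborel. w t x = Phi a R w0 w t x" if t: "t \<ge> 0" for t
  proof -
    define T where "T = t + 1"
    have T: "T > 0" "t \<in> {0..T}" using t by (auto simp: T_def)
    obtain D where D: "D \<ge> 0" "\<forall>s\<in>{0..T}. \<forall>n. L2_norm (\<lambda>x. V n s x - w s x) \<le> D * (1/2) ^ n" using unif[OF T(1)] by blast
    obtain l where l: "l > 0" "small_weight T \<epsilon> l" using small_weight_exists[OF T(1) e(1)] by blast
    have PL: "Phi a R w0 w t \<in> L2" by (rule duhamel_L2[OF Phi_dh[OF w0 a(1) R wc t]])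
    have "L2_norm (\<lambda>x. w t x - Phi a R w0 w t x) \<le> 0"
    proof (rule LIMSEQ_le_const[OF half])
      have "L2_norm (\<lambda>x. w t x - Phi a R w0 w t x) \<le> (D + 1/2 * (D * exp (l * t))) * (1/2) ^ n" for n
      proof -
        have "L2_norm (\<lambda>x. Phi a R w0 (V n) t x - Phi a R w0 w t x) \<le> 1/2 * (D * (1/2) ^ n * exp (l * t))"
        proof (rule contr[OF l(2) T(2) _ Vc wc])
          fix s assume s: "s \<in> {0..t}"
          have "D * (1/2) ^ n * 1 \<le> D * (1/2) ^ n * exp (l * s)" using D(1) l s by (intro mult_left_mono) auto
          then show "L2_norm (\<lambda>x. V n s x - w s x) \<le> D * (1/2) ^ n * exp (l * s)"
            using D(2)[rule_format, of s n] s T by auto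
        qed (use D in simp)
        moreover have "L2_norm (\<lambda>x. w t x - V (Suc n) t x) \<le> D * (1/2) ^ n"
        proof -
          have "D * (1/2) ^ Suc n \<le> D * (1/2) ^ n" using D(1) by simp
          then show ?thesis using D(2)[rule_format, OF T(2), of "Suc n"] by (simp only: L2_norm_diff_commute[of "w t"])
        qed
        ultimately show ?thesis
          using L2_norm_triangle3[OF w[OF t] VL[OF t] PL, of "Suc n"] unfolding VS by (simp add: algebra_simps)
      qed
      then show "\<exists>N. \<forall>n\<ge>N. L2_norm (\<lambda>x. w t x - Phi a R w0 w t x) \<le> (D + 1/2 * (D * exp (l * t))) * (1/2) ^ n" by blast
    qed
    then have "L2_norm (\<lambda>x. w t x - Phi a R w0 w t x) = 0"
      using L2_norm_nonneg[of "\<lambda>x. w t x - Phi a R w0 w t x"] by linarith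
    then show ?thesis using L2_norm_eq_0_AE[OF L2_diff[OF w[OF t] PL]] by simp
  qed
  have wd: "duhamel w0 (\<lambda>s. a * s) (\<lambda>s x. (cut R (w s))\<^sup>2 * (w s x)\<^sup>2) t (a * t) (w t)"
    if t: "t \<ge> 0" for t
    using duhamel_cong_AE[OF Phi_dh[OF w0 a(1) R wc t] L2_measurable[OF w[OF t]] fix_AE[OF t]] by (simp add: cut_square_def)
  have wR: "L2_norm (w t) \<le> R" if t: "t \<ge> 0" for t
  proof -
    obtain R' where R': "R' \<ge> 0" "\<forall>s\<in>{0..t+1}. L2_norm (w s) \<le> R'" using continuous_in_L2_bounded[OF wc]
      by blast
    have "\<forall>s\<in>{0..t+1}. L2_norm (w s) \<le> L2_norm w0"
      by (rule duhamel_energy(1)[OF w0 B0 a _ _ R'(1), where c="\<lambda>s. (cut R (w s))\<^sup>2"])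
         (use R' t wd cut_bounds[OF R] in \<open>auto intro: power_le_one\<close>)
    then show ?thesis using t by (simp add: R_def)
  qed
  have NlR: "cut_square R (w t) = (\<lambda>x. (w t x)\<^sup>2)" if "t \<ge> 0" for t
    using wR[OF that] by (simp add: cut_square_def cut_def)
  have "mild a w0 w"
    unfolding mild_def
  proof (intro conjI allI impI)
    show "continuous_in_L2 w" by (rule wc)
    show "AE x in lborel. w 0 x = w0 x" using fix_AE[of 0] by (simp add: Phi_def)
    fix t :: real assume t: "t > 0"
    have "(LBINT s:{0..t}. conv (deriv (heat_kernel (t - s))) (X_flow (a * (t - s)) (cut_square R (w s))) x)
       = (LBINT s:{0..t}. conv (deriv (heat_kernel (t - s))) (X_flow (a * (t - s)) (\<lambda>y. (w s y)\<^sup>2)) x)" for x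
      by (rule set_lebesgue_integral_cong) (auto simp: NlR)
    then show "AE x in lborel. w t x = conv (heat_kernel t) (X_flow (a * t) w0) x
        + 1/2 * (LBINT s:{0..t}. conv (deriv (heat_kernel (t - s))) (X_flow (a * (t - s)) (\<lambda>y. (w s y)\<^sup>2)) x)"
      using fix_AE[of t] t by (simp add: Phi_def)
  qed
  then show ?thesis by blast
qed

lemma fdn_cong_AE: assumes "AE x in lborel. f x = g x" shows "AE x in lborel. (fd k ^^ j) f x = (fd k ^^ j) g x"
proof (induct j)
  case (Suc j)
  then show ?case using AE_lborel_shift[OF Suc, of k] by (auto simp: fd_def)
qed (use assms in simp)

lemma L2_norm_fdn_cong_AE: assumes "f \<in> L2" "g \<in> L2" "AE x in lborel. f x = g x"
  shows "L2_norm ((fd k ^^ j) f) = L2_norm ((fd k ^^ j) g)"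
  by (rule L2_norm_cong_AE[OF L2_measurable[OF L2_fdn] L2_measurable[OF L2_fdn] fdn_cong_AE]) (use assms in auto)

text \<open>The delay \<open>s - \<theta> s\<close> of the clock is moved from the kernel to the
  forcing by \<open>W_Tm_f\<close>. The kernel becomes that of the exact equation, so
  \<open>duhamel_diff\<close> can compare the two.\<close>

lemma duhamel_shift_forcing:
  assumes d: "duhamel u0 \<theta> f t t v" and th: "\<And>s. s \<in> {0..t} \<Longrightarrow> \<theta> s \<le> s"
      and f: "\<And>s. s \<in> {0..t} \<Longrightarrow> integrable lborel (f s)"
  shows "duhamel u0 (\<lambda>s. s) (\<lambda>s. Tm (mu (s - \<theta> s)) (f s)) t t v"
proof -
  have e: "W (pk (t - s) (t - s)) b (Tm (mu (s - \<theta> s)) (f s)) = W (pk (t - s) (t - \<theta> s)) b (f s)"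
    if b: "b \<in> L2" and s: "s \<in> {0..t}" for b s
  proof -
    have "W (pk (t - s) (t - s)) b (Tm (mu (s - \<theta> s)) (f s)) = W (Tm (mu (s - \<theta> s)) (pk (t - s) (t - s))) b (f s)"
      using s by (intro real_distribution.W_Tm_f[OF rd_mu] pk_L2 b f) auto
    also have "Tm (mu (s - \<theta> s)) (pk (t - s) (t - s)) = pk (t - s) (t - s + (s - \<theta> s))"
      using s th[OF s] by (intro pk_Tm') auto
    finally show ?thesis by simp
  qed
  show ?thesis
    unfolding duhamel_def
  proof (intro conjI ballI)
    show "v \<in> L2" by (rule duhamel_L2[OF d])
    fix b assume b: "b \<in> L2"
    show "set_integrable lborel {0..t} (\<lambda>s. W (pk (t - s) (t - s)) b (Tm (mu (s - \<theta> s)) (f s)))"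
      using d b by (subst set_integrable_cong[OF refl refl e[OF b]]) (auto simp: duhamel_def)
    have "(LBINT s:{0..t}. W (pk (t - s) (t - s)) b (Tm (mu (s - \<theta> s)) (f s))) = (LBINT s:{0..t}. W (pk (t - s) (t - \<theta> s)) b (f s))"
      by (rule set_lebesgue_integral_cong) (auto simp: e[OF b])
    then show "ip b v = ip b (Tm (Q t t) u0) + 1/2 * (LBINT s:{0..t}. W (pk (t - s) (t - s)) b (Tm (mu (s - \<theta> s)) (f s)))"
      using d b by (simp add: duhamel_def)
  qed
qed

section \<open>Estimates for the splitting\<close>

text \<open>Membership in \<open>H^1\<close> expressed by differences, the form that all the flows
  are seen to preserve.\<close>

definition regular :: "(real \<Rightarrow> real) \<Rightarrow> bool" where
  "regular v \<longleftrightarrow> v \<in> L2 \<and> (\<exists>B\<ge>0. \<forall>k. L2_norm (fd k v) \<le> \<bar>k\<bar> * B)"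

definition burgers_path :: "(real \<Rightarrow> real) \<Rightarrow> real \<Rightarrow> real \<Rightarrow> real" where
  "burgers_path v = (SOME w. mild_burgers v w)"

lemma burgers_path_mild: assumes "regular v" shows "mild 0 v (burgers_path v)"
proof -
  obtain B where "v \<in> L2" "B \<ge> 0" "\<And>k. L2_norm (fd k v) \<le> \<bar>k\<bar> * B" using assms
    by (auto simp: regular_def)
  then have "\<exists>w. mild_burgers v w" unfolding mild_burgers_mild by (intro mild_exists[of v B 0]) auto
  then have "mild_burgers v (burgers_path v)" unfolding burgers_path_def by (rule someI_ex)
  then show ?thesis by (simp add: mild_burgers_mild)
qed

lemma burgers_path_props: assumes v: "regular v" and r: "r \<ge> 0"
  shows "burgers_path v r \<in> L2" "L2_norm (burgers_path v r) \<le> L2_norm v" "regular (burgers_path v r)"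
    "duhamel v (\<lambda>s. 0) (\<lambda>s x. (burgers_path v s x)\<^sup>2) r 0 (burgers_path v r)"
proof -
  obtain B where B: "v \<in> L2" "B \<ge> 0" "\<And>k. L2_norm (fd k v) \<le> \<bar>k\<bar> * B" using v
    by (auto simp: regular_def)
  have c: "continuous_in_L2 (burgers_path v)" using burgers_path_mild[OF v] by (simp add: mild_def)
  show L: "burgers_path v r \<in> L2" by (rule continuous_in_L2_L2[OF c r])
  show "L2_norm (burgers_path v r) \<le> L2_norm v" by (rule mild_energy[OF burgers_path_mild[OF v] B(1,3,2) _ _ r]) auto
  have d: "duhamel v (\<lambda>s. 0 * s) (\<lambda>s x. (burgers_path v s x)\<^sup>2) s (0 * s) (burgers_path v s)"
    if "s \<ge> 0" for s
    by (rule mild_dh[OF burgers_path_mild[OF v] B(1) order_refl that])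
  then show "duhamel v (\<lambda>s. 0) (\<lambda>s x. (burgers_path v s x)\<^sup>2) r 0 (burgers_path v r)" using r by simp
  obtain R where R: "R \<ge> 0" "\<forall>s\<in>{0..r+1}. L2_norm (burgers_path v s) \<le> R"
    using continuous_in_L2_bounded[OF c] by blast
  have "\<exists>B\<ge>0. \<forall>t\<in>{0..r+1}. \<forall>k. L2_norm (fd k (burgers_path v t)) \<le> \<bar>k\<bar> * B"
    by (rule duhamel_energy(2)[OF B(1,3,2) _ _ _ _ R(1), where a=0 and c="\<lambda>s. 1"]) (use R r d in auto)
  then obtain B'
    where B': "B' \<ge> 0" "\<forall>t\<in>{0..r+1}. \<forall>k. L2_norm (fd k (burgers_path v t)) \<le> \<bar>k\<bar> * B'"
      by blast
  show "regular (burgers_path v r)" unfolding regular_def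
    by (intro conjI L exI[of _ B'] allI) (use B' r in auto)
qed

lemma X_flow_props: assumes t: "t \<ge> 0" and v: "regular v"
  shows "X_flow t v \<in> L2" "L2_norm (X_flow t v) \<le> L2_norm v" "regular (X_flow t v)"
proof -
  have vL: "v \<in> L2" using v by (simp add: regular_def)
  note X = X_flow_L2[OF t vL]
  note TL = real_distribution.L2_Tm[OF rd_mu[of t] vL]
  have n: "L2_norm ((fd k ^^ j) (X_flow t v)) = L2_norm ((fd k ^^ j) (Tm (mu t) v))" for k j
    by (rule L2_norm_fdn_cong_AE[OF X(1) TL(1) X(2)])
  show "X_flow t v \<in> L2" by (rule X)
  show "L2_norm (X_flow t v) \<le> L2_norm v" using n[of 0 0] TL(2) by simp
  obtain B where B: "B \<ge> 0" "\<And>k. L2_norm (fd k v) \<le> \<bar>k\<bar> * B" using v by (auto simp: regular_def)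
  have "L2_norm (fd k (X_flow t v)) \<le> \<bar>k\<bar> * B" for k
    using n[of 1 k] real_distribution.L2_norm_fdn_Tm[OF rd_mu[of t] vL, where k=k and j=1] B(2)[of k] by simp
  then show "regular (X_flow t v)" using X(1) B(1) by (auto simp: regular_def)
qed

locale splitting =
  fixes u0 :: "real \<Rightarrow> real" and dt :: real
  assumes u0: "regular u0" and dt: "dt > 0"
begin

definition Z_iter :: "nat \<Rightarrow> real \<Rightarrow> real" where "Z_iter n = (Z_flow dt ^^ n) u0"
definition split_step :: "real \<Rightarrow> nat" where "split_step s = nat \<lfloor>s / dt\<rfloor>"
definition split_clock :: "real \<Rightarrow> real" where "split_clock s = real (split_step s) * dt"
text \<open>The splitting, followed along the Burgers clock: between grid times the current Burgers
  run, while the flow \<open>X\<close> acts at grid times without consuming this clock. So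
  \<open>split_clock s\<close> is the transport time spent by the moment \<open>s\<close>, and the
  path may jump at grid times.\<close>

definition split_path :: "real \<Rightarrow> real \<Rightarrow> real"
  where "split_path s = burgers_path (Z_iter (split_step s)) (s - split_clock s)"
abbreviation split_square :: "real \<Rightarrow> real \<Rightarrow> real"
  where "split_square \<equiv> (\<lambda>s x. (split_path s x)\<^sup>2)"

lemma Z_iter_Suc: "Z_iter (Suc n) = X_flow dt (burgers_path (Z_iter n) dt)"
  by (simp add: Z_iter_def Z_flow_def Y_flow_def burgers_path_def)

lemma Z_iter_regular: "regular (Z_iter n) \<and> L2_norm (Z_iter n) \<le> L2_norm u0"
proof (induct n)
  case 0 then show ?case using u0 by (simp add: Z_iter_def)
next
  case (Suc n)
  then have r: "regular (Z_iter n)" by simp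
  note Y = burgers_path_props[OF r less_imp_le[OF dt]]
  show ?case unfolding Z_iter_Suc using X_flow_props[OF less_imp_le[OF dt] Y(3)] Y(2) Suc by linarith
qed

lemma split_step_eq: "0 \<le> r \<Longrightarrow> r < dt \<Longrightarrow> split_step (real n * dt + r) = n"
proof -
  assume r: "0 \<le> r" "r < dt"
  have "\<lfloor>(real n * dt + r) / dt\<rfloor> = int n"
    using r dt by (intro floor_unique) (auto simp: add_divide_distrib)
  then show ?thesis by (simp add: split_step_def)
qed

lemma split_clock_bounds: assumes "s \<ge> 0" shows "0 \<le> split_clock s" "split_clock s \<le> s" "s - split_clock s < dt"
proof -
  have f: "0 \<le> \<lfloor>s / dt\<rfloor>" using assms dt by simp
  have e: "real (split_step s) = of_int \<lfloor>s / dt\<rfloor>" using f by (simp add: split_step_def)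
  show "0 \<le> split_clock s" using dt by (simp add: split_clock_def)
  have f1: "of_int \<lfloor>s / dt\<rfloor> \<le> s / dt" and f2: "s / dt < of_int \<lfloor>s / dt\<rfloor> + 1" by linarith+
  have "of_int \<lfloor>s / dt\<rfloor> * dt \<le> s / dt * dt" by (rule mult_right_mono[OF f1]) (use dt in simp)
  then show "split_clock s \<le> s" unfolding split_clock_def e using dt by simp
  have "s / dt * dt < (of_int \<lfloor>s / dt\<rfloor> + 1) * dt" by (rule mult_strict_right_mono[OF f2 dt])
  then show "s - split_clock s < dt" unfolding split_clock_def e using dt by (simp add: distrib_right)
qed

lemma split_clock_le: assumes "0 \<le> s" "s < real (Suc n) * dt" shows "split_clock s \<le> real n * dt"
proof -
  have "real (split_step s) * dt < real (Suc n) * dt" using split_clock_bounds(2)[OF assms(1)] assms(2)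
    unfolding split_clock_def by linarith
  then have "split_step s \<le> n" using dt by simp
  then show ?thesis using dt by (simp add: split_clock_def)
qed

lemma split_clock_mult: "split_clock (real n * dt) = real n * dt"
  using split_step_eq[of 0 n] dt by (simp add: split_clock_def)

lemma split_path_regular: assumes "s \<ge> 0"
  shows "regular (split_path s)" "split_path s \<in> L2" "L2_norm (split_path s) \<le> L2_norm u0"
proof -
  have r: "s - split_clock s \<ge> 0" using split_clock_bounds[OF assms] by simp
  note Y = burgers_path_props[OF conjunct1[OF Z_iter_regular[of "split_step s"]] r]
  show "regular (split_path s)" "split_path s \<in> L2" unfolding split_path_def using Y by auto
  show "L2_norm (split_path s) \<le> L2_norm u0" unfolding split_path_def using Y(2) Z_iter_regular[of "split_step s"]
    by linarith
qed

lemma u0L: "u0 \<in> L2" using u0 by (simp add: regular_def)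

text \<open>\<open>r = dt\<close> is allowed and gives the state after the Burgers substep but
  before \<open>X\<close>, which \<open>split_path\<close> itself never shows: at that moment it is
  already the next \<open>Z_iter\<close>.\<close>

lemma glue_step:
  assumes d: "duhamel u0 split_clock split_square (real n * dt) (real n * dt) (Z_iter n)" and r: "0 \<le> r" "r \<le> dt"
  shows "duhamel u0 split_clock split_square (real n * dt + r) (real n * dt) (burgers_path (Z_iter n) r)"
proof (rule duhamel_glue[OF d burgers_path_props(4)[OF conjunct1[OF Z_iter_regular] r(1)] u0L])
  show "0 \<le> real n * dt" "0 \<le> real n * dt" using dt by auto
  show "0 \<le> r" by (rule r)
  show "split_clock s \<le> real n * dt" if "s \<in> {0..real n * dt}" for s
    using that dt by (intro split_clock_le) (auto simp: algebra_simps)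
  fix s assume s: "s \<in> {0..<r}"
  then have k: "split_step (real n * dt + s) = n" using r by (intro split_step_eq) auto
  show "split_clock (real n * dt + s) = real n * dt" by (simp add: split_clock_def k)
  then show "split_square (real n * dt + s) = (\<lambda>x. (burgers_path (Z_iter n) s x)\<^sup>2)"
    by (simp add: split_path_def k)
qed

lemma glue_mu:
  assumes d: "duhamel u0 split_clock split_square (real n * dt) (real n * dt) (Z_iter n)" and r: "0 \<le> r" "r \<le> dt"
      and p: "p \<ge> 0"
  shows "duhamel u0 split_clock split_square (real n * dt + r) (real n * dt + p) (Tm (mu p) (burgers_path (Z_iter n) r))"
proof (rule duhamel_mu[OF glue_step[OF d r] u0L _ _ _ p])
  show "0 \<le> real n * dt + r" "0 \<le> real n * dt" using dt r by auto
  show "split_clock s \<le> real n * dt" if "s \<in> {0..<real n * dt + r}" for s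
    using that r dt by (intro split_clock_le) (auto simp: algebra_simps)
qed

text \<open>Induction over steps: a full Burgers substep is glued on, then \<open>X\<close> runs for
  \<open>dt\<close>, which brings both clocks to the next grid time.\<close>

lemma Z_iter_dh: "duhamel u0 split_clock split_square (real n * dt) (real n * dt) (Z_iter n)"
proof (induct n)
  case 0
  then show ?case using duhamel_0_intro[OF u0L] by (simp add: Z_iter_def)
next
  case (Suc n)
  have dt0: "0 \<le> dt" using dt by simp
  note Y = burgers_path_props[OF conjunct1[OF Z_iter_regular[of n]] dt0]
  have "duhamel u0 split_clock split_square (real n * dt + dt) (real n * dt + dt) (Tm (mu dt) (burgers_path (Z_iter n) dt))"
    by (rule glue_mu[OF Suc dt0 order_refl dt0])
  then have "duhamel u0 split_clock split_square (real n * dt + dt) (real n * dt + dt) (Z_iter (Suc n))"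
    unfolding Z_iter_Suc by (rule duhamel_cong_AE) (use X_flow_L2[OF dt0 Y(1)] in \<open>auto dest: L2_measurable\<close>)
  then show ?case by (simp add: algebra_simps)
qed

text \<open>The second form completes the missing transport \<open>s - split_clock s\<close>, so
  that splitting and exact solution are compared at equal clocks.\<close>

lemma split_path_dh: assumes "s \<ge> 0"
  shows "duhamel u0 split_clock split_square s (split_clock s) (split_path s)" "duhamel u0 split_clock split_square s s (Tm (mu (s - split_clock s)) (split_path s))"
proof -
  note b = split_clock_bounds[OF assms]
  have r: "0 \<le> s - split_clock s" "s - split_clock s \<le> dt" using b by auto
  show "duhamel u0 split_clock split_square s (split_clock s) (split_path s)"
    using glue_step[OF Z_iter_dh[of "split_step s"] r] by (simp add: split_path_def[symmetric] split_clock_def[symmetric])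
  show "duhamel u0 split_clock split_square s s (Tm (mu (s - split_clock s)) (split_path s))"
    using glue_mu[OF Z_iter_dh[of "split_step s"] r r(1)] by (simp add: split_path_def[symmetric] split_clock_def[symmetric])
qed

lemma Z_iter_zz: "AE x in lborel. split_path (real n * dt) x = Z_iter n x"
proof -
  have k: "split_step (real n * dt) = n" using split_step_eq[of 0 n] dt by simp
  have "mild 0 (Z_iter n) (burgers_path (Z_iter n))" by (rule burgers_path_mild[OF conjunct1[OF Z_iter_regular]])
  then show ?thesis by (simp add: split_path_def k split_clock_def mild_def)
qed

end

text \<open>The constants are fixed before the data, from \<open>T\<close> and \<open>R\<close>; the
  exact solution is an arbitrary mild one. Stability is \<open>duhamel_regularity\<close> for the
  path. For the error, the synchronised path \<open>E\<close> satisfies the exact Duhamel formula up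
  to a forcing error of order \<open>dt\<close>, and Gronwall applies to \<open>E - u\<close>; at
  grid times \<open>E\<close> is the splitting.\<close>

lemma splitting_estimates:
  assumes T: "T > 0" and R: "R \<ge> 0"
  shows "\<exists>C\<ge>1. \<exists>D\<ge>0. \<forall>u0 B0 u dt n. u0 \<in> L2 \<and> L2_norm u0 \<le> R \<and> B0 \<ge> 0 \<and> (\<forall>k. L2_norm (fd k u0) \<le> \<bar>k\<bar> * B0) \<and>
      mild 1 u0 u \<and> dt > 0 \<and> real n * dt \<le> T \<longrightarrow>
      (Z_flow dt ^^ n) u0 \<in> L2 \<and> L2_norm ((Z_flow dt ^^ n) u0) \<le> L2_norm u0 \<and>
      (\<forall>j\<in>{1,2}. \<forall>k. L2_norm ((fd k ^^ j) ((Z_flow dt ^^ n) u0)) \<le> C * L2_norm ((fd k ^^ j) u0)) \<and>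
      u (real n * dt) \<in> L2 \<and>
      L2_norm (\<lambda>x. (Z_flow dt ^^ n) u0 x - u (real n * dt) x) \<le> D * L2_norm u0 * B0 * dt"
proof -
  obtain C where C: "C \<ge> 1"
    and reg: "\<forall>u0 \<theta> c z. u0 \<in> L2 \<longrightarrow> (\<forall>s\<in>{0..T}. 0 \<le> c s \<and> c s \<le> 1 \<and> L2_norm (z s) \<le> R \<and> duhamel u0 \<theta> (\<lambda>s x. c s * (z s x)\<^sup>2) s (\<theta> s) (z s)) \<longrightarrow>
    (\<forall>t\<in>{0..T}. \<forall>j\<in>{1,2}. \<forall>k. L2_norm ((fd k ^^ j) (z t)) \<le> C * L2_norm ((fd k ^^ j) u0))"
    using duhamel_regularity[OF T R] by (elim exE conjE)
  define \<epsilon> where "\<epsilon> = 1 / (4 * R + 1)"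
  have e: "\<epsilon> > 0" "\<epsilon> * (2 * R) \<le> 1" "\<epsilon> \<le> 1" using R
    by (auto simp: \<epsilon>_def field_simps)
  obtain l where l: "l > 0" "small_weight T \<epsilon> l" using small_weight_exists[OF T e(1)] by blast
  \<comment> \<open>From \<open>gronwall_sup\<close>: twice \<open>A\<close>, which is
    \<open>6 * N * B * dt * exp (l * T)\<close> with \<open>B = C * B0\<close>, times another
    \<open>exp (l * T)\<close>.\<close>
  define D where "D = 12 * C * exp (l * T) * exp (l * T)"
  have D: "D \<ge> 0" using C by (simp add: D_def)
  have main: "(Z_flow dt ^^ n) u0 \<in> L2 \<and> L2_norm ((Z_flow dt ^^ n) u0) \<le> L2_norm u0 \<and>
      (\<forall>j\<in>{1,2}. \<forall>k. L2_norm ((fd k ^^ j) ((Z_flow dt ^^ n) u0)) \<le> C * L2_norm ((fd k ^^ j) u0)) \<and>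
      u (real n * dt) \<in> L2 \<and>
      L2_norm (\<lambda>x. (Z_flow dt ^^ n) u0 x - u (real n * dt) x) \<le> D * L2_norm u0 * B0 * dt"
    if h0: "u0 \<in> L2" and u0R: "L2_norm u0 \<le> R"
      and B0: "B0 \<ge> 0" "\<And>k. L2_norm (fd k u0) \<le> \<bar>k\<bar> * B0"
      and u: "mild 1 u0 u" and dt: "dt > 0" and n: "real n * dt \<le> T" for u0 B0 u dt n
  proof -
    have u0r: "regular u0" using h0 B0 by (auto simp: regular_def)
    interpret splitting u0 dt by unfold_locales (rule u0r, rule dt)
    define N where "N = L2_norm u0"
    have N: "0 \<le> N" "N \<le> R" using u0R by (auto simp: N_def)
    have zN: "L2_norm (split_path s) \<le> N" if "s \<ge> 0" for s using split_path_regular(3)[OF that] by (simp add: N_def)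
    have zreg: "\<forall>t\<in>{0..T}. \<forall>j\<in>{1,2}. \<forall>k. L2_norm ((fd k ^^ j) (split_path t)) \<le> C * L2_norm ((fd k ^^ j) u0)"
    proof (rule reg[THEN spec[of _ u0], THEN spec[of _ split_clock], THEN spec[of _ "\<lambda>s. 1"], THEN spec[of _ split_path], THEN mp, THEN mp])
      show "u0 \<in> L2" by (rule h0)
      show "\<forall>s\<in>{0..T}. 0 \<le> (1::real) \<and> (1::real) \<le> 1 \<and> L2_norm (split_path s) \<le> R \<and> duhamel u0 split_clock (\<lambda>s x. 1 * (split_path s x)\<^sup>2) s (split_clock s) (split_path s)"
        using order_trans[OF zN N(2)] split_path_dh(1) by auto
    qed
    define B where "B = C * B0"
    have B: "B \<ge> 0" using C B0 by (simp add: B_def)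
    have zB: "L2_norm (fd k (split_path s)) \<le> \<bar>k\<bar> * B" if "s \<in> {0..T}" for s k
    proof -
      have "C * L2_norm (fd k u0) \<le> C * (\<bar>k\<bar> * B0)" using C B0 by (intro mult_left_mono) auto
      then show ?thesis using zreg[rule_format, OF that, of 1 k] by (simp add: B_def mult_ac)
    qed
    have nT: "real n * dt \<in> {0..T}" using n dt by simp
    have ZL: "Z_iter n \<in> L2" using Z_iter_regular[of n] by (simp add: regular_def)
    have p1: "L2_norm (Z_iter n) \<le> L2_norm u0" using Z_iter_regular[of n] by simp
    have p2: "L2_norm ((fd k ^^ j) (Z_iter n)) \<le> C * L2_norm ((fd k ^^ j) u0)" if "j \<in> {1,2}" for j k
      using zreg[rule_format, OF nT that, of k] L2_norm_fdn_cong_AE[OF split_path_regular(2) ZL Z_iter_zz, where k=k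
      and j=j] dt by simp
    have uc: "continuous_in_L2 u" using u by (simp add: mild_def)
    have uL: "u s \<in> L2" if "s \<ge> 0" for s by (rule continuous_in_L2_L2[OF uc that])
    have uN: "L2_norm (u s) \<le> N" if "s \<ge> 0" for s
      unfolding N_def by (rule mild_energy[OF u h0 B0(2,1) _ _ that]) auto
    have ud: "duhamel u0 (\<lambda>s. s) (\<lambda>s x. (u s x)\<^sup>2) s s (u s)" if "s \<ge> 0" for s
      using mild_dh[OF u h0 _ that] by simp
    define E where "E s = Tm (mu (s - split_clock s)) (split_path s)" for s
    have EL: "E s \<in> L2" "L2_norm (E s) \<le> N" if "s \<ge> 0" for s
      unfolding E_def
      using real_distribution.L2_Tm[OF rd_mu split_path_regular(2)[OF that], of "s - split_clock s"] zN[OF that] by auto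
    have fi: "integrable lborel (\<lambda>x. (split_path s x)\<^sup>2)" if "s \<ge> 0" for s
      by (rule L2_integrable_sq[OF split_path_regular(2)[OF that]])
    have Ed: "duhamel u0 (\<lambda>s. s) (\<lambda>s. Tm (mu (s - split_clock s)) (\<lambda>x. (split_path s x)\<^sup>2)) s s (E s)" if "s \<ge> 0" for s
      unfolding E_def by (rule duhamel_shift_forcing[OF split_path_dh(2)[OF that]]) (use split_clock_bounds fi in auto)
    \<comment> \<open>The first term collects the delay: \<open>8 * N * B * dt\<close> for
      transporting the square and \<open>4 * N * B * dt\<close> for replacing
      \<open>split_path s\<close> by \<open>E s\<close>. The second is the true difference, absorbed
      by Gronwall.\<close>
    have forcing: "L1_norm (\<lambda>x. Tm (mu (s - split_clock s)) (\<lambda>x. (split_path s x)\<^sup>2) x - (u s x)\<^sup>2) \<le> 12 * N * B * dt + 2 * R * L2_norm (\<lambda>x. E s x - u s x)"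
      if s: "s \<in> {0..T}" for s
    proof -
      have s0: "s \<ge> 0" using s by simp
      define r where "r = s - split_clock s"
      have r: "0 \<le> r" "r \<le> dt" using split_clock_bounds[OF s0] by (auto simp: r_def)
      let ?z2 = "\<lambda>x. (split_path s x)\<^sup>2"
      have m2: "2 * r \<le> 2 * dt" using r by simp
      note zL = split_path_regular(2)[OF s0]
      have tz: "integrable lborel (Tm (mu r) ?z2)" by (rule real_distribution.L1_Tm(1)[OF rd_mu fi[OF s0]])
      have i: "integrable lborel (\<lambda>x. (E s x)\<^sup>2)" "integrable lborel (\<lambda>x. (u s x)\<^sup>2)"
        by (intro L2_integrable_sq EL uL s0)+
      have a1: "L1_norm (\<lambda>x. Tm (mu r) ?z2 x - ?z2 x) \<le> (2 * dt) * (4 * N * B)"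
      proof (rule order_trans[OF real_distribution.Tm_near_L1[OF rd_mu fi[OF s0] _ _ mu_moment'[OF r(1)],
        where B="4 * N * B"]])
        fix k
        have "L1_norm (fd k ?z2) \<le> 4 * L2_norm (split_path s) * L2_norm (fd k (split_path s))"
          using fd_square_L1[OF zL, of 1 k] by simp
        also have "\<dots> \<le> 4 * N * (\<bar>k\<bar> * B)" using zN[OF s0] zB[OF s, of k] N by (intro mult_mono) auto
        finally show "L1_norm (fd k ?z2) \<le> \<bar>k\<bar> * (4 * N * B)" by (simp add: mult_ac)
      next
        show "0 \<le> 4 * N * B" using N B by simp
        then show "2 * r * (4 * N * B) \<le> 2 * dt * (4 * N * B)" using m2 by (intro mult_right_mono)
      qed
      have a2: "L1_norm (\<lambda>x. ?z2 x - (E s x)\<^sup>2) \<le> (2 * dt * B) * (N + N)"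
      proof -
        have "L2_norm (\<lambda>x. E s x - split_path s x) \<le> 2 * r * B" unfolding E_def r_def[symmetric]
          by (rule real_distribution.Tm_near[OF rd_mu zL zB[OF s] B mu_moment'[OF r(1)]])
        also have "\<dots> \<le> 2 * dt * B" using m2 B by (intro mult_right_mono)
        finally have d: "L2_norm (\<lambda>x. split_path s x - E s x) \<le> 2 * dt * B"
          by (simp add: L2_norm_diff_commute[of "split_path s"])
        have "L1_norm (\<lambda>x. ?z2 x - (E s x)\<^sup>2) \<le> L2_norm (\<lambda>x. split_path s x - E s x) * (L2_norm (split_path s) + L2_norm (E s))"
          by (rule L1_norm_square_diff[OF zL EL(1)[OF s0]])
        also have "\<dots> \<le> (2 * dt * B) * (N + N)" using d zN[OF s0] EL(2)[OF s0] dt B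
          by (intro mult_mono add_mono) auto
        finally show ?thesis .
      qed
      have a3: "L1_norm (\<lambda>x. (E s x)\<^sup>2 - (u s x)\<^sup>2) \<le> L2_norm (\<lambda>x. E s x - u s x) * (R + R)"
      proof -
        have "L1_norm (\<lambda>x. (E s x)\<^sup>2 - (u s x)\<^sup>2) \<le> L2_norm (\<lambda>x. E s x - u s x) * (L2_norm (E s) + L2_norm (u s))"
          by (rule L1_norm_square_diff[OF EL(1)[OF s0] uL[OF s0]])
        also have "\<dots> \<le> L2_norm (\<lambda>x. E s x - u s x) * (R + R)"
          using EL(2)[OF s0] uN[OF s0] N by (intro mult_left_mono add_mono) auto
        finally show ?thesis .
      qed
      have "L1_norm (\<lambda>x. Tm (mu r) ?z2 x - (u s x)\<^sup>2) \<le> L1_norm (\<lambda>x. Tm (mu r) ?z2 x - ?z2 x) + L1_norm (\<lambda>x. ?z2 x - (u s x)\<^sup>2)"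
        using L1_norm_triangle[of "\<lambda>x. Tm (mu r) ?z2 x - ?z2 x" "\<lambda>x. ?z2 x - (u s x)\<^sup>2"] tz fi[OF s0] i
        by simp
      moreover have "L1_norm (\<lambda>x. ?z2 x - (u s x)\<^sup>2) \<le> L1_norm (\<lambda>x. ?z2 x - (E s x)\<^sup>2) + L1_norm (\<lambda>x. (E s x)\<^sup>2 - (u s x)\<^sup>2)"
        using L1_norm_triangle[of "\<lambda>x. ?z2 x - (E s x)\<^sup>2" "\<lambda>x. (E s x)\<^sup>2 - (u s x)\<^sup>2"] fi[OF s0] i by simp
      ultimately have "L1_norm (\<lambda>x. Tm (mu r) ?z2 x - (u s x)\<^sup>2) \<le> (2 * dt) * (4 * N * B) + (2 * dt * B) * (N + N) + L2_norm (\<lambda>x. E s x - u s x) * (R + R)"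
        using a1 a2 a3 by linarith
      also have "\<dots> = 12 * N * B * dt + 2 * R * L2_norm (\<lambda>x. E s x - u s x)" by (simp add: algebra_simps)
      finally show ?thesis by (simp add: r_def)
    qed
    define A where "A = 1/2 * (12 * N * B * dt) * exp (l * T)"
    have A: "A \<ge> 0" using N B dt by (simp add: A_def)
    have "L2_norm (\<lambda>x. E (real n * dt) x - u (real n * dt) x) \<le> 2 * A * exp (l * (real n * dt))"
    proof (rule gronwall_sup[where q="\<lambda>t. L2_norm (\<lambda>x. E t x - u t x)" and T=T
      and Bd="N + N", OF _ _ _ A _ nT])
      show "L2_norm (\<lambda>x. E t x - u t x) \<le> N + N" if "t \<in> {0..T}" for t
        using L2_norm_triangle_diff[OF EL(1) uL, of t t] EL(2)[of t] uN[of t] that by simp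
      fix M t assume M: "M \<ge> 0" "\<And>s. s \<in> {0..T} \<Longrightarrow> L2_norm (\<lambda>x. E s x - u s x) \<le> M * exp (l * s)" and t: "t \<in> {0..T}"
      have t0: "t \<ge> 0" using t by simp
      have "L2_norm (\<lambda>x. E t x - u t x) \<le> 1/2 * (\<epsilon> * (12 * N * B * dt + 2 * R * M) * exp (l * t))"
      proof (rule duhamel_diff[OF Ed[OF t0] ud[OF t0] l(2) t])
        fix s assume s: "s \<in> {0..t}"
        then have sT: "s \<in> {0..T}" "s \<ge> 0" using t by auto
        show "integrable lborel (Tm (mu (s - split_clock s)) (\<lambda>x. (split_path s x)\<^sup>2))"
          by (rule real_distribution.L1_Tm(1)[OF rd_mu fi[OF sT(2)]])
        show "integrable lborel (\<lambda>x. (u s x)\<^sup>2)" by (rule L2_integrable_sq[OF uL[OF sT(2)]])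
        have "L1_norm (\<lambda>x. Tm (mu (s - split_clock s)) (\<lambda>x. (split_path s x)\<^sup>2) x - (u s x)\<^sup>2) \<le> 12 * N * B * dt * 1 + 2 * R * (M * exp (l * s))"
          using forcing[OF sT(1)] mult_left_mono[OF M(2)[OF sT(1)], of "2 * R"] R by simp
        also have "\<dots> \<le> 12 * N * B * dt * exp (l * s) + 2 * R * (M * exp (l * s))"
          using N B dt l sT by (intro add_right_mono mult_left_mono) auto
        finally show "L1_norm (\<lambda>x. Tm (mu (s - split_clock s)) (\<lambda>x. (split_path s x)\<^sup>2) x - (u s x)\<^sup>2) \<le> (12 * N * B * dt + 2 * R * M) * exp (l * s)"
          by (simp add: algebra_simps)
      qed (use N B dt R M e in auto)
      also have "\<dots> = 1/2 * (\<epsilon> * (12 * N * B * dt) * exp (l * t)) + 1/2 * ((\<epsilon> * (2 * R)) * (M * exp (l * t)))" by (simp add: algebra_simps)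
      also have "\<dots> \<le> 1/2 * (1 * (12 * N * B * dt) * exp (l * T)) + 1/2 * (1 * (M * exp (l * t)))"
        using e N B dt M t l by (intro add_mono mult_left_mono mult_mono mult_right_mono) auto
      also have "\<dots> = A + 1/2 * (M * exp (l * t))" by (simp add: A_def)
      finally show "L2_norm (\<lambda>x. E t x - u t x) \<le> A + 1/2 * (M * exp (l * t))" .
    qed (use l in auto)
    also have "\<dots> \<le> 2 * A * exp (l * T)" using A l nT by (intro mult_left_mono) auto
    also have "\<dots> = D * N * B0 * dt" by (simp add: A_def B_def D_def)
    finally have err: "L2_norm (\<lambda>x. E (real n * dt) x - u (real n * dt) x) \<le> D * N * B0 * dt" .
    have n0: "real n * dt \<ge> 0" using dt by simp
    have EZ: "AE x in lborel. Z_iter n x - u (real n * dt) x = E (real n * dt) x - u (real n * dt) x"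
    proof -
      have "E (real n * dt) = split_path (real n * dt)"
        unfolding E_def split_clock_mult using L2_measurable[OF split_path_regular(2)[OF n0]] by (simp add: mu_0 Tm_return)
      then show ?thesis using Z_iter_zz[of n] by auto
    qed
    have "L2_norm (\<lambda>x. Z_iter n x - u (real n * dt) x) = L2_norm (\<lambda>x. E (real n * dt) x - u (real n * dt) x)"
      by (rule L2_norm_cong_AE[OF L2_measurable[OF L2_diff[OF ZL uL[OF n0]]] L2_measurable[OF L2_diff[OF EL(1)[OF n0] uL[OF n0]]] EZ])
    then have "L2_norm (\<lambda>x. Z_iter n x - u (real n * dt) x) \<le> D * L2_norm u0 * B0 * dt" using err
      by (simp add: N_def)
    then show ?thesis using ZL p1 p2 uL[OF n0] unfolding Z_iter_def by blast
  qed
  show ?thesis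
    by (rule exI[of _ C], intro conjI C, rule exI[of _ D], intro conjI D) (use main in blast)
qed

section \<open>Difference quotients and weak derivatives\<close>

text \<open>Finite levels permit induction along \<open>deriv\<close>, which the condition at all
  orders in \<open>test_function\<close> does not. The index is shifted: \<open>Ck k\<close> asks
  for \<open>k + 1\<close> derivatives.\<close>

definition Ck :: "nat \<Rightarrow> (real \<Rightarrow> real) \<Rightarrow> bool" where
  "Ck k f \<longleftrightarrow> (\<forall>i\<le>k. \<forall>x. (deriv ^^ i) f differentiable (at x))"

lemma differentiable_DERIV: "f differentiable (at x) \<Longrightarrow> (f has_real_derivative deriv f x) (at x)"
  by (simp add: DERIV_deriv_iff_real_differentiable)

lemma Ck_0: "Ck 0 f \<longleftrightarrow> (\<forall>x. f differentiable (at x))" by (simp add: Ck_def)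

lemma Ck_Suc: "Ck (Suc k) f \<longleftrightarrow> (\<forall>x. f differentiable (at x)) \<and> Ck k (deriv f)"
proof -
  have "Ck (Suc k) f \<longleftrightarrow> (\<forall>x. f differentiable (at x)) \<and> (\<forall>i\<le>k. \<forall>x. (deriv ^^ Suc i) f differentiable (at x))"
    unfolding Ck_def by (metis Suc_le_mono funpow_0 le0 not0_implies_Suc)
  then show ?thesis by (simp add: Ck_def funpow_swap1)
qed

lemma Ck_diff: "Ck k f \<Longrightarrow> f differentiable (at x)"
  by (cases k) (auto simp: Ck_0 Ck_Suc)

lemma deriv_add_fun: "(\<And>x. f differentiable (at x)) \<Longrightarrow> (\<And>x. g differentiable (at x)) \<Longrightarrow> deriv (\<lambda>x. f x + g x) = (\<lambda>x. deriv f x + deriv g (x::real) :: real)"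
  by (rule ext, rule DERIV_imp_deriv) (auto intro!: derivative_eq_intros differentiable_DERIV)

lemma deriv_mult_fun: "(\<And>x. f differentiable (at x)) \<Longrightarrow> (\<And>x. g differentiable (at x)) \<Longrightarrow> deriv (\<lambda>x. f x * g x) = (\<lambda>x. deriv f x * g x + f x * deriv g (x::real) :: real)"
  by (rule ext, rule DERIV_imp_deriv) (auto intro!: derivative_eq_intros differentiable_DERIV)

lemma Ck_add: "Ck k f \<Longrightarrow> Ck k g \<Longrightarrow> Ck k (\<lambda>x. f x + g x)"
proof (induct k arbitrary: f g)
  case (Suc k)
  then show ?case using Suc.hyps[of "deriv f" "deriv g"] by (simp add: Ck_Suc deriv_add_fun)
qed (simp add: Ck_0)

lemma Ck_le: "Ck (Suc k) f \<Longrightarrow> Ck k f" by (simp add: Ck_def)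

lemma Ck_mult: "Ck k f \<Longrightarrow> Ck k g \<Longrightarrow> Ck k (\<lambda>x. f x * g x)"
proof (induct k arbitrary: f g)
  case (Suc k)
  have "Ck k (\<lambda>x. deriv f x * g x + f x * deriv g x)"
    using Suc Ck_le by (intro Ck_add Suc.hyps) (auto simp: Ck_Suc)
  then show ?case using Suc by (simp add: Ck_Suc deriv_mult_fun)
qed (simp add: Ck_0)

lemma Ck_const: "Ck k (\<lambda>x. c)"
proof (induct k arbitrary: c)
  case (Suc k) then show ?case by (simp add: Ck_Suc)
qed (simp add: Ck_0)

lemma Ck_cmult: "Ck k f \<Longrightarrow> Ck k (\<lambda>x. c * f x)"
  by (rule Ck_mult[OF Ck_const])

lemma Ck_affine: "Ck k f \<Longrightarrow> Ck k (\<lambda>x. f (c * x + d))"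
proof (induct k arbitrary: f)
  case 0
  have "(\<lambda>x. f (c * x + d)) differentiable (at x)" for x
    using 0 by (intro differentiable_compose[of f "\<lambda>x. c * x + d"]) (auto simp: Ck_0)
  then show ?case by (simp add: Ck_0)
next
  case (Suc k)
  have d: "((\<lambda>x. f (c * x + d)) has_real_derivative c * deriv f (c * x + d)) (at x)" for x
  proof -
    have "(f has_real_derivative deriv f (c * x + d)) (at (c * x + d))" using Suc(2)
      by (intro differentiable_DERIV) (simp add: Ck_Suc)
    moreover have "((\<lambda>x. c * x + d) has_real_derivative c) (at x)" by (auto intro!: derivative_eq_intros)
    ultimately have "((\<lambda>x. f (c * x + d)) has_real_derivative deriv f (c * x + d) * c) (at x)" by (rule DERIV_chain2)
    then show ?thesis by (simp only: mult.commute)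
  qed
  then have "deriv (\<lambda>x. f (c * x + d)) = (\<lambda>x. c * deriv f (c * x + d))" using DERIV_imp_deriv by blast
  moreover have "Ck k (\<lambda>x. c * deriv f (c * x + d))" using Suc by (intro Ck_cmult Suc.hyps) (simp add: Ck_Suc)
  ultimately show ?case using d unfolding Ck_Suc by (auto simp: real_differentiable_def)
qed

section \<open>A smooth function that is flat at the origin\<close>

lemma power_le_fact_exp: fixes z :: real assumes "z \<ge> 0" shows "z ^ m \<le> fact m * exp z"
proof -
  have "(\<Sum>n\<in>{m}. z ^ n /\<^sub>R fact n) \<le> exp z"
    unfolding exp_def using assms by (intro sum_le_suminf summable_exp_generic) auto
  then show ?thesis by (simp add: field_simps)
qed

text \<open>The powers of \<open>x\<close> in the denominator make the linear span of the family
  closed under differentiation (\<open>bump_DERIV\<close>), so smoothness is an induction on the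
  order.\<close>

definition bump :: "nat \<Rightarrow> real \<Rightarrow> real" where
  "bump n x = (if x > 0 then exp (- (1/x)) / x ^ n else 0)"

text \<open>The exponential series at \<open>1/y\<close> beats every power of \<open>1/y\<close>;
  one extra order gives linear decay at 0, hence the derivative 0 there in
  \<open>bump_DERIV\<close>.\<close>

lemma bump_le: "\<bar>bump (Suc n) y\<bar> \<le> fact (Suc (Suc n)) * \<bar>y\<bar>"
proof (cases "y > 0")
  case True
  have "(1/y) ^ Suc (Suc n) \<le> fact (Suc (Suc n)) * exp (1/y)" using True by (intro power_le_fact_exp) simp
  then have "(1/y) ^ Suc (Suc n) * exp (-(1/y)) \<le> fact (Suc (Suc n)) * exp (1/y) * exp (-(1/y))"
    by (rule mult_right_mono) simp
  also have "\<dots> = fact (Suc (Suc n))" by (simp add: exp_minus)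
  finally have "(1/y) ^ Suc (Suc n) * exp (-(1/y)) * y \<le> fact (Suc (Suc n)) * y" using True
    by (intro mult_right_mono) auto
  moreover have "(1/y) ^ Suc (Suc n) * exp (-(1/y)) * y = bump (Suc n) y" using True by (simp add: bump_def field_simps)
  moreover have "bump (Suc n) y \<ge> 0" using True by (simp add: bump_def)
  ultimately show ?thesis using True by (simp only: abs_of_nonneg abs_of_pos)
next
  case False
  then have "bump (Suc n) y = 0" by (simp add: bump_def)
  then show ?thesis by (simp only: abs_zero) (intro mult_nonneg_nonneg abs_ge_zero fact_ge_zero)
qed

lemma bump_DERIV: "(bump n has_real_derivative bump (Suc (Suc n)) x - real n * bump (Suc n) x) (at x)"
proof -
  consider "x > 0" | "x < 0" | "x = 0" by linarith
  then show ?thesis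
  proof cases
    case 1
    have "((\<lambda>x. exp (- (1/x)) / x ^ n) has_real_derivative bump (Suc (Suc n)) x - real n * bump (Suc n) x) (at x)"
      using 1 by (auto intro!: derivative_eq_intros simp: bump_def) (cases n; simp add: field_simps power2_eq_square)
    then show ?thesis
      by (rule has_field_derivative_transform_within_open[of _ _ _ "{0<..}"]) (use 1 in \<open>auto simp: bump_def\<close>)
  next
    case 2
    have "((\<lambda>x. 0) has_real_derivative bump (Suc (Suc n)) x - real n * bump (Suc n) x) (at x)" using 2
      by (simp add: bump_def)
    then show ?thesis
      by (rule has_field_derivative_transform_within_open[of _ _ _ "{..<0}"]) (use 2 in \<open>auto simp: bump_def\<close>)
  next
    case 3
    have "((\<lambda>y. (bump n y - bump n 0) / (y - 0)) \<longlongrightarrow> 0) (at 0)"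
    proof (rule Lim_null_comparison)
      have "((\<lambda>y::real. fact (Suc (Suc n)) * \<bar>y\<bar>) \<longlongrightarrow> fact (Suc (Suc n)) * \<bar>0\<bar>) (at 0)" by (intro tendsto_intros)
      then show "((\<lambda>y::real. fact (Suc (Suc n)) * \<bar>y\<bar>) \<longlongrightarrow> 0) (at 0)" by simp
      have "norm ((bump n y - bump n 0) / (y - 0)) \<le> fact (Suc (Suc n)) * \<bar>y\<bar>" for y
      proof -
        have "(bump n y - bump n 0) / (y - 0) = bump (Suc n) y" by (simp add: bump_def field_simps)
        then show ?thesis using bump_le[of n y] by simp
      qed
      then show "\<forall>\<^sub>F y in at 0. norm ((bump n y - bump n 0) / (y - 0)) \<le> fact (Suc (Suc n)) * \<bar>y\<bar>" by simp
    qed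
    then show ?thesis using 3 by (simp add: has_field_derivative_iff bump_def)
  qed
qed

lemma Ck_bump: "Ck k (bump n)"
proof (induct k arbitrary: n)
  case 0 then show ?case using bump_DERIV by (auto simp: Ck_0 real_differentiable_def)
next
  case (Suc k)
  have "deriv (bump n) = (\<lambda>x. bump (Suc (Suc n)) x + (- real n) * bump (Suc n) x)"
    using DERIV_imp_deriv[OF bump_DERIV] by auto
  moreover have "Ck k (\<lambda>x. bump (Suc (Suc n)) x + (- real n) * bump (Suc n) x)" by (intro Ck_add Ck_cmult Suc)
  ultimately have "Ck k (deriv (bump n))" by (simp only:)
  then show ?case using bump_DERIV unfolding Ck_Suc real_differentiable_def by blast
qed

section \<open>Test functions and their pairings\<close>

lemma test_function_iff: "test_function \<phi> \<longleftrightarrow> (\<forall>k. Ck k \<phi>) \<and> (\<exists>M. \<forall>x. \<bar>x\<bar> > M \<longrightarrow> \<phi> x = 0)"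
proof -
  have "compact (closure {x. \<phi> x \<noteq> 0}) \<longleftrightarrow> (\<exists>M. \<forall>x. \<bar>x\<bar> > M \<longrightarrow> \<phi> x = 0)"
    unfolding compact_closure bounded_iff by (auto simp: not_le) (meson not_le)+
  moreover have "(\<forall>k x. (deriv ^^ k) \<phi> differentiable (at x)) \<longleftrightarrow> (\<forall>k. Ck k \<phi>)"
    by (auto simp: Ck_def)
  ultimately show ?thesis by (simp add: test_function_def)
qed

lemma test_Ck: "test_function \<phi> \<Longrightarrow> Ck k \<phi>" by (simp add: test_function_iff)

lemma test_support: "test_function \<phi> \<Longrightarrow> \<exists>M\<ge>0. \<forall>x. \<bar>x\<bar> > M \<longrightarrow> \<phi> x = 0"
  unfolding test_function_iff by (metis abs_ge_zero abs_of_nonneg le_cases order_trans not_le)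

lemma test_zero: "test_function (\<lambda>x. 0)" by (auto simp: test_function_iff Ck_const)

lemma test_add: "test_function \<phi> \<Longrightarrow> test_function \<psi> \<Longrightarrow> test_function (\<lambda>x. \<phi> x + \<psi> x)"
proof -
  assume a: "test_function \<phi>" "test_function \<psi>"
  obtain M N where "\<forall>x. \<bar>x\<bar> > M \<longrightarrow> \<phi> x = 0" "\<forall>x. \<bar>x\<bar> > N \<longrightarrow> \<psi> x = 0" using a by (auto simp: test_function_iff)
  then have "\<forall>x. \<bar>x\<bar> > max M N \<longrightarrow> \<phi> x + \<psi> x = 0" by auto
  then show ?thesis using a unfolding test_function_iff by (blast intro: Ck_add)
qed

lemma test_cmult: "test_function \<phi> \<Longrightarrow> test_function (\<lambda>x. c * \<phi> x)"
  unfolding test_function_iff using Ck_cmult by (metis mult_zero_right)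

lemma test_deriv: assumes t: "test_function \<phi>" shows "test_function (deriv \<phi>)"
proof -
  obtain M where M: "\<forall>x. \<bar>x\<bar> > M \<longrightarrow> \<phi> x = 0" using t by (auto simp: test_function_iff)
  have "deriv \<phi> x = 0" if "\<bar>x\<bar> > M" for x
  proof (rule DERIV_imp_deriv)
    have "((\<lambda>x. 0) has_real_derivative 0) (at x)" by simp
    then show "(\<phi> has_real_derivative 0) (at x)"
    proof (rule has_field_derivative_transform_within_open[of _ _ _ "{x. \<bar>x\<bar> > M}"])
      show "open {x::real. \<bar>x\<bar> > M}" by (intro open_Collect_less continuous_intros)
    qed (use M that in auto)
  qed
  moreover have "Ck k (deriv \<phi>)" for k using test_Ck[OF t, of "Suc k"] by (simp add: Ck_Suc)
  ultimately show ?thesis unfolding test_function_iff by blast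
qed

lemma test_derivn: "test_function \<phi> \<Longrightarrow> test_function ((deriv ^^ j) \<phi>)"
  by (induct j) (auto intro: test_deriv)

lemma test_sh: assumes t: "test_function \<phi>" shows "test_function (sh k \<phi>)"
proof -
  obtain M where M: "\<forall>x. \<bar>x\<bar> > M \<longrightarrow> \<phi> x = 0" using t by (auto simp: test_function_iff)
  then have "\<forall>x. \<bar>x\<bar> > M + \<bar>k\<bar> \<longrightarrow> sh k \<phi> x = 0" by (auto simp: sh_def)
  moreover have "Ck n (sh k \<phi>)" for n using Ck_affine[OF test_Ck[OF t, of n], of 1 k] by (simp add: sh_def[abs_def])
  ultimately show ?thesis unfolding test_function_iff by blast
qed

lemma test_fd: assumes t: "test_function \<phi>" shows "test_function (fd k \<phi>)"
proof -
  have eq: "fd k \<phi> = (\<lambda>x. sh k \<phi> x + (-1) * \<phi> x)" by (auto simp: fd_def sh_def)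
  show ?thesis unfolding eq by (intro test_add test_sh test_cmult t)
qed

lemma test_continuous: "test_function \<phi> \<Longrightarrow> continuous_on UNIV \<phi>"
  using Ck_diff[OF test_Ck] by (intro continuous_at_imp_continuous_on) (auto intro: differentiable_imp_continuous_within)

lemma test_measurable: "test_function \<phi> \<Longrightarrow> \<phi> \<in> borel_measurable borel"
  by (intro borel_measurable_continuous_onI test_continuous)

lemma test_bounded: assumes t: "test_function \<phi>" shows "\<exists>S\<ge>0. \<forall>x. \<bar>\<phi> x\<bar> \<le> S"
proof -
  obtain M where M: "M \<ge> 0" "\<forall>x. \<bar>x\<bar> > M \<longrightarrow> \<phi> x = 0" using test_support[OF t]
    by blast
  have "compact (\<phi> ` {-M..M})" using continuous_on_subset[OF test_continuous[OF t]]
    by (intro compact_continuous_image) auto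
  then obtain S where S: "\<forall>x\<in>{-M..M}. \<bar>\<phi> x\<bar> \<le> S" using compact_imp_bounded
    by (fastforce simp: bounded_iff)
  have "\<bar>\<phi> x\<bar> \<le> max S 0" for x using M S
    by (cases "\<bar>x\<bar> > M") (auto simp: abs_le_iff not_less le_max_iff_disj)
  then show ?thesis by (intro exI[of _ "max S 0"]) auto
qed

lemma loc_integrable_test:
  assumes f: "loc_integrable f" and t: "test_function \<phi>"
  shows "integrable lborel (\<lambda>x. f x * \<phi> x)"
proof -
  obtain M where M: "\<forall>x. \<bar>x\<bar> > M \<longrightarrow> \<phi> x = 0" using test_support[OF t] by blast
  obtain S where S: "\<forall>x. \<bar>\<phi> x\<bar> \<le> S" using test_bounded[OF t] by blast
  have i: "integrable lborel (\<lambda>x. indicator {-M..M} x * f x)" using f unfolding loc_integrable_def set_integrable_def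
    by simp
  have "(\<lambda>x. f x * \<phi> x) = (\<lambda>x. (indicator {-M..M} x * f x) * \<phi> x)"
    using M by (force simp: indicator_def fun_eq_iff)
  then show ?thesis using L1_bdd_integrable(1)[OF i test_measurable[OF t], of S] S by simp
qed

lemma loc_integrable_measurable: assumes f: "loc_integrable f" shows "f \<in> borel_measurable borel"
proof (rule borel_measurable_LIMSEQ_real)
  show "(\<lambda>x. indicator {- real n..real n} x * f x) \<in> borel_measurable borel" for n
  proof -
    have "set_integrable lborel {- real n..real n} f" using f unfolding loc_integrable_def by blast
    then show ?thesis unfolding set_integrable_def by (auto dest: borel_measurable_integrable)
  qed
  fix x
  obtain N where N: "\<bar>x\<bar> \<le> real N" using real_arch_simple by blast
  show "(\<lambda>n. indicator {- real n..real n} x * f x) \<longlonglongrightarrow> f x"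
    by (rule tendsto_eventually, rule eventually_sequentiallyI[of N]) (use N in \<open>auto simp: indicator_def\<close>)
qed

lemma L2_indicator: "indicator {a..b::real} \<in> L2"
proof (rule L2I)
  have "(\<lambda>x. (indicator {a..b} x :: real)\<^sup>2) = indicator {a..b}" by (auto simp: indicator_def fun_eq_iff)
  moreover have "integrable lborel (indicator {a..b} :: real \<Rightarrow> real)"
    by (rule integrable_real_indicator) (auto simp: emeasure_lborel_Icc_eq)
  ultimately show "integrable lborel (\<lambda>x. (indicator {a..b} x :: real)\<^sup>2)" by (simp only:)
qed simp

lemma L2_loc_integrable: "f \<in> L2 \<Longrightarrow> loc_integrable f"
  unfolding loc_integrable_def set_integrable_def using L2_mult_integrable[OF L2_indicator] by simp

lemma test_L2: assumes t: "test_function \<phi>" shows "\<phi> \<in> L2"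
proof (rule L2I[OF test_measurable[OF t]])
  have "loc_integrable \<phi>" unfolding loc_integrable_def
    using continuous_on_subset[OF test_continuous[OF t]] by (auto intro: borel_integrable_atLeastAtMost')
  then show "integrable lborel (\<lambda>x. (\<phi> x)\<^sup>2)" using loc_integrable_test[OF _ t]
    by (simp add: power2_eq_square)
qed

section \<open>The fundamental lemma of the calculus of variations\<close>

lemma loc_integrable_diff: "loc_integrable f \<Longrightarrow> loc_integrable g \<Longrightarrow> loc_integrable (\<lambda>x. f x - g x)"
  unfolding loc_integrable_def by (auto intro: set_integral_diff(1))

text \<open>A product of two bumps at the ends of the interval, dilated by \<open>Suc n\<close>,
  vanishes outside it, lies between 0 and 1, and tends to 1 inside because the exponent tends to 0
  there; dominated convergence then gives the indicator.\<close>

lemma fundamental_interval: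
  assumes h: "loc_integrable h"
      and z: "\<And>\<phi>. test_function \<phi> \<Longrightarrow> (LINT x|lborel. h x * \<phi> x) = 0"
  shows "(LINT x|lborel. h x * indicator {a<..<b} x) = 0"
proof -
  have [measurable]: "h \<in> borel_measurable borel" by (rule loc_integrable_measurable[OF h])
  define \<phi>
    where "\<phi> n x = bump 0 (real (Suc n) * x + - real (Suc n) * a) * bump 0 ((- real (Suc n)) * x + real (Suc n) * b)"
      for n x
  have e: "real (Suc n) * x + - real (Suc n) * a = real (Suc n) * (x - a)" "(- real (Suc n)) * x + real (Suc n) * b = real (Suc n) * (b - x)" for n x
    by (auto simp: algebra_simps)
  have sup: "\<phi> n x = 0" if "x \<notin> {a<..<b}" for n x
    using that unfolding \<phi>_def e bump_def by (auto simp: zero_less_mult_iff not_less)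
  have t: "test_function (\<phi> n)" for n
    unfolding test_function_iff
  proof (intro conjI allI exI[of _ "max \<bar>a\<bar> \<bar>b\<bar>"] impI)
    show "Ck k (\<phi> n)" for k unfolding \<phi>_def by (intro Ck_mult Ck_affine Ck_bump)
    show "\<phi> n x = 0" if "max \<bar>a\<bar> \<bar>b\<bar> < \<bar>x\<bar>" for x by (rule sup) (use that in auto)
  qed
  have b01: "0 \<le> bump 0 y \<and> bump 0 y \<le> 1" for y by (simp add: bump_def)
  have phib: "\<bar>\<phi> n x\<bar> \<le> 1" for n x
  proof -
    have "\<phi> n x \<le> 1 * 1" unfolding \<phi>_def using b01 by (intro mult_mono) auto
    moreover have "\<phi> n x \<ge> 0" unfolding \<phi>_def using b01 by (intro mult_nonneg_nonneg) auto
    ultimately show ?thesis by simp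
  qed
  have bl: "(\<lambda>n. bump 0 (real (Suc n) * y)) \<longlonglongrightarrow> 1" if y: "y > 0" for y
  proof -
    have "(\<lambda>n. exp (- (inverse (real (Suc n)) * (1 / y)))) \<longlonglongrightarrow> exp (- (0 * (1 / y)))"
      by (intro tendsto_intros LIMSEQ_inverse_real_of_nat)
    moreover have "bump 0 (real (Suc n) * y) = exp (- (inverse (real (Suc n)) * (1 / y)))" for n
      using y by (simp add: bump_def divide_inverse)
    ultimately show ?thesis by (simp del: of_nat_Suc)
  qed
  have "(\<lambda>n. LINT x|lborel. h x * \<phi> n x) \<longlonglongrightarrow> (LINT x|lborel. h x * indicator {a<..<b} x)"
  proof (rule integral_dominated_convergence[where w="\<lambda>x. \<bar>indicator {a..b} x * h x\<bar>"])
    show "integrable lborel (\<lambda>x. \<bar>indicator {a..b} x * h x\<bar>)" using h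
      unfolding loc_integrable_def set_integrable_def by simp
    show "(\<lambda>x. h x * \<phi> n x) \<in> borel_measurable lborel" for n using test_measurable[OF t[of n]] by simp
    show "AE x in lborel. (\<lambda>n. h x * \<phi> n x) \<longlonglongrightarrow> h x * indicator {a<..<b} x"
    proof (rule AE_I2, rule tendsto_mult[OF tendsto_const])
      fix x
      show "(\<lambda>n. \<phi> n x) \<longlonglongrightarrow> indicator {a<..<b} x"
      proof (cases "x \<in> {a<..<b}")
        case True
        have "(\<lambda>n. bump 0 (real (Suc n) * (x - a)) * bump 0 (real (Suc n) * (b - x))) \<longlonglongrightarrow> 1 * 1"
          using True by (intro tendsto_mult bl) auto
        then show ?thesis using True unfolding \<phi>_def e by simp
      qed (simp add: sup)
    qed
    show "AE x in lborel. norm (h x * \<phi> n x) \<le> \<bar>indicator {a..b} x * h x\<bar>" for n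
    proof (rule AE_I2)
      fix x
      show "norm (h x * \<phi> n x) \<le> \<bar>indicator {a..b} x * h x\<bar>"
      proof (cases "x \<in> {a<..<b}")
        case True
        then show ?thesis using mult_left_mono[OF phib[of n x], of "\<bar>h x\<bar>"] by (simp add: abs_mult)
      qed (simp add: sup)
    qed
  qed simp
  then show ?thesis using z[OF t] by (simp add: LIMSEQ_const_iff)
qed

text \<open>On a bounded interval the positive and negative parts of \<open>h\<close> are densities
  of finite measures. They agree on half lines by \<open>fundamental_interval\<close>, hence
  everywhere, so the integrals of the restricted \<open>h\<close> over all Borel sets
  vanish.\<close>

lemma fundamental_lemma:
  assumes h: "loc_integrable h"
      and z: "\<And>\<phi>. test_function \<phi> \<Longrightarrow> (LINT x|lborel. h x * \<phi> x) = 0"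
  shows "AE x in lborel. h x = 0"
proof -
  have hm[measurable]: "h \<in> borel_measurable borel" by (rule loc_integrable_measurable[OF h])
  have "AE x in lborel. h x * indicator {- real N<..<real N} x = 0" for N
  proof -
    let ?f = "\<lambda>x. h x * indicator {- real N<..<real N} x"
    have i: "integrable lborel ?f"
    proof (rule Bochner_Integration.integrable_bound)
      show "integrable lborel (\<lambda>x. indicator {- real N..real N} x * h x)" using h
        unfolding loc_integrable_def set_integrable_def by simp
    qed (auto simp: indicator_def)
    let ?p = "\<lambda>x. max (?f x) 0" and ?m = "\<lambda>x. max (- ?f x) 0"
    have ip: "integrable lborel ?p" "integrable lborel ?m" using i by auto
    let ?P = "density lborel (\<lambda>x. ennreal (?p x))" and ?M = "density lborel (\<lambda>x. ennreal (?m x))"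
    have ie: "integrable lborel (\<lambda>x. g x * indicator A x)" if "integrable lborel g" "A \<in> sets borel"
      for g :: "real \<Rightarrow> real" and A
      using integrable_mult_indicator[OF _ that(1), of A] that(2) by (simp add: mult.commute)
    have em: "emeasure (density lborel (\<lambda>x. ennreal (g x))) A = ennreal (LINT x|lborel. g x * indicator A x)"
      if g: "integrable lborel g" "\<And>x. g x \<ge> 0" and A[measurable]: "A \<in> sets borel"
        for g :: "real \<Rightarrow> real" and A
    proof -
      have "emeasure (density lborel (\<lambda>x. ennreal (g x))) A = (\<integral>\<^sup>+x. ennreal (g x * indicator A x) \<partial>lborel)"
        using g by (subst emeasure_density) (auto intro!: nn_integral_cong simp: indicator_def)
      also have "\<dots> = ennreal (LINT x|lborel. g x * indicator A x)"
        using g ie[OF g(1) A] by (intro nn_integral_eq_integral) auto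
      finally show ?thesis .
    qed
    have dif: "(LINT x|lborel. ?p x * indicator A x) - (LINT x|lborel. ?m x * indicator A x) = (LINT x|lborel. ?f x * indicator A x)"
      if A: "A \<in> sets borel" for A
    proof -
      have "(LINT x|lborel. ?p x * indicator A x) - (LINT x|lborel. ?m x * indicator A x) = (LINT x|lborel. ?p x * indicator A x - ?m x * indicator A x)"
        by (rule Bochner_Integration.integral_diff[symmetric]) (intro ie ip A)+
      also have "\<dots> = (LINT x|lborel. ?f x * indicator A x)"
        by (intro Bochner_Integration.integral_cong) (auto simp: max_def left_diff_distrib[symmetric])
      finally show ?thesis .
    qed
    have "?P = ?M"
    proof (rule measure_eqI_lessThan)
      fix y :: real
      show "emeasure ?P {y<..} < \<infinity>" by (subst em[OF ip(1)]) auto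
      have "(LINT x|lborel. ?f x * indicator {y<..} x) = (LINT x|lborel. h x * indicator {max y (- real N)<..<real N} x)"
        by (intro Bochner_Integration.integral_cong) (auto simp: indicator_def)
      then have "(LINT x|lborel. ?f x * indicator {y<..} x) = 0" using fundamental_interval[OF h z] by simp
      then show "emeasure ?P {y<..} = emeasure ?M {y<..}"
        using dif[of "{y<..}"] by (subst (1 2) em) (use ip in auto)
    qed simp_all
    have "AE x in lborel. ?f x = 0"
    proof (rule sigma_finite_measure.density_zero[OF lborel.sigma_finite_measure_axioms i])
      fix A :: "real set" assume "A \<in> sets lborel"
      then have A: "A \<in> sets borel" by simp
      have "ennreal (LINT x|lborel. ?p x * indicator A x) = ennreal (LINT x|lborel. ?m x * indicator A x)"
        using \<open>?P = ?M\<close> em[OF ip(1) _ A] em[OF ip(2) _ A] by simp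
      then have "(LINT x|lborel. ?p x * indicator A x) = (LINT x|lborel. ?m x * indicator A x)"
        by (subst (asm) ennreal_inj) (auto intro!: Bochner_Integration.integral_nonneg)
      then show "(LINT x:A|lborel. ?f x) = 0" using dif[OF A] by (simp add: set_lebesgue_integral_def mult.commute)
    qed
    then show ?thesis .
  qed
  then have "AE x in lborel. \<forall>N. h x * indicator {- real N<..<real N} x = 0" by (subst AE_all_countable) blast
  then show ?thesis
  proof eventually_elim
    case (elim x)
    obtain N where N: "\<bar>x\<bar> < real N" using reals_Archimedean2 by blast
    then have "x \<in> {- real N<..<real N}" by auto
    then show ?case using elim[rule_format, of N] by simp
  qed
qed

section \<open>Differences and derivatives of test functions\<close>

lemma fd_uminus: "fd (- k) F = (\<lambda>x. - sh (- k) (fd k F) x)"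
  by (auto simp: fd_def sh_def fun_eq_iff)

lemma fd_deriv_bound:
  assumes d: "\<And>z. (F has_real_derivative f z) (at z)" and c: "continuous_on UNIV f" and f: "f \<in> L2"
  shows "L2_norm (fd k F) \<le> \<bar>k\<bar> * L2_norm f"
proof -
  have pos: "L2_norm (fd k F) \<le> k * L2_norm f" if k: "k > 0" for k
  proof -
    interpret real_distribution "Uk k" by (rule rd_Uk[OF k])
    have "fd k F = (\<lambda>x. k * Tm (Uk k) f x)" using fd_FTC[OF d c k] by blast
    then have "L2_norm (fd k F) = k * L2_norm (Tm (Uk k) f)" using k by (simp add: L2_norm_scale)
    then show ?thesis using L2_Tm(2)[OF f] k by (simp add: mult_left_mono)
  qed
  consider "k > 0" | "k = 0" | "- k > 0" by linarith
  then show ?thesis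
  proof cases
    case 2 then show ?thesis by (simp add: fd_def[abs_def])
  next
    case 3
    have "L2_norm (fd k F) = L2_norm (fd (- k) F)" using fd_uminus[of "- k" F] by (simp add: L2_norm_uminus L2_norm_sh)
    then show ?thesis using pos[OF 3] 3 by simp
  qed (use pos in auto)
qed

lemma test_DERIV: "test_function \<phi> \<Longrightarrow> (\<phi> has_real_derivative deriv \<phi> x) (at x)"
  by (rule differentiable_DERIV[OF Ck_diff[OF test_Ck]])

lemma deriv_fd: assumes d: "\<And>z. (F has_real_derivative f z) (at z)"
  shows "(fd k F has_real_derivative fd k f x) (at x)"
proof -
  have "((\<lambda>x. F (x + k)) has_real_derivative f (x + k) * 1) (at x)"
    by (rule DERIV_chain2[OF d]) (auto intro!: derivative_eq_intros)
  then show ?thesis unfolding fd_def[abs_def] by (auto intro!: derivative_eq_intros d)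
qed

lemma derivn_fd: "test_function \<phi> \<Longrightarrow> (deriv ^^ j) (fd k \<phi>) = fd k ((deriv ^^ j) \<phi>)"
proof (induct j)
  case (Suc j)
  have "deriv (fd k ((deriv ^^ j) \<phi>)) = fd k (deriv ((deriv ^^ j) \<phi>))"
    using DERIV_imp_deriv[OF deriv_fd[OF test_DERIV[OF test_derivn[OF Suc(2)]]]] by blast
  then show ?case using Suc by simp
qed simp

text \<open>An antiderivative of \<open>\<phi>\<close> need not be compactly supported, but its
  difference by \<open>k\<close> is: far out the antiderivative is constant on each side. The norm
  bound is \<open>fd_deriv_bound\<close> for the antiderivative.\<close>

lemma test_fd_antiderivative:
  assumes t: "test_function \<phi>"
  shows "\<exists>\<psi>. test_function \<psi> \<and> deriv \<psi> = fd k \<phi> \<and> L2_norm \<psi> \<le> \<bar>k\<bar> * L2_norm \<phi>"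
proof -
  have "isCont \<phi> x" for x using test_continuous[OF t] by (simp add: continuous_on_eq_continuous_at)
  then have "\<exists>\<Phi>. \<forall>x. - \<infinity> < ereal x \<longrightarrow> ereal x < \<infinity> \<longrightarrow> (\<Phi> has_vector_derivative \<phi> x) (at x)"
    by (intro einterval_antiderivative) auto
  then obtain \<Phi> where \<Phi>: "\<And>x. (\<Phi> has_real_derivative \<phi> x) (at x)"
    by (auto simp: has_real_derivative_iff_has_vector_derivative)
  have d: "deriv (fd k \<Phi>) = fd k \<phi>" using DERIV_imp_deriv[OF deriv_fd[OF \<Phi>]] by blast
  obtain M where M: "\<forall>x. \<bar>x\<bar> > M \<longrightarrow> \<phi> x = 0" using test_support[OF t] by blast
  have "fd k \<Phi> x = 0" if x: "\<bar>x\<bar> > M + \<bar>k\<bar>" for x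
  proof -
    have z: "\<phi> z = 0" if "z \<in> {min x (x + k)..max x (x + k)}" for z
      using that x by (intro M[rule_format]) (auto simp: min_def max_def split: if_splits)
    have "norm (\<Phi> (x + k) - \<Phi> x) \<le> 0 * norm (x + k - x)"
    proof (rule field_differentiable_bound)
      show "(\<Phi> has_field_derivative \<phi> z) (at z within {min x (x + k)..max x (x + k)})" for z
        using \<Phi> by (rule has_field_derivative_at_within)
    qed (use z in auto)
    then show ?thesis by (simp add: fd_def)
  qed
  moreover have "Ck n (fd k \<Phi>)" for n
  proof -
    have "Ck (Suc n) (fd k \<Phi>)"
      unfolding Ck_Suc d using deriv_fd[OF \<Phi>] test_Ck[OF test_fd[OF t]] by (auto simp: real_differentiable_def)
    then show ?thesis by (rule Ck_le)
  qed
  ultimately have "test_function (fd k \<Phi>)" unfolding test_function_iff by blast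
  then show ?thesis using d fd_deriv_bound[OF \<Phi> test_continuous[OF t] test_L2[OF t]] by blast
qed

text \<open>Dual of the bound of differences by derivatives: the pairing of a \<open>j\<close>-th difference with \<open>\<phi>\<close> becomes
  the pairing of a \<open>j\<close>-th weak derivative with \<open>\<psi>\<close>.\<close>

lemma test_fdn_antiderivative:
  assumes t: "test_function \<phi>"
  shows "\<exists>\<psi>. test_function \<psi> \<and> (deriv ^^ j) \<psi> = (fd k ^^ j) \<phi> \<and> L2_norm \<psi> \<le> \<bar>k\<bar> ^ j * L2_norm \<phi>"
proof (induct j)
  case 0 then show ?case using t by auto
next
  case (Suc j)
  obtain \<psi>
    where p: "test_function \<psi>" "(deriv ^^ j) \<psi> = (fd k ^^ j) \<phi>" "L2_norm \<psi> \<le> \<bar>k\<bar> ^ j * L2_norm \<phi>" using Suc by blast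
  obtain \<psi>'
    where q: "test_function \<psi>'" "deriv \<psi>' = fd k \<psi>" "L2_norm \<psi>' \<le> \<bar>k\<bar> * L2_norm \<psi>"
      using test_fd_antiderivative[OF p(1)] by blast
  have "(deriv ^^ Suc j) \<psi>' = (deriv ^^ j) (deriv \<psi>')" by (simp only: funpow_Suc_right o_apply)
  also have "\<dots> = (fd k ^^ Suc j) \<phi>" using derivn_fd[OF p(1)] p(2) q(2) by simp
  finally have "(deriv ^^ Suc j) \<psi>' = (fd k ^^ Suc j) \<phi>" .
  moreover have "L2_norm \<psi>' \<le> \<bar>k\<bar> ^ Suc j * L2_norm \<phi>"
    using order_trans[OF q(3) mult_left_mono[OF p(3) abs_ge_zero]] by (simp add: mult_ac)
  ultimately show ?case using q(1) by blast
qed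

lemma test_fd_taylor:
  assumes t: "test_function \<phi>" and k: "k > 0"
  shows "L2_norm (\<lambda>x. fd k \<phi> x - k * deriv \<phi> x) \<le> k * (k * L2_norm ((deriv ^^ 2) \<phi>))"
proof -
  interpret real_distribution "Uk k" by (rule rd_Uk[OF k])
  have e: "fd k \<phi> x = k * Tm (Uk k) (deriv \<phi>) x" for x
    by (rule fd_FTC[OF test_DERIV[OF t] test_continuous[OF test_deriv[OF t]] k])
  note t1 = test_deriv[OF t] and t2 = test_deriv[OF test_deriv[OF t]]
  have "L2_norm (\<lambda>x. Tm (Uk k) (deriv \<phi>) x - deriv \<phi> x) \<le> k * L2_norm (deriv (deriv \<phi>))"
    using fd_deriv_bound[OF test_DERIV[OF t1] test_continuous[OF t2] test_L2[OF t2]]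
    by (intro Tm_near Uk_moment[OF k] test_L2[OF t1]) auto
  moreover have "(\<lambda>x. fd k \<phi> x - k * deriv \<phi> x) = (\<lambda>x. k * (Tm (Uk k) (deriv \<phi>) x - deriv \<phi> x))" by (simp add: e algebra_simps)
  ultimately show ?thesis using k by (simp add: L2_norm_scale numeral_2_eq_2)
qed

text \<open>Induction: the error of order \<open>j + 1\<close> is a difference of the error
  \<open>E\<close> of order \<open>j\<close> plus \<open>k ^ j\<close> times the first order error
  of the \<open>j\<close>-th derivative. The derivative of \<open>E\<close> is the error of order
  \<open>j\<close> for \<open>deriv \<phi>\<close>, which is why \<open>\<phi>\<close> is
  generalised.\<close>

lemma test_fdn_taylor:
  assumes t: "test_function \<phi>"
  shows "\<exists>c\<ge>0. \<forall>k>0. L2_norm (\<lambda>x. (fd k ^^ j) \<phi> x - k ^ j * (deriv ^^ j) \<phi> x) \<le> c * k ^ Suc j"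
  using t
proof (induct j arbitrary: \<phi>)
  case 0
  then show ?case by (intro exI[of _ 0]) simp
next
  case (Suc j)
  let ?\<phi>j = "(deriv ^^ j) \<phi>"
  obtain c where c: "c \<ge> 0" "\<forall>k>0. L2_norm (\<lambda>x. (fd k ^^ j) (deriv \<phi>) x - k ^ j * (deriv ^^ j) (deriv \<phi>) x) \<le> c * k ^ Suc j"
    using Suc.hyps[OF test_deriv[OF Suc(2)]] by blast
  define m where "m = L2_norm ((deriv ^^ 2) ?\<phi>j)"
  have tj: "test_function ?\<phi>j" by (rule test_derivn[OF Suc(2)])
  have tf: "test_function ((fd k ^^ j) \<phi>)" for k by (induct j) (auto intro: test_fd Suc(2))
  have ex: "(deriv ^^ j) (deriv \<phi>) = deriv ?\<phi>j" by (simp add: funpow_swap1)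
  have "L2_norm (\<lambda>x. (fd k ^^ Suc j) \<phi> x - k ^ Suc j * (deriv ^^ Suc j) \<phi> x) \<le> (c + m) * k ^ Suc (Suc j)" if k: "k > 0" for k
  proof -
    define E where "E x = (fd k ^^ j) \<phi> x + (- (k ^ j)) * ?\<phi>j x" for x
    have tE: "test_function E" unfolding E_def by (intro test_add test_cmult tf tj)
    have df: "deriv ((fd k ^^ j) \<phi>) = (fd k ^^ j) (deriv \<phi>)"
    proof (induct j)
      case (Suc i)
      have "test_function ((fd k ^^ i) \<phi>)" by (induct i) (auto intro: test_fd \<open>test_function \<phi>\<close>)
      then show ?case using derivn_fd[of "(fd k ^^ i) \<phi>" 1 k] Suc by simp
    qed simp
    have dE: "deriv E = (\<lambda>x. (fd k ^^ j) (deriv \<phi>) x - k ^ j * (deriv ^^ j) (deriv \<phi>) x)"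
      unfolding E_def ex df[symmetric]
      by (rule ext, rule DERIV_imp_deriv) (auto intro!: derivative_eq_intros test_DERIV tf tj)
    have "L2_norm (fd k E) \<le> \<bar>k\<bar> * L2_norm (deriv E)"
      by (intro fd_deriv_bound test_DERIV tE test_continuous test_L2 test_deriv)
    also have "\<dots> \<le> k * (c * k ^ Suc j)" unfolding dE using k c(2)[rule_format, OF k] by (intro mult_mono) auto
    finally have 1: "L2_norm (fd k E) \<le> c * k ^ Suc (Suc j)" by (simp add: mult_ac)
    let ?F = "\<lambda>x. k ^ j * (fd k ?\<phi>j x - k * deriv ?\<phi>j x)"
    have "L2_norm ?F \<le> k ^ j * (k * (k * m))"
      unfolding L2_norm_scale m_def using k by (simp add: mult_left_mono test_fd_taylor[OF tj k])
    then have 2: "L2_norm ?F \<le> m * k ^ Suc (Suc j)" by (simp add: mult_ac)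
    have "(\<lambda>x. (fd k ^^ Suc j) \<phi> x - k ^ Suc j * (deriv ^^ Suc j) \<phi> x) = (\<lambda>x. fd k E x + ?F x)"
      by (simp add: fd_def E_def fun_eq_iff algebra_simps)
    then have "L2_norm (\<lambda>x. (fd k ^^ Suc j) \<phi> x - k ^ Suc j * (deriv ^^ Suc j) \<phi> x) \<le> L2_norm (fd k E) + L2_norm ?F"
      using L2_norm_triangle[of "fd k E" ?F] by (simp add: L2_fd L2_scale L2_diff test_L2 tE tj test_deriv)
    then show ?thesis using 1 2 by (simp add: distrib_right)
  qed
  moreover have "c + m \<ge> 0" using c by (simp add: m_def)
  ultimately show ?case by blast
qed

section \<open>From difference bounds to weak derivatives and back\<close>

lemma le_of_halves:
  fixes a b c :: real
  assumes "\<And>n. a \<le> b + c * (1/2) ^ n"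
  shows "a \<le> b"
proof -
  have "(\<lambda>n. b + c * (1/2) ^ n) \<longlonglongrightarrow> b + c * 0" by (intro tendsto_intros LIMSEQ_power_zero) auto
  then show ?thesis using assms by (intro LIMSEQ_le_const[of "\<lambda>n. b + c * (1/2) ^ n"]) auto
qed

text \<open>Maximising \<open>2 L \<phi> - \<parallel>\<phi>\<parallel>\<^sup>2\<close> over test functions: by the parallelogram law a maximising sequence is
  Cauchy, and its limit represents \<open>L\<close>.\<close>

lemma riesz_test_functions:
  assumes add: "\<And>\<phi> \<psi>. test_function \<phi> \<Longrightarrow> test_function \<psi> \<Longrightarrow> L (\<lambda>x. \<phi> x + \<psi> x) = L \<phi> + L \<psi>"
    and scale: "\<And>c \<phi>. test_function \<phi> \<Longrightarrow> L (\<lambda>x. c * \<phi> x) = c * L \<phi>"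
    and bd: "\<And>\<phi>. test_function \<phi> \<Longrightarrow> \<bar>L \<phi>\<bar> \<le> C * L2_norm \<phi>"
    and C: "C \<ge> 0"
  shows "\<exists>g\<in>L2. L2_norm g \<le> C \<and> (\<forall>\<phi>. test_function \<phi> \<longrightarrow> L \<phi> = ip g \<phi>)"
proof -
  define J where "J \<phi> = 2 * L \<phi> - (L2_norm \<phi>)\<^sup>2" for \<phi>
  define S where "S = Sup (J ` Collect test_function)"
  have "J \<phi> \<le> C\<^sup>2" if "test_function \<phi>" for \<phi>
    using bd[OF that] zero_le_power2[of "L2_norm \<phi> - C"] by (simp add: J_def power2_eq_square algebra_simps)
  then have bdd: "bdd_above (J ` Collect test_function)" by (intro bdd_aboveI[of _ "C\<^sup>2"]) auto
  have JS: "J \<phi> \<le> S" if "test_function \<phi>" for \<phi> unfolding S_def using that bdd by (intro cSup_upper) auto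
  have "\<exists>\<phi>. test_function \<phi> \<and> J \<phi> > S - (1/4) ^ n" for n
  proof -
    have "S - (1/4) ^ n < Sup (J ` Collect test_function)" unfolding S_def[symmetric] by simp
    then show ?thesis using test_zero by (subst (asm) less_cSup_iff[OF _ bdd]) auto
  qed
  then obtain F where F: "\<And>n. test_function (F n)" "\<And>n. J (F n) > S - (1/4) ^ n" by metis
  have FL: "F n \<in> L2" for n by (rule test_L2[OF F(1)])
  have sq_add: "(L2_norm (\<lambda>x. \<phi> x + c * \<psi> x))\<^sup>2 = (L2_norm \<phi>)\<^sup>2 + 2 * c * ip \<phi> \<psi> + c\<^sup>2 * (L2_norm \<psi>)\<^sup>2"
    if "\<phi> \<in> L2" "\<psi> \<in> L2" for \<phi> \<psi> c
  proof -
    have i: "integrable lborel (\<lambda>x. (\<phi> x)\<^sup>2)" "integrable lborel (\<lambda>x. 2 * c * (\<phi> x * \<psi> x))" "integrable lborel (\<lambda>x. c\<^sup>2 * (\<psi> x)\<^sup>2)"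
      using that by (auto intro: L2_integrable_sq L2_mult_integrable)
    have "(LINT x|lborel. (\<phi> x + c * \<psi> x)\<^sup>2) = (LINT x|lborel. (\<phi> x)\<^sup>2 + 2 * c * (\<phi> x * \<psi> x) + c\<^sup>2 * (\<psi> x)\<^sup>2)"
      by (intro Bochner_Integration.integral_cong) (auto simp: power2_eq_square algebra_simps)
    also have "\<dots> = (LINT x|lborel. (\<phi> x)\<^sup>2) + (LINT x|lborel. 2 * c * (\<phi> x * \<psi> x)) + (LINT x|lborel. c\<^sup>2 * (\<psi> x)\<^sup>2)"
      using i by (simp only: Bochner_Integration.integral_add Bochner_Integration.integrable_add)
    finally show ?thesis by (simp add: L2_norm_sq ip_def)
  qed
  have d: "L2_norm (\<lambda>x. F (Suc n) x - F n x) \<le> 2 * (1/2) ^ n" for n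
  proof (rule power2_le_imp_le)
    let ?m = "\<lambda>x. (1/2) * (F (Suc n) x + F n x)"
    have tm: "test_function ?m" by (intro test_cmult test_add F)
    have "L ?m = (L (F (Suc n)) + L (F n)) / 2"
      using scale[OF test_add[OF F(1) F(1)], of "1/2" "Suc n" n] add[OF F(1) F(1), of "Suc n" n] by simp
    moreover have "4 * (L2_norm ?m)\<^sup>2 = (L2_norm (F (Suc n)))\<^sup>2 + 2 * ip (F (Suc n)) (F n) + (L2_norm (F n))\<^sup>2"
      using sq_add[OF FL FL, of "Suc n" 1 n] unfolding L2_norm_scale by (simp add: power_mult_distrib power2_eq_square)
    moreover have "(L2_norm (\<lambda>x. F (Suc n) x - F n x))\<^sup>2 = (L2_norm (F (Suc n)))\<^sup>2 - 2 * ip (F (Suc n)) (F n) + (L2_norm (F n))\<^sup>2"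
      using sq_add[OF FL FL, of "Suc n" "-1" n] by simp
    ultimately have "(L2_norm (\<lambda>x. F (Suc n) x - F n x))\<^sup>2 = 4 * J ?m - 2 * J (F (Suc n)) - 2 * J (F n)"
      unfolding J_def by argo
    also have "\<dots> \<le> 4 * S - 2 * (S - (1/4) ^ Suc n) - 2 * (S - (1/4) ^ n)"
      using JS[OF tm] F(2)[of n] F(2)[of "Suc n"] by (intro diff_mono mult_left_mono) auto
    also have "\<dots> \<le> 4 * (1/4) ^ n" by simp
    also have "\<dots> = (2 * (1/2) ^ n)\<^sup>2" by (simp add: power_mult_distrib power2_eq_square flip: power_mult_distrib)
    finally show "(L2_norm (\<lambda>x. F (Suc n) x - F n x))\<^sup>2 \<le> (2 * (1/2) ^ n)\<^sup>2" .
  qed simp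
  obtain g where g: "g \<in> L2" "\<And>n. L2_norm (\<lambda>x. F n x - g x) \<le> 4 * (1/2) ^ n"
    using L2_complete[of F 2, OF FL d] by auto
  have rep: "L \<phi> = ip g \<phi>" if t: "test_function \<phi>" for \<phi>
  proof -
    define m where "m = (L2_norm \<phi>)\<^sup>2 + 1"
    have "\<bar>L \<phi> - ip g \<phi>\<bar> \<le> 0 + (m + 4 * L2_norm \<phi>) * (1/2) ^ n" for n
    proof -
      \<comment> \<open>Perturbing a near maximiser by \<open>s * \<phi>\<close> cannot raise
        \<open>J\<close> by more than the gap \<open>(1/4)^n\<close>; with \<open>s\<close> of both
        signs and size \<open>(1/2)^n\<close> this pins down \<open>L \<phi>\<close>.\<close>
      have v: "2 * s * (L \<phi> - ip (F n) \<phi>) \<le> s\<^sup>2 * (L2_norm \<phi>)\<^sup>2 + (1/4) ^ n" for s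
      proof -
        have "L (\<lambda>x. F n x + s * \<phi> x) = L (F n) + s * L \<phi>" using add[OF F(1) test_cmult[OF t]] scale[OF t]
          by simp
        then have "J (\<lambda>x. F n x + s * \<phi> x) = J (F n) + 2 * s * (L \<phi> - ip (F n) \<phi>) - s\<^sup>2 * (L2_norm \<phi>)\<^sup>2"
          unfolding J_def sq_add[OF FL test_L2[OF t]] by (simp add: algebra_simps)
        then show ?thesis using JS[OF test_add[OF F(1) test_cmult[OF t]], of n s] F(2)[of n] by linarith
      qed
      have q: "(1/4::real) ^ n = (1/2) ^ n * (1/2) ^ n" by (simp flip: power_mult_distrib)
      define h where "h = (1/2::real) ^ n"
      have h: "h > 0" by (simp add: h_def)
      have "h * (2 * (L \<phi> - ip (F n) \<phi>)) \<le> h * (h * m)" "h * (- (2 * (L \<phi> - ip (F n) \<phi>))) \<le> h * (h * m)"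
        using v[of h] v[of "- h"] unfolding q h_def[symmetric] m_def by (simp_all add: power2_eq_square algebra_simps)
      then have "2 * (L \<phi> - ip (F n) \<phi>) \<le> h * m" "- (2 * (L \<phi> - ip (F n) \<phi>)) \<le> h * m" using h
        by (simp_all only: mult_le_cancel_left_pos)
      then have "2 * \<bar>L \<phi> - ip (F n) \<phi>\<bar> \<le> h * m" by linarith
      from order_trans[OF _ this] have 1: "\<bar>L \<phi> - ip (F n) \<phi>\<bar> \<le> h * m" by simp
      have "\<bar>ip \<phi> (\<lambda>x. F n x - g x)\<bar> \<le> L2_norm \<phi> * (4 * h)"
        using order_trans[OF ip_CS[OF test_L2[OF t] L2_diff[OF FL g(1)]] mult_left_mono[OF g(2)[of n] L2_norm_nonneg]]
        by (simp add: h_def)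
      then have "\<bar>ip (F n) \<phi> - ip g \<phi>\<bar> \<le> L2_norm \<phi> * (4 * h)"
        using ip_diff_right[OF test_L2[OF t] FL g(1)] by (simp add: ip_commute)
      then show ?thesis using 1 unfolding h_def[symmetric] distrib_right by (simp add: mult_ac)
    qed
    then have "\<bar>L \<phi> - ip g \<phi>\<bar> \<le> 0" by (rule le_of_halves)
    then show ?thesis by simp
  qed
  have "L2_norm g * L2_norm g \<le> C * L2_norm g"
  proof (rule le_of_halves)
    fix n
    let ?e = "4 * (1/2::real) ^ n"
    have "ip g (\<lambda>x. g x - F n x) \<le> L2_norm g * ?e"
      using abs_le_D1[OF order_trans[OF ip_CS[OF g(1) L2_diff[OF g(1) FL]] mult_left_mono[OF _ L2_norm_nonneg]]] g(2)[of n]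
      by (simp add: L2_norm_diff_commute[of g])
    moreover have "ip g (F n) \<le> C * (L2_norm g + ?e)"
    proof -
      have "L2_norm (F n) \<le> L2_norm g + ?e" using L2_norm_le_diff[OF FL g(1), of n] g(2)[of n] by linarith
      then have "C * L2_norm (F n) \<le> C * (L2_norm g + ?e)" using C by (rule mult_left_mono)
      then show ?thesis using bd[OF F(1), of n] rep[OF F(1), of n] by linarith
    qed
    moreover have "L2_norm g * L2_norm g = ip g (F n) + ip g (\<lambda>x. g x - F n x)"
      using L2_norm_sq_ip[of g] ip_diff_right[OF g(1) g(1) FL, of n] by (simp add: power2_eq_square)
    ultimately show "L2_norm g * L2_norm g \<le> C * L2_norm g + (4 * C + 4 * L2_norm g) * (1/2) ^ n"
      by (simp add: algebra_simps)
  qed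
  then have "L2_norm g \<le> C" using C L2_norm_nonneg[of g] by (cases "L2_norm g = 0") auto
  then show ?thesis using g(1) rep by blast
qed

text \<open>The \<open>j\<close>-th difference of \<open>\<phi>\<close> divided by
  \<open>k ^ j\<close> tends to its derivative, and its pairing with \<open>v\<close> is that of a
  difference of \<open>v\<close> with \<open>\<phi>\<close>. So the distributional derivative is
  bounded by \<open>C\<close> in the \<open>L2\<close> norm of \<open>\<phi>\<close>, and the Riesz
  representation yields \<open>g\<close>.\<close>

lemma weak_deriv_of_fdn:
  assumes v: "v \<in> L2" and C: "C \<ge> 0" and b: "\<And>k. L2_norm ((fd k ^^ j) v) \<le> \<bar>k\<bar> ^ j * C"
  shows "\<exists>g\<in>L2. L2_norm g \<le> C \<and> is_weak_deriv j v g"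
proof -
  define L where "L \<phi> = (-1) ^ j * ip v ((deriv ^^ j) \<phi>)" for \<phi>
  have dl: "(deriv ^^ j) (\<lambda>x. \<phi> x + c * \<psi> x) = (\<lambda>x. (deriv ^^ j) \<phi> x + c * (deriv ^^ j) \<psi> x)"
    if "test_function \<phi>" "test_function \<psi>" for \<phi> \<psi> c
  proof (induct j)
    case (Suc j)
    have "deriv (\<lambda>x. (deriv ^^ j) \<phi> x + c * (deriv ^^ j) \<psi> x) = (\<lambda>x. deriv ((deriv ^^ j) \<phi>) x + c * deriv ((deriv ^^ j) \<psi>) x)"
      by (rule ext, rule DERIV_imp_deriv) (auto intro!: derivative_eq_intros test_DERIV test_derivn that)
    then show ?case using Suc by simp
  qed simp
  have bd: "\<bar>L \<phi>\<bar> \<le> C * L2_norm \<phi>" if t: "test_function \<phi>" for \<phi>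
  proof -
    obtain c where c: "c \<ge> 0" "\<forall>k>0. L2_norm (\<lambda>x. (fd k ^^ j) \<phi> x - k ^ j * (deriv ^^ j) \<phi> x) \<le> c * k ^ Suc j"
      using test_fdn_taylor[OF t] by blast
    let ?d = "(deriv ^^ j) \<phi>"
    have dL: "?d \<in> L2" by (rule test_L2[OF test_derivn[OF t]])
    have "\<bar>ip v ?d\<bar> \<le> C * L2_norm \<phi> + (L2_norm v * c) * (1/2) ^ n" for n
    proof -
      define k :: real where "k = (1/2) ^ n"
      have k: "k > 0" by (simp add: k_def)
      have "\<bar>ip v ((fd k ^^ j) \<phi>)\<bar> \<le> L2_norm ((fd (- k) ^^ j) v) * L2_norm \<phi>"
        unfolding ip_fdn[OF v test_L2[OF t]] by (intro ip_CS L2_fdn v test_L2 t)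
      also have "\<dots> \<le> (k ^ j * C) * L2_norm \<phi>" using b[of "- k"] k by (intro mult_right_mono) auto
      finally have 1: "\<bar>ip v ((fd k ^^ j) \<phi>)\<bar> \<le> (k ^ j * C) * L2_norm \<phi>" .
      have "\<bar>ip v (\<lambda>x. (fd k ^^ j) \<phi> x - k ^ j * ?d x)\<bar> \<le> L2_norm v * (c * k ^ Suc j)"
        using c k by (intro order_trans[OF ip_CS mult_left_mono] L2_diff L2_scale L2_fdn test_L2 t v dL) auto
      then have "\<bar>ip v ((fd k ^^ j) \<phi>) - k ^ j * ip v ?d\<bar> \<le> L2_norm v * (c * k ^ Suc j)"
        using ip_diff_right[OF v L2_fdn[OF test_L2[OF t]] L2_scale[OF dL]] by (simp add: ip_scale_right)
      then have "\<bar>k ^ j * ip v ?d\<bar> \<le> (k ^ j * C) * L2_norm \<phi> + L2_norm v * (c * k ^ Suc j)" using 1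
        by linarith
      then have "k ^ j * \<bar>ip v ?d\<bar> \<le> k ^ j * (C * L2_norm \<phi> + L2_norm v * c * k)" using k
        by (simp add: abs_mult algebra_simps)
      then have "\<bar>ip v ?d\<bar> \<le> C * L2_norm \<phi> + L2_norm v * c * k"
        by (rule mult_left_le_imp_le) (use k in simp)
      then show ?thesis by (simp add: k_def)
    qed
    then have "\<bar>ip v ?d\<bar> \<le> C * L2_norm \<phi>" by (rule le_of_halves)
    then show ?thesis by (simp add: L_def abs_mult power_abs)
  qed
  have add: "L (\<lambda>x. \<phi> x + c * \<psi> x) = L \<phi> + c * L \<psi>"
    if "test_function \<phi>" "test_function \<psi>" for \<phi> \<psi> c
    unfolding L_def dl[OF that] using that v
    by (simp add: ip_add_right L2_scale test_L2 test_derivn ip_scale_right algebra_simps)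
  have "\<exists>g\<in>L2. L2_norm g \<le> C \<and> (\<forall>\<phi>. test_function \<phi> \<longrightarrow> L \<phi> = ip g \<phi>)"
  proof (rule riesz_test_functions[OF _ _ bd C])
    show "L (\<lambda>x. \<phi> x + \<psi> x) = L \<phi> + L \<psi>" if "test_function \<phi>" "test_function \<psi>"
      for \<phi> \<psi> using add[OF that, of 1] by simp
    have "L (\<lambda>x. 0) = 0" using bd[OF test_zero] by simp
    then show "L (\<lambda>x. c * \<phi> x) = c * L \<phi>" if "test_function \<phi>" for c \<phi>
      using add[OF test_zero that, of c] by simp
  qed
  then obtain g
    where g: "g \<in> L2" "L2_norm g \<le> C" "\<And>\<phi>. test_function \<phi> \<Longrightarrow> L \<phi> = ip g \<phi>"
      by blast
  have "ip v ((deriv ^^ j) \<phi>) = (-1) ^ j * ip g \<phi>" if "test_function \<phi>" for \<phi>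
    unfolding g(3)[OF that, symmetric] L_def by (simp flip: mult.assoc power_mult_distrib)
  then have "is_weak_deriv j v g" using v g(1) by (simp add: is_weak_deriv_def L2_loc_integrable ip_def)
  then show ?thesis using g by blast
qed

text \<open>Through the antiderivative of \<open>test_fdn_antiderivative\<close> the pairing with a
  difference becomes one with \<open>g\<close>. This bounds it on test functions only, so Riesz
  supplies a function of the right norm with the same pairings, and the fundamental lemma identifies
  it with the difference.\<close>

lemma fdn_le_weak_deriv:
  assumes f: "f \<in> L2" and g: "g \<in> L2" and w: "is_weak_deriv j f g"
  shows "L2_norm ((fd k ^^ j) f) \<le> \<bar>k\<bar> ^ j * L2_norm g"
proof -
  define L where "L = ip ((fd k ^^ j) f)"
  have bd: "\<bar>L \<phi>\<bar> \<le> (\<bar>k\<bar> ^ j * L2_norm g) * L2_norm \<phi>" if t: "test_function \<phi>"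
    for \<phi>
  proof -
    obtain \<psi>
      where p: "test_function \<psi>" "(deriv ^^ j) \<psi> = (fd (- k) ^^ j) \<phi>" "L2_norm \<psi> \<le> \<bar>- k\<bar> ^ j * L2_norm \<phi>"
      using test_fdn_antiderivative[OF t] by blast
    have "L \<phi> = ip f ((fd (- k) ^^ j) \<phi>)" using ip_fdn[OF test_L2[OF t] f, of j k] by (simp add: L_def ip_commute)
    also have "\<dots> = (-1) ^ j * ip g \<psi>" using w p(1) unfolding p(2)[symmetric] is_weak_deriv_def ip_def by blast
    finally have "\<bar>L \<phi>\<bar> = \<bar>ip g \<psi>\<bar>" by (simp add: abs_mult power_abs)
    also have "\<dots> \<le> L2_norm g * (\<bar>k\<bar> ^ j * L2_norm \<phi>)"
      using order_trans[OF ip_CS[OF g test_L2[OF p(1)]] mult_left_mono[OF p(3) L2_norm_nonneg]] by simp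
    finally show ?thesis by (simp add: mult_ac)
  qed
  have "\<exists>h\<in>L2. L2_norm h \<le> \<bar>k\<bar> ^ j * L2_norm g \<and> (\<forall>\<phi>. test_function \<phi> \<longrightarrow> L \<phi> = ip h \<phi>)"
    using f by (intro riesz_test_functions bd) (auto simp: L_def ip_add_right ip_scale_right L2_fdn test_L2)
  then obtain h
    where h: "h \<in> L2" "L2_norm h \<le> \<bar>k\<bar> ^ j * L2_norm g" "\<And>\<phi>. test_function \<phi> \<Longrightarrow> L \<phi> = ip h \<phi>" by blast
  note fk = L2_fdn[OF f, of j k]
  have "AE x in lborel. (fd k ^^ j) f x - h x = 0"
  proof (rule fundamental_lemma)
    show "loc_integrable (\<lambda>x. (fd k ^^ j) f x - h x)" by (intro L2_loc_integrable L2_diff fk h)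
    fix \<phi> assume t: "test_function \<phi>"
    have "(LINT x|lborel. ((fd k ^^ j) f x - h x) * \<phi> x) = ip \<phi> (\<lambda>x. (fd k ^^ j) f x - h x)"
      by (simp add: ip_def mult.commute)
    also have "\<dots> = 0" using h(3)[OF t] ip_diff_right[OF test_L2[OF t] fk h(1)] by (simp add: L_def ip_commute)
    finally show "(LINT x|lborel. ((fd k ^^ j) f x - h x) * \<phi> x) = 0" .
  qed
  then have "AE x in lborel. (fd k ^^ j) f x = h x" by simp
  then have "L2_norm ((fd k ^^ j) f) = L2_norm h" using fk h(1) by (intro L2_norm_cong_AE) (auto dest: L2_measurable)
  then show ?thesis using h(2) by simp
qed

text \<open>\<open>weak_deriv\<close> is an arbitrary choice among representatives; the fundamental
  lemma makes any two agree almost everywhere.\<close>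

lemma L2_norm_weak_deriv:
  assumes g: "g \<in> L2" and w: "is_weak_deriv j f g"
  shows "L2_norm (weak_deriv j f) = L2_norm g"
proof -
  let ?w = "weak_deriv j f"
  have w': "is_weak_deriv j f ?w" unfolding weak_deriv_def by (rule someI[of "is_weak_deriv j f", OF w])
  have l: "loc_integrable g" "loc_integrable ?w" using w w' unfolding is_weak_deriv_def by blast+
  have "AE x in lborel. ?w x - g x = 0"
  proof (rule fundamental_lemma[OF loc_integrable_diff[OF l(2,1)]])
    fix \<phi> assume t: "test_function \<phi>"
    have "(-1::real) ^ j * (LINT x|lborel. ?w x * \<phi> x) = (-1) ^ j * (LINT x|lborel. g x * \<phi> x)"
    proof (rule trans[OF sym])
      show "(LINT x|lborel. f x * (deriv ^^ j) \<phi> x) = (-1) ^ j * (LINT x|lborel. ?w x * \<phi> x)" using w' t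
        by (simp only: is_weak_deriv_def)
      show "(LINT x|lborel. f x * (deriv ^^ j) \<phi> x) = (-1) ^ j * (LINT x|lborel. g x * \<phi> x)" using w t
        by (simp only: is_weak_deriv_def)
    qed
    then show "(LINT x|lborel. (?w x - g x) * \<phi> x) = 0"
      using loc_integrable_test[OF l(1) t] loc_integrable_test[OF l(2) t] by (simp add: left_diff_distrib)
  qed
  then have "AE x in lborel. ?w x = g x" by simp
  then show ?thesis by (rule L2_norm_cong_AE[OF loc_integrable_measurable[OF l(2)] loc_integrable_measurable[OF l(1)]])
qed

lemma L2_norm_weak_deriv_0: "f \<in> L2 \<Longrightarrow> L2_norm (weak_deriv 0 f) = L2_norm f"
  by (rule L2_norm_weak_deriv) (auto simp: is_weak_deriv_def L2_loc_integrable)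

lemma Sobolev_fdn:
  assumes "f \<in> Sobolev r" "j \<le> r"
  shows "L2_norm ((fd k ^^ j) f) \<le> \<bar>k\<bar> ^ j * L2_norm (weak_deriv j f)"
proof -
  obtain g where "g \<in> L2" "is_weak_deriv j f g" and "f \<in> L2" using assms by (auto simp: Sobolev_def)
  then show ?thesis using fdn_le_weak_deriv[of f g j k] L2_norm_weak_deriv[of g j f] by simp
qed

lemma Sobolev_of_fdn:
  assumes v: "v \<in> L2" and a: "\<And>j. a j \<ge> 0"
      and b: "\<And>j k. j \<le> r \<Longrightarrow> L2_norm ((fd k ^^ j) v) \<le> \<bar>k\<bar> ^ j * a j"
  shows "v \<in> Sobolev r" and "j \<le> r \<Longrightarrow> L2_norm (weak_deriv j v) \<le> a j"
proof -
  have e: "\<exists>g\<in>L2. L2_norm g \<le> a j \<and> is_weak_deriv j v g" if "j \<le> r" for j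
    using weak_deriv_of_fdn[OF v a b[OF that]] by blast
  show "v \<in> Sobolev r" using e v unfolding Sobolev_def by blast
  show "L2_norm (weak_deriv j v) \<le> a j" if "j \<le> r"
    using e[OF that] L2_norm_weak_deriv by metis
qed

section \<open>Assembly of the two estimates\<close>

lemma weak_deriv_le_Sobolev_norm: "j \<le> r \<Longrightarrow> L2_norm (weak_deriv j f) \<le> Sobolev_norm r f"
  unfolding Sobolev_norm_def
  by (intro real_le_rsqrt member_le_sum[of j "{..r}" "\<lambda>j. (L2_norm (weak_deriv j f))\<^sup>2"]) auto

theorem theorem1p1:
  fixes r :: nat
  assumes "r \<in> {1, 2}"
  shows "\<exists>(C1 :: real \<Rightarrow> real \<Rightarrow> real) (C2 :: real \<Rightarrow> real \<Rightarrow> real).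
    \<forall>u0 \<in> Sobolev r. \<forall>T > 0. \<forall>dt \<in> {0<..<1}. \<forall>n :: nat. real n * dt \<le> T \<longrightarrow>
      (\<lambda>x. (Z_flow dt ^^ n) u0 x - S_flow (real n * dt) u0 x) \<in> L2 \<and>
      L2_norm (\<lambda>x. (Z_flow dt ^^ n) u0 x - S_flow (real n * dt) u0 x)
        \<le> C1 T (Sobolev_norm 1 u0) * (Sobolev_norm r u0)\<^sup>2 * dt powr (real r / 2) \<and>
      (Z_flow dt ^^ n) u0 \<in> Sobolev r \<and>
      Sobolev_norm r ((Z_flow dt ^^ n) u0) \<le> C2 T (L2_norm u0) * Sobolev_norm r u0"
proof -
  have "\<exists>C D. C \<ge> 1 \<and> D \<ge> 0 \<and> (\<forall>u0 B0 u dt n. u0 \<in> L2 \<and> L2_norm u0 \<le> R \<and> B0 \<ge> 0 \<and> (\<forall>k. L2_norm (fd k u0) \<le> \<bar>k\<bar> * B0) \<and>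
      mild 1 u0 u \<and> dt > 0 \<and> real n * dt \<le> T \<longrightarrow>
      (Z_flow dt ^^ n) u0 \<in> L2 \<and> L2_norm ((Z_flow dt ^^ n) u0) \<le> L2_norm u0 \<and>
      (\<forall>j\<in>{1,2}. \<forall>k. L2_norm ((fd k ^^ j) ((Z_flow dt ^^ n) u0)) \<le> C * L2_norm ((fd k ^^ j) u0)) \<and>
      u (real n * dt) \<in> L2 \<and>
      L2_norm (\<lambda>x. (Z_flow dt ^^ n) u0 x - u (real n * dt) x) \<le> D * L2_norm u0 * B0 * dt)"
    (is "\<exists>C D. ?P T R C D") if "T > 0" "R \<ge> 0" for T R
    using splitting_estimates[OF that] by blast
  note ex = this
  \<comment> \<open>\<open>C\<close> and \<open>D\<close> are chosen from \<open>T\<close> and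
    \<open>R\<close> alone, \<open>C\<close> first, so that they can be named before the
    data.\<close>
  define C where "C T R = (SOME C. \<exists>D. ?P T R C D)" for T R
  define D where "D T R = (SOME D. ?P T R (C T R) D)" for T R
  have CD: "?P T R (C T R) (D T R)" if "T > 0" "R \<ge> 0" for T R
    unfolding D_def by (rule someI_ex, unfold C_def, rule someI_ex, rule ex[OF that])
  show ?thesis
  proof (rule exI[of _ D], rule exI[of _ C], intro ballI allI impI)
    fix u0 and T dt :: real and n :: nat
    assume u0S: "u0 \<in> Sobolev r" and T: "T > 0" and dt: "dt \<in> {0<..<1}" and n: "real n * dt \<le> T"
    have r: "1 \<le> r" "r \<le> 2" using assms by auto
    let ?N = "Sobolev_norm r u0" and ?w = "\<lambda>j. L2_norm (weak_deriv j u0)"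
    have u0: "u0 \<in> L2" using u0S by (simp add: Sobolev_def)
    have w0: "?w 0 = L2_norm u0" by (rule L2_norm_weak_deriv_0[OF u0])
    have N: "?w j \<le> ?N" if "j \<le> r" for j by (rule weak_deriv_le_Sobolev_norm[OF that])
    have L1: "L2_norm u0 \<le> Sobolev_norm 1 u0" using weak_deriv_le_Sobolev_norm[of 0 1 u0] w0 by simp
    have B: "L2_norm (fd k u0) \<le> \<bar>k\<bar> * ?w 1" for k using Sobolev_fdn[OF u0S r(1), of k] by simp
    obtain w where "mild 1 u0 w" using mild_exists[OF u0 B L2_norm_nonneg, of 1] by auto
    \<comment> \<open>Existence of one mild solution makes the function selected in
      \<open>S_flow\<close> a mild solution.\<close>
    then have S: "mild 1 u0 (SOME u. mild_augmented_burgers u0 u)"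
      unfolding mild_augmented_burgers_mild by (rule someI[of "mild 1 u0"])
    \<comment> \<open>\<open>R\<close> is left open: the error uses
      \<open>R = Sobolev_norm 1 u0\<close> and the stability bound \<open>R = L2_norm u0\<close>,
      which gives each constant its stated dependence.\<close>
    have P: "?P T R (C T R) (D T R)" if "L2_norm u0 \<le> R" for R
      using that L2_norm_nonneg[of u0] by (intro CD T) linarith
    let ?Z = "(Z_flow dt ^^ n) u0"
    note hyp = u0 L2_norm_nonneg B S dt n
    have Z1: "S_flow (real n * dt) u0 \<in> L2" "?Z \<in> L2" "L2_norm ?Z \<le> L2_norm u0"
       "L2_norm (\<lambda>x. ?Z x - S_flow (real n * dt) u0 x) \<le> D T (Sobolev_norm 1 u0) * L2_norm u0 * ?w 1 * dt"
      using P[OF L1] hyp L1 unfolding S_flow_def greaterThanLessThan_iff by blast+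
    have Z2: "L2_norm ((fd k ^^ j) ?Z) \<le> C T (L2_norm u0) * L2_norm ((fd k ^^ j) u0)" if "j \<in> {1,2}" for j k
      using P[OF order_refl] hyp that unfolding greaterThanLessThan_iff by blast
    have C1: "C T (L2_norm u0) \<ge> 1" and D0: "D T (Sobolev_norm 1 u0) \<ge> 0" using P[OF order_refl] P[OF L1] by blast+
    define c where "c = C T (L2_norm u0)"
    have fdZ: "L2_norm ((fd k ^^ j) ?Z) \<le> \<bar>k\<bar> ^ j * (c * ?w j)" if "j \<le> r" for j k
    proof (cases "j = 0")
      case True
      have "1 * L2_norm u0 \<le> c * L2_norm u0" using C1 by (intro mult_right_mono) (auto simp: c_def)
      then show ?thesis using Z1(3) True w0 by simp
    next
      case False
      then have "j \<in> {1,2}" using that r by auto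
      from Z2[OF this, of k] have "L2_norm ((fd k ^^ j) ?Z) \<le> c * L2_norm ((fd k ^^ j) u0)" by (simp add: c_def)
      also have "\<dots> \<le> c * (\<bar>k\<bar> ^ j * ?w j)" using C1 Sobolev_fdn[OF u0S that, of k]
        by (intro mult_left_mono) (auto simp: c_def)
      finally show ?thesis by (simp add: mult_ac)
    qed
    have cw: "0 \<le> c * ?w j" for j using C1 by (simp add: c_def)
    note Sob = Sobolev_of_fdn[where a="\<lambda>j. c * ?w j", OF Z1(2) cw fdZ]
    have "Sobolev_norm r ?Z \<le> sqrt (\<Sum>j\<le>r. (c * ?w j)\<^sup>2)"
      unfolding Sobolev_norm_def by (intro real_sqrt_le_mono sum_mono power_mono Sob(2)) auto
    also have "\<dots> = c * ?N"
      using C1 by (simp add: Sobolev_norm_def power_mult_distrib real_sqrt_mult c_def flip: sum_distrib_left)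
    finally have 1: "Sobolev_norm r ?Z \<le> c * ?N" .
    have N0: "?N \<ge> 0" using N[of 0] L2_norm_nonneg[of "weak_deriv 0 u0"] by linarith
    \<comment> \<open>Both norms are at most \<open>?N\<close>, and \<open>dt < 1\<close> with
      \<open>r \<le> 2\<close> lets \<open>dt\<close> be weakened to
      \<open>dt powr (real r / 2)\<close>.\<close>
    have "L2_norm u0 * ?w 1 * dt \<le> ?N\<^sup>2 * dt powr (real r / 2)"
    proof (rule mult_mono)
      show "L2_norm u0 * ?w 1 \<le> ?N\<^sup>2" unfolding power2_eq_square using N[of 0] N[of 1] w0 r N0
        by (intro mult_mono) auto
      have "dt powr 1 \<le> dt powr (real r / 2)" using dt r by (intro powr_mono') auto
      then show "dt \<le> dt powr (real r / 2)" using dt by simp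
    qed (use dt in auto)
    from mult_left_mono[OF this D0] have 2: "L2_norm (\<lambda>x. ?Z x - S_flow (real n * dt) u0 x) \<le> D T (Sobolev_norm 1 u0) * ?N\<^sup>2 * dt powr (real r / 2)"
      using Z1(4) by (simp add: mult.assoc)
    show "(\<lambda>x. ?Z x - S_flow (real n * dt) u0 x) \<in> L2 \<and>
      L2_norm (\<lambda>x. ?Z x - S_flow (real n * dt) u0 x) \<le> D T (Sobolev_norm 1 u0) * ?N\<^sup>2 * dt powr (real r / 2) \<and>
      ?Z \<in> Sobolev r \<and> Sobolev_norm r ?Z \<le> C T (L2_norm u0) * ?N"
      using 1 2 Sob(1) L2_diff[OF Z1(2,1)] unfolding c_def by blast
  qed
qed

end
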